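(* Let $M>0$ and let $\hat C_{M,\alpha}(t)=e^{\frac12 t}\tilde C_{M,\alpha}(t)e^{t\bar C_{M,\alpha}(t)}$, where $\tilde C_{M,\alpha}(t)=3+\frac32t+\frac12t^2+\frac3{16}t^3+\sqrt M(1+\frac14t+\frac14t^2+\frac1{16}t^3)+\|\alpha'\|_\infty\sqrt M(5+2t+t^2+\frac38t^3)+\|\alpha'\|_\infty M(3+\frac54t+\frac12t^2+\frac18t^3)$ and $\bar C_{M,\alpha}(t)=2+\|\alpha'\|_\infty\sqrt M+\sqrt M(\frac12+\frac18t+\frac1{16}t^2)+\|\alpha'\|_\infty M(1+\frac14t+\frac18t^2)$. Then the $\alpha$-dissipative solution operator $T_t$ is Lipschitz continuous in the sense that for all $(u_0,\rho_0,\nu_0,\mu_0),(\bar u_0,\bar\rho_0,\bar\nu_0,\bar\mu_0)\in\mathcal{D}_0^{\alpha,M}$ and $t\ge0$, $$d_{\mathcal{D}_0^{\alpha,M}}\big(t,(u_0,\rho_0,\nu_0,\mu_0),(\bar u_0,\bar\rho_0,\bar\nu_0,\bar\mu_0)\big)\le\hat C_{M,\alpha}(t)\,d_{\mathcal{D}_0^{\alpha,M}}\big(0,(u_0,\rho_0,\nu_0,\mu_0),(\bar u_0,\bar\rho_0,\bar\nu_0,\bar\mu_0)\big).$$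
   Context: Fix $\alpha\in W^{1,\infty}(\mathbb{R})$ with either $0\le\alpha(x)<1$ for all $x$, or $\alpha\equiv1$. Lagrangian set: $E_1=\{f\in L^\infty(\mathbb{R}): f'\in L^2,\ \lim_{x\to-\infty}f=0\}$, $E_2=\{f\in L^\infty: f'\in L^2\}$, norms $\|f\|_\infty+\|f'\|_2$; $B=E_2\times E_2\times E_1\times L^2(\mathbb{R})\times E_1$. $\mathcal{F}^\alpha$ is the set of $X=(y,U,H,r,V)$ with $(y-\mathrm{id},U,H,r,V)\in B$ and: (i) $y-\mathrm{id},U,H,V\in W^{1,\infty}$, $r\in L^\infty$; (ii) $y_\xi\ge0$, $H_\xi\ge0$, $y_\xi+H_\xi>c$ a.e. for some $c>0$; (iii) $y_\xi V_\xi=U_\xi^2+r^2$ a.e.; (iv) $0\le V_\xi\le H_\xi$ a.e.; (v) if $0\le\alpha<1$, there is $\kappa:\mathbb{R}\to(0,1]$ with $V_\xi=\kappa(y)H_\xi$ a.e. and $\kappa(y(\xi))=1$ whenever $U_\xi(\xi)<0$ or $r(\xi)\neq0$; (vi) if $\alpha\equiv1$, a.e. $y_\xi=0\Rightarrow V_\xi=0$ and $y_\xi>0\Rightarrow V_\xi=H_\xi$. $\mathcal{F}_i^\alpha=\{X\in\mathcal{F}^\alpha:V=H\}$, $\mathcal{F}_0^\alpha=\{X\in\mathcal{F}^\alpha: y+H=\mathrm{id}\}$, $\mathcal{F}^{\alpha,M}=\{X\in\mathcal{F}^\alpha:\|H\|_\infty\le M\}$, $\mathcal{F}_{i,0}^{\alpha,M}=\mathcal{F}_i^\alpha\cap\mathcal{F}_0^\alpha\cap\mathcal{F}^{\alpha,M}$.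 Flow: for $X_0=(y_0,U_0,H_0,r_0,V_0)\in\mathcal{F}_i^\alpha$, let $\tau(\xi)=0$ if $y_{0,\xi}(\xi)=0$, $\tau(\xi)=-2U_{0,\xi}(\xi)/H_{0,\xi}(\xi)$ if $r_0(\xi)=0$ and $U_{0,\xi}(\xi)<0$, and $\tau(\xi)=\infty$ otherwise. $S_t(X_0)$ is the value at time $t$ of the unique solution $X(t)=(y,U,H,r,V)(t)$ with $X(0)=X_0$ of $y_t=U$, $U_t=\frac12V-\frac14\lim_{\xi\to\infty}V$, $H_t=0$, $r_t=0$, where $V(\xi,t)=\int_{-\infty}^\xi H_{0,\xi}(\eta)\big(1-\mathbf{1}_{\{t\ge\tau(\eta)\}}\alpha(y(\eta,\tau(\eta)))\big)d\eta$. Relabeling: $G$ is the group of homeomorphisms $f$ of $\mathbb{R}$ with $f-\mathrm{id}, f^{-1}-\mathrm{id}\in W^{1,\infty}(\mathbb{R})$ and $f_\xi-1\in L^2(\mathbb{R})$; $X\bullet f=(y\circ f,U\circ f,H\circ f,(r\circ f)f_\xi,V\circ f)$; $\Pi X=X\bullet(y+H)^{-1}$. Metric: for $X\in\mathcal{F}^\alpha$ let $\Omega_c(X)=\{\xi: U_\xi(\xi)\ge0\text{ or }r(\xi)\ne0\}$, $\Omega_d(X)=\{\xi:U_\xi(\xi)<0\text{ and }r(\xi)=0\}$, $H_\infty=\lim_{\xi\to\infty}H(\xi)$; $g(X)=y_\xi+H_\xi-\alpha(y)H_\xi$ on $\Omega_d(X)$ and $y_\xi+V_\xi$ on $\Omega_c(X)$;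 $g_2(X)=\|\alpha'\|_\infty H_\infty U_\xi$ on $\Omega_d(X)$, $0$ on $\Omega_c(X)$; $g_3(X)=\|\alpha'\|_\infty UU_\xi$ on $\Omega_d(X)$, $0$ on $\Omega_c(X)$. With $Z=(y_\xi,U_\xi,H_\xi,r)$, $\tilde d(X,\bar X)=\|y-\bar y\|_\infty+\|U-\bar U\|_\infty+\|\alpha'\|_\infty\|UH_\xi-\bar U\bar H_\xi\|_2+\|H_\xi-\bar H_\xi\|_1+\|Z-\bar Z\|_2+\|g(X)-g(\bar X)\|_2+\|g_2(X)-g_2(\bar X)\|_2+\|g_3(X)-g_3(\bar X)\|_2$. $J(X,\bar X)=\inf_{f,g\in G}(\tilde d(X\bullet f,\bar X)+\tilde d(X,\bar X\bullet g))$. For $X,\bar X\in\mathcal{F}_{i,0}^{\alpha,M}$, $d_M(t,X,\bar X)=\inf\sum_{n=1}^NJ(\Pi S_t(X_{n-1}),\Pi S_t(X_n))$ over all finite sequences $X_0=X,X_1,\dots,X_N=\bar X$ in $\mathcal{F}_{i,0}^{\alpha,M}$. Eulerian side: $\mathcal{D}^\alpha$ is the set of $(u,\rho,\nu,\mu)$ with $u\in L^\infty$, $u_x\in L^2$, $\rho\in L^2$, $\mu\le\nu$ positive finite Radon measures, $\mu_{ac}=(u_x^2+\rho^2)dx$, if $0\le\alpha<1$ then $\frac{d\mu}{d\nu}>0$ and $\frac{d\mu}{d\nu}(x)=1$ whenever $u_x(x)<0$ or $\rho(x)\ne0$, and if $\alpha\equiv1$ then $\mu=\nu_{ac}$. $L:\mathcal{D}^\alpha\to\mathcal{F}^\alpha$: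 $y(\xi)=\sup\{x:\nu((-\infty,x))+x<\xi\}$, $H(\xi)=\xi-y(\xi)$, $U=u\circ y$, $r=(\rho\circ y)y_\xi$, $V(\xi)=\int_{-\infty}^\xi\frac{d\mu}{d\nu}\circ y(\eta)H_\xi(\eta)d\eta$. $M:\mathcal{F}^\alpha\to\mathcal{D}^\alpha$: $u(x)=U(\xi)$ for any $\xi$ with $y(\xi)=x$, $\rho\,dx=y_\#(r\,d\xi)$, $\nu=y_\#(H_\xi d\xi)$, $\mu=y_\#(V_\xi d\xi)$. $\mathcal{D}_0^\alpha=M(\mathcal{F}_i^\alpha)$, $\mathcal{D}^{\alpha,M}=\{(u,\rho,\nu,\mu)\in\mathcal{D}^\alpha:\nu(\mathbb{R})\le M\}$, $\mathcal{D}_0^{\alpha,M}=\mathcal{D}_0^\alpha\cap\mathcal{D}^{\alpha,M}$. The solution operator is $T_t=M\circ S_t\circ L$, and $d_{\mathcal{D}_0^{\alpha,M}}(t,(u,\rho,\nu,\mu),(\bar u,\bar\rho,\bar\nu,\bar\mu))=d_M(t,L(u,\rho,\nu,\mu),L(\bar u,\bar\rho,\bar\nu,\bar\mu))$. *)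

theory Defs
  imports "HOL-Analysis.Analysis"
begin

text \<open>Weak derivative: f is locally absolutely continuous with a.e. derivative g,
  i.e. f b - f a equals the Lebesgue integral of g over [a,b].  (This selects the
  continuous representative of f, which exists for all functions considered.)\<close>
definition has_weak_deriv :: "(real \<Rightarrow> real) \<Rightarrow> (real \<Rightarrow> real) \<Rightarrow> bool" where
  "has_weak_deriv f g \<longleftrightarrow> g \<in> borel_measurable lborel \<and>
     (\<forall>a b. a \<le> b \<longrightarrow> set_integrable lborel {a..b} g \<and>
        f b - f a = (LINT x:{a..b}|lborel. g x))"

definition wd :: "(real \<Rightarrow> real) \<Rightarrow> real \<Rightarrow> real" where
  "wd f = (SOME g. has_weak_deriv f g)"

definition Linf :: "(real \<Rightarrow> real) \<Rightarrow> bool" where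
  "Linf f \<longleftrightarrow> f \<in> borel_measurable lborel \<and> (\<exists>C. AE x in lborel. \<bar>f x\<bar> \<le> C)"

definition L2 :: "(real \<Rightarrow> real) \<Rightarrow> bool" where
  "L2 f \<longleftrightarrow> f \<in> borel_measurable lborel \<and> integrable lborel (\<lambda>x. (f x)\<^sup>2)"

definition W1inf :: "(real \<Rightarrow> real) \<Rightarrow> bool" where
  "W1inf f \<longleftrightarrow> Linf f \<and> (\<exists>g. has_weak_deriv f g \<and> Linf g)"

definition E2 :: "(real \<Rightarrow> real) \<Rightarrow> bool" where
  "E2 f \<longleftrightarrow> Linf f \<and> (\<exists>g. has_weak_deriv f g \<and> L2 g)"

definition E1 :: "(real \<Rightarrow> real) \<Rightarrow> bool" where
  "E1 f \<longleftrightarrow> E2 f \<and> (f \<longlongrightarrow> 0) at_bot"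

text \<open>Norms (extended-valued, so that they are meaningful for every function).\<close>
definition Linf_norm :: "(real \<Rightarrow> real) \<Rightarrow> ennreal" where
  "Linf_norm f = (INF C \<in> {C::ennreal. AE x in lborel. ennreal \<bar>f x\<bar> \<le> C}. C)"

definition sqrt_e :: "ennreal \<Rightarrow> ennreal" where
  "sqrt_e I = (if I = top then top else ennreal (sqrt (enn2real I)))"

definition L2_norm :: "(real \<Rightarrow> real) \<Rightarrow> ennreal" where
  "L2_norm f = sqrt_e (\<integral>\<^sup>+ x. ennreal ((f x)\<^sup>2) \<partial>lborel)"

definition L1_norm :: "(real \<Rightarrow> real) \<Rightarrow> ennreal" where
  "L1_norm f = (\<integral>\<^sup>+ x. ennreal \<bar>f x\<bar> \<partial>lborel)"

definition dnorm :: "(real \<Rightarrow> real) \<Rightarrow> real" where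
  "dnorm \<alpha> = enn2real (Linf_norm (wd \<alpha>))"

type_synonym lag = "(real \<Rightarrow> real) \<times> (real \<Rightarrow> real) \<times> (real \<Rightarrow> real) \<times> (real \<Rightarrow> real) \<times> (real \<Rightarrow> real)"

definition inF :: "(real \<Rightarrow> real) \<Rightarrow> lag \<Rightarrow> bool" where
  "inF \<alpha> X \<longleftrightarrow> (case X of (y, U, H, r, V) \<Rightarrow>
     E2 (\<lambda>\<xi>. y \<xi> - \<xi>) \<and> E2 U \<and> E1 H \<and> L2 r \<and> E1 V \<and>
     W1inf (\<lambda>\<xi>. y \<xi> - \<xi>) \<and> W1inf U \<and> W1inf H \<and> W1inf V \<and> Linf r \<and>
     (AE \<xi> in lborel. wd y \<xi> \<ge> 0) \<and> (AE \<xi> in lborel. wd H \<xi> \<ge> 0) \<and>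
     (\<exists>c>0. AE \<xi> in lborel. wd y \<xi> + wd H \<xi> > c) \<and>
     (AE \<xi> in lborel. wd y \<xi> * wd V \<xi> = (wd U \<xi>)\<^sup>2 + (r \<xi>)\<^sup>2) \<and>
     (AE \<xi> in lborel. 0 \<le> wd V \<xi> \<and> wd V \<xi> \<le> wd H \<xi>) \<and>
     ((\<forall>x. 0 \<le> \<alpha> x \<and> \<alpha> x < 1) \<longrightarrow>
        (\<exists>\<kappa>. (\<forall>x. 0 < \<kappa> x \<and> \<kappa> x \<le> 1) \<and>
           (AE \<xi> in lborel. wd V \<xi> = \<kappa> (y \<xi>) * wd H \<xi>) \<and>
           (AE \<xi> in lborel. (wd U \<xi> < 0 \<or> r \<xi> \<noteq> 0) \<longrightarrow> \<kappa> (y \<xi>) = 1))) \<and>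
     ((\<forall>x. \<alpha> x = 1) \<longrightarrow>
        (AE \<xi> in lborel. (wd y \<xi> = 0 \<longrightarrow> wd V \<xi> = 0) \<and>
                         (wd y \<xi> > 0 \<longrightarrow> wd V \<xi> = wd H \<xi>))))"

definition inFi :: "(real \<Rightarrow> real) \<Rightarrow> lag \<Rightarrow> bool" where
  "inFi \<alpha> X \<longleftrightarrow> inF \<alpha> X \<and> (case X of (y, U, H, r, V) \<Rightarrow> V = H)"

definition inF0 :: "(real \<Rightarrow> real) \<Rightarrow> lag \<Rightarrow> bool" where
  "inF0 \<alpha> X \<longleftrightarrow> inF \<alpha> X \<and> (case X of (y, U, H, r, V) \<Rightarrow> (\<forall>\<xi>. y \<xi> + H \<xi> = \<xi>))"

definition inFM :: "(real \<Rightarrow> real) \<Rightarrow> real \<Rightarrow> lag \<Rightarrow> bool" where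
  "inFM \<alpha> M X \<longleftrightarrow> inF \<alpha> X \<and> (case X of (y, U, H, r, V) \<Rightarrow> Linf_norm H \<le> ennreal M)"

definition inFi0M :: "(real \<Rightarrow> real) \<Rightarrow> real \<Rightarrow> lag \<Rightarrow> bool" where
  "inFi0M \<alpha> M X \<longleftrightarrow> inFi \<alpha> X \<and> inF0 \<alpha> X \<and> inFM \<alpha> M X"

definition tau :: "lag \<Rightarrow> real \<Rightarrow> ereal" where
  "tau X0 \<xi> = (case X0 of (y0, U0, H0, r0, V0) \<Rightarrow>
     (if wd y0 \<xi> = 0 then 0
      else if r0 \<xi> = 0 \<and> wd U0 \<xi> < 0 then ereal (- 2 * wd U0 \<xi> / wd H0 \<xi>)
      else \<infinity>))"

text \<open>V(xi,t) built from a candidate trajectory yy (yy t xi = y(xi,t)).\<close>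
definition Vflow :: "(real \<Rightarrow> real) \<Rightarrow> lag \<Rightarrow> (real \<Rightarrow> real \<Rightarrow> real) \<Rightarrow> real \<Rightarrow> real \<Rightarrow> real" where
  "Vflow \<alpha> X0 yy t \<xi> = (case X0 of (y0, U0, H0, r0, V0) \<Rightarrow>
     (LINT \<eta>:{..\<xi>}|lborel. wd H0 \<eta> *
        (1 - (if tau X0 \<eta> \<le> ereal t then \<alpha> (yy (real_of_ereal (tau X0 \<eta>)) \<eta>) else 0))))"

definition Vflow_inf :: "(real \<Rightarrow> real) \<Rightarrow> lag \<Rightarrow> (real \<Rightarrow> real \<Rightarrow> real) \<Rightarrow> real \<Rightarrow> real" where
  "Vflow_inf \<alpha> X0 yy t = Lim at_top (\<lambda>\<xi>. Vflow \<alpha> X0 yy t \<xi>)"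

text \<open>(yy, UU) solves the system y_t = U, U_t = V/2 - V_infty/4 (in integrated form)
  for t >= 0 with initial data X0; for t < 0 the values are normalised to the data.\<close>
definition is_flow :: "(real \<Rightarrow> real) \<Rightarrow> lag \<Rightarrow> (real \<Rightarrow> real \<Rightarrow> real) \<Rightarrow> (real \<Rightarrow> real \<Rightarrow> real) \<Rightarrow> bool" where
  "is_flow \<alpha> X0 yy UU \<longleftrightarrow> (case X0 of (y0, U0, H0, r0, V0) \<Rightarrow>
     (\<forall>t \<xi>. (t < 0 \<longrightarrow> yy t \<xi> = y0 \<xi> \<and> UU t \<xi> = U0 \<xi>) \<and>
        (0 \<le> t \<longrightarrow>
           yy t \<xi> = y0 \<xi> + (LINT s:{0..t}|lborel. UU s \<xi>) \<and>
           UU t \<xi> = U0 \<xi> + (LINT s:{0..t}|lborel. Vflow \<alpha> X0 yy s \<xi> / 2 - Vflow_inf \<alpha> X0 yy s / 4))))"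

definition Sflow :: "(real \<Rightarrow> real) \<Rightarrow> real \<Rightarrow> lag \<Rightarrow> lag" where
  "Sflow \<alpha> t X0 = (case X0 of (y0, U0, H0, r0, V0) \<Rightarrow>
     (let p = (THE p. is_flow \<alpha> X0 (fst p) (snd p)) in
       (fst p t, snd p t, H0, r0, Vflow \<alpha> X0 (fst p) t)))"

definition inG :: "(real \<Rightarrow> real) \<Rightarrow> bool" where
  "inG f \<longleftrightarrow> (\<exists>g. homeomorphism UNIV UNIV f g) \<and>
     W1inf (\<lambda>\<xi>. f \<xi> - \<xi>) \<and> W1inf (\<lambda>\<xi>. inv f \<xi> - \<xi>) \<and> L2 (\<lambda>\<xi>. wd f \<xi> - 1)"

definition relabel :: "lag \<Rightarrow> (real \<Rightarrow> real) \<Rightarrow> lag" where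
  "relabel X f = (case X of (y, U, H, r, V) \<Rightarrow>
     (y \<circ> f, U \<circ> f, H \<circ> f, (\<lambda>\<xi>. r (f \<xi>) * wd f \<xi>), V \<circ> f))"

definition PiX :: "lag \<Rightarrow> lag" where
  "PiX X = (case X of (y, U, H, r, V) \<Rightarrow> relabel X (inv (\<lambda>\<xi>. y \<xi> + H \<xi>)))"

definition Omega_d :: "lag \<Rightarrow> real set" where
  "Omega_d X = (case X of (y, U, H, r, V) \<Rightarrow> {\<xi>. wd U \<xi> < 0 \<and> r \<xi> = 0})"

definition Hinf :: "lag \<Rightarrow> real" where
  "Hinf X = (case X of (y, U, H, r, V) \<Rightarrow> Lim at_top H)"

definition gX :: "(real \<Rightarrow> real) \<Rightarrow> lag \<Rightarrow> real \<Rightarrow> real" where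
  "gX \<alpha> X \<xi> = (case X of (y, U, H, r, V) \<Rightarrow>
     (if \<xi> \<in> Omega_d X then wd y \<xi> + wd H \<xi> - \<alpha> (y \<xi>) * wd H \<xi> else wd y \<xi> + wd V \<xi>))"

definition g2X :: "(real \<Rightarrow> real) \<Rightarrow> lag \<Rightarrow> real \<Rightarrow> real" where
  "g2X \<alpha> X \<xi> = (case X of (y, U, H, r, V) \<Rightarrow>
     (if \<xi> \<in> Omega_d X then dnorm \<alpha> * Hinf X * wd U \<xi> else 0))"

definition g3X :: "(real \<Rightarrow> real) \<Rightarrow> lag \<Rightarrow> real \<Rightarrow> real" where
  "g3X \<alpha> X \<xi> = (case X of (y, U, H, r, V) \<Rightarrow>
     (if \<xi> \<in> Omega_d X then dnorm \<alpha> * U \<xi> * wd U \<xi> else 0))"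

definition dtilde :: "(real \<Rightarrow> real) \<Rightarrow> lag \<Rightarrow> lag \<Rightarrow> ennreal" where
  "dtilde \<alpha> X Xb = (case X of (y, U, H, r, V) \<Rightarrow> case Xb of (yb, Ub, Hb, rb, Vb) \<Rightarrow>
     Linf_norm (\<lambda>\<xi>. y \<xi> - yb \<xi>) + Linf_norm (\<lambda>\<xi>. U \<xi> - Ub \<xi>)
     + ennreal (dnorm \<alpha>) * L2_norm (\<lambda>\<xi>. U \<xi> * wd H \<xi> - Ub \<xi> * wd Hb \<xi>)
     + L1_norm (\<lambda>\<xi>. wd H \<xi> - wd Hb \<xi>)
     + sqrt_e (\<integral>\<^sup>+ \<xi>. ennreal ((wd y \<xi> - wd yb \<xi>)\<^sup>2 + (wd U \<xi> - wd Ub \<xi>)\<^sup>2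
                              + (wd H \<xi> - wd Hb \<xi>)\<^sup>2 + (r \<xi> - rb \<xi>)\<^sup>2) \<partial>lborel)
     + L2_norm (\<lambda>\<xi>. gX \<alpha> X \<xi> - gX \<alpha> Xb \<xi>)
     + L2_norm (\<lambda>\<xi>. g2X \<alpha> X \<xi> - g2X \<alpha> Xb \<xi>)
     + L2_norm (\<lambda>\<xi>. g3X \<alpha> X \<xi> - g3X \<alpha> Xb \<xi>))"

definition Jdist :: "(real \<Rightarrow> real) \<Rightarrow> lag \<Rightarrow> lag \<Rightarrow> ennreal" where
  "Jdist \<alpha> X Xb = (INF fg \<in> {fg. inG (fst fg) \<and> inG (snd fg)}.
      dtilde \<alpha> (relabel X (fst fg)) Xb + dtilde \<alpha> X (relabel Xb (snd fg)))"

definition dM :: "(real \<Rightarrow> real) \<Rightarrow> real \<Rightarrow> real \<Rightarrow> lag \<Rightarrow> lag \<Rightarrow> ennreal" where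
  "dM \<alpha> M t X Xb = (INF NXs \<in> {(N::nat, Xs). Xs 0 = X \<and> Xs N = Xb \<and> (\<forall>n\<le>N. inFi0M \<alpha> M (Xs n))}.
      (\<Sum>n\<in>{1..fst NXs}. Jdist \<alpha> (PiX (Sflow \<alpha> t (snd NXs (n - 1)))) (PiX (Sflow \<alpha> t (snd NXs n)))))"

type_synonym eul = "(real \<Rightarrow> real) \<times> (real \<Rightarrow> real) \<times> real measure \<times> real measure"

definition is_ac_part :: "real measure \<Rightarrow> real measure \<Rightarrow> bool" where
  "is_ac_part \<nu> m \<longleftrightarrow> absolutely_continuous lborel m \<and>
     (\<exists>N\<in>sets borel. emeasure lborel N = 0 \<and> (\<forall>A\<in>sets borel. emeasure m A = emeasure \<nu> (A - N)))"

definition inD :: "(real \<Rightarrow> real) \<Rightarrow> eul \<Rightarrow> bool" where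
  "inD \<alpha> w \<longleftrightarrow> (case w of (u, \<rho>, \<nu>, \<mu>) \<Rightarrow>
     Linf u \<and> (\<exists>g. has_weak_deriv u g \<and> L2 g) \<and> L2 \<rho> \<and>
     sets \<nu> = sets borel \<and> sets \<mu> = sets borel \<and> finite_measure \<nu> \<and> finite_measure \<mu> \<and>
     (\<forall>A\<in>sets borel. emeasure \<mu> A \<le> emeasure \<nu> A) \<and>
     is_ac_part \<mu> (density lborel (\<lambda>x. ennreal ((wd u x)\<^sup>2 + (\<rho> x)\<^sup>2))) \<and>
     ((\<forall>x. 0 \<le> \<alpha> x \<and> \<alpha> x < 1) \<longrightarrow>
        (AE x in \<nu>. RN_deriv \<nu> \<mu> x > 0) \<and>
        (AE x in lborel. (wd u x < 0 \<or> \<rho> x \<noteq> 0) \<longrightarrow> RN_deriv \<nu> \<mu> x = 1)) \<and>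
     ((\<forall>x. \<alpha> x = 1) \<longrightarrow> is_ac_part \<nu> \<mu>))"

definition Lmap :: "eul \<Rightarrow> lag" where
  "Lmap w = (case w of (u, \<rho>, \<nu>, \<mu>) \<Rightarrow>
     (let y = (\<lambda>\<xi>. Sup {x. measure \<nu> {..<x} + x < \<xi>});
          H = (\<lambda>\<xi>. \<xi> - y \<xi>) in
      (y, u \<circ> y, H, (\<lambda>\<xi>. \<rho> (y \<xi>) * wd y \<xi>),
       (\<lambda>\<xi>. LINT \<eta>:{..\<xi>}|lborel. enn2real (RN_deriv \<nu> \<mu> (y \<eta>)) * wd H \<eta>))))"

text \<open>w = M(X): the map M from Lagrangian to Eulerian coordinates, as a relation
  (rho is only determined almost everywhere).\<close>
definition Mrel :: "lag \<Rightarrow> eul \<Rightarrow> bool" where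
  "Mrel X w \<longleftrightarrow> (case X of (y, U, H, r, V) \<Rightarrow> case w of (u, \<rho>, \<nu>, \<mu>) \<Rightarrow>
     (\<forall>\<xi>. u (y \<xi>) = U \<xi>) \<and>
     (\<forall>a b. a \<le> b \<longrightarrow> set_integrable lborel {a..b} \<rho> \<and>
        (LINT x:{a..b}|lborel. \<rho> x) = (LINT \<xi>:(y -` {a..b})|lborel. r \<xi>)) \<and>
     \<nu> = distr (density lborel (\<lambda>\<xi>. ennreal (wd H \<xi>))) borel y \<and>
     \<mu> = distr (density lborel (\<lambda>\<xi>. ennreal (wd V \<xi>))) borel y)"

definition inD0 :: "(real \<Rightarrow> real) \<Rightarrow> eul \<Rightarrow> bool" where
  "inD0 \<alpha> w \<longleftrightarrow> inD \<alpha> w \<and> (\<exists>X. inFi \<alpha> X \<and> Mrel X w)"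

definition inD0M :: "(real \<Rightarrow> real) \<Rightarrow> real \<Rightarrow> eul \<Rightarrow> bool" where
  "inD0M \<alpha> M w \<longleftrightarrow> inD0 \<alpha> w \<and> (case w of (u, \<rho>, \<nu>, \<mu>) \<Rightarrow> measure \<nu> UNIV \<le> M)"

definition dD :: "(real \<Rightarrow> real) \<Rightarrow> real \<Rightarrow> real \<Rightarrow> eul \<Rightarrow> eul \<Rightarrow> ennreal" where
  "dD \<alpha> M t w wb = dM \<alpha> M t (Lmap w) (Lmap wb)"

definition Ctilde :: "(real \<Rightarrow> real) \<Rightarrow> real \<Rightarrow> real \<Rightarrow> real" where
  "Ctilde \<alpha> M t = 3 + 3/2*t + 1/2*t^2 + 3/16*t^3
     + sqrt M * (1 + 1/4*t + 1/4*t^2 + 1/16*t^3)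
     + dnorm \<alpha> * sqrt M * (5 + 2*t + t^2 + 3/8*t^3)
     + dnorm \<alpha> * M * (3 + 5/4*t + 1/2*t^2 + 1/8*t^3)"

definition Cbar :: "(real \<Rightarrow> real) \<Rightarrow> real \<Rightarrow> real \<Rightarrow> real" where
  "Cbar \<alpha> M t = 2 + dnorm \<alpha> * sqrt M + sqrt M * (1/2 + 1/8*t + 1/16*t^2)
     + dnorm \<alpha> * M * (1 + 1/4*t + 1/8*t^2)"

definition Chat :: "(real \<Rightarrow> real) \<Rightarrow> real \<Rightarrow> real \<Rightarrow> real" where
  "Chat \<alpha> M t = exp (t/2) * Ctilde \<alpha> M t * exp (t * Cbar \<alpha> M t)"

end

theory Submission
  imports Defs
begin

text \<open>
  In Lagrangian variables the system is integrated explicitly once the fraction of energy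
  \<open>\<phi> = \<alpha>(y(\<tau>))\<close> lost at the breaking time \<open>\<tau> = - 2 U\<^sub>\<xi> / H\<^sub>\<xi>\<close> is known, and \<open>\<phi>\<close> is a
  fixed point of a contraction; this gives existence and uniqueness of the flow. For two solutions
  the pointwise differences at time \<open>t\<close> are bounded by the integrands of the distance at time 0:
  where both or neither of them break the formulas are compared directly, and where only one
  breaks the terms \<open>g\<close>, \<open>g\<^sub>2\<close>, \<open>g\<^sub>3\<close> account for the energy loss. The only
  feedback, the sup norm of \<open>y - y'\<close> entering through \<open>\<alpha>(y)\<close>, is closed by Gronwall's inequality.
  Relabelling commutes with the flow, so that this estimate applies to relabelled data, and passing
  to the normalised representative at time \<open>t\<close> costs a factor \<open>e\<^bsup>t/2\<^esup>\<close> because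
  \<open>y\<^sub>\<xi> + H\<^sub>\<xi> \<ge> e\<^bsup>-t\<^esup>\<close>. Sums and infima then carry the bound over to the metric.
\<close>

section \<open>Weak derivatives and bi-Lipschitz changes of variables\<close>

text \<open>The derivatives in the metric are given by \<open>wd\<close>, an arbitrary choice, so a
  constraint such as \<open>a + h = 1\<close> for them holds only almost everywhere. The estimates
  are therefore made for representatives \<open>a, b, h, r\<close> that satisfy the constraints at
  every point, and \<open>dtilde\<close> is expressed through these. The flow is a
  \<open>THE\<close> over all pairs of functions solving the integral equations, with integrals that
  are 0 for non-integrable integrands; evaluating it needs uniqueness among candidates that are not
  assumed measurable.

  Relabelling destroys the normalisation \<open>a + h = 1\<close>, but each summand of
  \<open>Jdist\<close> relabels only one of the two data. This makes the estimates asymmetric: only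
  the second solution has \<open>a' + h' = 1\<close>, and then \<open>h' <= 1\<close> makes
  \<open>sqrt M\<close> a bound for the \<open>L2\<close> norms of \<open>h'\<close> and of
  \<open>sqrt h'\<close>.

  The constants \<open>Ctilde\<close> and \<open>Cbar\<close> are not produced term by term. The
  argument gives a Gronwall factor times a polynomial in \<open>t\<close>, \<open>sqrt M\<close> and
  \<open>dnorm \<alpha>\<close>, which is fitted under the prescribed constant by bounding
  \<open>exp (t * Cbar \<alpha> M t)\<close> from below by that factor times a product of Taylor
  polynomials.\<close>

lemma has_weak_derivD:
  assumes "has_weak_deriv f g"
  shows "g \<in> borel_measurable borel" "set_integrable lborel {a..b} g"
    "a \<le> b \<Longrightarrow> f b - f a = (LINT x:{a..b}|lborel. g x)"
proof -
  show "g \<in> borel_measurable borel" using assms by (simp add: has_weak_deriv_def)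
  show "set_integrable lborel {a..b} g"
    using assms by (cases "a \<le> b") (auto simp: has_weak_deriv_def set_integrable_def)
  show "a \<le> b \<Longrightarrow> f b - f a = (LINT x:{a..b}|lborel. g x)"
    using assms by (simp add: has_weak_deriv_def)
qed

text \<open>By Lebesgue differentiation \<open>g x\<close> is, off a negligible set, the limit of
  its averages over \<open>{x..x+h}\<close>, and these are nonnegative. Uniqueness of weak
  derivatives rests on this.\<close>

lemma AE_nonneg_if_interval_integrals_nonneg:
  fixes g :: "real \<Rightarrow> real"
  assumes [measurable]: "g \<in> borel_measurable borel"
    and int: "\<And>a b. set_integrable lborel {a..b} g"
    and nn: "\<And>a b. a \<le> b \<Longrightarrow> 0 \<le> (LINT x:{a..b}|lborel. g x)"
  shows "AE x in lborel. 0 \<le> g x"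
proof -
  have "g integrable_on cbox a b" for a b
    using set_borel_integral_eq_integral(1)[OF int] by simp
  then obtain N where N: "negligible N" and
    *: "\<And>x e. x \<notin> N \<Longrightarrow> 0 < e \<Longrightarrow> \<exists>d>0. \<forall>h. 0 < h \<and> h < d \<longrightarrow>
        norm (integral (cbox x (x + h *\<^sub>R One)) g /\<^sub>R h ^ DIM(real) - g x) < e"
    using integrable_ccontinuous_explicit[of g] by metis
  have "0 \<le> g x" if xN: "x \<notin> N" for x
  proof (rule ccontr)
    assume "\<not> 0 \<le> g x"
    then have "0 < - g x" by simp
    from *[OF xN this] obtain d where d: "d > 0" "\<And>h. 0 < h \<Longrightarrow> h < d \<Longrightarrow>
        norm (integral (cbox x (x + h *\<^sub>R One)) g /\<^sub>R h ^ DIM(real) - g x) < - g x"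
      by blast
    have "norm (integral {x..x + d/2} g / (d/2) - g x) < - g x"
      using d(2)[of "d/2"] d(1) by (auto simp: field_simps)
    moreover have "0 \<le> integral {x..x + d/2} g / (d/2)"
      using nn[of x "x + d/2"] d(1) set_borel_integral_eq_integral(2)[OF int, of x "x + d/2"]
      by (intro divide_nonneg_pos) auto
    ultimately show False unfolding real_norm_def by linarith
  qed
  then have "AE x in lebesgue. 0 \<le> g x"
    using N by (intro AE_I'[of N]) (auto simp: negligible_iff_null_sets)
  then show ?thesis by (simp add: AE_completion_iff)
qed

lemma has_weak_deriv_diff:
  assumes "has_weak_deriv f g" "has_weak_deriv f' g'"
  shows "has_weak_deriv (\<lambda>x. f x - f' x) (\<lambda>x. g x - g' x)"
  unfolding has_weak_deriv_def
proof (intro conjI allI impI)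
  show "(\<lambda>x. g x - g' x) \<in> borel_measurable lborel"
    using has_weak_derivD(1)[OF assms(1)] has_weak_derivD(1)[OF assms(2)] by simp
next
  fix a b :: real assume "a \<le> b"
  note i = has_weak_derivD(2)[OF assms(1), of a b] has_weak_derivD(2)[OF assms(2), of a b]
  show "set_integrable lborel {a..b} (\<lambda>x. g x - g' x)" by (rule set_integral_diff[OF i])
  show "f b - f' b - (f a - f' a) = (LINT x:{a..b}|lborel. g x - g' x)"
    using set_integral_diff(2)[OF i] has_weak_derivD(3)[OF assms(1) \<open>a \<le> b\<close>]
      has_weak_derivD(3)[OF assms(2) \<open>a \<le> b\<close>] by simp
qed

lemma has_weak_deriv_cmult:
  assumes "has_weak_deriv f g"
  shows "has_weak_deriv (\<lambda>x. c * f x) (\<lambda>x. c * g x)"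
  unfolding has_weak_deriv_def
proof (intro conjI allI impI)
  show "(\<lambda>x. c * g x) \<in> borel_measurable lborel"
    using has_weak_derivD(1)[OF assms(1)] by simp
next
  fix a b :: real assume "a \<le> b"
  note i = has_weak_derivD(2)[OF assms(1), of a b]
  show "set_integrable lborel {a..b} (\<lambda>x. c * g x)" using i by simp
  show "c * f b - c * f a = (LINT x:{a..b}|lborel. c * g x)"
    using has_weak_derivD(3)[OF assms(1) \<open>a \<le> b\<close>] by (simp add: right_diff_distrib[symmetric])
qed

lemma has_weak_deriv_add:
  assumes "has_weak_deriv f g" "has_weak_deriv f' g'"
  shows "has_weak_deriv (\<lambda>x. f x + f' x) (\<lambda>x. g x + g' x)"
  using has_weak_deriv_diff[OF assms(1) has_weak_deriv_cmult[OF assms(2), of "-1"]] by simp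

lemma has_weak_deriv_id: "has_weak_deriv (\<lambda>x. x) (\<lambda>x. 1)"
  by (auto simp add: has_weak_deriv_def set_integrable_def set_lebesgue_integral_def)

lemma has_weak_deriv_AE_cong:
  assumes "has_weak_deriv f g" "AE x in lborel. g x = g' x" "g' \<in> borel_measurable borel"
  shows "has_weak_deriv f g'"
proof -
  have [measurable]: "g \<in> borel_measurable borel" "g' \<in> borel_measurable borel"
    using assms has_weak_derivD by auto
  have "set_integrable lborel {a..b} g' \<and> f b - f a = (LINT x:{a..b}|lborel. g' x)" if "a \<le> b" for a b
  proof -
    have "integrable lborel (\<lambda>x. indicator {a..b} x *\<^sub>R g x) = integrable lborel (\<lambda>x. indicator {a..b} x *\<^sub>R g' x)"
      using assms(2) by (intro integrable_cong_AE) auto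
    moreover have "(LINT x:{a..b}|lborel. g x) = (LINT x:{a..b}|lborel. g' x)"
      unfolding set_lebesgue_integral_def using assms(2) by (intro integral_cong_AE) auto
    ultimately show ?thesis
      using has_weak_derivD[OF assms(1)] that by (simp add: set_integrable_def)
  qed
  then show ?thesis using assms(3) by (simp add: has_weak_deriv_def)
qed

lemma has_weak_deriv_AE_nonneg:
  assumes "has_weak_deriv f g" "mono f"
  shows "AE x in lborel. 0 \<le> g x"
proof (rule AE_nonneg_if_interval_integrals_nonneg)
  show "0 \<le> (LINT x:{a..b}|lborel. g x)" if "a \<le> b" for a b
    using has_weak_derivD(3)[OF assms(1) that] monoD[OF assms(2) that] by simp
qed (use has_weak_derivD[OF assms(1)] in auto)

lemma has_weak_deriv_unique:
  assumes "has_weak_deriv f g" "has_weak_deriv f g'"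
  shows "AE x in lborel. g x = g' x"
proof -
  have 1: "has_weak_deriv (\<lambda>x. f x - f x) (\<lambda>x. g x - g' x)"
    "has_weak_deriv (\<lambda>x. f x - f x) (\<lambda>x. g' x - g x)"
    using has_weak_deriv_diff assms by blast+
  have 2: "mono (\<lambda>x. f x - f x)" by (simp add: mono_def)
  show ?thesis using has_weak_deriv_AE_nonneg[OF 1(1) 2] has_weak_deriv_AE_nonneg[OF 1(2) 2] by eventually_elim simp
qed

lemma has_weak_deriv_wd: "has_weak_deriv f g \<Longrightarrow> has_weak_deriv f (wd f)"
  unfolding wd_def by (rule someI[of "has_weak_deriv f"])

lemma AE_wd_eq: "has_weak_deriv f g \<Longrightarrow> AE x in lborel. wd f x = g x"
  using has_weak_deriv_unique has_weak_deriv_wd by blast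

lemma has_weak_deriv_lipschitz:
  assumes "has_weak_deriv f g" "AE x in lborel. \<bar>g x\<bar> \<le> C" "a \<le> b"
  shows "\<bar>f b - f a\<bar> \<le> C * (b - a)"
proof -
  have i: "set_integrable lborel {a..b} g" and [measurable]: "g \<in> borel_measurable borel"
    using has_weak_derivD[OF assms(1)] by auto
  have ic: "set_integrable lborel {a..b} (\<lambda>x. C)"
    unfolding set_integrable_def by (intro borel_integrable_compact) auto
  have "norm (LINT x:{a..b}|lborel. g x) \<le> (LINT x:{a..b}|lborel. C)"
    unfolding set_lebesgue_integral_def
  proof (rule order_trans[OF integral_norm_bound integral_mono_AE])
    show "AE x in lborel. norm (indicator {a..b} x *\<^sub>R g x) \<le> indicator {a..b} x *\<^sub>R C"
      using assms(2) by eventually_elim (auto simp: indicator_def)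
  qed (use i ic in \<open>auto simp: set_integrable_def\<close>)
  also have "(LINT x:{a..b}|lborel. C) = C * (b - a)" using assms(3) by (simp add: set_lebesgue_integral_def)
  finally show ?thesis using has_weak_derivD(3)[OF assms(1,3)] by simp
qed

lemma has_weak_deriv_continuous:
  assumes "has_weak_deriv f g"
  shows "continuous_on UNIV f"
proof -
  have "continuous_on {-c..c} f" for c
  proof (cases "-c \<le> c")
    case True
    have i: "g integrable_on {-c..c}"
      using set_borel_integral_eq_integral(1)[OF has_weak_derivD(2)[OF assms]] .
    have "f x = f (-c) + integral {-c..x} g" if "x \<in> {-c..c}" for x
      using has_weak_derivD(3)[OF assms, of "-c" x] that
       set_borel_integral_eq_integral(2)[OF has_weak_derivD(2)[OF assms, of "-c" x]] by auto
    moreover have "continuous_on {-c..c} (\<lambda>x. f (-c) + integral {-c..x} g)"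
      by (rule continuous_on_add[OF continuous_on_const indefinite_integral_continuous_1[OF i]])
    ultimately show ?thesis by (rule continuous_on_eq[OF _ sym, rotated])
  qed auto
  then have "isCont f x" for x
  proof -
    have "continuous_on {-(\<bar>x\<bar>+1)..\<bar>x\<bar>+1} f" by fact
    then have "continuous_on {-(\<bar>x\<bar>+1)<..<\<bar>x\<bar>+1} f" by (rule continuous_on_subset) auto
    then show ?thesis by (rule continuous_on_interior) (auto simp: interior_open)
  qed
  then show ?thesis by (simp add: continuous_at_imp_continuous_on)
qed

lemma has_weak_deriv_measurable: "has_weak_deriv f g \<Longrightarrow> f \<in> borel_measurable borel"
  using has_weak_deriv_continuous by (rule borel_measurable_continuous_onI)

text \<open>The bounds on \<open>f'\<close> hold at every point, not just almost everywhere, so that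
  division by \<open>f'\<close> and the transport of pointwise sign conditions under multiplication
  by \<open>f'\<close> need no exceptional set.\<close>

definition bilip :: "(real \<Rightarrow> real) \<Rightarrow> (real \<Rightarrow> real) \<Rightarrow> bool" where
  "bilip f f' \<longleftrightarrow> has_weak_deriv f f' \<and> (\<exists>c>0. \<exists>C. \<forall>x. c \<le> f' x \<and> f' x \<le> C)"

lemma bilip_bounds:
  assumes "bilip f f'"
  obtains c C where "c > 0" "C > 0" "\<And>x. c \<le> f' x" "\<And>x. f' x \<le> C"
    "\<And>x y. x \<le> y \<Longrightarrow> c * (y - x) \<le> f y - f x" "\<And>x y. x \<le> y \<Longrightarrow> f y - f x \<le> C * (y - x)"
proof -
  from assms obtain c C where c: "c > 0" "\<And>x. c \<le> f' x" "\<And>x. f' x \<le> C" and w: "has_weak_deriv f f'"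
    unfolding bilip_def by auto
  have C: "C > 0" using c by (meson less_le_trans)
  have "c * (y - x) \<le> f y - f x" if "x \<le> y" for x y
  proof -
    \<comment> \<open>The lower bound for increments of \<open>f\<close> comes from the Lipschitz
      bound for \<open>C * x - f x\<close>, whose derivative lies between 0 and
      \<open>C - c\<close>.\<close>
    have "\<bar>C * 1 - f' z\<bar> \<le> C - c" for z using c(2,3)[of z] by linarith
    then have "\<bar>C * y - f y - (C * x - f x)\<bar> \<le> (C - c) * (y - x)"
      by (intro has_weak_deriv_lipschitz[OF has_weak_deriv_diff[OF has_weak_deriv_cmult[OF has_weak_deriv_id, of C] w] _ that])
         auto
    then show ?thesis by (simp add: algebra_simps)
  qed
  moreover have "f y - f x \<le> C * (y - x)" if "x \<le> y" for x y
  proof -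
    have "\<bar>f' z\<bar> \<le> C" for z using c(1) c(2,3)[of z] by linarith
    then show ?thesis using has_weak_deriv_lipschitz[OF w _ that, of C] by auto
  qed
  ultimately show thesis using that c C by blast
qed

lemma bilip_pos: "bilip f f' \<Longrightarrow> 0 < f' x"
  unfolding bilip_def by (meson less_le_trans)

lemma bilip_measurable:
  assumes "bilip f f'" shows "f \<in> borel_measurable borel" "f' \<in> borel_measurable borel"
  using assms has_weak_deriv_measurable has_weak_derivD(1) unfolding bilip_def by auto

lemma bilip_strict_mono:
  assumes "bilip f f'" shows "strict_mono f"
proof (rule strict_monoI)
  fix x y :: real assume "x < y"
  obtain c where "c > 0" "\<And>x y. x \<le> y \<Longrightarrow> c * (y - x) \<le> f y - f x" using bilip_bounds[OF assms] by metis
  from this(2)[of x y] \<open>x < y\<close> mult_pos_pos[OF this(1), of "y - x"] show "f x < f y" by simp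
qed

lemma bilip_bij:
  assumes "bilip f f'" shows "bij f"
proof -
  obtain c where c: "c > 0" "\<And>x y. x \<le> y \<Longrightarrow> c * (y - x) \<le> f y - f x" using bilip_bounds[OF assms] by metis
  have cont: "continuous_on UNIV f" using assms has_weak_deriv_continuous bilip_def by blast
  have "z \<in> range f" for z
  proof -
    define d where "d = \<bar>z - f 0\<bar> / c"
    have d: "d \<ge> 0" "c * d = \<bar>z - f 0\<bar>" using c by (auto simp: d_def)
    have "f (-d) \<le> z" "z \<le> f d" using c(2)[of "-d" 0] c(2)[of 0 d] d by auto
    then have "\<exists>x. -d \<le> x \<and> x \<le> d \<and> f x = z"
      using d cont by (intro IVT') (auto intro: continuous_on_subset)
    then show ?thesis by auto
  qed
  then show ?thesis using bilip_strict_mono[OF assms] by (auto simp: bij_def strict_mono_imp_inj_on)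
qed

lemma bilip_inv:
  assumes "bilip f f'" shows "f (inv f x) = x" "inv f (f x) = x"
  using bilip_bij[OF assms] by (simp_all add: bij_def surj_f_inv_f)

lemma bilip_le_iff: "bilip f f' \<Longrightarrow> f x \<le> f y \<longleftrightarrow> x \<le> y"
  using bilip_strict_mono strict_mono_less_eq by blast

text \<open>Lebesgue measure is determined by intervals, and the mass of \<open>f' dx\<close> on the
  preimage of \<open>(l, u)\<close> is \<open>u - l\<close> by the defining identity of the weak
  derivative. The substitution rules below follow from this identity of measures.\<close>

lemma bilip_distr:
  assumes "bilip f f'"
  shows "distr (density lborel (\<lambda>x. ennreal (f' x))) borel f = lborel"
proof (rule lborel_eqI[symmetric])
  note [measurable] = bilip_measurable[OF assms]
  have w: "has_weak_deriv f f'" using assms bilip_def by blast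
  fix l u :: real assume "\<And>b. b \<in> Basis \<Longrightarrow> l \<bullet> b \<le> u \<bullet> b"
  then have lu: "l \<le> u" by simp
  let ?a = "inv f l" and ?b = "inv f u"
  have ab: "?a \<le> ?b" using bilip_le_iff[OF assms, of ?a ?b] lu by (simp add: bilip_inv[OF assms])
  have vi: "f -` box l u = {?a<..<?b}"
    using bilip_le_iff[OF assms, of _ ?a] bilip_le_iff[OF assms, of ?b] by (auto simp: bilip_inv[OF assms] not_le[symmetric])
  have "emeasure (distr (density lborel (\<lambda>x. ennreal (f' x))) borel f) (box l u)
     = (\<integral>\<^sup>+x. ennreal (f' x) * indicator {?a<..<?b} x \<partial>lborel)"
    by (subst emeasure_distr) (simp_all only: vi emeasure_density, auto simp: emeasure_density)
  also have "\<dots> = (\<integral>\<^sup>+x. ennreal (indicator {?a..?b} x * f' x) \<partial>lborel)"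
    by (rule nn_integral_cong_AE, rule AE_I'[of "{?a, ?b}"]) (auto simp: indicator_def countable_imp_null_set_lborel)
  also have "\<dots> = ennreal (LINT x:{?a..?b}|lborel. f' x)"
    unfolding set_lebesgue_integral_def
    using has_weak_derivD(2)[OF w, of ?a ?b] bilip_pos[OF assms]
    by (subst nn_integral_eq_integral) (auto simp: set_integrable_def less_imp_le)
  also have "(LINT x:{?a..?b}|lborel. f' x) = u - l"
    using has_weak_derivD(3)[OF w ab] by (simp add: bilip_inv[OF assms])
  finally show "emeasure (distr (density lborel (\<lambda>x. ennreal (f' x))) borel f) (box l u) = (\<Prod>b\<in>Basis. (u - l) \<bullet> b)"
    by simp
qed simp

lemma bilip_nn_integral:
  assumes "bilip f f'" and [measurable]: "F \<in> borel_measurable borel"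
  shows "(\<integral>\<^sup>+x. F (f x) * ennreal (f' x) \<partial>lborel) = (\<integral>\<^sup>+x. F x \<partial>lborel)"
proof -
  note [measurable] = bilip_measurable[OF assms(1)]
  have "(\<integral>\<^sup>+x. F x \<partial>lborel) = (\<integral>\<^sup>+x. F x \<partial>distr (density lborel (\<lambda>x. ennreal (f' x))) borel f)"
    using bilip_distr[OF assms(1)] by simp
  also have "\<dots> = (\<integral>\<^sup>+x. ennreal (f' x) * F (f x) \<partial>lborel)"
    by (subst nn_integral_distr) (auto simp: nn_integral_density)
  finally show ?thesis by (simp add: mult.commute)
qed

lemma bilip_integrable:
  fixes F :: "real \<Rightarrow> real"
  assumes "bilip f f'" and [measurable]: "F \<in> borel_measurable borel"
  shows "integrable lborel (\<lambda>x. F (f x) * f' x) \<longleftrightarrow> integrable lborel F"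
proof -
  note [measurable] = bilip_measurable[OF assms(1)]
  have "integrable lborel F \<longleftrightarrow> integrable (distr (density lborel (\<lambda>x. ennreal (f' x))) borel f) F"
    using bilip_distr[OF assms(1)] by simp
  also have "\<dots> \<longleftrightarrow> integrable lborel (\<lambda>x. f' x *\<^sub>R F (f x))"
    using bilip_pos[OF assms(1)] by (subst integrable_distr_eq) (auto simp: integrable_density less_imp_le)
  finally show ?thesis by (simp add: mult.commute)
qed

lemma bilip_integral:
  fixes F :: "real \<Rightarrow> real"
  assumes "bilip f f'" and [measurable]: "F \<in> borel_measurable borel"
  shows "(LINT x|lborel. F (f x) * f' x) = (LINT x|lborel. F x)"
proof -
  note [measurable] = bilip_measurable[OF assms(1)]
  have "integral\<^sup>L lborel F = integral\<^sup>L (distr (density lborel (\<lambda>x. ennreal (f' x))) borel f) F"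
    using bilip_distr[OF assms(1)] by simp
  also have "\<dots> = (LINT x|lborel. f' x *\<^sub>R F (f x))"
    using bilip_pos[OF assms(1)] by (subst integral_distr) (auto simp: integral_density less_imp_le)
  finally show ?thesis by (simp add: mult.commute)
qed

text \<open>By substitution the preimage of a null set has mass 0 under \<open>f' dx\<close>, hence
  is null because \<open>f' > 0\<close>.\<close>

lemma bilip_AE:
  assumes "bilip f f'" "AE x in lborel. P x"
  shows "AE x in lborel. P (f x)"
proof -
  note [measurable] = bilip_measurable[OF assms(1)]
  from assms(2) obtain N where N: "{x. \<not> P x} \<subseteq> N" "N \<in> sets borel" "emeasure lborel N = 0"
    by (auto elim!: AE_E)
  note [measurable] = N(2)
  have "(\<integral>\<^sup>+x. indicator N (f x) * ennreal (f' x) \<partial>lborel) = 0"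
    by (subst bilip_nn_integral[OF assms(1)]) (use N in auto)
  then have "AE x in lborel. indicator N (f x) * ennreal (f' x) = 0"
    by (subst (asm) nn_integral_0_iff_AE) auto
  then show ?thesis
  proof eventually_elim
    case (elim x)
    then have "f x \<notin> N" using bilip_pos[OF assms(1), of x] by (auto simp: indicator_def)
    then show ?case using N(1) by auto
  qed
qed

lemma bilip_chain:
  assumes "bilip f f'" "has_weak_deriv F F'"
  shows "has_weak_deriv (\<lambda>x. F (f x)) (\<lambda>x. F' (f x) * f' x)"
  unfolding has_weak_deriv_def
proof (intro conjI allI impI)
  note [measurable] = bilip_measurable[OF assms(1)] has_weak_derivD(1)[OF assms(2)]
  show "(\<lambda>x. F' (f x) * f' x) \<in> borel_measurable lborel" by simp
  fix a b :: real assume ab: "a \<le> b"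
  let ?F = "\<lambda>x. indicator {f a..f b} x * F' x"
  have eq: "?F (f x) * f' x = indicator {a..b} x * (F' (f x) * f' x)" for x
    using bilip_le_iff[OF assms(1)] by (auto simp: indicator_def)
  have i: "integrable lborel ?F"
    using has_weak_derivD(2)[OF assms(2)] by (simp add: set_integrable_def)
  then have "integrable lborel (\<lambda>x. ?F (f x) * f' x)"
    by (subst bilip_integrable[OF assms(1)]) auto
  then show "set_integrable lborel {a..b} (\<lambda>x. F' (f x) * f' x)"
    unfolding eq by (simp add: set_integrable_def)
  have "(LINT x|lborel. ?F (f x) * f' x) = (LINT x|lborel. ?F x)"
    by (rule bilip_integral[OF assms(1)]) simp
  then show "F (f b) - F (f a) = (LINT x:{a..b}|lborel. F' (f x) * f' x)"
    unfolding eq using has_weak_derivD(3)[OF assms(2), of "f a" "f b"] bilip_le_iff[OF assms(1)] ab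
    by (simp add: set_lebesgue_integral_def)
qed

lemma bilip_comp:
  assumes "bilip f f'" "bilip g g'"
  shows "bilip (\<lambda>x. f (g x)) (\<lambda>x. f' (g x) * g' x)"
proof -
  obtain c C where f: "c > 0" "C > 0" "\<And>x. c \<le> f' x" "\<And>x. f' x \<le> C" using bilip_bounds[OF assms(1)] by metis
  obtain d D where g: "d > 0" "D > 0" "\<And>x. d \<le> g' x" "\<And>x. g' x \<le> D" using bilip_bounds[OF assms(2)] by metis
  have "c * d > 0" "\<And>x. c * d \<le> f' (g x) * g' x" "\<And>x. f' (g x) * g' x \<le> C * D"
    using f g by (auto intro!: mult_mono intro: order_trans less_imp_le)
  then show ?thesis
    using bilip_chain[OF assms(2)] assms(1) unfolding bilip_def by blast
qed

lemma bilip_inverse: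
  assumes "bilip f f'"
  shows "bilip (inv f) (\<lambda>x. 1 / f' (inv f x))"
proof -
  obtain c C where f: "c > 0" "C > 0" "\<And>x. c \<le> f' x" "\<And>x. f' x \<le> C"
    "\<And>x y. x \<le> y \<Longrightarrow> c * (y - x) \<le> f y - f x"
    using bilip_bounds[OF assms(1)] by metis
  note [measurable] = bilip_measurable[OF assms(1)]
  have mono: "x \<le> y \<Longrightarrow> inv f x \<le> inv f y" for x y
    using bilip_le_iff[OF assms, of "inv f x" "inv f y"] by (simp add: bilip_inv[OF assms])
  then have [measurable]: "inv f \<in> borel_measurable borel"
    by (intro borel_measurable_mono) (auto simp: mono_def)
  have pos: "f' x \<noteq> 0" "f' x > 0" for x using bilip_pos[OF assms, of x] by auto
  have bd: "1 / C \<le> 1 / f' x" "1 / f' x \<le> 1 / c" for x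
    using f(1,2) f(3,4)[of x] pos(2)[of x] by (auto simp: divide_simps)
  have "has_weak_deriv (inv f) (\<lambda>x. 1 / f' (inv f x))"
    unfolding has_weak_deriv_def
  proof (intro conjI allI impI)
    fix a b :: real assume ab: "a \<le> b"
    let ?F = "\<lambda>x. indicator {a..b} x * (1 / f' (inv f x))"
    have eq: "?F (f x) * f' x = indicator {inv f a..inv f b} x" for x
      using pos[of x] bilip_le_iff[OF assms, of x "inv f b"] bilip_le_iff[OF assms, of "inv f a" x] 
      by (auto simp: indicator_def bilip_inv[OF assms])
    have "integrable lborel (\<lambda>x. ?F (f x) * f' x)"
      unfolding eq by (rule integrable_real_indicator) (auto simp: emeasure_lborel_Icc_eq)
    then have "integrable lborel ?F" by (subst (asm) bilip_integrable[OF assms]) auto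
    then show "set_integrable lborel {a..b} (\<lambda>x. 1 / f' (inv f x))" by (simp add: set_integrable_def)
    have "(LINT x|lborel. ?F (f x) * f' x) = (LINT x|lborel. ?F x)"
      by (rule bilip_integral[OF assms(1)]) simp
    then show "inv f b - inv f a = (LINT x:{a..b}|lborel. 1 / f' (inv f x))"
      unfolding eq using mono[OF ab] by (simp add: set_lebesgue_integral_def)
  qed simp
  then show ?thesis using bd f(1,2) unfolding bilip_def by (metis divide_pos_pos zero_less_one)
qed

text \<open>The set where the bound fails is open and null, hence empty.\<close>

lemma continuous_AE_le:
  fixes f :: "real \<Rightarrow> real"
  assumes "continuous_on UNIV f" "AE x in lborel. f x \<le> C"
  shows "f x \<le> C"
proof (rule ccontr)
  assume "\<not> f x \<le> C"
  have "open {x. C < f x}" by (rule open_Collect_less) (use assms in auto)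
  moreover have "{x. C < f x} \<in> null_sets lborel"
    using \<open>open {x. C < f x}\<close> assms(2) AE_iff_null[of lborel "\<lambda>x. f x \<le> C"] by (auto simp: not_le)
  then have "negligible {x. C < f x}"
    by (auto simp: negligible_iff_null_sets intro: null_sets_completionI)
  ultimately have "{x. C < f x} = {}" using open_not_negligible by blast
  then show False using \<open>\<not> f x \<le> C\<close> by (auto simp: not_le)
qed

section \<open>The relabelling group in terms of explicit derivatives\<close>

definition diffeo :: "(real \<Rightarrow> real) \<Rightarrow> (real \<Rightarrow> real) \<Rightarrow> bool" where
  "diffeo f f' \<longleftrightarrow> bilip f f' \<and> (\<exists>C. \<forall>x. \<bar>f x - x\<bar> \<le> C) \<and> integrable lborel (\<lambda>x. (f' x - 1)\<^sup>2)"

lemma W1inf_minus_id: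
  assumes "W1inf (\<lambda>x. f x - x)"
  obtains f' C where "has_weak_deriv f f'" "AE x in lborel. \<bar>f' x\<bar> \<le> C" "\<And>x. \<bar>f x - x\<bar> \<le> C"
proof -
  from assms obtain g C1 C2 where g: "has_weak_deriv (\<lambda>x. f x - x) g" "AE x in lborel. \<bar>g x\<bar> \<le> C1"
    "AE x in lborel. \<bar>f x - x\<bar> \<le> C2"
    by (auto simp: W1inf_def Linf_def)
  have w: "has_weak_deriv f (\<lambda>x. g x + 1)"
    using has_weak_deriv_add[OF g(1) has_weak_deriv_id] by simp
  have c: "\<bar>f x - x\<bar> \<le> C2" for x
    by (rule continuous_AE_le[OF _ g(3)])
       (intro continuous_intros has_weak_deriv_continuous[OF g(1)])
  have "AE x in lborel. \<bar>g x + 1\<bar> \<le> max C2 (C1 + 1)"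
    using g(2) by eventually_elim linarith
  moreover have "\<bar>f x - x\<bar> \<le> max C2 (C1 + 1)" for x using c[of x] by simp
  ultimately show thesis using that w by blast
qed

text \<open>A homeomorphism at bounded distance from the identity is increasing. The Lipschitz bound
  of its inverse bounds \<open>f'\<close> below by \<open>1 / D\<close> almost everywhere, and
  clipping \<open>f'\<close> makes the bounds hold everywhere.\<close>

lemma inG_imp_diffeo:
  assumes "inG f"
  obtains f' where "diffeo f f'"
proof -
  from assms obtain g where hom: "homeomorphism UNIV UNIV f g" and
    W: "W1inf (\<lambda>\<xi>. f \<xi> - \<xi>)" "W1inf (\<lambda>\<xi>. inv f \<xi> - \<xi>)" "L2 (\<lambda>\<xi>. wd f \<xi> - 1)"
    by (auto simp: inG_def)
  have inj: "inj f" using hom by (metis UNIV_I homeomorphism_apply1 injI)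
  have surj: "surj f" using hom by (simp add: homeomorphism_image1)
  have cont: "continuous_on UNIV f" using hom by (simp add: homeomorphism_def)
  obtain f' C where f': "has_weak_deriv f f'" "AE x in lborel. \<bar>f' x\<bar> \<le> C" "\<And>x. \<bar>f x - x\<bar> \<le> C"
    using W1inf_minus_id[OF W(1)] by metis
  obtain i' D where i': "has_weak_deriv (inv f) i'" "AE x in lborel. \<bar>i' x\<bar> \<le> D"
    using W1inf_minus_id[OF W(2)] by metis
  note [measurable] = has_weak_derivD(1)[OF f'(1)]
  have mono: "f x \<le> f y" if "x \<le> y" for x y
  proof (rule ccontr)
    assume "\<not> f x \<le> f y"
    \<comment> \<open>The points lie so far out that \<open>f a < f y\<close> and
      \<open>f x < f b\<close>, because \<open>f\<close> stays within \<open>C\<close> of the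
      identity. With \<open>f y < f x\<close> this contradicts monotonicity along
      \<open>a < x < y\<close> and \<open>x < y < b\<close>.\<close>
    define a where "a = min x (f y - C) - 1"
    define b where "b = max y (f x + C) + 1"
    have lt: "a < x" "x < y" "y < b" using that \<open>\<not> f x \<le> f y\<close> by (auto simp: a_def b_def le_less)
    have 1: "f a < f y" "f x < f b" using f'(3)[of a] f'(3)[of b] unfolding a_def b_def by linarith+
    show False
      using continuous_inj_imp_mono[of a x y f] continuous_inj_imp_mono[of x y b f] lt 1 \<open>\<not> f x \<le> f y\<close>
       continuous_on_subset[OF cont] inj_on_subset[OF inj] by fastforce
  qed
  have D: "y - x \<le> D * (f y - f x)" if "x \<le> y" for x y
    using has_weak_deriv_lipschitz[OF i' mono[OF that]] inj that by simp
  have Dp: "D > 0" using D[of 0 1] mono[of 0 1] by (smt (verit) mult_nonpos_nonneg)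
  have "AE x in lborel. 0 \<le> f' x - 1 / D"
  proof (rule has_weak_deriv_AE_nonneg[OF has_weak_deriv_diff[OF f'(1) has_weak_deriv_cmult[OF has_weak_deriv_id, of "1/D", simplified mult_1_right]]])
    have "1 / D * (y - x) \<le> f y - f x" if "x \<le> y" for x y
      using D[OF that] Dp by (simp add: field_simps)
    then show "mono (\<lambda>x. f x - 1 / D * x)" by (force simp: mono_def right_diff_distrib)
  qed
  then have AE: "AE x in lborel. 1 / D \<le> f' x \<and> f' x \<le> C" using f'(2) by eventually_elim auto
  \<comment> \<open>Clipping needs ordered levels; in the wrong order the two almost-everywhere
    bounds on \<open>f'\<close> would exclude almost every point.\<close>
  have C: "1 / D \<le> C"
  proof (rule ccontr)
    assume "\<not> 1 / D \<le> C"
    have "AE x::real in lborel. (1::real) \<le> 0"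
      by (rule eventually_mono[OF AE]) (use \<open>\<not> 1 / D \<le> C\<close> in linarith)
    then show False using continuous_AE_le[of "\<lambda>x. 1" 0 0] by simp
  qed
  define F' where "F' x = min C (max (1/D) (f' x))" for x
  have eq: "AE x in lborel. f' x = F' x" using AE by eventually_elim (auto simp: F'_def)
  have [measurable]: "F' \<in> borel_measurable borel" unfolding F'_def by measurable
  have w: "has_weak_deriv f F'" by (rule has_weak_deriv_AE_cong[OF f'(1) eq]) simp
  have bl: "bilip f F'" unfolding bilip_def
    using w Dp C by (intro conjI exI[of _ "1/D"] exI[of _ C]) (auto simp: F'_def)
  have [measurable]: "wd f \<in> borel_measurable borel" using has_weak_derivD(1)[OF has_weak_deriv_wd[OF w]] .
  have "integrable lborel (\<lambda>x. (F' x - 1)\<^sup>2)"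
  proof (subst integrable_cong_AE)
    show "AE x in lborel. (F' x - 1)\<^sup>2 = (wd f x - 1)\<^sup>2" using AE_wd_eq[OF w] by eventually_elim simp
    show "integrable lborel (\<lambda>x. (wd f x - 1)\<^sup>2)" using W(3) by (simp add: L2_def)
  qed auto
  then show thesis using that bl f'(3) unfolding diffeo_def by blast
qed

lemma diffeo_bilip: "diffeo f f' \<Longrightarrow> bilip f f'"
  by (simp add: diffeo_def)

lemma bilip_W1inf:
  assumes "bilip f f'" "\<And>x. \<bar>f x - x\<bar> \<le> C"
  shows "W1inf (\<lambda>x. f x - x)"
proof -
  obtain c D where f: "c > 0" "D > 0" "\<And>x. c \<le> f' x" "\<And>x. f' x \<le> D" using bilip_bounds[OF assms(1)] by metis
  note [measurable] = bilip_measurable[OF assms(1)]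
  have "\<bar>f' x - 1\<bar> \<le> D + 1" for x using f(1) f(3,4)[of x] by linarith
  then have "Linf (\<lambda>x. f' x - 1)" "Linf (\<lambda>x. f x - x)" using assms(2) by (auto simp: Linf_def)
  moreover have "has_weak_deriv (\<lambda>x. f x - x) (\<lambda>x. f' x - 1)"
    using has_weak_deriv_diff[OF _ has_weak_deriv_id] assms(1) by (auto simp: bilip_def)
  ultimately show ?thesis by (auto simp: W1inf_def)
qed

text \<open>After substituting \<open>f\<close>, the integrand for the inverse becomes
  \<open>(f' - 1)^2 / f'\<close>, which is at most \<open>(f' - 1)^2 / c\<close>.\<close>

lemma diffeo_inverse:
  assumes "diffeo f f'"
  shows "diffeo (inv f) (\<lambda>x. 1 / f' (inv f x))"
proof -
  have bl: "bilip f f'" using assms diffeo_def by blast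
  note bi = bilip_inverse[OF bl]
  note [measurable] = bilip_measurable[OF bl] bilip_measurable[OF bi]
  obtain C where "\<And>x. \<bar>f x - x\<bar> \<le> C" using assms diffeo_def by blast
  then have "\<bar>inv f x - x\<bar> \<le> C" for x using bl by (metis abs_minus_commute bilip_inv(1))
  moreover have "integrable lborel (\<lambda>x. (1 / f' (inv f x) - 1)\<^sup>2)"
  proof (subst bilip_integrable[OF bl, symmetric])
    obtain c D where f: "c > 0" "D > 0" "\<And>x. c \<le> f' x" "\<And>x. f' x \<le> D" using bilip_bounds[OF bl] by metis
    show "integrable lborel (\<lambda>x. (1 / f' (inv f (f x)) - 1)\<^sup>2 * f' x)"
    proof (rule Bochner_Integration.integrable_bound)
      show "integrable lborel (\<lambda>x. 1 / c * (f' x - 1)\<^sup>2)" using assms by (simp add: diffeo_def)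
      have "(1 / f' x - 1)\<^sup>2 * f' x \<le> 1 / c * (f' x - 1)\<^sup>2" for x
      proof -
        have p: "f' x > 0" using bilip_pos[OF bl] .
        have "(1 / f' x - 1)\<^sup>2 * f' x = (f' x - 1)\<^sup>2 * (1 / f' x)"
          using p by (simp add: field_simps power2_eq_square)
        also have "\<dots> \<le> (f' x - 1)\<^sup>2 * (1 / c)"
          using p f(1) f(3)[of x] by (intro mult_left_mono) (auto simp: divide_simps)
        finally show ?thesis by (simp add: mult.commute)
      qed
      then show "AE x in lborel. norm ((1 / f' (inv f (f x)) - 1)\<^sup>2 * f' x) \<le> norm (1 / c * (f' x - 1)\<^sup>2)"
        using bilip_pos[OF bl] f(1) by (auto simp: abs_mult bilip_inv[OF bl] less_imp_le)
    qed (simp add: bilip_inv[OF bl])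
  qed simp
  ultimately show ?thesis using bi unfolding diffeo_def by blast
qed

lemma diffeo_imp_inG:
  assumes "diffeo f f'"
  shows "inG f"
proof -
  have bl: "bilip f f'" using assms diffeo_def by blast
  have w: "has_weak_deriv f f'" using bl bilip_def by blast
  note bi = bilip_inverse[OF bl]
  obtain C where C: "\<And>x. \<bar>f x - x\<bar> \<le> C" using assms diffeo_def by blast
  obtain D where D: "\<And>x. \<bar>inv f x - x\<bar> \<le> D" using diffeo_inverse[OF assms] diffeo_def by blast
  have "homeomorphism UNIV UNIV f (inv f)"
    using has_weak_deriv_continuous[OF w] has_weak_deriv_continuous[of "inv f"] bi bilip_bij[OF bl]
    unfolding homeomorphism_def bilip_def by (auto simp: bij_is_surj bij_is_inj surj_f_inv_f bij_imp_bij_inv)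
  moreover have "L2 (\<lambda>x. wd f x - 1)"
  proof -
    note [measurable] = has_weak_derivD(1)[OF has_weak_deriv_wd[OF w]] bilip_measurable[OF bl]
    have "integrable lborel (\<lambda>x. (wd f x - 1)\<^sup>2)"
    proof (subst integrable_cong_AE)
      show "AE x in lborel. (wd f x - 1)\<^sup>2 = (f' x - 1)\<^sup>2" using AE_wd_eq[OF w] by eventually_elim simp
      show "integrable lborel (\<lambda>x. (f' x - 1)\<^sup>2)" using assms by (simp add: diffeo_def)
    qed auto
    then show ?thesis by (simp add: L2_def)
  qed
  ultimately show ?thesis
    using bilip_W1inf[OF bl C] bilip_W1inf[OF bi D] unfolding inG_def by blast
qed

lemma integrable_power2_add:
  fixes f g :: "'a \<Rightarrow> real"
  assumes "integrable M (\<lambda>x. (f x)\<^sup>2)" "integrable M (\<lambda>x. (g x)\<^sup>2)"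
    and [measurable]: "f \<in> borel_measurable M" "g \<in> borel_measurable M"
  shows "integrable M (\<lambda>x. (f x + g x)\<^sup>2)"
proof (rule Bochner_Integration.integrable_bound)
  show "integrable M (\<lambda>x. 2 * (f x)\<^sup>2 + 2 * (g x)\<^sup>2)" using assms by simp
  have "(f x + g x)\<^sup>2 \<le> 2 * (f x)\<^sup>2 + 2 * (g x)\<^sup>2" for x
    using sum_squares_bound[of "f x" "g x"] by (simp add: power2_sum)
  then show "AE x in M. norm ((f x + g x)\<^sup>2) \<le> norm (2 * (f x)\<^sup>2 + 2 * (g x)\<^sup>2)" by auto
qed simp

text \<open>\<open>f'(g) g' - 1 = (f'(g) - 1) g' + (g' - 1)\<close>; in the square of the first
  summand one factor \<open>g'\<close> is bounded and the other is used up by the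
  substitution.\<close>

lemma diffeo_comp:
  assumes "diffeo f f'" "diffeo g g'"
  shows "diffeo (\<lambda>x. f (g x)) (\<lambda>x. f' (g x) * g' x)"
proof -
  have f: "bilip f f'" and g: "bilip g g'" using assms diffeo_def by auto
  note [measurable] = bilip_measurable[OF f] bilip_measurable[OF g]
  obtain C where C: "\<And>x. \<bar>f x - x\<bar> \<le> C" using assms(1) diffeo_def by blast
  obtain D where D: "\<And>x. \<bar>g x - x\<bar> \<le> D" using assms(2) diffeo_def by blast
  have "\<bar>f (g x) - x\<bar> \<le> C + D" for x using C[of "g x"] D[of x] by linarith
  moreover have "integrable lborel (\<lambda>x. ((f' (g x) - 1) * g' x + (g' x - 1))\<^sup>2)"
  proof (rule integrable_power2_add)
    obtain c K where K: "\<And>x. g' x \<le> K" "K > 0" using bilip_bounds[OF g] by metis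
    have "integrable lborel (\<lambda>x. (f' (g x) - 1)\<^sup>2 * g' x)"
      using assms(1) by (subst bilip_integrable[OF g]) (auto simp: diffeo_def)
    then have "integrable lborel (\<lambda>x. K * ((f' (g x) - 1)\<^sup>2 * g' x))" by simp
    then show "integrable lborel (\<lambda>x. ((f' (g x) - 1) * g' x)\<^sup>2)"
    proof (rule Bochner_Integration.integrable_bound)
      have "((f' (g x) - 1) * g' x)\<^sup>2 \<le> K * ((f' (g x) - 1)\<^sup>2 * g' x)" for x
      proof -
        have "((f' (g x) - 1) * g' x)\<^sup>2 = g' x * ((f' (g x) - 1)\<^sup>2 * g' x)" by (simp add: power2_eq_square)
        also have "\<dots> \<le> K * ((f' (g x) - 1)\<^sup>2 * g' x)"
          using K(1) bilip_pos[OF g, of x] by (intro mult_right_mono) auto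
        finally show ?thesis .
      qed
      then show "AE x in lborel. norm (((f' (g x) - 1) * g' x)\<^sup>2) \<le> norm (K * ((f' (g x) - 1)\<^sup>2 * g' x))"
        by (intro AE_I2) (metis abs_ge_self order_trans real_norm_def abs_of_nonneg zero_le_power2)
    qed simp
    show "integrable lborel (\<lambda>x. (g' x - 1)\<^sup>2)" using assms(2) by (simp add: diffeo_def)
  qed simp_all
  then have "integrable lborel (\<lambda>x. (f' (g x) * g' x - 1)\<^sup>2)" by (simp add: algebra_simps)
  ultimately show ?thesis using bilip_comp[OF f g] unfolding diffeo_def by blast
qed

section \<open>Extended-valued norms and real bounds for them\<close>

lemma sqrt_e_le_iff: "0 \<le> c \<Longrightarrow> sqrt_e I \<le> ennreal c \<longleftrightarrow> I \<le> ennreal (c\<^sup>2)"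
proof (cases I)
  case (real r)
  assume c: "0 \<le> c"
  have "sqrt r \<le> c \<longleftrightarrow> r \<le> c\<^sup>2" using c real(1) by (metis real_sqrt_le_iff real_sqrt_abs abs_of_nonneg)
  then show ?thesis using real c by (simp add: sqrt_e_def ennreal_le_iff)
qed (auto simp: sqrt_e_def top_unique)

lemma sqrt_e_mono: "I \<le> J \<Longrightarrow> sqrt_e I \<le> sqrt_e J"
  by (auto simp: sqrt_e_def top_unique enn2real_mono less_top intro!: ennreal_leI real_sqrt_le_mono)

lemma sqrt_e_cmult: "0 \<le> c \<Longrightarrow> sqrt_e (ennreal c * I) = ennreal (sqrt c) * sqrt_e I"
proof (cases I)
  case (real r)
  assume c: "0 \<le> c"
  then show ?thesis using real by (simp add: sqrt_e_def ennreal_mult[symmetric] real_sqrt_mult)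
next
  case top
  assume c: "0 \<le> c"
  then show ?thesis using top by (cases "c = 0") (auto simp: sqrt_e_def ennreal_mult_top)
qed

section \<open>The distance in terms of explicit derivatives\<close>

text \<open>Measurability, a real bound and its sign are bundled so that an \<open>L2\<close>
  estimate can be read off from the syntactic shape of a pointwise majorant by
  \<open>L2le_add\<close> and \<open>L2le_cmult\<close>.\<close>

definition L2le :: "(real \<Rightarrow> real) \<Rightarrow> real \<Rightarrow> bool" where
  "L2le f c \<longleftrightarrow> f \<in> borel_measurable borel \<and> 0 \<le> c \<and> (\<integral>\<^sup>+ x. ennreal ((f x)\<^sup>2) \<partial>lborel) \<le> ennreal (c\<^sup>2)"

lemma L2le_nonneg: "L2le f c \<Longrightarrow> 0 \<le> c" and L2le_meas: "L2le f c \<Longrightarrow> f \<in> borel_measurable borel"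
  by (auto simp: L2le_def)

lemma L2le_iff:
  "0 \<le> c \<Longrightarrow> f \<in> borel_measurable borel \<Longrightarrow> L2le f c \<longleftrightarrow> L2_norm f \<le> ennreal c"
  by (simp add: L2le_def L2_norm_def sqrt_e_le_iff)

lemma L2le_imp_le: "L2le f c \<Longrightarrow> L2_norm f \<le> ennreal c"
  by (simp add: L2le_def L2_norm_def sqrt_e_le_iff)

lemma L2le_mono:
  assumes "L2le g c" "\<And>x. \<bar>f x\<bar> \<le> \<bar>g x\<bar>" "f \<in> borel_measurable borel"
  shows "L2le f c"
proof -
  have "(\<integral>\<^sup>+ x. ennreal ((f x)\<^sup>2) \<partial>lborel) \<le> (\<integral>\<^sup>+ x. ennreal ((g x)\<^sup>2) \<partial>lborel)"
    using assms(2) by (intro nn_integral_mono ennreal_leI) (simp add: abs_le_square_iff)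
  then show ?thesis using assms by (auto simp: L2le_def)
qed

lemma L2le_cmult:
  assumes "L2le f c" "0 \<le> k"
  shows "L2le (\<lambda>x. k * f x) (k * c)"
proof -
  have [measurable]: "f \<in> borel_measurable borel" using assms by (simp add: L2le_def)
  have "(\<integral>\<^sup>+ x. ennreal ((k * f x)\<^sup>2) \<partial>lborel) = ennreal (k\<^sup>2) * (\<integral>\<^sup>+ x. ennreal ((f x)\<^sup>2) \<partial>lborel)"
    by (subst nn_integral_cmult[symmetric]) (auto simp: power_mult_distrib ennreal_mult)
  also have "\<dots> \<le> ennreal (k\<^sup>2) * ennreal (c\<^sup>2)" using assms by (intro mult_left_mono) (auto simp: L2le_def)
  finally show ?thesis using assms by (auto simp: L2le_def power_mult_distrib ennreal_mult)
qed

lemma L2le_Cauchy_Schwarz: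
  assumes "L2le f c" "L2le g d"
  shows "(\<integral>\<^sup>+ x. ennreal \<bar>f x * g x\<bar> \<partial>lborel) \<le> ennreal (c * d)"
proof -
  have [measurable]: "f \<in> borel_measurable borel" "g \<in> borel_measurable borel" and cd: "0 \<le> c" "0 \<le> d"
    using assms by (auto simp: L2le_def)
  let ?I = "\<integral>\<^sup>+ x. ennreal \<bar>f x * g x\<bar> \<partial>lborel"
  have "?I\<^sup>2 = (\<integral>\<^sup>+ x. ennreal \<bar>f x\<bar> * ennreal \<bar>g x\<bar> \<partial>lborel)\<^sup>2" by (simp add: abs_mult ennreal_mult)
  also have "\<dots> \<le> (\<integral>\<^sup>+ x. (ennreal \<bar>f x\<bar>)\<^sup>2 \<partial>lborel) * (\<integral>\<^sup>+ x. (ennreal \<bar>g x\<bar>)\<^sup>2 \<partial>lborel)"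
    by (rule Cauchy_Schwarz_nn_integral) auto
  also have "\<dots> \<le> ennreal (c\<^sup>2) * ennreal (d\<^sup>2)"
    using assms by (intro mult_mono) (auto simp: L2le_def ennreal_power)
  also have "\<dots> = ennreal ((c * d)\<^sup>2)" by (simp add: power_mult_distrib ennreal_mult)
  finally have sq: "?I\<^sup>2 \<le> ennreal ((c * d)\<^sup>2)" .
  show ?thesis
  proof (cases ?I)
    case (real r)
    then have "ennreal (r\<^sup>2) \<le> ennreal ((c * d)\<^sup>2)" using sq by (simp add: ennreal_power)
    then have "r\<^sup>2 \<le> (c * d)\<^sup>2" by (subst (asm) ennreal_le_iff) auto
    then have "r \<le> c * d" by (rule power2_le_imp_le) (use cd in auto)
    then show ?thesis using real by (simp add: ennreal_leI)
  next
    case top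
    then show ?thesis using sq by (simp add: top_unique power2_eq_square ennreal_mult_top)
  qed
qed

lemma L2le_add:
  assumes "L2le f c" "L2le g d"
  shows "L2le (\<lambda>x. f x + g x) (c + d)"
proof -
  have [measurable]: "f \<in> borel_measurable borel" "g \<in> borel_measurable borel" and cd: "0 \<le> c" "0 \<le> d"
    using assms by (auto simp: L2le_def)
  have "(\<integral>\<^sup>+ x. ennreal ((f x + g x)\<^sup>2) \<partial>lborel)
      \<le> (\<integral>\<^sup>+ x. ennreal ((f x)\<^sup>2) + ennreal ((g x)\<^sup>2) + 2 * ennreal \<bar>f x * g x\<bar> \<partial>lborel)"
  proof (rule nn_integral_mono)
    fix x
    have "(f x + g x)\<^sup>2 \<le> (f x)\<^sup>2 + (g x)\<^sup>2 + 2 * \<bar>f x * g x\<bar>" by (simp add: power2_sum)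
    then have "ennreal ((f x + g x)\<^sup>2) \<le> ennreal ((f x)\<^sup>2 + (g x)\<^sup>2 + 2 * \<bar>f x * g x\<bar>)" by (rule ennreal_leI)
    then show "ennreal ((f x + g x)\<^sup>2) \<le> ennreal ((f x)\<^sup>2) + ennreal ((g x)\<^sup>2) + 2 * ennreal \<bar>f x * g x\<bar>"
      by (simp add: ennreal_plus ennreal_mult)
  qed
  also have "\<dots> = (\<integral>\<^sup>+ x. ennreal ((f x)\<^sup>2) \<partial>lborel) + (\<integral>\<^sup>+ x. ennreal ((g x)\<^sup>2) \<partial>lborel)
      + 2 * (\<integral>\<^sup>+ x. ennreal \<bar>f x * g x\<bar> \<partial>lborel)"
    by (simp add: nn_integral_add nn_integral_cmult)
  also have "\<dots> \<le> ennreal (c\<^sup>2) + ennreal (d\<^sup>2) + 2 * ennreal (c * d)"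
    using assms by (intro add_mono mult_left_mono L2le_Cauchy_Schwarz) (auto simp: L2le_def)
  also have "\<dots> = ennreal ((c + d)\<^sup>2)"
    using cd by (simp add: power2_sum ennreal_plus ennreal_mult ac_simps)
  finally show ?thesis using cd by (auto simp: L2le_def)
qed

lemma L2le_norm_eq: "L2_norm f = ennreal c \<Longrightarrow> 0 \<le> c \<Longrightarrow> f \<in> borel_measurable borel \<Longrightarrow> L2le f c"
  by (simp add: L2le_iff)

lemma L2_norm_cong_AE: "AE x in lborel. f x = g x \<Longrightarrow> L2_norm f = L2_norm g"
  unfolding L2_norm_def by (intro arg_cong[where f=sqrt_e] nn_integral_cong_AE) auto

lemma L2_norm_cmult:
  assumes "0 \<le> c" and [measurable]: "f \<in> borel_measurable borel"
  shows "L2_norm (\<lambda>x. c * f x) = ennreal c * L2_norm f"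
proof -
  have "(\<integral>\<^sup>+ x. ennreal ((c * f x)\<^sup>2) \<partial>lborel) = ennreal (c\<^sup>2) * (\<integral>\<^sup>+ x. ennreal ((f x)\<^sup>2) \<partial>lborel)"
    by (subst nn_integral_cmult[symmetric]) (auto simp: power_mult_distrib ennreal_mult)
  then show ?thesis using assms(1) by (simp add: L2_norm_def sqrt_e_cmult)
qed

lemma L1_norm_cong_AE: "AE x in lborel. f x = g x \<Longrightarrow> L1_norm f = L1_norm g"
  unfolding L1_norm_def by (intro nn_integral_cong_AE) auto

lemma Linf_norm_le: "(\<And>x. \<bar>f x\<bar> \<le> c) \<Longrightarrow> Linf_norm f \<le> ennreal c"
  unfolding Linf_norm_def by (rule INF_lower2[of "ennreal c"]) (auto intro: ennreal_leI)

text \<open>The infimum is already that of countably many essential bounds, whose exceptional sets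
  have a null union.\<close>

lemma Linf_norm_AE_le:
  "AE x in lborel. ennreal \<bar>f x\<bar> \<le> Linf_norm f"
proof (cases "Linf_norm f = top")
  case False
  let ?S = "{C::ennreal. AE x in lborel. ennreal \<bar>f x\<bar> \<le> C}"
  have ne: "?S \<noteq> {}" by (auto intro!: exI[of _ top])
  obtain u :: "nat \<Rightarrow> ennreal" where u: "range u \<subseteq> ?S" "Inf ?S = (INF n. u n)"
    using ennreal_Inf_countable_INF[OF ne] by blast
  have "AE x in lborel. \<forall>n::nat. ennreal \<bar>f x\<bar> \<le> u n"
    using u(1) by (subst AE_all_countable) auto
  then show ?thesis
  proof eventually_elim
    case (elim x)
    have "Linf_norm f = (INF n. u n)" using u(2) by (simp add: Linf_norm_def)
    then show ?case using elim by (auto intro!: INF_greatest)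
  qed
qed simp

lemma Linf_norm_bound:
  assumes "continuous_on UNIV f" "Linf_norm f \<le> ennreal c" "0 \<le> c"
  shows "\<bar>f x\<bar> \<le> c"
proof (rule continuous_AE_le[of "\<lambda>x. \<bar>f x\<bar>"])
  show "AE x in lborel. \<bar>f x\<bar> \<le> c"
    using Linf_norm_AE_le[of f] 
  proof eventually_elim
    case (elim x)
    then have "ennreal \<bar>f x\<bar> \<le> ennreal c" using assms(2) by (rule order_trans)
    then show ?case using assms(3) by simp
  qed
qed (intro continuous_intros assms)

lemma Linf_norm_comp_le:
  assumes "bilip k k'"
  shows "Linf_norm (\<lambda>x. f (k x)) \<le> Linf_norm f"
  unfolding Linf_norm_def image_ident
  by (rule Inf_superset_mono, rule subsetI) (use bilip_AE[OF assms] in simp)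

text \<open>Of the two factors \<open>k'\<close> one is absorbed by the change of variables and the
  other is bounded by \<open>C\<close>. The \<open>L2\<close> norm of a relabelled derivative thus
  grows by \<open>sqrt C\<close> only, which later becomes \<open>exp (t / 2)\<close>.\<close>

lemma nn_integral_scale_le:
  assumes "bilip k k'" "\<And>x. k' x \<le> C" and [measurable]: "f \<in> borel_measurable borel" and "\<And>x. 0 \<le> f x"
  shows "(\<integral>\<^sup>+ x. ennreal (f (k x) * (k' x)\<^sup>2) \<partial>lborel) \<le> ennreal C * (\<integral>\<^sup>+ x. ennreal (f x) \<partial>lborel)"
proof -
  note [measurable] = bilip_measurable[OF assms(1)]
  have C: "0 \<le> C" using bilip_pos[OF assms(1), of 0] assms(2)[of 0] by simp
  have "(\<integral>\<^sup>+ x. ennreal (f (k x) * (k' x)\<^sup>2) \<partial>lborel) \<le> (\<integral>\<^sup>+ x. ennreal C * (ennreal (f (k x)) * ennreal (k' x)) \<partial>lborel)"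
  proof (rule nn_integral_mono)
    fix x
    have "f (k x) * (k' x)\<^sup>2 \<le> C * (f (k x) * k' x)"
      using assms(2)[of x] assms(4)[of "k x"] bilip_pos[OF assms(1), of x]
      mult_right_mono[of "k' x" C "f (k x) * k' x"] by (simp add: power2_eq_square algebra_simps)
    then show "ennreal (f (k x) * (k' x)\<^sup>2) \<le> ennreal C * (ennreal (f (k x)) * ennreal (k' x))"
      using C assms(4)[of "k x"] bilip_pos[OF assms(1), of x]
      by (simp add: ennreal_mult[symmetric] ennreal_leI)
  qed
  also have "\<dots> = ennreal C * (\<integral>\<^sup>+ x. ennreal (f x) \<partial>lborel)"
    by (subst nn_integral_cmult) (auto simp: bilip_nn_integral[OF assms(1), of "\<lambda>x. ennreal (f x)"])
  finally show ?thesis .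
qed

lemma L2_norm_scale_le:
  assumes "bilip k k'" "\<And>x. k' x \<le> C" and [measurable]: "f \<in> borel_measurable borel"
  shows "L2_norm (\<lambda>x. f (k x) * k' x) \<le> ennreal (sqrt C) * L2_norm f"
proof -
  have C: "0 \<le> C" using bilip_pos[OF assms(1), of 0] assms(2)[of 0] by simp
  show ?thesis unfolding L2_norm_def sqrt_e_cmult[OF C, symmetric] power_mult_distrib
    by (intro sqrt_e_mono nn_integral_scale_le[OF assms(1,2)]) auto
qed

lemma L1_norm_scale:
  assumes "bilip k k'" and [measurable]: "f \<in> borel_measurable borel"
  shows "L1_norm (\<lambda>x. f (k x) * k' x) = L1_norm f"
  unfolding L1_norm_def
  using bilip_nn_integral[OF assms(1), of "\<lambda>x. ennreal \<bar>f x\<bar>"] bilip_pos[OF assms(1)]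
  by (simp add: abs_mult ennreal_mult less_imp_le)

text \<open>Tuples \<open>(y, U, y\<^sub>\<xi>, U\<^sub>\<xi>, H\<^sub>\<xi>, r, V\<^sub>\<xi>, H\<^sub>\<infinity>)\<close>, with chosen representatives
  of the derivatives in place of the arbitrary ones given by \<^const>\<open>wd\<close>.\<close>

type_synonym ldata = "(real \<Rightarrow> real) \<times> (real \<Rightarrow> real) \<times> (real \<Rightarrow> real) \<times> (real \<Rightarrow> real) \<times>
  (real \<Rightarrow> real) \<times> (real \<Rightarrow> real) \<times> (real \<Rightarrow> real) \<times> real"

lemma ldata_cases:
  obtains y U a b h r v Hi where "(D :: ldata) = (y, U, a, b, h, r, v, Hi)"
  by (metis prod.exhaust)

definition ldata_g :: "(real \<Rightarrow> real) \<Rightarrow> ldata \<Rightarrow> real \<Rightarrow> real" where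
  "ldata_g \<alpha> D \<xi> = (case D of (y, U, a, b, h, r, v, Hi) \<Rightarrow>
     if b \<xi> < 0 \<and> r \<xi> = 0 then a \<xi> + h \<xi> - \<alpha> (y \<xi>) * h \<xi> else a \<xi> + v \<xi>)"

definition ldata_g2 :: "(real \<Rightarrow> real) \<Rightarrow> ldata \<Rightarrow> real \<Rightarrow> real" where
  "ldata_g2 \<alpha> D \<xi> = (case D of (y, U, a, b, h, r, v, Hi) \<Rightarrow>
     if b \<xi> < 0 \<and> r \<xi> = 0 then dnorm \<alpha> * Hi * b \<xi> else 0)"

definition ldata_g3 :: "(real \<Rightarrow> real) \<Rightarrow> ldata \<Rightarrow> real \<Rightarrow> real" where
  "ldata_g3 \<alpha> D \<xi> = (case D of (y, U, a, b, h, r, v, Hi) \<Rightarrow>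
     if b \<xi> < 0 \<and> r \<xi> = 0 then dnorm \<alpha> * U \<xi> * b \<xi> else 0)"

definition ldist :: "(real \<Rightarrow> real) \<Rightarrow> ldata \<Rightarrow> ldata \<Rightarrow> ennreal" where
  "ldist \<alpha> D Db = (case D of (y, U, a, b, h, r, v, Hi) \<Rightarrow> case Db of (yb, Ub, ab, bb, hb, rb, vb, Hib) \<Rightarrow>
     Linf_norm (\<lambda>\<xi>. y \<xi> - yb \<xi>) + Linf_norm (\<lambda>\<xi>. U \<xi> - Ub \<xi>)
     + ennreal (dnorm \<alpha>) * L2_norm (\<lambda>\<xi>. U \<xi> * h \<xi> - Ub \<xi> * hb \<xi>)
     + L1_norm (\<lambda>\<xi>. h \<xi> - hb \<xi>)
     + sqrt_e (\<integral>\<^sup>+ \<xi>. ennreal ((a \<xi> - ab \<xi>)\<^sup>2 + (b \<xi> - bb \<xi>)\<^sup>2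
                              + (h \<xi> - hb \<xi>)\<^sup>2 + (r \<xi> - rb \<xi>)\<^sup>2) \<partial>lborel)
     + L2_norm (\<lambda>\<xi>. ldata_g \<alpha> D \<xi> - ldata_g \<alpha> Db \<xi>)
     + L2_norm (\<lambda>\<xi>. ldata_g2 \<alpha> D \<xi> - ldata_g2 \<alpha> Db \<xi>)
     + L2_norm (\<lambda>\<xi>. ldata_g3 \<alpha> D \<xi> - ldata_g3 \<alpha> Db \<xi>))"

text \<open>\<open>y\<close> and \<open>U\<close> must agree with the tuple exactly,
  \<open>r\<close> almost everywhere. \<open>H\<close> and \<open>V\<close> enter through any choice
  of weak derivative, and \<open>H\<close> also through its limit.\<close>

definition ldata_of :: "lag \<Rightarrow> ldata \<Rightarrow> bool" where
  "ldata_of X D \<longleftrightarrow> (case X of (y', U', H, r', V) \<Rightarrow> case D of (y, U, a, b, h, r, v, Hi) \<Rightarrow>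
     y' = y \<and> U' = U \<and> has_weak_deriv y a \<and> has_weak_deriv U b \<and> has_weak_deriv H h \<and>
     has_weak_deriv V v \<and> (AE \<xi> in lborel. r' \<xi> = r \<xi>) \<and> (H \<longlongrightarrow> Hi) at_top)"

lemma dtilde_eq_ldist:
  assumes "ldata_of X D" "ldata_of Xb Db"
  shows "dtilde \<alpha> X Xb = ldist \<alpha> D Db"
proof -
  obtain y U a b h r v Hi where D: "D = (y, U, a, b, h, r, v, Hi)" by (cases D rule: ldata_cases)
  obtain yb Ub ab bb hb rb vb Hib where Db: "Db = (yb, Ub, ab, bb, hb, rb, vb, Hib)" by (cases Db rule: ldata_cases)
  from assms(1) D obtain H R V where X: "X = (y, U, H, R, V)" by (cases X) (auto simp: ldata_of_def)
  from assms(2) Db obtain Hb Rb Vb where Xb: "Xb = (yb, Ub, Hb, Rb, Vb)" by (cases Xb) (auto simp: ldata_of_def)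
  have w: "AE \<xi> in lborel. wd y \<xi> = a \<xi>" "AE \<xi> in lborel. wd U \<xi> = b \<xi>" "AE \<xi> in lborel. wd H \<xi> = h \<xi>"
    "AE \<xi> in lborel. wd V \<xi> = v \<xi>" "AE \<xi> in lborel. R \<xi> = r \<xi>"
    using assms(1) unfolding ldata_of_def X D prod.case by (blast intro: AE_wd_eq)+
  have wL: "Lim at_top H = Hi"
    using assms(1) unfolding ldata_of_def X D prod.case by (intro tendsto_Lim) auto
  have wb: "AE \<xi> in lborel. wd yb \<xi> = ab \<xi>" "AE \<xi> in lborel. wd Ub \<xi> = bb \<xi>" "AE \<xi> in lborel. wd Hb \<xi> = hb \<xi>"
    "AE \<xi> in lborel. wd Vb \<xi> = vb \<xi>" "AE \<xi> in lborel. Rb \<xi> = rb \<xi>"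
    using assms(2) unfolding ldata_of_def Xb Db prod.case by (blast intro: AE_wd_eq)+
  have wbL: "Lim at_top Hb = Hib"
    using assms(2) unfolding ldata_of_def Xb Db prod.case by (intro tendsto_Lim) auto
  have g: "AE \<xi> in lborel. gX \<alpha> X \<xi> = ldata_g \<alpha> D \<xi> \<and> g2X \<alpha> X \<xi> = ldata_g2 \<alpha> D \<xi> \<and> g3X \<alpha> X \<xi> = ldata_g3 \<alpha> D \<xi>"
    using w(1-5) by eventually_elim
      (auto simp: gX_def g2X_def g3X_def ldata_g_def ldata_g2_def ldata_g3_def X D Omega_d_def Hinf_def wL)
  have gb: "AE \<xi> in lborel. gX \<alpha> Xb \<xi> = ldata_g \<alpha> Db \<xi> \<and> g2X \<alpha> Xb \<xi> = ldata_g2 \<alpha> Db \<xi> \<and> g3X \<alpha> Xb \<xi> = ldata_g3 \<alpha> Db \<xi>"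
    using wb(1-5) by eventually_elim
      (auto simp: gX_def g2X_def g3X_def ldata_g_def ldata_g2_def ldata_g3_def Xb Db Omega_d_def Hinf_def wbL)
  have 1: "L2_norm (\<lambda>\<xi>. U \<xi> * wd H \<xi> - Ub \<xi> * wd Hb \<xi>) = L2_norm (\<lambda>\<xi>. U \<xi> * h \<xi> - Ub \<xi> * hb \<xi>)"
    by (rule L2_norm_cong_AE) (use w(3) wb(3) in eventually_elim, simp)
  have 2: "L1_norm (\<lambda>\<xi>. wd H \<xi> - wd Hb \<xi>) = L1_norm (\<lambda>\<xi>. h \<xi> - hb \<xi>)"
    by (rule L1_norm_cong_AE) (use w(3) wb(3) in eventually_elim, simp)
  have 3: "(\<integral>\<^sup>+ \<xi>. ennreal ((wd y \<xi> - wd yb \<xi>)\<^sup>2 + (wd U \<xi> - wd Ub \<xi>)\<^sup>2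
                              + (wd H \<xi> - wd Hb \<xi>)\<^sup>2 + (R \<xi> - Rb \<xi>)\<^sup>2) \<partial>lborel)
    = (\<integral>\<^sup>+ \<xi>. ennreal ((a \<xi> - ab \<xi>)\<^sup>2 + (b \<xi> - bb \<xi>)\<^sup>2
                              + (h \<xi> - hb \<xi>)\<^sup>2 + (r \<xi> - rb \<xi>)\<^sup>2) \<partial>lborel)"
    by (rule nn_integral_cong_AE) (use w(1,2,3,5) wb(1,2,3,5) in eventually_elim, simp)
  have 4: "L2_norm (\<lambda>\<xi>. gX \<alpha> X \<xi> - gX \<alpha> Xb \<xi>) = L2_norm (\<lambda>\<xi>. ldata_g \<alpha> D \<xi> - ldata_g \<alpha> Db \<xi>)"
    "L2_norm (\<lambda>\<xi>. g2X \<alpha> X \<xi> - g2X \<alpha> Xb \<xi>) = L2_norm (\<lambda>\<xi>. ldata_g2 \<alpha> D \<xi> - ldata_g2 \<alpha> Db \<xi>)"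
    "L2_norm (\<lambda>\<xi>. g3X \<alpha> X \<xi> - g3X \<alpha> Xb \<xi>) = L2_norm (\<lambda>\<xi>. ldata_g3 \<alpha> D \<xi> - ldata_g3 \<alpha> Db \<xi>)"
    by (rule L2_norm_cong_AE, use g gb in eventually_elim, simp)+
  show ?thesis using 1 2 3 4 unfolding dtilde_def ldist_def X Xb D Db by simp
qed

lemma Linf_norm_minus_commute: "Linf_norm (\<lambda>x. f x - g x) = Linf_norm (\<lambda>x. g x - f x)"
  by (simp add: Linf_norm_def abs_minus_commute)

lemma L1_norm_minus_commute: "L1_norm (\<lambda>x. f x - g x) = L1_norm (\<lambda>x. g x - f x)"
  by (simp add: L1_norm_def abs_minus_commute)

lemma L2_norm_minus_commute: "L2_norm (\<lambda>x. f x - g x) = L2_norm (\<lambda>x. g x - f x)"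
  by (simp add: L2_norm_def power2_commute)

definition ldata_scale :: "ldata \<Rightarrow> (real \<Rightarrow> real) \<Rightarrow> (real \<Rightarrow> real) \<Rightarrow> ldata" where
  "ldata_scale D k k' = (case D of (y, U, a, b, h, r, v, Hi) \<Rightarrow>
    (\<lambda>\<xi>. y (k \<xi>), \<lambda>\<xi>. U (k \<xi>), \<lambda>\<xi>. a (k \<xi>) * k' \<xi>, \<lambda>\<xi>. b (k \<xi>) * k' \<xi>, \<lambda>\<xi>. h (k \<xi>) * k' \<xi>,
     \<lambda>\<xi>. r (k \<xi>) * k' \<xi>, \<lambda>\<xi>. v (k \<xi>) * k' \<xi>, Hi))"

definition ldata_meas :: "ldata \<Rightarrow> bool" where
  "ldata_meas D \<longleftrightarrow> (case D of (y, U, a, b, h, r, v, Hi) \<Rightarrow>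
    y \<in> borel_measurable borel \<and> U \<in> borel_measurable borel \<and> a \<in> borel_measurable borel \<and>
    b \<in> borel_measurable borel \<and> h \<in> borel_measurable borel \<and> r \<in> borel_measurable borel \<and>
    v \<in> borel_measurable borel)"

lemma ldata_g_meas:
  assumes "ldata_meas D" and [measurable]: "\<alpha> \<in> borel_measurable borel"
  shows "ldata_g \<alpha> D \<in> borel_measurable borel" "ldata_g2 \<alpha> D \<in> borel_measurable borel" "ldata_g3 \<alpha> D \<in> borel_measurable borel"
proof -
  obtain y U a b h r v Hi where D: "D = (y, U, a, b, h, r, v, Hi)" by (cases D rule: ldata_cases)
  have [measurable]: "y \<in> borel_measurable borel" "U \<in> borel_measurable borel" "a \<in> borel_measurable borel"
    "b \<in> borel_measurable borel" "h \<in> borel_measurable borel" "r \<in> borel_measurable borel" "v \<in> borel_measurable borel"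
    using assms(1) by (auto simp: ldata_meas_def D)
  show "ldata_g \<alpha> D \<in> borel_measurable borel" "ldata_g2 \<alpha> D \<in> borel_measurable borel" "ldata_g3 \<alpha> D \<in> borel_measurable borel"
    unfolding ldata_g_def[abs_def] ldata_g2_def[abs_def] ldata_g3_def[abs_def] D prod.case by measurable
qed

text \<open>The three functions are homogeneous of degree one in \<open>(a, b, h, r, v)\<close>, and
  multiplication by \<open>k' > 0\<close> preserves the conditions \<open>b < 0\<close> and
  \<open>r = 0\<close> that describe \<open>Omega_d\<close>.\<close>

lemma ldata_g_scale:
  assumes "bilip k k'"
  shows "ldata_g \<alpha> (ldata_scale D k k') x = ldata_g \<alpha> D (k x) * k' x"
    "ldata_g2 \<alpha> (ldata_scale D k k') x = ldata_g2 \<alpha> D (k x) * k' x"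
    "ldata_g3 \<alpha> (ldata_scale D k k') x = ldata_g3 \<alpha> D (k x) * k' x"
  using bilip_pos[OF assms, of x]
  by (cases D rule: ldata_cases; auto simp: ldata_g_def ldata_g2_def ldata_g3_def ldata_scale_def algebra_simps
      mult_less_0_iff zero_less_mult_iff)+

text \<open>Sup norms do not increase and the \<open>L1\<close> norm is invariant, so
  \<open>1 <= C\<close> lets the factor \<open>sqrt C\<close> of the \<open>L2\<close> terms serve
  for the whole distance.\<close>

lemma ldist_scale_le:
  assumes k: "bilip k k'" "\<And>x. k' x \<le> C" "1 \<le> C"
    and m: "ldata_meas D" "ldata_meas Db" and [measurable]: "\<alpha> \<in> borel_measurable borel"
  shows "ldist \<alpha> (ldata_scale D k k') (ldata_scale Db k k') \<le> ennreal (sqrt C) * ldist \<alpha> D Db"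
proof -
  obtain y U a b h r v Hi where D: "D = (y, U, a, b, h, r, v, Hi)" by (cases D rule: ldata_cases)
  obtain yb Ub ab bb hb rb vb Hib where Db: "Db = (yb, Ub, ab, bb, hb, rb, vb, Hib)" by (cases Db rule: ldata_cases)
  have [measurable]: "y \<in> borel_measurable borel" "U \<in> borel_measurable borel" "a \<in> borel_measurable borel"
    "b \<in> borel_measurable borel" "h \<in> borel_measurable borel" "r \<in> borel_measurable borel" "v \<in> borel_measurable borel"
    "yb \<in> borel_measurable borel" "Ub \<in> borel_measurable borel" "ab \<in> borel_measurable borel"
    "bb \<in> borel_measurable borel" "hb \<in> borel_measurable borel" "rb \<in> borel_measurable borel" "vb \<in> borel_measurable borel"
    using m unfolding ldata_meas_def D Db prod.case by blast+
  note [measurable] = ldata_g_meas[OF m(1)] ldata_g_meas[OF m(2)]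
  have s: "1 \<le> ennreal (sqrt C)" using k(3) by simp
  have ge: "x \<le> ennreal (sqrt C) * x" for x using mult_right_mono[OF s, of x] by simp
  have C: "0 \<le> C" using k(3) by simp
  let ?S = "\<lambda>\<xi>. (a \<xi> - ab \<xi>)\<^sup>2 + (b \<xi> - bb \<xi>)\<^sup>2 + (h \<xi> - hb \<xi>)\<^sup>2 + (r \<xi> - rb \<xi>)\<^sup>2"
  have S: "(a (k x) * k' x - ab (k x) * k' x)\<^sup>2 + (b (k x) * k' x - bb (k x) * k' x)\<^sup>2
     + (h (k x) * k' x - hb (k x) * k' x)\<^sup>2 + (r (k x) * k' x - rb (k x) * k' x)\<^sup>2 = ?S (k x) * (k' x)\<^sup>2" for x
    by (simp add: left_diff_distrib[symmetric] power_mult_distrib distrib_right)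
  have 1: "Linf_norm (\<lambda>\<xi>. y (k \<xi>) - yb (k \<xi>)) \<le> ennreal (sqrt C) * Linf_norm (\<lambda>\<xi>. y \<xi> - yb \<xi>)"
    by (rule order_trans[OF Linf_norm_comp_le[OF k(1), of "\<lambda>\<xi>. y \<xi> - yb \<xi>"] ge])
  have 2: "Linf_norm (\<lambda>\<xi>. U (k \<xi>) - Ub (k \<xi>)) \<le> ennreal (sqrt C) * Linf_norm (\<lambda>\<xi>. U \<xi> - Ub \<xi>)"
    by (rule order_trans[OF Linf_norm_comp_le[OF k(1), of "\<lambda>\<xi>. U \<xi> - Ub \<xi>"] ge])
  have 3: "L2_norm (\<lambda>\<xi>. U (k \<xi>) * (h (k \<xi>) * k' \<xi>) - Ub (k \<xi>) * (hb (k \<xi>) * k' \<xi>))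
     \<le> ennreal (sqrt C) * L2_norm (\<lambda>\<xi>. U \<xi> * h \<xi> - Ub \<xi> * hb \<xi>)"
    using L2_norm_scale_le[OF k(1,2), of "\<lambda>\<xi>. U \<xi> * h \<xi> - Ub \<xi> * hb \<xi>"] by (simp add: algebra_simps)
  have 4: "L1_norm (\<lambda>\<xi>. h (k \<xi>) * k' \<xi> - hb (k \<xi>) * k' \<xi>) \<le> ennreal (sqrt C) * L1_norm (\<lambda>\<xi>. h \<xi> - hb \<xi>)"
    using L1_norm_scale[OF k(1), of "\<lambda>\<xi>. h \<xi> - hb \<xi>"] ge[of "L1_norm (\<lambda>\<xi>. h \<xi> - hb \<xi>)"]
    by (simp add: left_diff_distrib)
  have 5: "sqrt_e (\<integral>\<^sup>+ \<xi>. ennreal (?S (k \<xi>) * (k' \<xi>)\<^sup>2) \<partial>lborel) \<le> ennreal (sqrt C) * sqrt_e (\<integral>\<^sup>+ \<xi>. ennreal (?S \<xi>) \<partial>lborel)"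
    unfolding sqrt_e_cmult[OF C, symmetric]
    by (intro sqrt_e_mono nn_integral_scale_le[OF k(1,2), of ?S]) auto
  have 6: "L2_norm (\<lambda>\<xi>. (ldata_g \<alpha> D (k \<xi>) - ldata_g \<alpha> Db (k \<xi>)) * k' \<xi>) \<le> ennreal (sqrt C) * L2_norm (\<lambda>\<xi>. ldata_g \<alpha> D \<xi> - ldata_g \<alpha> Db \<xi>)"
    "L2_norm (\<lambda>\<xi>. (ldata_g2 \<alpha> D (k \<xi>) - ldata_g2 \<alpha> Db (k \<xi>)) * k' \<xi>) \<le> ennreal (sqrt C) * L2_norm (\<lambda>\<xi>. ldata_g2 \<alpha> D \<xi> - ldata_g2 \<alpha> Db \<xi>)"
    "L2_norm (\<lambda>\<xi>. (ldata_g3 \<alpha> D (k \<xi>) - ldata_g3 \<alpha> Db (k \<xi>)) * k' \<xi>) \<le> ennreal (sqrt C) * L2_norm (\<lambda>\<xi>. ldata_g3 \<alpha> D \<xi> - ldata_g3 \<alpha> Db \<xi>)"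
    by (rule L2_norm_scale_le[OF k(1,2)], simp)+
  have e: "ldist \<alpha> (ldata_scale D k k') (ldata_scale Db k k') =
     Linf_norm (\<lambda>\<xi>. y (k \<xi>) - yb (k \<xi>)) + Linf_norm (\<lambda>\<xi>. U (k \<xi>) - Ub (k \<xi>))
     + ennreal (dnorm \<alpha>) * L2_norm (\<lambda>\<xi>. U (k \<xi>) * (h (k \<xi>) * k' \<xi>) - Ub (k \<xi>) * (hb (k \<xi>) * k' \<xi>))
     + L1_norm (\<lambda>\<xi>. h (k \<xi>) * k' \<xi> - hb (k \<xi>) * k' \<xi>)
     + sqrt_e (\<integral>\<^sup>+ \<xi>. ennreal (?S (k \<xi>) * (k' \<xi>)\<^sup>2) \<partial>lborel)
     + L2_norm (\<lambda>\<xi>. (ldata_g \<alpha> D (k \<xi>) - ldata_g \<alpha> Db (k \<xi>)) * k' \<xi>)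
     + L2_norm (\<lambda>\<xi>. (ldata_g2 \<alpha> D (k \<xi>) - ldata_g2 \<alpha> Db (k \<xi>)) * k' \<xi>)
     + L2_norm (\<lambda>\<xi>. (ldata_g3 \<alpha> D (k \<xi>) - ldata_g3 \<alpha> Db (k \<xi>)) * k' \<xi>)"
    unfolding ldist_def ldata_g_scale[OF k(1)] left_diff_distrib
    unfolding ldata_scale_def D Db prod.case S ..
  have "ennreal (dnorm \<alpha>) * L2_norm (\<lambda>\<xi>. U (k \<xi>) * (h (k \<xi>) * k' \<xi>) - Ub (k \<xi>) * (hb (k \<xi>) * k' \<xi>))
    \<le> ennreal (sqrt C) * (ennreal (dnorm \<alpha>) * L2_norm (\<lambda>\<xi>. U \<xi> * h \<xi> - Ub \<xi> * hb \<xi>))"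
    using mult_left_mono[OF 3, of "ennreal (dnorm \<alpha>)"] by (simp add: ac_simps)
  then show ?thesis unfolding e using 1 2 4 5 6
    unfolding ldist_def D Db prod.case distrib_left
    by (intro add_mono) (simp_all add: D Db)
qed

lemma ldata_scale_comp:
  "ldata_scale (ldata_scale D f f') k k' = ldata_scale D (\<lambda>x. f (k x)) (\<lambda>x. f' (k x) * k' x)"
  by (cases D rule: ldata_cases) (simp add: ldata_scale_def mult.assoc)

section \<open>Integration in time and against the kernel of the system\<close>

lemma Fubini_time:
  fixes F :: "real \<Rightarrow> real \<Rightarrow> real" and c h :: "real \<Rightarrow> real"
  assumes [measurable]: "(\<lambda>x. F (fst x) (snd x)) \<in> borel_measurable (borel \<Otimes>\<^sub>M borel)"
    and [measurable]: "c \<in> borel_measurable borel" and c: "\<And>\<eta>. \<bar>c \<eta>\<bar> \<le> 1"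
    and h: "integrable lborel h" and F: "\<And>s \<eta>. 0 \<le> s \<Longrightarrow> s \<le> t \<Longrightarrow> \<bar>F s \<eta>\<bar> \<le> C * h \<eta>"
  shows "set_integrable lborel {0..t} (\<lambda>s. LINT \<eta>|lborel. c \<eta> * F s \<eta>)"
    and "(LINT s:{0..t}|lborel. (LINT \<eta>|lborel. c \<eta> * F s \<eta>)) = (LINT \<eta>|lborel. c \<eta> * (LINT s:{0..t}|lborel. F s \<eta>))"
proof -
  let ?G = "\<lambda>s \<eta>. indicator {0..t} s * (c \<eta> * F s \<eta>)"
  have b: "\<bar>?G s \<eta>\<bar> \<le> indicator {0..t} s * (C * h \<eta>)" for s \<eta>
  proof (cases "s \<in> {0..t}")
    case True
    have "\<bar>c \<eta> * F s \<eta>\<bar> \<le> 1 * (C * h \<eta>)"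
      unfolding abs_mult using c[of \<eta>] F[of s \<eta>] True by (intro mult_mono) auto
    then show ?thesis using True by simp
  qed simp
  have hm [measurable]: "h \<in> borel_measurable borel" using h by auto
  have meas [measurable]: "(\<lambda>x. ?G (fst x) (snd x)) \<in> borel_measurable (borel \<Otimes>\<^sub>M borel)" by measurable
  have s [measurable]: "(\<lambda>\<eta>. F s \<eta>) \<in> borel_measurable borel" for s
    using measurable_Pair2[OF assms(1), of s] by simp
  have 1: "integrable lborel (\<lambda>\<eta>. ?G s \<eta>)" for s
  proof (rule Bochner_Integration.integrable_bound)
    show "integrable lborel (\<lambda>\<eta>. indicator {0..t} s * (C * h \<eta>))" using h by simp
    show "AE \<eta> in lborel. norm (?G s \<eta>) \<le> norm (indicator {0..t} s * (C * h \<eta>))"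
      using b[of s] by (intro AE_I2) (metis abs_ge_self order_trans real_norm_def)
  qed simp
  have 2: "integrable lborel (\<lambda>s. LINT \<eta>|lborel. norm (?G s \<eta>))"
  proof (rule Bochner_Integration.integrable_bound)
    show "integrable lborel (\<lambda>s. indicator {0..t} s * (LINT \<eta>|lborel. C * h \<eta>))"
      by (intro integrable_mult_left integrable_real_indicator) (auto simp: emeasure_lborel_Icc_eq)
    have [measurable]: "(\<lambda>x. norm (?G (fst x) (snd x))) \<in> borel_measurable (borel \<Otimes>\<^sub>M lborel)" by measurable
    show "(\<lambda>s. LINT \<eta>|lborel. norm (?G s \<eta>)) \<in> borel_measurable lborel"
      using lborel.borel_measurable_lebesgue_integral[of "\<lambda>s \<eta>. norm (?G s \<eta>)" borel] by (simp add: split_beta')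
    show "AE s in lborel. norm (LINT \<eta>|lborel. norm (?G s \<eta>)) \<le> norm (indicator {0..t} s * (LINT \<eta>|lborel. C * h \<eta>))"
    proof (rule AE_I2)
      fix s
      have "(LINT \<eta>|lborel. norm (?G s \<eta>)) \<le> (LINT \<eta>|lborel. indicator {0..t} s * (C * h \<eta>))"
        using b[of s] 1[of s] h by (intro integral_mono) auto
      then show "norm (LINT \<eta>|lborel. norm (?G s \<eta>)) \<le> norm (indicator {0..t} s * (LINT \<eta>|lborel. C * h \<eta>))"
        by (simp add: order_trans[OF _ abs_ge_self])
    qed
  qed
  have int: "integrable (lborel \<Otimes>\<^sub>M lborel) (case_prod ?G)"
    by (rule lborel_pair.Fubini_integrable) (use 1 2 in \<open>auto simp: split_beta'\<close>)
  have e1: "(LINT \<eta>|lborel. ?G s \<eta>) = indicator {0..t} s *\<^sub>R (LINT \<eta>|lborel. c \<eta> * F s \<eta>)" for s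
    by simp
  have e2: "(LINT s|lborel. ?G s \<eta>) = c \<eta> * (LINT s:{0..t}|lborel. F s \<eta>)" for \<eta>
    unfolding set_lebesgue_integral_def
    by (subst integral_mult_right_zero[symmetric]) (simp add: ac_simps)
  have "integrable lborel (\<lambda>s. LINT \<eta>|lborel. ?G s \<eta>)"
    using lborel_pair.integrable_fst'[OF int] by simp
  then show "set_integrable lborel {0..t} (\<lambda>s. LINT \<eta>|lborel. c \<eta> * F s \<eta>)"
    unfolding set_integrable_def e1 .
  have "(LINT \<eta>|lborel. (LINT s|lborel. ?G s \<eta>)) = (LINT s|lborel. (LINT \<eta>|lborel. ?G s \<eta>))"
    by (rule lborel_pair.Fubini_integral[OF int])
  then show "(LINT s:{0..t}|lborel. (LINT \<eta>|lborel. c \<eta> * F s \<eta>)) = (LINT \<eta>|lborel. c \<eta> * (LINT s:{0..t}|lborel. F s \<eta>))"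
    unfolding e1 e2 by (simp add: set_lebesgue_integral_def)
qed

text \<open>Integration against this kernel is the operator \<open>V\<^sub>\<xi> \<mapsto> V/2 - V\<^sub>\<infinity>/4\<close>.\<close>

definition kap :: "real \<Rightarrow> real \<Rightarrow> real" where
  "kap \<xi> \<eta> = (if \<eta> \<le> \<xi> then 1/4 else -1/4)"

lemma kap_measurable [measurable]: "kap \<xi> \<in> borel_measurable borel"
  unfolding kap_def by measurable

lemma abs_kap [simp]: "\<bar>kap \<xi> \<eta>\<bar> = 1/4"
  by (simp add: kap_def)

lemma integrable_kap:
  assumes "integrable lborel f"
  shows "integrable lborel (\<lambda>\<eta>. kap \<xi> \<eta> * f \<eta>)"
proof (rule Bochner_Integration.integrable_bound[OF assms])
  show "(\<lambda>\<eta>. kap \<xi> \<eta> * f \<eta>) \<in> borel_measurable lborel" using assms by simp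
qed (auto simp: abs_mult)

lemma integral_kap_le:
  assumes "integrable lborel f"
  shows "\<bar>LINT \<eta>|lborel. kap \<xi> \<eta> * f \<eta>\<bar> \<le> (LINT \<eta>|lborel. \<bar>f \<eta>\<bar>) / 4"
  using integral_norm_bound[of lborel "\<lambda>\<eta>. kap \<xi> \<eta> * f \<eta>"] by (simp add: abs_mult)

text \<open>When \<open>\<xi>\<close> passes \<open>\<eta>\<close> the kernel rises from
  \<open>-1/4\<close> to \<open>1/4\<close>; the jump \<open>1/2\<close> is the factor in the
  derivative.\<close>

lemma has_weak_deriv_kap:
  assumes f: "integrable lborel f"
  shows "has_weak_deriv (\<lambda>\<xi>. LINT \<eta>|lborel. kap \<xi> \<eta> * f \<eta>) (\<lambda>\<xi>. f \<xi> / 2)"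
  unfolding has_weak_deriv_def
proof (intro conjI allI impI)
  show "(\<lambda>\<xi>. f \<xi> / 2) \<in> borel_measurable lborel" using f by auto
  have [measurable]: "f \<in> borel_measurable borel" using f by auto
  fix a b :: real assume "a \<le> b"
  show "set_integrable lborel {a..b} (\<lambda>\<xi>. f \<xi> / 2)"
    using integrable_mult_indicator[OF _ f, of "{a..b}"] by (simp add: set_integrable_def)
  have "(LINT \<eta>|lborel. kap b \<eta> * f \<eta>) - (LINT \<eta>|lborel. kap a \<eta> * f \<eta>) = (LINT \<eta>|lborel. kap b \<eta> * f \<eta> - kap a \<eta> * f \<eta>)"
    by (rule Bochner_Integration.integral_diff[symmetric]) (intro integrable_kap f)+
  also have "\<dots> = (LINT x:{a..b}|lborel. f x / 2)"
    unfolding set_lebesgue_integral_def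
  proof (rule integral_cong_AE)
    show "AE \<eta> in lborel. kap b \<eta> * f \<eta> - kap a \<eta> * f \<eta> = indicat_real {a..b} \<eta> *\<^sub>R (f \<eta> / 2)"
      using AE_lborel_singleton[of a] by eventually_elim (use \<open>a \<le> b\<close> in \<open>auto simp: kap_def indicator_def\<close>)
  qed simp_all
  finally show "(LINT \<eta>|lborel. kap b \<eta> * f \<eta>) - (LINT \<eta>|lborel. kap a \<eta> * f \<eta>) = (LINT x:{a..b}|lborel. f x / 2)" .
qed

lemma has_weak_deriv_atMost:
  assumes f: "integrable lborel f"
  shows "has_weak_deriv (\<lambda>\<xi>. LINT \<eta>:{..\<xi>}|lborel. f \<eta>) f"
  unfolding has_weak_deriv_def
proof (intro conjI allI impI)
  show "f \<in> borel_measurable lborel" using f by auto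
  have [measurable]: "f \<in> borel_measurable borel" using f by auto
  fix a b :: real assume "a \<le> b"
  have i: "set_integrable lborel S f" if "S \<in> sets borel" for S
    using integrable_mult_indicator[OF _ f, of S] that by (simp add: set_integrable_def)
  show "set_integrable lborel {a..b} f" by (rule i) simp
  have "{..b} = {..a} \<union> {a<..b}" using \<open>a \<le> b\<close> by auto
  then have "(LINT \<eta>:{..b}|lborel. f \<eta>) = (LINT \<eta>:{..a}|lborel. f \<eta>) + (LINT \<eta>:{a<..b}|lborel. f \<eta>)"
    by (simp only:) (rule set_integral_Un, auto intro: i)
  moreover have "(LINT \<eta>:{a<..b}|lborel. f \<eta>) = (LINT \<eta>:{a..b}|lborel. f \<eta>)"
    unfolding set_lebesgue_integral_def
  proof (rule integral_cong_AE)
    show "AE \<eta> in lborel. indicat_real {a<..b} \<eta> *\<^sub>R f \<eta> = indicat_real {a..b} \<eta> *\<^sub>R f \<eta>"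
      using AE_lborel_singleton[of a] by eventually_elim (auto simp: indicator_def)
  qed simp_all
  ultimately show "(LINT \<eta>:{..b}|lborel. f \<eta>) - (LINT \<eta>:{..a}|lborel. f \<eta>) = (LINT x:{a..b}|lborel. f x)" by simp
qed

lemma tendsto_integral_atMost:
  fixes f :: "real \<Rightarrow> real"
  assumes f: "integrable lborel f"
  shows "((\<lambda>\<xi>. LINT \<eta>:{..\<xi>}|lborel. f \<eta>) \<longlongrightarrow> (LINT \<eta>|lborel. f \<eta>)) at_top"
  unfolding set_lebesgue_integral_def
proof (rule integral_dominated_convergence_at_top[where w = "\<lambda>x. \<bar>f x\<bar>"])
  have [measurable]: "f \<in> borel_measurable borel" using f by auto
  show "\<forall>\<^sub>F i in at_top. AE x in lborel. norm (indicat_real {..i} x *\<^sub>R f x) \<le> \<bar>f x\<bar>"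
    by (intro always_eventually allI AE_I2) (auto simp: indicator_def)
  show "AE x in lborel. ((\<lambda>i. indicat_real {..i} x *\<^sub>R f x) \<longlongrightarrow> f x) at_top"
  proof (rule AE_I2)
    fix x :: real
    have "\<forall>\<^sub>F i in at_top. indicat_real {..i} x *\<^sub>R f x = f x"
      using eventually_ge_at_top[of x] by eventually_elim (simp add: indicator_def)
    then show "((\<lambda>i. indicat_real {..i} x *\<^sub>R f x) \<longlongrightarrow> f x) at_top" by (rule tendsto_eventually)
  qed
qed (use f in auto)

section \<open>The flow for a prescribed energy loss\<close>

text \<open>Here \<open>a, b, h\<close> are the initial \<open>y\<^sub>\<xi>, U\<^sub>\<xi>, H\<^sub>\<xi>\<close>, and \<open>\<phi>\<close> is a prescribed fraction of energy
  that is lost on the set \<open>B\<close> of labels which break; labels with \<open>a = 0\<close> break at time 0. The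
  functions \<open>k\<close> and \<open>kk\<close> are the first and second integrals in time of \<open>V\<^sub>\<xi> = v\<close>.\<close>

locale breaking_flow =
  fixes \<alpha> :: "real \<Rightarrow> real" and A M :: real and y0 U0 a b h r \<phi> :: "real \<Rightarrow> real"
  assumes \<alpha>_lip: "\<And>x y. \<bar>\<alpha> x - \<alpha> y\<bar> \<le> A * \<bar>x - y\<bar>"
    and \<alpha>_range: "\<And>x. 0 \<le> \<alpha> x" "\<And>x. \<alpha> x \<le> 1"
    and meas [measurable]: "a \<in> borel_measurable borel" "b \<in> borel_measurable borel"
      "h \<in> borel_measurable borel" "r \<in> borel_measurable borel" "\<phi> \<in> borel_measurable borel"
    and deriv0: "has_weak_deriv y0 a" "has_weak_deriv U0 b"
    and nonneg: "\<And>\<xi>. 0 \<le> a \<xi>" "\<And>\<xi>. 0 \<le> h \<xi>"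
    and energy: "\<And>\<xi>. a \<xi> * h \<xi> = (b \<xi>)\<^sup>2 + (r \<xi>)\<^sup>2"
    and pos: "\<And>\<xi>. 0 < a \<xi> + h \<xi>"
    and h_int: "integrable lborel h" and h_le: "(LINT \<xi>|lborel. h \<xi>) \<le> M"
    and \<phi>_range: "\<And>\<xi>. 0 \<le> \<phi> \<xi>" "\<And>\<xi>. \<phi> \<xi> \<le> 1"
begin

text \<open>By \<open>energy\<close>, \<open>a = 0\<close> forces \<open>b = r = 0\<close>, so that
  \<open>-2 b / h\<close> then gives the breaking time 0 prescribed by \<open>tau\<close>. One
  formula covers both kinds of breaking.\<close>

definition B :: "real \<Rightarrow> bool" where "B \<xi> \<longleftrightarrow> r \<xi> = 0 \<and> (b \<xi> < 0 \<or> a \<xi> = 0)"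
definition \<tau> :: "real \<Rightarrow> real" where "\<tau> \<xi> = - 2 * b \<xi> / h \<xi>"
text \<open>Time elapsed since breaking. Integrating the lost energy \<open>h * \<phi>\<close> once
  and twice in time gives \<open>h * \<phi> * \<theta>\<close> and
  \<open>h * \<phi> * \<theta>^2 / 2\<close>, the corrections in \<open>k\<close> and
  \<open>kk\<close>.\<close>

definition \<theta> :: "real \<Rightarrow> real \<Rightarrow> real" where "\<theta> t \<xi> = (if B \<xi> \<and> \<tau> \<xi> \<le> t then t - \<tau> \<xi> else 0)"
definition k :: "real \<Rightarrow> real \<Rightarrow> real" where "k t \<xi> = h \<xi> * (t - \<theta> t \<xi> * \<phi> \<xi>)"
definition kk :: "real \<Rightarrow> real \<Rightarrow> real" where "kk t \<xi> = h \<xi> * (t\<^sup>2 / 2 - (\<theta> t \<xi>)\<^sup>2 / 2 * \<phi> \<xi>)"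
definition I :: "real \<Rightarrow> real \<Rightarrow> real" where "I t \<xi> = (LINT \<eta>|lborel. kap \<xi> \<eta> * k t \<eta>)"
definition U :: "real \<Rightarrow> real \<Rightarrow> real" where "U t \<xi> = U0 \<xi> + I t \<xi>"
definition y :: "real \<Rightarrow> real \<Rightarrow> real" where
  "y t \<xi> = y0 \<xi> + t * U0 \<xi> + (LINT \<eta>|lborel. kap \<xi> \<eta> * kk t \<eta>)"
definition v :: "real \<Rightarrow> real \<Rightarrow> real" where "v t \<xi> = h \<xi> * (1 - (if B \<xi> \<and> \<tau> \<xi> \<le> t then \<phi> \<xi> else 0))"
definition y\<xi> :: "real \<Rightarrow> real \<Rightarrow> real" where "y\<xi> t \<xi> = a \<xi> + t * b \<xi> + kk t \<xi> / 2"
definition U\<xi> :: "real \<Rightarrow> real \<Rightarrow> real" where "U\<xi> t \<xi> = b \<xi> + k t \<xi> / 2"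

lemma meas0 [measurable]: "y0 \<in> borel_measurable borel" "U0 \<in> borel_measurable borel"
  using deriv0 has_weak_deriv_measurable by auto

lemma \<alpha>_meas [measurable]: "\<alpha> \<in> borel_measurable borel"
proof (rule borel_measurable_continuous_onI)
  have "A-lipschitz_on UNIV \<alpha>" using \<alpha>_lip[of 0 1]
    by (auto simp: lipschitz_on_def dist_real_def \<alpha>_lip intro: order_trans[OF abs_ge_zero])
  then show "continuous_on UNIV \<alpha>" by (rule lipschitz_on_continuous_on)
qed

lemma A_nonneg: "0 \<le> A" using \<alpha>_lip[of 0 1] by (auto intro: order_trans[OF abs_ge_zero])

lemma M_nonneg: "0 \<le> M" using h_le nonneg by (intro order_trans[OF integral_nonneg_AE h_le]) auto

lemma B_meas [measurable]: "Measurable.pred borel B" unfolding B_def by measurable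

lemma \<tau>_meas [measurable]: "\<tau> \<in> borel_measurable borel" unfolding \<tau>_def by measurable

text \<open>With \<open>r = 0\<close> the energy identity is \<open>a h = b^2\<close>, and
  \<open>pos\<close> excludes \<open>h = 0\<close>. Hence \<open>\<tau>\<close> and \<open>h\<close>
  determine the rest: before breaking \<open>y\<xi> = h (t - \<tau>)^2 / 4\<close> and
  \<open>U\<xi> = h (t - \<tau>) / 2\<close>, which vanish together at
  \<open>\<tau>\<close>.\<close>

lemma B_facts:
  assumes "B \<xi>"
  shows "r \<xi> = 0" "b \<xi> \<le> 0" "0 < h \<xi>" "a \<xi> * h \<xi> = (b \<xi>)\<^sup>2" "\<tau> \<xi> * h \<xi> = - 2 * b \<xi>" "0 \<le> \<tau> \<xi>"
    "b \<xi> = - (\<tau> \<xi> * h \<xi> / 2)" "a \<xi> = (\<tau> \<xi>)\<^sup>2 / 4 * h \<xi>"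
proof -
  show r: "r \<xi> = 0" using assms by (simp add: B_def)
  show e: "a \<xi> * h \<xi> = (b \<xi>)\<^sup>2" using energy[of \<xi>] r by simp
  show b: "b \<xi> \<le> 0" using assms e by (auto simp: B_def)
  show h: "0 < h \<xi>"
  proof (rule ccontr)
    assume "\<not> 0 < h \<xi>"
    then have "h \<xi> = 0" using nonneg(2)[of \<xi>] by simp
    then have "b \<xi> = 0" using e by simp
    then show False using assms pos[of \<xi>] \<open>h \<xi> = 0\<close> by (auto simp: B_def)
  qed
  show t: "\<tau> \<xi> * h \<xi> = - 2 * b \<xi>" using h by (simp add: \<tau>_def)
  then show b2: "b \<xi> = - (\<tau> \<xi> * h \<xi> / 2)" by simp
  show "0 \<le> \<tau> \<xi>" using b h by (simp add: \<tau>_def divide_nonpos_pos)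
  have "a \<xi> * h \<xi> = ((\<tau> \<xi>)\<^sup>2 / 4 * h \<xi>) * h \<xi>"
    unfolding e b2 by (simp add: power2_eq_square algebra_simps)
  then show "a \<xi> = (\<tau> \<xi>)\<^sup>2 / 4 * h \<xi>" using h by simp
qed

lemma \<theta>_bounds: "0 \<le> t \<Longrightarrow> 0 \<le> \<theta> t \<xi>" "0 \<le> t \<Longrightarrow> \<theta> t \<xi> \<le> t"
  using B_facts(6)[of \<xi>] by (auto simp: \<theta>_def)

lemma \<theta>_pair_meas [measurable]: "(\<lambda>x. \<theta> (fst x) (snd x)) \<in> borel_measurable (borel \<Otimes>\<^sub>M borel)"
  unfolding \<theta>_def by measurable

lemma \<theta>_meas [measurable]: "\<theta> t \<in> borel_measurable borel"
  unfolding \<theta>_def by measurable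

lemma k_meas [measurable]: "k t \<in> borel_measurable borel" "kk t \<in> borel_measurable borel"
    "v t \<in> borel_measurable borel" "y\<xi> t \<in> borel_measurable borel" "U\<xi> t \<in> borel_measurable borel"
  unfolding k_def kk_def v_def y\<xi>_def U\<xi>_def by measurable

lemma k_pair_meas [measurable]: "(\<lambda>x. k (fst x) (snd x)) \<in> borel_measurable (borel \<Otimes>\<^sub>M borel)"
  "(\<lambda>x. v (fst x) (snd x)) \<in> borel_measurable (borel \<Otimes>\<^sub>M borel)"
  unfolding k_def v_def by measurable

lemma v_bounds: "0 \<le> v t \<xi>" "v t \<xi> \<le> h \<xi>"
  using nonneg(2)[of \<xi>] \<phi>_range[of \<xi>] by (auto simp: v_def mult_left_le)

lemma k_bounds: assumes "0 \<le> t" shows "0 \<le> k t \<xi>" "k t \<xi> \<le> t * h \<xi>"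
proof -
  have "0 \<le> \<theta> t \<xi> * \<phi> \<xi>" using \<theta>_bounds(1)[OF assms, of \<xi>] \<phi>_range[of \<xi>] by simp
  moreover have "\<theta> t \<xi> * \<phi> \<xi> \<le> t * 1"
    using \<theta>_bounds[OF assms, of \<xi>] \<phi>_range[of \<xi>] assms by (intro mult_mono) auto
  ultimately show "0 \<le> k t \<xi>" "k t \<xi> \<le> t * h \<xi>"
    using nonneg(2)[of \<xi>] by (auto simp: k_def mult.commute[of t] intro!: mult_left_mono)
qed

lemma kk_bounds: assumes "0 \<le> t" shows "0 \<le> kk t \<xi>" "kk t \<xi> \<le> t\<^sup>2 / 2 * h \<xi>"
proof -
  have "0 \<le> (\<theta> t \<xi>)\<^sup>2 / 2 * \<phi> \<xi>" using \<phi>_range[of \<xi>] by simp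
  moreover have "(\<theta> t \<xi>)\<^sup>2 / 2 * \<phi> \<xi> \<le> t\<^sup>2 / 2 * 1"
    using \<theta>_bounds[OF assms, of \<xi>] \<phi>_range[of \<xi>] assms
    by (intro mult_mono divide_right_mono power_mono) auto
  ultimately show "0 \<le> kk t \<xi>" "kk t \<xi> \<le> t\<^sup>2 / 2 * h \<xi>"
    using nonneg(2)[of \<xi>] mult_left_mono[of "t\<^sup>2 / 2 - (\<theta> t \<xi>)\<^sup>2 / 2 * \<phi> \<xi>" "t\<^sup>2 / 2" "h \<xi>"]
    unfolding kk_def by (auto simp only: mult.commute[of _ "h \<xi>"] intro!: mult_nonneg_nonneg)
qed

lemma k_int: assumes "0 \<le> t" shows "integrable lborel (k t)" "integrable lborel (kk t)" "integrable lborel (v t)"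
proof -
  show "integrable lborel (k t)"
    by (rule Bochner_Integration.integrable_bound[of _ "\<lambda>\<xi>. t * h \<xi>"])
       (use h_int k_bounds[OF assms] in \<open>auto intro: order_trans[OF _ abs_ge_self]\<close>)
  show "integrable lborel (kk t)"
    by (rule Bochner_Integration.integrable_bound[of _ "\<lambda>\<xi>. t\<^sup>2 / 2 * h \<xi>"])
       (use h_int kk_bounds[OF assms] in \<open>auto intro: order_trans[OF _ abs_ge_self]\<close>)
  show "integrable lborel (v t)"
    by (rule Bochner_Integration.integrable_bound[of _ "\<lambda>\<xi>. h \<xi>"])
       (use h_int v_bounds nonneg in auto)
qed

lemma deriv_t:
  assumes "0 \<le> t"
  shows "has_weak_deriv (U t) (U\<xi> t)" "has_weak_deriv (y t) (y\<xi> t)"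
proof -
  have "has_weak_deriv (\<lambda>\<xi>. U0 \<xi> + (LINT \<eta>|lborel. kap \<xi> \<eta> * k t \<eta>)) (\<lambda>\<xi>. b \<xi> + k t \<xi> / 2)"
    by (intro has_weak_deriv_add deriv0 has_weak_deriv_kap k_int assms)
  then show "has_weak_deriv (U t) (U\<xi> t)" by (simp add: U_def[abs_def] U\<xi>_def[abs_def] I_def)
  have "has_weak_deriv (\<lambda>\<xi>. y0 \<xi> + t * U0 \<xi> + (LINT \<eta>|lborel. kap \<xi> \<eta> * kk t \<eta>)) (\<lambda>\<xi>. a \<xi> + t * b \<xi> + kk t \<xi> / 2)"
    by (intro has_weak_deriv_add has_weak_deriv_cmult deriv0 has_weak_deriv_kap k_int assms)
  then show "has_weak_deriv (y t) (y\<xi> t)" by (simp add: y_def[abs_def] y\<xi>_def[abs_def])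
qed

lemma integral_v_time:
  assumes "0 \<le> t" shows "(LINT s:{0..t}|lborel. v s \<eta>) = k t \<eta>"
proof (cases "B \<eta> \<and> \<tau> \<eta> \<le> t")
  case True
  have t0: "0 \<le> \<tau> \<eta>" using B_facts True by blast
  have "(LINT s:{0..t}|lborel. v s \<eta>) = (LINT s|lborel. h \<eta> * indicator {0..t} s - h \<eta> * \<phi> \<eta> * indicator {\<tau> \<eta>..t} s)"
    unfolding set_lebesgue_integral_def using True t0
    by (intro Bochner_Integration.integral_cong) (auto simp: v_def indicator_def algebra_simps)
  also have "\<dots> = h \<eta> * t - h \<eta> * \<phi> \<eta> * (t - \<tau> \<eta>)"
    using True t0 assms by (subst Bochner_Integration.integral_diff) (auto simp: emeasure_lborel_Icc_eq)
  finally show ?thesis using True by (simp add: k_def \<theta>_def algebra_simps)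
next
  case False
  have "(LINT s:{0..t}|lborel. v s \<eta>) = (LINT s|lborel. h \<eta> * indicator {0..t} s)"
    unfolding set_lebesgue_integral_def using False
    by (intro Bochner_Integration.integral_cong) (auto simp: v_def indicator_def)
  then show ?thesis using False assms by (auto simp: k_def \<theta>_def)
qed

lemma integral_id_Icc:
  fixes c d :: real
  assumes "c \<le> d" shows "(LINT s:{c..d}|lborel. s - c) = (d - c)\<^sup>2 / 2" "set_integrable lborel {c..d} (\<lambda>s. s - c)"
proof -
  have "((\<lambda>s. s - c) has_integral ((d - c)\<^sup>2 / 2 - (c - c)\<^sup>2 / 2)) {c..d}"
    using assms by (intro fundamental_theorem_of_calculus)
      (auto intro!: derivative_eq_intros simp: has_real_derivative_iff_has_vector_derivative[symmetric])
  moreover show i: "set_integrable lborel {c..d} (\<lambda>s. s - c)"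
    unfolding set_integrable_def by (intro borel_integrable_compact continuous_intros) auto
  ultimately show "(LINT s:{c..d}|lborel. s - c) = (d - c)\<^sup>2 / 2"
    using set_borel_integral_eq_integral(2)[OF i] by (simp add: integral_unique)
qed

lemma integral_k_time:
  assumes "0 \<le> t" shows "(LINT s:{0..t}|lborel. k s \<eta>) = kk t \<eta>"
proof (cases "B \<eta> \<and> \<tau> \<eta> \<le> t")
  case True
  have t0: "0 \<le> \<tau> \<eta>" using B_facts True by blast
  note i0 = integral_id_Icc[OF assms] and i1 = integral_id_Icc[of "\<tau> \<eta>" t]
  have "(LINT s:{0..t}|lborel. k s \<eta>) = (LINT s|lborel. h \<eta> * (indicator {0..t} s *\<^sub>R (s - 0)) - h \<eta> * \<phi> \<eta> * (indicator {\<tau> \<eta>..t} s *\<^sub>R (s - \<tau> \<eta>)))"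
    unfolding set_lebesgue_integral_def using True t0
    by (intro Bochner_Integration.integral_cong) (auto simp: k_def \<theta>_def indicator_def algebra_simps)
  also have "\<dots> = h \<eta> * (t\<^sup>2 / 2) - h \<eta> * \<phi> \<eta> * ((t - \<tau> \<eta>)\<^sup>2 / 2)"
  proof (subst Bochner_Integration.integral_diff)
    show "integrable lborel (\<lambda>s. h \<eta> * (indicator {0..t} s *\<^sub>R (s - 0)))"
      using i0(2) unfolding set_integrable_def by (rule integrable_mult_right)
    show "integrable lborel (\<lambda>s. h \<eta> * \<phi> \<eta> * (indicator {\<tau> \<eta>..t} s *\<^sub>R (s - \<tau> \<eta>)))"
      using i1(2) True unfolding set_integrable_def by (intro integrable_mult_right) auto
    have "(LINT s|lborel. indicator {0..t} s *\<^sub>R (s - 0)) = t\<^sup>2 / 2"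
      "(LINT s|lborel. indicator {\<tau> \<eta>..t} s *\<^sub>R (s - \<tau> \<eta>)) = (t - \<tau> \<eta>)\<^sup>2 / 2"
      using i0(1) i1(1) True by (simp_all add: set_lebesgue_integral_def)
    then show "(LINT s|lborel. h \<eta> * (indicator {0..t} s *\<^sub>R (s - 0))) - (LINT s|lborel. h \<eta> * \<phi> \<eta> * (indicator {\<tau> \<eta>..t} s *\<^sub>R (s - \<tau> \<eta>)))
       = h \<eta> * (t\<^sup>2 / 2) - h \<eta> * \<phi> \<eta> * ((t - \<tau> \<eta>)\<^sup>2 / 2)"
      by (simp only: integral_mult_right_zero)
  qed
  finally show ?thesis using True by (simp add: kk_def \<theta>_def algebra_simps)
next
  case False
  have "(LINT s:{0..t}|lborel. k s \<eta>) = (LINT s|lborel. h \<eta> * (indicator {0..t} s *\<^sub>R (s - 0)))"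
    unfolding set_lebesgue_integral_def using False
    by (intro Bochner_Integration.integral_cong) (auto simp: k_def \<theta>_def indicator_def)
  then show ?thesis using False integral_id_Icc[OF assms] by (auto simp: kk_def \<theta>_def set_lebesgue_integral_def)
qed

lemma U_time_integral:
  assumes "0 \<le> t"
  shows "set_integrable lborel {0..t} (\<lambda>s. U s \<xi>)" "y t \<xi> = y0 \<xi> + (LINT s:{0..t}|lborel. U s \<xi>)"
proof -
  note F = Fubini_time[where F = k and c = "kap \<xi>" and t = t and C = t and h = h]
  have bd: "\<bar>k s \<eta>\<bar> \<le> t * h \<eta>" if "0 \<le> s" "s \<le> t" for s \<eta>
    using k_bounds[OF that(1), of \<eta>] mult_right_mono[OF that(2) nonneg(2)[of \<eta>]] by simp
  have c: "set_integrable lborel {0..t} (\<lambda>s. U0 \<xi>)"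
    unfolding set_integrable_def by (intro borel_integrable_compact) auto
  have i: "set_integrable lborel {0..t} (\<lambda>s. I s \<xi>)"
    unfolding I_def by (rule F(1)) (use bd h_int in auto)
  show "set_integrable lborel {0..t} (\<lambda>s. U s \<xi>)" unfolding U_def by (rule set_integral_add(1)[OF c i])
  have "(LINT s:{0..t}|lborel. U s \<xi>) = (LINT s:{0..t}|lborel. U0 \<xi>) + (LINT s:{0..t}|lborel. I s \<xi>)"
    unfolding U_def by (rule set_integral_add(2)[OF c i])
  also have "(LINT s:{0..t}|lborel. U0 \<xi>) = t * U0 \<xi>" using assms by (simp add: set_lebesgue_integral_def)
  also have "(LINT s:{0..t}|lborel. I s \<xi>) = (LINT \<eta>|lborel. kap \<xi> \<eta> * kk t \<eta>)"
    unfolding I_def by (subst F(2)) (use bd h_int in \<open>auto simp: integral_k_time[OF assms]\<close>)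
  finally show "y t \<xi> = y0 \<xi> + (LINT s:{0..t}|lborel. U s \<xi>)" by (simp add: y_def)
qed

lemma v_time_integral:
  assumes "0 \<le> t"
  shows "U t \<xi> = U0 \<xi> + (LINT s:{0..t}|lborel. (LINT \<eta>:{..\<xi>}|lborel. v s \<eta>) / 2 - (LINT \<eta>|lborel. v s \<eta>) / 4)"
proof -
  note F = Fubini_time[where F = v and c = "kap \<xi>" and t = t and C = 1 and h = h]
  have bd: "\<bar>v s \<eta>\<bar> \<le> 1 * h \<eta>" for s \<eta> using v_bounds[of s \<eta>] by simp
  have e: "(LINT \<eta>:{..\<xi>}|lborel. v s \<eta>) / 2 - (LINT \<eta>|lborel. v s \<eta>) / 4 = (LINT \<eta>|lborel. kap \<xi> \<eta> * v s \<eta>)" for s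
  proof -
    have iv: "integrable lborel (v s)"
      by (rule Bochner_Integration.integrable_bound[OF h_int]) (use v_bounds nonneg in auto)
    then have i2: "integrable lborel (\<lambda>\<eta>. indicator {..\<xi>} \<eta> * v s \<eta>)"
      using integrable_mult_indicator[of "{..\<xi>}" lborel "v s"] by simp
    have "(LINT \<eta>|lborel. kap \<xi> \<eta> * v s \<eta>) = (LINT \<eta>|lborel. (indicator {..\<xi>} \<eta> * v s \<eta>) / 2 - v s \<eta> / 4)"
      by (intro Bochner_Integration.integral_cong) (auto simp: kap_def indicator_def)
    then show ?thesis using iv i2 by (simp add: set_lebesgue_integral_def)
  qed
  show ?thesis unfolding e
    by (subst F(2)) (use bd h_int in \<open>auto simp: integral_v_time[OF assms] U_def I_def\<close>)
qed

end

context breaking_flow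
begin

lemma k_0: "k 0 \<xi> = 0" "kk 0 \<xi> = 0"
  using \<theta>_bounds[of 0 \<xi>] by (simp_all add: k_def kk_def)

lemma y0_eq: "y 0 = y0" and U0_eq: "U 0 = U0"
  by (simp_all add: y_def U_def I_def k_0 fun_eq_iff)

lemma I_le:
  assumes "0 \<le> s" shows "\<bar>I s \<xi>\<bar> \<le> s * (LINT \<xi>|lborel. h \<xi>) / 4"
proof -
  have "(LINT \<eta>|lborel. \<bar>k s \<eta>\<bar>) \<le> (LINT \<eta>|lborel. s * h \<eta>)"
    using k_bounds[OF assms] k_int[OF assms] h_int by (intro integral_mono) auto
  then show ?thesis using integral_kap_le[OF k_int(1)[OF assms], of \<xi>] unfolding I_def by simp
qed

lemma y_minus_y0_le:
  assumes "0 \<le> s" shows "\<bar>y s \<xi> - y0 \<xi>\<bar> \<le> s * \<bar>U0 \<xi>\<bar> + s\<^sup>2 / 8 * (LINT \<xi>|lborel. h \<xi>)"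
proof -
  have "(LINT \<eta>|lborel. \<bar>kk s \<eta>\<bar>) \<le> (LINT \<eta>|lborel. s\<^sup>2 / 2 * h \<eta>)"
    using kk_bounds[OF assms] k_int[OF assms] h_int by (intro integral_mono) auto
  then have "\<bar>LINT \<eta>|lborel. kap \<xi> \<eta> * kk s \<eta>\<bar> \<le> s\<^sup>2 / 8 * (LINT \<xi>|lborel. h \<xi>)"
    using integral_kap_le[OF k_int(2)[OF assms], of \<xi>] by simp
  moreover have "\<bar>s * U0 \<xi>\<bar> = s * \<bar>U0 \<xi>\<bar>" using assms by (simp add: abs_mult)
  ultimately show ?thesis unfolding y_def by linarith
qed

text \<open>The speed is at most \<open>|U0| + t M / 4\<close>. At the level of \<open>kk\<close>
  this is a difference of squares, with \<open>\<theta>\<close> controlled by its increment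
  \<open>t - s\<close>.\<close>

lemma y_increment_le:
  assumes "0 \<le> s" "s \<le> t"
  shows "\<bar>y t \<xi> - y s \<xi>\<bar> \<le> (t - s) * (\<bar>U0 \<xi>\<bar> + t * M / 4)"
proof -
  have t: "0 \<le> t" using assms by simp
  have kb: "\<bar>kk t \<eta> - kk s \<eta>\<bar> \<le> (t - s) * t * h \<eta>" for \<eta>
  proof -
    have th: "0 \<le> \<theta> s \<eta>" "\<theta> s \<eta> \<le> \<theta> t \<eta>" "\<theta> t \<eta> - \<theta> s \<eta> \<le> t - s" "\<theta> s \<eta> \<le> s" "\<theta> t \<eta> \<le> t"
      using \<theta>_bounds[OF assms(1), of \<eta>] \<theta>_bounds[OF t, of \<eta>] assms by (auto simp: \<theta>_def)
    let ?d = "((\<theta> t \<eta>)\<^sup>2 - (\<theta> s \<eta>)\<^sup>2) * \<phi> \<eta>"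
    have "(\<theta> t \<eta>)\<^sup>2 - (\<theta> s \<eta>)\<^sup>2 = (\<theta> t \<eta> - \<theta> s \<eta>) * (\<theta> t \<eta> + \<theta> s \<eta>)"
      by (simp add: power2_eq_square algebra_simps)
    moreover have "\<dots> \<le> (t - s) * (t + s)" using th assms by (intro mult_mono) auto
    moreover have "0 \<le> (\<theta> t \<eta> - \<theta> s \<eta>) * (\<theta> t \<eta> + \<theta> s \<eta>)" using th by (intro mult_nonneg_nonneg) auto
    ultimately have d: "0 \<le> ?d" "?d \<le> (t - s) * (t + s)"
      using \<phi>_range[of \<eta>] by (auto intro!: mult_nonneg_nonneg intro: order_trans[OF mult_left_le])
    have "kk t \<eta> - kk s \<eta> = h \<eta> * (((t - s) * (t + s) - ?d) / 2)"
      unfolding kk_def by (simp add: power2_eq_square algebra_simps diff_divide_distrib)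
    moreover have "((t - s) * (t + s) - ?d) / 2 \<le> (t - s) * t"
    proof -
      have "(t - s) * (t + s) \<le> (t - s) * (2 * t)" using assms by (intro mult_left_mono) auto
      then show ?thesis using d by simp
    qed
    moreover have "0 \<le> ((t - s) * (t + s) - ?d) / 2" using d by simp
    ultimately have "0 \<le> kk t \<eta> - kk s \<eta>" "kk t \<eta> - kk s \<eta> \<le> h \<eta> * ((t - s) * t)"
      using nonneg(2)[of \<eta>] by (simp_all only: mult_nonneg_nonneg mult_left_mono)
    then show ?thesis by (simp add: mult.commute)
  qed
  have "\<bar>(LINT \<eta>|lborel. kap \<xi> \<eta> * kk t \<eta>) - (LINT \<eta>|lborel. kap \<xi> \<eta> * kk s \<eta>)\<bar> = \<bar>LINT \<eta>|lborel. kap \<xi> \<eta> * (kk t \<eta> - kk s \<eta>)\<bar>"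
    using k_int(2)[OF assms(1)] k_int(2)[OF t] by (simp add: right_diff_distrib integrable_kap)
  also have "\<dots> \<le> (LINT \<eta>|lborel. \<bar>kk t \<eta> - kk s \<eta>\<bar>) / 4"
    using k_int(2)[OF assms(1)] k_int(2)[OF t] by (intro integral_kap_le) auto
  also have "(LINT \<eta>|lborel. \<bar>kk t \<eta> - kk s \<eta>\<bar>) \<le> (LINT \<eta>|lborel. (t - s) * t * h \<eta>)"
    using kb k_int(2)[OF assms(1)] k_int(2)[OF t] h_int by (intro integral_mono) auto
  also have "\<dots> \<le> (t - s) * t * M" using h_le assms t by (simp add: mult_left_mono)
  finally have 1: "\<bar>(LINT \<eta>|lborel. kap \<xi> \<eta> * kk t \<eta>) - (LINT \<eta>|lborel. kap \<xi> \<eta> * kk s \<eta>)\<bar> \<le> (t - s) * (t * M / 4)"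
    by simp
  have "y t \<xi> - y s \<xi> = (t - s) * U0 \<xi> + ((LINT \<eta>|lborel. kap \<xi> \<eta> * kk t \<eta>) - (LINT \<eta>|lborel. kap \<xi> \<eta> * kk s \<eta>))"
    unfolding y_def by (simp add: algebra_simps)
  then have "\<bar>y t \<xi> - y s \<xi>\<bar> \<le> (t - s) * \<bar>U0 \<xi>\<bar> + (t - s) * (t * M / 4)"
    using 1 assms abs_triangle_ineq[of "(t - s) * U0 \<xi>" "(LINT \<eta>|lborel. kap \<xi> \<eta> * kk t \<eta>) - (LINT \<eta>|lborel. kap \<xi> \<eta> * kk s \<eta>)"]
    by (simp add: abs_mult)
  then show ?thesis by (simp add: distrib_left)
qed

text \<open>Since \<open>\<tau> h = -2 b\<close>, the quotient in the breaking time cancels. The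
  right side is Lipschitz in \<open>(b, h)\<close>, which \<open>\<tau>\<close> itself is
  not.\<close>

lemma B_h_\<theta>: "B \<xi> \<Longrightarrow> 0 \<le> t \<Longrightarrow> h \<xi> * \<theta> t \<xi> = max 0 (t * h \<xi> + 2 * b \<xi>)"
  using B_facts(3,5)[of \<xi>] mult_left_mono[of "\<tau> \<xi>" t "h \<xi>"] mult_strict_left_mono[of t "\<tau> \<xi>" "h \<xi>"]
  by (auto simp: \<theta>_def max_def algebra_simps not_le)

lemma not_B_k: "\<not> B \<xi> \<Longrightarrow> k t \<xi> = t * h \<xi>" "\<not> B \<xi> \<Longrightarrow> v t \<xi> = h \<xi>"
  by (auto simp: k_def v_def \<theta>_def)

end

text \<open>The prescribed loss is now consistent with the trajectory it generates; this is the
  fixed-point equation behind the explicit formulas.\<close>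

locale breaking_solution = breaking_flow +
  assumes A_eq: "A = dnorm \<alpha>"
    and \<phi>_eq: "\<And>\<xi>. B \<xi> \<Longrightarrow> \<phi> \<xi> = \<alpha> (y (\<tau> \<xi>) \<xi>)"
begin

text \<open>The energy density for which \<open>g = y\<xi> + e\<close> at all times: before breaking
  the loss is evaluated at the current position, as \<open>g\<close> does on \<open>Omega_d\<close>,
  and from \<open>\<tau>\<close> on it is frozen and \<open>e\<close> equals \<open>v\<close>. The
  time \<open>min \<tau> t\<close> merges both phases.\<close>

definition e :: "real \<Rightarrow> real \<Rightarrow> real" where
  "e t \<xi> = (if B \<xi> then (1 - \<alpha> (y (min (\<tau> \<xi>) t) \<xi>)) * h \<xi> else h \<xi>)"

definition D :: "real \<Rightarrow> ldata" where
  "D t = (y t, U t, y\<xi> t, U\<xi> t, h, r, v t, LINT \<xi>|lborel. h \<xi>)"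

lemma U\<xi>_broken: "B \<xi> \<Longrightarrow> \<tau> \<xi> \<le> t \<Longrightarrow> 0 \<le> U\<xi> t \<xi>"
proof -
  assume B: "B \<xi>" "\<tau> \<xi> \<le> t"
  have "0 \<le> (t - \<tau> \<xi>) * (1 - \<phi> \<xi>) * h \<xi>" using B \<phi>_range[of \<xi>] nonneg(2)[of \<xi>] by (intro mult_nonneg_nonneg) auto
  moreover have "U\<xi> t \<xi> = (t - \<tau> \<xi>) * (1 - \<phi> \<xi>) * h \<xi> / 2"
    unfolding U\<xi>_def B_facts(7)[OF B(1)] k_def \<theta>_def using B by (simp add: field_simps)
  ultimately show ?thesis by simp
qed

lemma U\<xi>_unbroken: "B \<xi> \<Longrightarrow> t < \<tau> \<xi> \<Longrightarrow> U\<xi> t \<xi> = b \<xi> + t * h \<xi> / 2 \<and> U\<xi> t \<xi> < 0"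
  using B_facts(3,5)[of \<xi>] mult_strict_left_mono[of t "\<tau> \<xi>" "h \<xi>"]
  by (auto simp: U\<xi>_def k_def \<theta>_def algebra_simps)

lemma m_neg_iff: "B \<xi> \<Longrightarrow> b \<xi> + t * h \<xi> / 2 < 0 \<longleftrightarrow> t < \<tau> \<xi>"
  using B_facts(3,5)[of \<xi>] mult_strict_left_mono[of t "\<tau> \<xi>" "h \<xi>"] mult_left_mono[of "\<tau> \<xi>" t "h \<xi>"]
  by (cases "t < \<tau> \<xi>") (auto simp: algebra_simps not_less)

lemma not_B_Omega_d: "\<not> B \<xi> \<Longrightarrow> 0 \<le> t \<Longrightarrow> \<not> (U\<xi> t \<xi> < 0 \<and> r \<xi> = 0)"
  using k_bounds(1)[of t \<xi>] by (auto simp: B_def U\<xi>_def)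

lemma ldata_g_D:
  assumes "0 \<le> t" shows "ldata_g \<alpha> (D t) \<xi> = y\<xi> t \<xi> + e t \<xi>"
proof (cases "B \<xi>")
  case True
  show ?thesis
  proof (cases "\<tau> \<xi> \<le> t")
    case t: True
    then show ?thesis using True U\<xi>_broken[OF True t] \<phi>_eq[OF True]
      by (auto simp: ldata_g_def D_def e_def v_def algebra_simps)
  next
    case t: False
    then show ?thesis using True U\<xi>_unbroken[OF True, of t] B_facts(1)[OF True]
      by (auto simp: ldata_g_def D_def e_def min_def algebra_simps)
  qed
next
  case False
  then show ?thesis using not_B_Omega_d[OF False assms] not_B_k(2)[OF False]
    by (auto simp: ldata_g_def D_def e_def)
qed

text \<open>Along a breaking label \<open>U\<xi> = b + t h / 2 < 0\<close> before
  \<open>\<tau>\<close>, while from \<open>\<tau>\<close> on both \<open>U\<xi>\<close> and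
  \<open>b + t h / 2\<close> are nonnegative. Membership in \<open>Omega_d\<close> thus becomes a
  minimum with 0, which is Lipschitz.\<close>

lemma ldata_g23_D:
  assumes "0 \<le> t"
  shows "ldata_g2 \<alpha> (D t) \<xi> = (if B \<xi> then A * (LINT \<xi>|lborel. h \<xi>) * min 0 (b \<xi> + t * h \<xi> / 2) else 0)"
   "ldata_g3 \<alpha> (D t) \<xi> = (if B \<xi> then A * U t \<xi> * min 0 (b \<xi> + t * h \<xi> / 2) else 0)"
proof -
  have "(if U\<xi> t \<xi> < 0 \<and> r \<xi> = 0 then U\<xi> t \<xi> else 0) = (if B \<xi> then min 0 (b \<xi> + t * h \<xi> / 2) else 0)"
  proof (cases "B \<xi>")
    case True
    then show ?thesis
      using U\<xi>_unbroken[OF True, of t] U\<xi>_broken[OF True, of t] m_neg_iff[OF True, of t] B_facts(1)[OF True]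
      by (cases "t < \<tau> \<xi>") (auto simp: min_def)
  next
    case False then show ?thesis using not_B_Omega_d[OF False assms] by auto
  qed
  then show "ldata_g2 \<alpha> (D t) \<xi> = (if B \<xi> then A * (LINT \<xi>|lborel. h \<xi>) * min 0 (b \<xi> + t * h \<xi> / 2) else 0)"
   "ldata_g3 \<alpha> (D t) \<xi> = (if B \<xi> then A * U t \<xi> * min 0 (b \<xi> + t * h \<xi> / 2) else 0)"
    by (auto simp: ldata_g2_def ldata_g3_def D_def A_eq split: if_splits)
qed

lemma D_meas: "0 \<le> t \<Longrightarrow> ldata_meas (D t)"
  using has_weak_deriv_measurable[OF deriv_t(1)] has_weak_deriv_measurable[OF deriv_t(2)]
  by (simp add: ldata_meas_def D_def)

end

text \<open>Both expressions are convex combinations of \<open>x\<close> and \<open>x - u\<close>.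
  The change of weights can be charged to \<open>u\<close> or to \<open>u'\<close>, whence the
  minimum; it permits using the energy of whichever solution breaks later.\<close>

lemma abs_prod_diff_le:
  fixes u u' p p' x x' :: real
  assumes "0 \<le> p" "p \<le> 1" "0 \<le> p'" "p' \<le> 1" "0 \<le> u" "0 \<le> u'"
  shows "\<bar>(1 - p) * x + p * (x - u) - ((1 - p') * x' + p' * (x' - u'))\<bar>
     \<le> max \<bar>x - x'\<bar> \<bar>(x - u) - (x' - u')\<bar> + min u u' * \<bar>p - p'\<bar>"
proof -
  have conv: "\<bar>(1 - q) * s + q * t\<bar> \<le> max \<bar>s\<bar> \<bar>t\<bar>" if "0 \<le> q" "q \<le> 1" for q s t :: real
  proof -
    have "\<bar>(1 - q) * s + q * t\<bar> \<le> (1 - q) * \<bar>s\<bar> + q * \<bar>t\<bar>"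
      using that abs_triangle_ineq[of "(1 - q) * s" "q * t"] by (simp add: abs_mult)
    also have "\<dots> \<le> (1 - q) * max \<bar>s\<bar> \<bar>t\<bar> + q * max \<bar>s\<bar> \<bar>t\<bar>"
      using that by (intro add_mono mult_left_mono) auto
    finally show ?thesis by (simp add: algebra_simps)
  qed
  let ?l = "(1 - p) * x + p * (x - u) - ((1 - p') * x' + p' * (x' - u'))"
  have 1: "?l = ((1 - p) * (x - x') + p * ((x - u) - (x' - u'))) - u' * (p - p')" by algebra
  have 2: "?l = ((1 - p') * (x - x') + p' * ((x - u) - (x' - u'))) - u * (p - p')" by algebra
  have "\<bar>?l\<bar> \<le> max \<bar>x - x'\<bar> \<bar>(x - u) - (x' - u')\<bar> + u' * \<bar>p - p'\<bar>"
    unfolding 1 using conv[of p "x - x'" "(x - u) - (x' - u')"] assms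
      abs_triangle_ineq4[of "(1 - p) * (x - x') + p * ((x - u) - (x' - u'))" "u' * (p - p')"] by (simp add: abs_mult)
  moreover have "\<bar>?l\<bar> \<le> max \<bar>x - x'\<bar> \<bar>(x - u) - (x' - u')\<bar> + u * \<bar>p - p'\<bar>"
    unfolding 2 using conv[of p' "x - x'" "(x - u) - (x' - u')"] assms
      abs_triangle_ineq4[of "(1 - p') * (x - x') + p' * ((x - u) - (x' - u'))" "u * (p - p')"] by (simp add: abs_mult)
  ultimately show ?thesis by (auto simp: min_def)
qed

lemma abs_fraction_diff_le:
  fixes h h' x x' :: real
  assumes "0 \<le> x" "x \<le> 1" "0 \<le> x'" "x' \<le> 1" "0 \<le> h" "0 \<le> h'"
  shows "\<bar>(1 - x) * h - (1 - x') * h'\<bar> \<le> \<bar>h - h'\<bar> + min h h' * \<bar>x - x'\<bar>"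
  using abs_prod_diff_le[of x x' h h' h h'] assms by (simp add: algebra_simps)

section \<open>Comparison of two solutions\<close>

locale flow_pair =
  X: breaking_solution \<alpha> A M y0 U0 a b h r \<phi> + Y: breaking_solution \<alpha> A M y0' U0' a' b' h' r' \<phi>'
  for \<alpha> A M y0 U0 a b h r \<phi> y0' U0' a' b' h' r' \<phi>'
begin

text \<open>The integrands of the distance at time 0: \<open>z\<close> belongs to the term with
  \<open>Z\<close>, \<open>w\<close> to the term with \<open>U H_\<xi>\<close> including its factor,
  \<open>G\<close>, \<open>G2\<close>, \<open>G3\<close> to the last three; \<open>dp\<close>,
  \<open>dq\<close>, \<open>dh\<close> are components of \<open>z\<close>.\<close>

definition dp where "dp \<xi> = \<bar>a \<xi> - a' \<xi>\<bar>"
definition dq where "dq \<xi> = \<bar>b \<xi> - b' \<xi>\<bar>"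
definition dh where "dh \<xi> = \<bar>h \<xi> - h' \<xi>\<bar>"
definition z where "z \<xi> = sqrt ((a \<xi> - a' \<xi>)\<^sup>2 + (b \<xi> - b' \<xi>)\<^sup>2 + (h \<xi> - h' \<xi>)\<^sup>2 + (r \<xi> - r' \<xi>)\<^sup>2)"
definition w where "w \<xi> = A * \<bar>U0 \<xi> * h \<xi> - U0' \<xi> * h' \<xi>\<bar>"
definition G where "G \<xi> = \<bar>ldata_g \<alpha> (X.D 0) \<xi> - ldata_g \<alpha> (Y.D 0) \<xi>\<bar>"
definition G2 where "G2 \<xi> = \<bar>ldata_g2 \<alpha> (X.D 0) \<xi> - ldata_g2 \<alpha> (Y.D 0) \<xi>\<bar>"
definition G3 where "G3 \<xi> = \<bar>ldata_g3 \<alpha> (X.D 0) \<xi> - ldata_g3 \<alpha> (Y.D 0) \<xi>\<bar>"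

lemma diffs_nonneg [simp]: "0 \<le> dp \<xi>" "0 \<le> dq \<xi>" "0 \<le> dh \<xi>" "0 \<le> z \<xi>" "0 \<le> w \<xi>" "0 \<le> G \<xi>" "0 \<le> G2 \<xi>" "0 \<le> G3 \<xi>"
  using X.A_nonneg by (auto simp: dp_def dq_def dh_def z_def w_def G_def G2_def G3_def)

lemma diffs_le_z: "dp \<xi> \<le> z \<xi>" "dq \<xi> \<le> z \<xi>" "dh \<xi> \<le> z \<xi>"
  unfolding dp_def dq_def dh_def z_def
  by (intro real_le_rsqrt; simp)+

text \<open>Both points break: the difference of the remaining energy fractions is controlled even though
  the breaking times differ, because \<open>(\<tau>' - \<tau>) h' = 2 (b - b') + \<tau> (h - h')\<close>.\<close>

lemma fraction_diff_aux:
  assumes st: "0 \<le> s" and B: "X.B \<xi>" "Y.B \<xi>" and le: "min (X.\<tau> \<xi>) s \<le> min (Y.\<tau> \<xi>) s"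
    and \<beta>: "\<And>s' \<xi>. 0 \<le> s' \<Longrightarrow> s' \<le> s \<Longrightarrow> \<bar>X.y s' \<xi> - Y.y s' \<xi>\<bar> \<le> \<beta>"
  shows "min (h \<xi>) (h' \<xi>) * \<bar>\<alpha> (X.y (min (X.\<tau> \<xi>) s) \<xi>) - \<alpha> (Y.y (min (Y.\<tau> \<xi>) s) \<xi>)\<bar>
     \<le> A * \<beta> * min (h \<xi>) (h' \<xi>) + 2 * G3 \<xi> + s * w \<xi> + A * M * s / 4 * (2 * dq \<xi> + s * dh \<xi>)"
proof -
  let ?\<sigma> = "min (X.\<tau> \<xi>) s" and ?\<sigma>' = "min (Y.\<tau> \<xi>) s" and ?m = "min (h \<xi>) (h' \<xi>)"
  have \<sigma>: "0 \<le> ?\<sigma>" "0 \<le> ?\<sigma>'" "?\<sigma> \<le> s" "?\<sigma>' \<le> s" using X.B_facts(6)[OF B(1)] Y.B_facts(6)[OF B(2)] st by auto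
  have m: "0 \<le> ?m" "?m \<le> h' \<xi>" using X.nonneg Y.nonneg by auto
  have A: "0 \<le> A" and M: "0 \<le> M" using X.A_nonneg X.M_nonneg by auto
  define u where "u = \<bar>U0' \<xi>\<bar>"
  have u: "0 \<le> u" by (simp add: u_def)
  have "\<bar>X.y ?\<sigma> \<xi> - Y.y ?\<sigma>' \<xi>\<bar> \<le> \<bar>X.y ?\<sigma> \<xi> - Y.y ?\<sigma> \<xi>\<bar> + \<bar>Y.y ?\<sigma>' \<xi> - Y.y ?\<sigma> \<xi>\<bar>" by linarith
  also have "\<dots> \<le> \<beta> + (?\<sigma>' - ?\<sigma>) * (u + ?\<sigma>' * M / 4)"
    unfolding u_def by (intro add_mono \<beta> Y.y_increment_le \<sigma> le)
  also have "\<dots> \<le> \<beta> + (?\<sigma>' - ?\<sigma>) * (u + s * M / 4)"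
    using \<sigma> le M by (intro add_mono mult_left_mono divide_right_mono mult_right_mono) auto
  finally have y: "\<bar>X.y ?\<sigma> \<xi> - Y.y ?\<sigma>' \<xi>\<bar> \<le> \<beta> + (?\<sigma>' - ?\<sigma>) * (u + s * M / 4)" .
  have d: "(?\<sigma>' - ?\<sigma>) * h' \<xi> \<le> 2 * dq \<xi> + s * dh \<xi>" "A * u * ((?\<sigma>' - ?\<sigma>) * h' \<xi>) \<le> 2 * G3 \<xi> + s * w \<xi>"
  proof -
    have "(?\<sigma>' - ?\<sigma>) * h' \<xi> \<le> 2 * dq \<xi> + s * dh \<xi> \<and> A * u * ((?\<sigma>' - ?\<sigma>) * h' \<xi>) \<le> 2 * G3 \<xi> + s * w \<xi>"
    proof (cases "X.\<tau> \<xi> \<le> s")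
      case False
      then have "?\<sigma>' - ?\<sigma> = 0" using \<sigma> le by auto
      then show ?thesis using st by simp
    next
      case True
      let ?d = "(Y.\<tau> \<xi> - X.\<tau> \<xi>) * h' \<xi>"
      have 0: "0 \<le> X.\<tau> \<xi>" using X.B_facts(6)[OF B(1)] .
      have 1: "?\<sigma>' - ?\<sigma> \<le> Y.\<tau> \<xi> - X.\<tau> \<xi>" using True by auto
      have 2: "(?\<sigma>' - ?\<sigma>) * h' \<xi> \<le> ?d" using 1 Y.nonneg(2)[of \<xi>] by (rule mult_right_mono)
      have e: "?d = 2 * (b \<xi> - b' \<xi>) + X.\<tau> \<xi> * (h \<xi> - h' \<xi>)"
        using X.B_facts(5)[OF B(1)] Y.B_facts(5)[OF B(2)] by (simp add: algebra_simps)
      have "X.\<tau> \<xi> * (h \<xi> - h' \<xi>) \<le> s * dh \<xi>"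
        unfolding dh_def using True 0 by (intro order_trans[OF mult_left_mono[OF abs_ge_self] mult_right_mono]) auto
      then have "?d \<le> 2 * dq \<xi> + s * dh \<xi>" unfolding e dq_def by (simp add: abs_if)
      moreover have "A * u * ?d \<le> 2 * G3 \<xi> + s * w \<xi>"
      proof -
        have dn: "0 \<le> ?d" using 1 le Y.nonneg(2)[of \<xi>] by (intro mult_nonneg_nonneg) auto
        have g3: "G3 \<xi> = \<bar>A * U0 \<xi> * b \<xi> - A * U0' \<xi> * b' \<xi>\<bar>"
          unfolding G3_def X.ldata_g23_D(2)[OF order_refl] Y.ldata_g23_D(2)[OF order_refl]
          using B X.B_facts(2)[OF B(1)] Y.B_facts(2)[OF B(2)] by (simp add: min_def X.U0_eq Y.U0_eq)
        \<comment> \<open>No bound for \<open>U0'\<close> in terms of \<open>M\<close> is available.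
          Multiplying the identity for \<open>?d\<close> by \<open>A * U0'\<close> and using
          \<open>\<tau> h = -2 b\<close> leaves differences of the products \<open>U0 b\<close> and
          \<open>U0 h\<close>, the integrands of \<open>G3\<close> and \<open>w\<close>.\<close>
        have eq: "A * U0' \<xi> * ?d = 2 * (A * U0 \<xi> * b \<xi> - A * U0' \<xi> * b' \<xi>) + X.\<tau> \<xi> * (A * (U0 \<xi> * h \<xi> - U0' \<xi> * h' \<xi>))"
        proof -
          have "X.\<tau> \<xi> * h \<xi> = - 2 * b \<xi>" using X.B_facts(5)[OF B(1)] .
          then show ?thesis unfolding e by algebra
        qed
        have "A * u * ?d = \<bar>A * U0' \<xi> * ?d\<bar>"
          unfolding abs_mult[of "A * U0' \<xi>" ?d] abs_mult[of A] u_def using A dn by simp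
        also have "\<dots> \<le> 2 * G3 \<xi> + X.\<tau> \<xi> * w \<xi>"
        proof -
          have "X.\<tau> \<xi> * w \<xi> = \<bar>X.\<tau> \<xi> * (A * (U0 \<xi> * h \<xi> - U0' \<xi> * h' \<xi>))\<bar>"
            using 0 A by (simp add: w_def abs_mult)
          moreover have "2 * G3 \<xi> = \<bar>2 * (A * U0 \<xi> * b \<xi> - A * U0' \<xi> * b' \<xi>)\<bar>"
            unfolding g3 by (simp only: abs_mult[of 2] abs_numeral)
          ultimately show ?thesis unfolding eq by (simp only: abs_triangle_ineq)
        qed
        also have "\<dots> \<le> 2 * G3 \<xi> + s * w \<xi>" using True by (intro add_left_mono mult_right_mono) auto
        finally show ?thesis .
      qed
      moreover have "A * u * ((?\<sigma>' - ?\<sigma>) * h' \<xi>) \<le> A * u * ?d" using 2 A u by (intro mult_left_mono) auto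
      ultimately show ?thesis using 2 by linarith
    qed
    then show "(?\<sigma>' - ?\<sigma>) * h' \<xi> \<le> 2 * dq \<xi> + s * dh \<xi>" "A * u * ((?\<sigma>' - ?\<sigma>) * h' \<xi>) \<le> 2 * G3 \<xi> + s * w \<xi>" by auto
  qed
  have "?m * \<bar>\<alpha> (X.y ?\<sigma> \<xi>) - \<alpha> (Y.y ?\<sigma>' \<xi>)\<bar> \<le> ?m * (A * (\<beta> + (?\<sigma>' - ?\<sigma>) * (u + s * M / 4)))"
    using m A y by (intro mult_left_mono order_trans[OF X.\<alpha>_lip]) auto
  also have "\<dots> = A * \<beta> * ?m + (A * ((?\<sigma>' - ?\<sigma>) * (u + s * M / 4))) * ?m" by (simp add: algebra_simps)
  also have "\<dots> \<le> A * \<beta> * ?m + (A * ((?\<sigma>' - ?\<sigma>) * (u + s * M / 4))) * h' \<xi>"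
    using m A le u st M by (intro add_left_mono mult_left_mono mult_nonneg_nonneg add_nonneg_nonneg) auto
  also have "\<dots> = A * \<beta> * ?m + (A * u * ((?\<sigma>' - ?\<sigma>) * h' \<xi>) + A * M * s / 4 * ((?\<sigma>' - ?\<sigma>) * h' \<xi>))"
    by (simp add: algebra_simps)
  also have "\<dots> \<le> A * \<beta> * ?m + ((2 * G3 \<xi> + s * w \<xi>) + A * M * s / 4 * (2 * dq \<xi> + s * dh \<xi>))"
    using d A M st by (intro add_left_mono add_mono mult_left_mono) auto
  finally show ?thesis by simp
qed

end

text \<open>The locale is symmetric in the two solutions, so what is proved for one order of
  breaking, or for the first solution alone breaking, is reused by interpreting the exchanged
  pair.\<close>

lemma flow_pair_swap:
  assumes "flow_pair \<alpha> A M y0 U0 a b h r \<phi> y0' U0' a' b' h' r' \<phi>'"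
  shows "flow_pair \<alpha> A M y0' U0' a' b' h' r' \<phi>' y0 U0 a b h r \<phi>"
  using assms by (simp add: flow_pair_def)

context flow_pair
begin

lemma fraction_diff:
  assumes "0 \<le> s" "X.B \<xi>" "Y.B \<xi>"
    and \<beta>: "\<And>s' \<xi>. 0 \<le> s' \<Longrightarrow> s' \<le> s \<Longrightarrow> \<bar>X.y s' \<xi> - Y.y s' \<xi>\<bar> \<le> \<beta>"
  shows "min (h \<xi>) (h' \<xi>) * \<bar>\<alpha> (X.y (min (X.\<tau> \<xi>) s) \<xi>) - \<alpha> (Y.y (min (Y.\<tau> \<xi>) s) \<xi>)\<bar>
     \<le> A * \<beta> * min (h \<xi>) (h' \<xi>) + 2 * G3 \<xi> + s * w \<xi> + A * M * s / 4 * (2 * dq \<xi> + s * dh \<xi>)"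
proof (cases "min (X.\<tau> \<xi>) s \<le> min (Y.\<tau> \<xi>) s")
  case True
  then show ?thesis using fraction_diff_aux assms by blast
next
  case False
  interpret S: flow_pair \<alpha> A M y0' U0' a' b' h' r' \<phi>' y0 U0 a b h r \<phi>
    by (rule flow_pair_swap) (rule flow_pair_axioms)
  have eq: "S.G3 \<xi> = G3 \<xi>" "S.w \<xi> = w \<xi>" "S.dq \<xi> = dq \<xi>" "S.dh \<xi> = dh \<xi>"
    by (simp_all add: S.G3_def G3_def S.w_def w_def S.dq_def dq_def S.dh_def dh_def abs_minus_commute)
  have \<beta>': "\<bar>Y.y s' \<xi> - X.y s' \<xi>\<bar> \<le> \<beta>" if "0 \<le> s'" "s' \<le> s" for s' \<xi>
    using \<beta>[OF that, of \<xi>] by (simp add: abs_minus_commute)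
  have "min (Y.\<tau> \<xi>) s \<le> min (X.\<tau> \<xi>) s" using False by linarith
  from S.fraction_diff_aux[OF assms(1,3,2) this \<beta>'] show ?thesis
    unfolding eq min.commute[of "h' \<xi>"] abs_minus_commute[of "\<alpha> (Y.y _ \<xi>)"] .
qed

text \<open>Only one point breaks: the loss of energy is visible at time 0 in \<open>g\<close>, up to the change of
  \<open>\<alpha>\<close> along the trajectory, which \<open>g\<^sub>2\<close> and \<open>g\<^sub>3\<close> control since \<open>\<tau> h = - 2 b\<close>.\<close>

lemma single_break_aux:
  assumes "0 \<le> s" "X.B \<xi>" "\<not> Y.B \<xi>"
  shows "\<bar>(1 - \<alpha> (X.y (min (X.\<tau> \<xi>) s) \<xi>)) * h \<xi> - h' \<xi>\<bar> \<le> G \<xi> + dp \<xi> + 2 * G3 \<xi> + s / 4 * G2 \<xi>"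
proof -
  let ?\<sigma> = "min (X.\<tau> \<xi>) s"
  define H where "H = (LINT \<xi>|lborel. h \<xi>)"
  have H: "0 \<le> H" unfolding H_def using X.nonneg by (intro integral_nonneg_AE) auto
  have A: "0 \<le> A" using X.A_nonneg .
  have \<sigma>: "0 \<le> ?\<sigma>" "?\<sigma> \<le> s" "?\<sigma> \<le> X.\<tau> \<xi>" using X.B_facts(6)[OF assms(2)] assms(1) by auto
  have b: "b \<xi> \<le> 0" using X.B_facts(2)[OF assms(2)] .
  have \<sigma>h: "?\<sigma> * h \<xi> \<le> 2 * \<bar>b \<xi>\<bar>"
    using X.B_facts(5)[OF assms(2)] mult_right_mono[OF \<sigma>(3) X.nonneg(2)[of \<xi>]] b by simp
  have g3: "G3 \<xi> = A * \<bar>U0 \<xi>\<bar> * \<bar>b \<xi>\<bar>" and g2: "G2 \<xi> = A * H * \<bar>b \<xi>\<bar>"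
    unfolding G3_def G2_def X.ldata_g23_D[OF order_refl] Y.ldata_g23_D[OF order_refl]
    using assms(2,3) b A H by (auto simp: min_def X.U0_eq abs_mult H_def)
  have y00: "X.y\<xi> 0 \<xi> = a \<xi>" "Y.y\<xi> 0 \<xi> = a' \<xi>"
    by (auto simp: X.y\<xi>_def Y.y\<xi>_def X.kk_def Y.kk_def X.\<theta>_def Y.\<theta>_def) (use X.B_facts(6)[of \<xi>] Y.B_facts(6)[of \<xi>] in auto)
  have min0: "min (X.\<tau> \<xi>) 0 = 0" using X.B_facts(6)[OF assms(2)] by simp
  have g: "G \<xi> = \<bar>a \<xi> + (1 - \<alpha> (y0 \<xi>)) * h \<xi> - (a' \<xi> + h' \<xi>)\<bar>"
    unfolding G_def X.ldata_g_D[OF order_refl] Y.ldata_g_D[OF order_refl] y00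
    using assms(2,3) by (simp add: X.e_def Y.e_def min0 X.y0_eq)
  have "A * \<bar>X.y ?\<sigma> \<xi> - y0 \<xi>\<bar> * h \<xi> \<le> A * (?\<sigma> * \<bar>U0 \<xi>\<bar> + ?\<sigma>\<^sup>2 / 8 * H) * h \<xi>"
    using X.y_minus_y0_le[OF \<sigma>(1), of \<xi>] A X.nonneg(2)[of \<xi>] unfolding H_def
    by (intro mult_right_mono mult_left_mono) auto
  also have "\<dots> = A * \<bar>U0 \<xi>\<bar> * (?\<sigma> * h \<xi>) + ?\<sigma> / 8 * (A * H * (?\<sigma> * h \<xi>))"
    by (simp add: power2_eq_square algebra_simps)
  also have "\<dots> \<le> A * \<bar>U0 \<xi>\<bar> * (2 * \<bar>b \<xi>\<bar>) + s / 8 * (A * H * (2 * \<bar>b \<xi>\<bar>))"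
  proof (intro add_mono)
    show "A * \<bar>U0 \<xi>\<bar> * (?\<sigma> * h \<xi>) \<le> A * \<bar>U0 \<xi>\<bar> * (2 * \<bar>b \<xi>\<bar>)" using A \<sigma>h by (intro mult_left_mono) auto
    have "A * H * (?\<sigma> * h \<xi>) \<le> A * H * (2 * \<bar>b \<xi>\<bar>)" using A H \<sigma>h by (intro mult_left_mono) auto
    moreover have "0 \<le> A * H * (?\<sigma> * h \<xi>)" using A H \<sigma> X.nonneg(2)[of \<xi>] by (intro mult_nonneg_nonneg) auto
    ultimately show "?\<sigma> / 8 * (A * H * (?\<sigma> * h \<xi>)) \<le> s / 8 * (A * H * (2 * \<bar>b \<xi>\<bar>))"
      using \<sigma> assms(1) by (intro mult_mono[OF divide_right_mono]) simp_all
  qed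
  also have "\<dots> = 2 * G3 \<xi> + s / 4 * G2 \<xi>" unfolding g2 g3 by simp
  finally have 1: "A * \<bar>X.y ?\<sigma> \<xi> - y0 \<xi>\<bar> * h \<xi> \<le> 2 * G3 \<xi> + s / 4 * G2 \<xi>" .
  have "\<bar>(\<alpha> (y0 \<xi>) - \<alpha> (X.y ?\<sigma> \<xi>)) * h \<xi>\<bar> \<le> A * \<bar>y0 \<xi> - X.y ?\<sigma> \<xi>\<bar> * h \<xi>"
    unfolding abs_mult using X.nonneg(2)[of \<xi>] X.\<alpha>_lip by (simp add: mult_right_mono)
  with 1 have 2: "\<bar>(\<alpha> (y0 \<xi>) - \<alpha> (X.y ?\<sigma> \<xi>)) * h \<xi>\<bar> \<le> 2 * G3 \<xi> + s / 4 * G2 \<xi>"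
    by (simp add: abs_minus_commute)
  have "(1 - \<alpha> (X.y ?\<sigma> \<xi>)) * h \<xi> - h' \<xi> = (a \<xi> + (1 - \<alpha> (y0 \<xi>)) * h \<xi> - (a' \<xi> + h' \<xi>)) - (a \<xi> - a' \<xi>)
     + (\<alpha> (y0 \<xi>) - \<alpha> (X.y ?\<sigma> \<xi>)) * h \<xi>" by (simp add: algebra_simps)
  then show ?thesis using 2 unfolding g dp_def by linarith
qed

lemma single_break_aux':
  assumes "0 \<le> s" "\<not> X.B \<xi>" "Y.B \<xi>"
  shows "\<bar>(1 - \<alpha> (Y.y (min (Y.\<tau> \<xi>) s) \<xi>)) * h' \<xi> - h \<xi>\<bar> \<le> G \<xi> + dp \<xi> + 2 * G3 \<xi> + s / 4 * G2 \<xi>"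
proof -
  interpret S: flow_pair \<alpha> A M y0' U0' a' b' h' r' \<phi>' y0 U0 a b h r \<phi>
    by (rule flow_pair_swap) (rule flow_pair_axioms)
  have eq: "S.G3 \<xi> = G3 \<xi>" "S.G \<xi> = G \<xi>" "S.G2 \<xi> = G2 \<xi>" "S.dp \<xi> = dp \<xi>"
    by (simp_all add: S.G3_def G3_def S.G_def G_def S.G2_def G2_def S.dp_def dp_def abs_minus_commute)
  show ?thesis using S.single_break_aux[OF assms(1,3,2)] unfolding eq .
qed

text \<open>A common majorant for labels where both solutions break and labels where only one does,
  nondecreasing in \<open>t\<close>. The feedback \<open>\<beta>\<close> occurs only with the factor
  \<open>h'\<close>, whose \<open>L2\<close> norm is at most \<open>sqrt M\<close> once
  \<open>a' + h' = 1\<close>.\<close>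

definition R :: "real \<Rightarrow> real \<Rightarrow> real \<Rightarrow> real" where
  "R \<beta> t \<xi> = G \<xi> + 2 * G3 \<xi> + t / 4 * G2 \<xi> + t * w \<xi> + A * M * t / 4 * (2 + t) * z \<xi> + A * \<beta> * h' \<xi>"

lemma dqdh_le: "0 \<le> t \<Longrightarrow> 2 * dq \<xi> + t * dh \<xi> \<le> (2 + t) * z \<xi>"
  using diffs_le_z[of \<xi>] mult_left_mono[of "dh \<xi>" "z \<xi>" t] by (simp add: distrib_right)

lemma R_both:
  assumes "0 \<le> t" "0 \<le> \<beta>"
  shows "A * \<beta> * min (h \<xi>) (h' \<xi>) + 2 * G3 \<xi> + t * w \<xi> + A * M * t / 4 * (2 * dq \<xi> + t * dh \<xi>) \<le> R \<beta> t \<xi>"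
proof -
  have "A * \<beta> * min (h \<xi>) (h' \<xi>) \<le> A * \<beta> * h' \<xi>" using assms X.A_nonneg by (intro mult_left_mono) auto
  moreover have "A * M * t / 4 * (2 * dq \<xi> + t * dh \<xi>) \<le> A * M * t / 4 * ((2 + t) * z \<xi>)"
    using assms X.A_nonneg X.M_nonneg by (intro mult_left_mono dqdh_le) auto
  moreover have "0 \<le> t / 4 * G2 \<xi>" using assms by simp
  ultimately show ?thesis unfolding R_def mult.assoc[of "A * M * t / 4"] using diffs_nonneg(6)[of \<xi>] by linarith
qed

lemma R_single:
  assumes "0 \<le> t" "0 \<le> \<beta>"
  shows "G \<xi> + 2 * G3 \<xi> + t / 4 * G2 \<xi> \<le> R \<beta> t \<xi>"
proof -
  have "0 \<le> t * w \<xi>" "0 \<le> A * M * t / 4 * (2 + t) * z \<xi>" "0 \<le> A * \<beta> * h' \<xi>"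
    using assms X.A_nonneg X.M_nonneg Y.nonneg(2)[of \<xi>] by auto
  then show ?thesis unfolding R_def by linarith
qed

lemma R_nonneg: "0 \<le> t \<Longrightarrow> 0 \<le> \<beta> \<Longrightarrow> 0 \<le> R \<beta> t \<xi>"
  using R_single[of t \<beta> \<xi>] diffs_nonneg[of \<xi>] mult_nonneg_nonneg[of "t/4" "G2 \<xi>"] by linarith

lemma R_mono: "0 \<le> s \<Longrightarrow> s \<le> t \<Longrightarrow> R \<beta> s \<xi> \<le> R \<beta> t \<xi>"
  unfolding R_def using X.A_nonneg X.M_nonneg
  by (intro add_mono mult_mono order_refl mult_nonneg_nonneg divide_right_mono) auto

lemma e_diff:
  assumes t: "0 \<le> t"
    and \<beta>: "\<And>s' \<xi>. 0 \<le> s' \<Longrightarrow> s' \<le> t \<Longrightarrow> \<bar>X.y s' \<xi> - Y.y s' \<xi>\<bar> \<le> \<beta>"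
  shows "\<bar>X.e t \<xi> - Y.e t \<xi>\<bar> \<le> z \<xi> + R \<beta> t \<xi>"
proof -
  have b0: "0 \<le> \<beta>" using \<beta>[of 0] t abs_ge_zero order_trans by blast
  note R = R_both[OF t b0, of \<xi>] R_single[OF t b0, of \<xi>] R_nonneg[OF t b0, of \<xi>] and dz = diffs_le_z[of \<xi>]
  consider "X.B \<xi>" "Y.B \<xi>" | "X.B \<xi>" "\<not> Y.B \<xi>" | "\<not> X.B \<xi>" "Y.B \<xi>" | "\<not> X.B \<xi>" "\<not> Y.B \<xi>" by blast
  then show ?thesis
  proof cases
    case 1
    have "\<bar>X.e t \<xi> - Y.e t \<xi>\<bar> \<le> dh \<xi> + min (h \<xi>) (h' \<xi>) * \<bar>\<alpha> (X.y (min (X.\<tau> \<xi>) t) \<xi>) - \<alpha> (Y.y (min (Y.\<tau> \<xi>) t) \<xi>)\<bar>"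
      unfolding X.e_def Y.e_def dh_def using 1 X.\<alpha>_range X.nonneg(2) Y.nonneg(2)
      by (simp add: abs_fraction_diff_le)
    then show ?thesis using fraction_diff[OF t 1 \<beta>] R dz by linarith
  next
    case 2
    then show ?thesis unfolding X.e_def Y.e_def using single_break_aux[OF t 2] R dz by simp
  next
    case 3
    then show ?thesis unfolding X.e_def Y.e_def using single_break_aux'[OF t 3] R dz by (simp add: abs_minus_commute)
  next
    case 4
    then show ?thesis unfolding X.e_def Y.e_def using R dz by (simp add: dh_def)
  qed
qed

end

section \<open>Pointwise differences of derivatives and of accumulated energy\<close>

lemma set_integral_abs_le:
  fixes f :: "real \<Rightarrow> real"
  assumes "set_integrable lborel {0..t} f" "0 \<le> t" "\<And>s. 0 \<le> s \<Longrightarrow> s \<le> t \<Longrightarrow> \<bar>f s\<bar> \<le> C"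
  shows "\<bar>LINT s:{0..t}|lborel. f s\<bar> \<le> t * C"
proof -
  have "norm (LINT s|lborel. indicator {0..t} s *\<^sub>R f s) \<le> (LINT s|lborel. indicator {0..t} s *\<^sub>R C)"
  proof (rule order_trans[OF integral_norm_bound integral_mono_AE])
    show "integrable lborel (\<lambda>s. indicator {0..t} s *\<^sub>R C)"
      by (intro borel_integrable_compact) auto
    show "AE s in lborel. norm (indicator {0..t} s *\<^sub>R f s) \<le> indicator {0..t} s *\<^sub>R C"
      using assms(3) by (intro AE_I2) (auto simp: indicator_def)
  qed (use assms(1) in \<open>auto simp: set_integrable_def\<close>)
  then show ?thesis using assms(2) by (simp add: set_lebesgue_integral_def)
qed

text \<open>The triangle inequality for a Euclidean norm of which two components change;
  \<open>c\<close> holds the squares of the differences of \<open>h\<close> and \<open>r\<close>,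
  which are constant in time.\<close>

lemma sqrt_sum_le:
  fixes p q x y c :: real
  assumes "0 \<le> x" "0 \<le> y" "0 \<le> c" "\<bar>p'\<bar> \<le> \<bar>p\<bar> + x" "\<bar>q'\<bar> \<le> \<bar>q\<bar> + y"
  shows "sqrt (p'\<^sup>2 + q'\<^sup>2 + c) \<le> sqrt (p\<^sup>2 + q\<^sup>2 + c) + x + y"
proof (rule real_le_lsqrt)
  let ?s = "sqrt (p\<^sup>2 + q\<^sup>2 + c)"
  have s: "?s\<^sup>2 = p\<^sup>2 + q\<^sup>2 + c" "0 \<le> ?s" using assms(3) by auto
  have pq: "\<bar>p\<bar> \<le> ?s" "\<bar>q\<bar> \<le> ?s" using assms(3) by (auto intro!: real_le_rsqrt)
  show "0 \<le> ?s + x + y" using assms s by auto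
  have "p'\<^sup>2 \<le> (\<bar>p\<bar> + x)\<^sup>2" "q'\<^sup>2 \<le> (\<bar>q\<bar> + y)\<^sup>2"
    using assms by (simp_all add: abs_le_square_iff[symmetric])
  moreover have "(\<bar>p\<bar> + x)\<^sup>2 = p\<^sup>2 + 2 * \<bar>p\<bar> * x + x\<^sup>2" "(\<bar>q\<bar> + y)\<^sup>2 = q\<^sup>2 + 2 * \<bar>q\<bar> * y + y\<^sup>2"
    by (simp_all add: power2_sum)
  moreover have "\<bar>p\<bar> * x \<le> ?s * x" "\<bar>q\<bar> * y \<le> ?s * y" using pq assms by (auto intro: mult_right_mono)
  moreover have "(?s + x + y)\<^sup>2 = ?s\<^sup>2 + 2 * (?s * x) + 2 * (?s * y) + x\<^sup>2 + y\<^sup>2 + 2 * (x * y)"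
    by (simp add: power2_eq_square algebra_simps)
  moreover have "0 \<le> x * y" using assms by simp
  ultimately show "p'\<^sup>2 + q'\<^sup>2 + c \<le> (?s + x + y)\<^sup>2" unfolding s(1) by linarith
qed

lemma (in breaking_flow) k_time_int:
  assumes t: "0 \<le> t" shows "set_integrable lborel {0..t} (\<lambda>s. k s \<xi>)"
  unfolding set_integrable_def
proof (rule Bochner_Integration.integrable_bound)
  have [measurable]: "(\<lambda>s. k s \<xi>) \<in> borel_measurable borel"
    unfolding k_def \<theta>_def by measurable
  show "(\<lambda>s. indicator {0..t} s *\<^sub>R k s \<xi>) \<in> borel_measurable lborel" by simp
  show "integrable lborel (\<lambda>s. indicator {0..t} s * (t * h \<xi>))"
    by (intro integrable_mult_left integrable_real_indicator) (auto simp: emeasure_lborel_Icc_eq)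
  show "AE s in lborel. norm (indicator {0..t} s *\<^sub>R k s \<xi>) \<le> norm (indicator {0..t} s * (t * h \<xi>))"
  proof (rule AE_I2)
    fix s
    show "norm (indicator {0..t} s *\<^sub>R k s \<xi>) \<le> norm (indicator {0..t} s * (t * h \<xi>))"
      using k_bounds[of s \<xi>] mult_right_mono[OF _ nonneg(2), of s t \<xi>] by (cases "s \<in> {0..t}") auto
  qed
qed

context flow_pair
begin

text \<open>Up to the breaking time the rates are \<open>h\<close> and \<open>h'\<close>, afterwards
  \<open>(1 - \<phi>) h\<close> and \<open>h'\<close>. The accumulated difference is a combination
  with weights \<open>\<tau>\<close> and \<open>t - \<tau>\<close>, hence at most \<open>t\<close>
  times the larger of the two bounds.\<close>

lemma k_diff_single:
  assumes t: "0 \<le> t" and B: "X.B \<xi>" "\<not> Y.B \<xi>"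
  shows "\<bar>X.k t \<xi> - Y.k t \<xi>\<bar> \<le> t * max (dh \<xi>) (G \<xi> + dp \<xi> + 2 * G3 \<xi> + t / 4 * G2 \<xi>)"
proof (cases "X.\<tau> \<xi> \<le> t")
  case True
  let ?S = "G \<xi> + dp \<xi> + 2 * G3 \<xi> + t / 4 * G2 \<xi>"
  have 0: "0 \<le> X.\<tau> \<xi>" using X.B_facts(6)[OF B(1)] .
  have "X.k t \<xi> - Y.k t \<xi> = X.\<tau> \<xi> * (h \<xi> - h' \<xi>) + (t - X.\<tau> \<xi>) * ((1 - \<phi> \<xi>) * h \<xi> - h' \<xi>)"
    unfolding Y.not_B_k(1)[OF B(2)] using True B by (simp add: X.k_def X.\<theta>_def algebra_simps)
  also have "\<bar>\<dots>\<bar> \<le> X.\<tau> \<xi> * dh \<xi> + (t - X.\<tau> \<xi>) * \<bar>(1 - \<phi> \<xi>) * h \<xi> - h' \<xi>\<bar>"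
    using abs_triangle_ineq[of "X.\<tau> \<xi> * (h \<xi> - h' \<xi>)" "(t - X.\<tau> \<xi>) * ((1 - \<phi> \<xi>) * h \<xi> - h' \<xi>)"] 0 True
    by (simp add: abs_mult dh_def)
  also have "\<dots> \<le> X.\<tau> \<xi> * max (dh \<xi>) ?S + (t - X.\<tau> \<xi>) * max (dh \<xi>) ?S"
    using single_break_aux[OF t B] X.\<phi>_eq[OF B(1)] 0 True by (intro add_mono mult_left_mono) (auto simp: min_def)
  finally show ?thesis by (simp add: algebra_simps)
next
  case False
  then have "X.k t \<xi> - Y.k t \<xi> = t * (h \<xi> - h' \<xi>)"
    unfolding Y.not_B_k(1)[OF B(2)] by (simp add: X.k_def X.\<theta>_def algebra_simps)
  then have "\<bar>X.k t \<xi> - Y.k t \<xi>\<bar> = t * dh \<xi>" using t by (simp add: abs_mult dh_def)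
  also have "\<dots> \<le> t * max (dh \<xi>) (G \<xi> + dp \<xi> + 2 * G3 \<xi> + t / 4 * G2 \<xi>)" using t by (intro mult_left_mono) auto
  finally show ?thesis .
qed

lemma k_diff_single':
  assumes t: "0 \<le> t" and B: "\<not> X.B \<xi>" "Y.B \<xi>"
  shows "\<bar>X.k t \<xi> - Y.k t \<xi>\<bar> \<le> t * max (dh \<xi>) (G \<xi> + dp \<xi> + 2 * G3 \<xi> + t / 4 * G2 \<xi>)"
proof -
  interpret S: flow_pair \<alpha> A M y0' U0' a' b' h' r' \<phi>' y0 U0 a b h r \<phi>
    by (rule flow_pair_swap) (rule flow_pair_axioms)
  have eq: "S.G3 \<xi> = G3 \<xi>" "S.G \<xi> = G \<xi>" "S.G2 \<xi> = G2 \<xi>" "S.dp \<xi> = dp \<xi>" "S.dh \<xi> = dh \<xi>"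
    by (simp_all add: S.G3_def G3_def S.G_def G_def S.G2_def G2_def S.dp_def dp_def S.dh_def dh_def abs_minus_commute)
  show ?thesis using S.k_diff_single[OF t B(2,1)] unfolding eq by (simp add: abs_minus_commute)
qed

text \<open>If both labels have broken by time \<open>t\<close>, the loss fractions are those
  compared in \<open>fraction_diff\<close>. If one has not, its \<open>h \<theta>\<close> is zero
  and so is the minimum.\<close>

lemma loss_diff:
  assumes t: "0 \<le> t" and B: "X.B \<xi>" "Y.B \<xi>"
    and \<beta>: "\<And>s' \<xi>. 0 \<le> s' \<Longrightarrow> s' \<le> t \<Longrightarrow> \<bar>X.y s' \<xi> - Y.y s' \<xi>\<bar> \<le> \<beta>"
  shows "min (max 0 (t * h \<xi> + 2 * b \<xi>)) (max 0 (t * h' \<xi> + 2 * b' \<xi>)) * \<bar>\<phi> \<xi> - \<phi>' \<xi>\<bar>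
    \<le> t * (A * \<beta> * min (h \<xi>) (h' \<xi>) + 2 * G3 \<xi> + t * w \<xi> + A * M * t / 4 * (2 * dq \<xi> + t * dh \<xi>))"
proof (cases "X.\<tau> \<xi> \<le> t \<and> Y.\<tau> \<xi> \<le> t")
  case True
  have "max 0 (t * h \<xi> + 2 * b \<xi>) \<le> t * h \<xi>" "max 0 (t * h' \<xi> + 2 * b' \<xi>) \<le> t * h' \<xi>"
    using X.B_facts(2)[OF B(1)] Y.B_facts(2)[OF B(2)] t X.nonneg(2)[of \<xi>] Y.nonneg(2)[of \<xi>] by auto
  then have "min (max 0 (t * h \<xi> + 2 * b \<xi>)) (max 0 (t * h' \<xi> + 2 * b' \<xi>)) \<le> t * min (h \<xi>) (h' \<xi>)"
    by (auto simp: min_def)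
  then have "min (max 0 (t * h \<xi> + 2 * b \<xi>)) (max 0 (t * h' \<xi> + 2 * b' \<xi>)) * \<bar>\<phi> \<xi> - \<phi>' \<xi>\<bar>
    \<le> t * min (h \<xi>) (h' \<xi>) * \<bar>\<phi> \<xi> - \<phi>' \<xi>\<bar>" by (rule mult_right_mono) simp
  also have "\<dots> = t * (min (h \<xi>) (h' \<xi>) * \<bar>\<alpha> (X.y (min (X.\<tau> \<xi>) t) \<xi>) - \<alpha> (Y.y (min (Y.\<tau> \<xi>) t) \<xi>)\<bar>)"
    using True X.\<phi>_eq[OF B(1)] Y.\<phi>_eq[OF B(2)] by (simp add: min_absorb1)
  finally show ?thesis using mult_left_mono[OF fraction_diff[OF t B \<beta>] t] by linarith
next
  case False
  have "max 0 (t * h \<xi> + 2 * b \<xi>) = 0 \<or> max 0 (t * h' \<xi> + 2 * b' \<xi>) = 0"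
    using False X.m_neg_iff[OF B(1), of t] Y.m_neg_iff[OF B(2), of t] by (auto simp: max_def not_le)
  then have z: "min (max 0 (t * h \<xi> + 2 * b \<xi>)) (max 0 (t * h' \<xi> + 2 * b' \<xi>)) = 0" by (auto simp: min_def)
  have "0 \<le> \<beta>" using \<beta>[of 0] t abs_ge_zero order_trans by blast
  then show ?thesis unfolding z using t X.A_nonneg X.M_nonneg X.nonneg(2)[of \<xi>] Y.nonneg(2)[of \<xi>]
    by (auto intro!: mult_nonneg_nonneg add_nonneg_nonneg)
qed

lemma U\<xi>_diff:
  assumes t: "0 \<le> t"
    and \<beta>: "\<And>s' \<xi>. 0 \<le> s' \<Longrightarrow> s' \<le> t \<Longrightarrow> \<bar>X.y s' \<xi> - Y.y s' \<xi>\<bar> \<le> \<beta>"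
  shows "\<bar>X.U\<xi> t \<xi> - Y.U\<xi> t \<xi>\<bar> \<le> dq \<xi> + t / 2 * (z \<xi> + R \<beta> t \<xi>)"
proof -
  have b0: "0 \<le> \<beta>" using \<beta>[of 0] t abs_ge_zero order_trans by blast
  note R = R_both[OF t b0, of \<xi>] R_single[OF t b0, of \<xi>] R_nonneg[OF t b0, of \<xi>] and dz = diffs_le_z[of \<xi>]
  have kd: ?thesis if "\<bar>X.k t \<xi> - Y.k t \<xi>\<bar> \<le> t * c" "c \<le> z \<xi> + R \<beta> t \<xi>" for c
  proof -
    have "\<bar>X.k t \<xi> - Y.k t \<xi>\<bar> \<le> t * (z \<xi> + R \<beta> t \<xi>)" using that mult_left_mono[OF that(2) t] by linarith
    moreover have "X.U\<xi> t \<xi> - Y.U\<xi> t \<xi> = (b \<xi> - b' \<xi>) + (X.k t \<xi> - Y.k t \<xi>) / 2"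
      by (simp add: X.U\<xi>_def Y.U\<xi>_def field_simps)
    moreover have "\<bar>p + q / 2\<bar> \<le> \<bar>p\<bar> + c / 2" if "\<bar>q\<bar> \<le> c" for p q c :: real
      using that by linarith
    ultimately show ?thesis unfolding dq_def by (metis times_divide_eq_left)
  qed
  consider "X.B \<xi>" "Y.B \<xi>" | "X.B \<xi>" "\<not> Y.B \<xi>" | "\<not> X.B \<xi>" "Y.B \<xi>" | "\<not> X.B \<xi>" "\<not> Y.B \<xi>" by blast
  then show ?thesis
  proof cases
    case 1
    let ?m = "b \<xi> + t * h \<xi> / 2" and ?m' = "b' \<xi> + t * h' \<xi> / 2"
    let ?u = "max 0 ?m" and ?u' = "max 0 ?m'"
    have u2: "2 * ?u = max 0 (t * h \<xi> + 2 * b \<xi>)" "2 * ?u' = max 0 (t * h' \<xi> + 2 * b' \<xi>)" by (auto simp: max_def)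
    have mm: "2 * min ?u ?u' = min (max 0 (t * h \<xi> + 2 * b \<xi>)) (max 0 (t * h' \<xi> + 2 * b' \<xi>))"
      unfolding u2[symmetric] by (auto simp: min_def)
    \<comment> \<open>A convex combination of \<open>?m\<close> (no loss) and
      \<open>?m - max 0 ?m = min 0 ?m\<close> (total loss). Both are 1-Lipschitz in
      \<open>?m\<close>, so apart from the change of weights no larger constant arises.\<close>
    have U: "X.U\<xi> t \<xi> = (1 - \<phi> \<xi>) * ?m + \<phi> \<xi> * (?m - ?u)" "Y.U\<xi> t \<xi> = (1 - \<phi>' \<xi>) * ?m' + \<phi>' \<xi> * (?m' - ?u')"
    proof -
      have "X.k t \<xi> = t * h \<xi> - \<phi> \<xi> * (2 * ?u)" "Y.k t \<xi> = t * h' \<xi> - \<phi>' \<xi> * (2 * ?u')"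
        unfolding u2 X.B_h_\<theta>[OF 1(1) t, symmetric] Y.B_h_\<theta>[OF 1(2) t, symmetric]
        by (simp_all add: X.k_def Y.k_def algebra_simps)
      moreover have "c + K / 2 = (1 - p) * (c + x / 2) + p * (c + x / 2 - u)" if "K = x - p * (2 * u)" for c K p x u :: real
        unfolding that by (simp add: field_simps)
      ultimately show "X.U\<xi> t \<xi> = (1 - \<phi> \<xi>) * ?m + \<phi> \<xi> * (?m - ?u)" "Y.U\<xi> t \<xi> = (1 - \<phi>' \<xi>) * ?m' + \<phi>' \<xi> * (?m' - ?u')"
        unfolding X.U\<xi>_def Y.U\<xi>_def by blast+
    qed
    have "\<bar>X.U\<xi> t \<xi> - Y.U\<xi> t \<xi>\<bar> \<le> max \<bar>?m - ?m'\<bar> \<bar>(?m - ?u) - (?m' - ?u')\<bar> + min ?u ?u' * \<bar>\<phi> \<xi> - \<phi>' \<xi>\<bar>"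
      unfolding U by (rule abs_prod_diff_le) (use X.\<phi>_range Y.\<phi>_range in auto)
    also have "max \<bar>?m - ?m'\<bar> \<bar>(?m - ?u) - (?m' - ?u')\<bar> \<le> \<bar>?m - ?m'\<bar>" by (auto simp: max_def)
    also have "\<bar>?m - ?m'\<bar> \<le> dq \<xi> + t / 2 * dh \<xi>"
    proof -
      have "?m - ?m' = (b \<xi> - b' \<xi>) + t / 2 * (h \<xi> - h' \<xi>)" by (simp add: field_simps)
      then show ?thesis using t abs_triangle_ineq[of "b \<xi> - b' \<xi>" "t / 2 * (h \<xi> - h' \<xi>)"] by (simp add: dq_def dh_def abs_mult)
    qed
    also have "min ?u ?u' * \<bar>\<phi> \<xi> - \<phi>' \<xi>\<bar> \<le> t / 2 * R \<beta> t \<xi>"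
      using loss_diff[OF t 1 \<beta>] mult_left_mono[OF R(1) t] unfolding mm[symmetric] by simp
    also have "dq \<xi> + t / 2 * dh \<xi> \<le> dq \<xi> + t / 2 * z \<xi>" using dz(3) t by (intro add_left_mono mult_left_mono) auto
    finally show ?thesis by (simp add: algebra_simps)
  next
    case 2
    show ?thesis by (rule kd[OF k_diff_single[OF t 2]]) (use R dz in auto)
  next
    case 3
    show ?thesis by (rule kd[OF k_diff_single'[OF t 3]]) (use R dz in auto)
  next
    case 4
    show ?thesis
      by (rule kd[of "dh \<xi>"]) (use R dz t in \<open>auto simp: X.not_B_k[OF 4(1)] Y.not_B_k[OF 4(2)] dh_def abs_mult right_diff_distrib[symmetric]\<close>)
  qed
qed

text \<open>\<open>y\<xi>\<close> is the time integral of \<open>U\<xi>\<close> added to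
  \<open>a\<close>; the bound of \<open>U\<xi>_diff\<close> is nondecreasing in time and can be
  frozen at \<open>t\<close> before integrating.\<close>

lemma y\<xi>_diff:
  assumes t: "0 \<le> t"
    and \<beta>: "\<And>s' \<xi>. 0 \<le> s' \<Longrightarrow> s' \<le> t \<Longrightarrow> \<bar>X.y s' \<xi> - Y.y s' \<xi>\<bar> \<le> \<beta>"
  shows "\<bar>X.y\<xi> t \<xi> - Y.y\<xi> t \<xi>\<bar> \<le> dp \<xi> + t * dq \<xi> + t\<^sup>2 / 2 * (z \<xi> + R \<beta> t \<xi>)"
proof -
  have b0: "0 \<le> \<beta>" using \<beta>[of 0] t abs_ge_zero order_trans by blast
  have bd: "\<bar>X.U\<xi> s \<xi> - Y.U\<xi> s \<xi>\<bar> \<le> dq \<xi> + t / 2 * (z \<xi> + R \<beta> t \<xi>)" if "0 \<le> s" "s \<le> t" for s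
  proof -
    have "\<bar>X.U\<xi> s \<xi> - Y.U\<xi> s \<xi>\<bar> \<le> dq \<xi> + s / 2 * (z \<xi> + R \<beta> s \<xi>)"
      by (rule U\<xi>_diff[OF that(1)]) (use \<beta> that in auto)
    also have "\<dots> \<le> dq \<xi> + t / 2 * (z \<xi> + R \<beta> t \<xi>)"
      using that R_mono[OF that] R_nonneg[OF that(1) b0, of \<xi>] by (intro add_mono mult_mono) auto
    finally show ?thesis .
  qed
  note ik = X.k_time_int[OF t, of \<xi>] Y.k_time_int[OF t, of \<xi>]
  have i: "set_integrable lborel {0..t} (\<lambda>s. X.k s \<xi> - Y.k s \<xi>)" by (rule set_integral_diff(1)[OF ik])
  have c: "set_integrable lborel {0..t} (\<lambda>s. b \<xi> - b' \<xi>)"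
    unfolding set_integrable_def by (intro borel_integrable_compact) auto
  have i2: "set_integrable lborel {0..t} (\<lambda>s. (X.k s \<xi> - Y.k s \<xi>) / 2)" using i by simp
  have e: "X.U\<xi> s \<xi> - Y.U\<xi> s \<xi> = (b \<xi> - b' \<xi>) + (X.k s \<xi> - Y.k s \<xi>) / 2" for s
    by (simp add: X.U\<xi>_def Y.U\<xi>_def field_simps)

  have "(LINT s:{0..t}|lborel. X.U\<xi> s \<xi> - Y.U\<xi> s \<xi>) = (LINT s:{0..t}|lborel. b \<xi> - b' \<xi>) + (LINT s:{0..t}|lborel. (X.k s \<xi> - Y.k s \<xi>) / 2)"
    unfolding e by (rule set_integral_add(2)[OF c i2])
  also have "\<dots> = t * (b \<xi> - b' \<xi>) + (X.kk t \<xi> - Y.kk t \<xi>) / 2"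
    using t set_integral_diff(2)[OF ik] by (simp add: X.integral_k_time Y.integral_k_time) (simp add: set_lebesgue_integral_def)
  finally have "X.y\<xi> t \<xi> - Y.y\<xi> t \<xi> = (a \<xi> - a' \<xi>) + (LINT s:{0..t}|lborel. X.U\<xi> s \<xi> - Y.U\<xi> s \<xi>)"
    by (simp add: X.y\<xi>_def Y.y\<xi>_def field_simps)
  moreover have "\<bar>LINT s:{0..t}|lborel. X.U\<xi> s \<xi> - Y.U\<xi> s \<xi>\<bar> \<le> t * (dq \<xi> + t / 2 * (z \<xi> + R \<beta> t \<xi>))"
    by (rule set_integral_abs_le[OF _ t bd]) (use set_integral_add(1)[OF c i2] e in auto)
  ultimately have "\<bar>X.y\<xi> t \<xi> - Y.y\<xi> t \<xi>\<bar> \<le> dp \<xi> + t * (dq \<xi> + t / 2 * (z \<xi> + R \<beta> t \<xi>))"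
    unfolding dp_def by linarith
  then show ?thesis by (simp add: power2_eq_square algebra_simps)
qed

text \<open>The part of the difference of \<open>k\<close> that is measured in \<open>L2\<close>;
  the integrable term \<open>t * dh\<close> and the feedback in \<open>\<beta>\<close> are kept
  apart. The summand \<open>2 z\<close> comes from \<open>2 dq\<close> where both break,
  \<open>t z\<close> from \<open>t dp\<close> where one does.\<close>

definition DD :: "real \<Rightarrow> real \<Rightarrow> real" where
  "DD t \<xi> = (2 + t) * z \<xi> + t * G \<xi> + 2 * t * G3 \<xi> + t\<^sup>2 / 4 * G2 \<xi> + t\<^sup>2 * w \<xi> + A * M * t\<^sup>2 / 4 * (2 + t) * z \<xi>"

lemma DD_nonneg: "0 \<le> t \<Longrightarrow> 0 \<le> DD t \<xi>"
  unfolding DD_def using X.A_nonneg X.M_nonneg by (intro add_nonneg_nonneg mult_nonneg_nonneg) auto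

lemma k_diff_le_DD:
  assumes t: "0 \<le> t"
    and \<beta>: "\<And>s' \<xi>. 0 \<le> s' \<Longrightarrow> s' \<le> t \<Longrightarrow> \<bar>X.y s' \<xi> - Y.y s' \<xi>\<bar> \<le> \<beta>"
  shows "\<bar>X.k t \<xi> - Y.k t \<xi>\<bar> \<le> t * dh \<xi> + (DD t \<xi> + t * A * \<beta> * h' \<xi>)"
proof -
  have b0: "0 \<le> \<beta>" using \<beta>[of 0] t abs_ge_zero order_trans by blast
  note dz = diffs_le_z[of \<xi>]
  have tp: "0 \<le> t * A * \<beta> * h' \<xi>" using t b0 X.A_nonneg Y.nonneg(2)[of \<xi>] by simp
  have nn: "0 \<le> t * dh \<xi>" "0 \<le> t * G \<xi>" "0 \<le> 2 * t * G3 \<xi>" "0 \<le> t\<^sup>2 / 4 * G2 \<xi>" "0 \<le> t\<^sup>2 * w \<xi>" "0 \<le> t * z \<xi>"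
     "0 \<le> A * M * t\<^sup>2 / 4 * (2 + t) * z \<xi>"
    using t X.A_nonneg X.M_nonneg by auto
  have single: ?thesis if "\<bar>X.k t \<xi> - Y.k t \<xi>\<bar> \<le> t * max (dh \<xi>) (G \<xi> + dp \<xi> + 2 * G3 \<xi> + t / 4 * G2 \<xi>)"
  proof -
    have "max (dh \<xi>) (G \<xi> + dp \<xi> + 2 * G3 \<xi> + t / 4 * G2 \<xi>) \<le> dh \<xi> + (G \<xi> + z \<xi> + 2 * G3 \<xi> + t / 4 * G2 \<xi>)"
    proof (rule max.boundedI)
      have "0 \<le> t / 4 * G2 \<xi>" using t by simp
      then show "dh \<xi> \<le> dh \<xi> + (G \<xi> + z \<xi> + 2 * G3 \<xi> + t / 4 * G2 \<xi>)" using diffs_nonneg[of \<xi>] by linarith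
      show "G \<xi> + dp \<xi> + 2 * G3 \<xi> + t / 4 * G2 \<xi> \<le> dh \<xi> + (G \<xi> + z \<xi> + 2 * G3 \<xi> + t / 4 * G2 \<xi>)"
        using dz diffs_nonneg(3)[of \<xi>] by linarith
    qed
    then have "t * max (dh \<xi>) (G \<xi> + dp \<xi> + 2 * G3 \<xi> + t / 4 * G2 \<xi>) \<le> t * (dh \<xi> + (G \<xi> + z \<xi> + 2 * G3 \<xi> + t / 4 * G2 \<xi>))"
      using t by (rule mult_left_mono)
    also have "\<dots> = t * dh \<xi> + (t * G \<xi> + t * z \<xi> + 2 * t * G3 \<xi> + t\<^sup>2 / 4 * G2 \<xi>)"
      by (simp add: power2_eq_square algebra_simps)
    moreover have "(2 + t) * z \<xi> = 2 * z \<xi> + t * z \<xi>" by (rule distrib_right)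
    ultimately show ?thesis using that nn tp diffs_nonneg(4)[of \<xi>] unfolding DD_def by linarith
  qed
  consider "X.B \<xi>" "Y.B \<xi>" | "X.B \<xi>" "\<not> Y.B \<xi>" | "\<not> X.B \<xi>" "Y.B \<xi>" | "\<not> X.B \<xi>" "\<not> Y.B \<xi>" by blast
  then show ?thesis
  proof cases
    case 1
    let ?x = "t * h \<xi>" and ?x' = "t * h' \<xi>"
    let ?u = "max 0 (?x + 2 * b \<xi>)" and ?u' = "max 0 (?x' + 2 * b' \<xi>)"
    have K: "X.k t \<xi> = (1 - \<phi> \<xi>) * ?x + \<phi> \<xi> * (?x - ?u)" "Y.k t \<xi> = (1 - \<phi>' \<xi>) * ?x' + \<phi>' \<xi> * (?x' - ?u')"
      unfolding X.B_h_\<theta>[OF 1(1) t, symmetric] Y.B_h_\<theta>[OF 1(2) t, symmetric]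
      by (simp_all add: X.k_def Y.k_def algebra_simps)
    have "\<bar>X.k t \<xi> - Y.k t \<xi>\<bar> \<le> max \<bar>?x - ?x'\<bar> \<bar>(?x - ?u) - (?x' - ?u')\<bar> + min ?u ?u' * \<bar>\<phi> \<xi> - \<phi>' \<xi>\<bar>"
      unfolding K by (rule abs_prod_diff_le) (use X.\<phi>_range Y.\<phi>_range in auto)
    \<comment> \<open>\<open>x - max 0 (x + 2 c)\<close> is \<open>min x (- 2 c)\<close>, which
      accounts for the additional \<open>2 dq\<close>.\<close>
    also have "max \<bar>?x - ?x'\<bar> \<bar>(?x - ?u) - (?x' - ?u')\<bar> \<le> \<bar>?x - ?x'\<bar> + 2 * dq \<xi>"
    proof -
      have "max \<bar>x - x'\<bar> \<bar>(x - max 0 (x + 2 * c)) - (x' - max 0 (x' + 2 * c'))\<bar> \<le> \<bar>x - x'\<bar> + 2 * \<bar>c - c'\<bar>"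
        for x x' c c' :: real by (auto simp: max_def abs_if)
      then show ?thesis unfolding dq_def .
    qed
    also have "\<bar>?x - ?x'\<bar> = t * dh \<xi>" using t by (simp add: dh_def abs_mult right_diff_distrib[symmetric])
    also have "min ?u ?u' * \<bar>\<phi> \<xi> - \<phi>' \<xi>\<bar> \<le> t * (A * \<beta> * h' \<xi> + 2 * G3 \<xi> + t * w \<xi> + A * M * t / 4 * ((2 + t) * z \<xi>))"
      using b0 X.A_nonneg X.M_nonneg t
      by (intro order_trans[OF loss_diff[OF t 1 \<beta>]] mult_left_mono add_mono dqdh_le order_refl) auto
    also have "\<dots> = t * A * \<beta> * h' \<xi> + 2 * t * G3 \<xi> + t\<^sup>2 * w \<xi> + A * M * t\<^sup>2 / 4 * (2 + t) * z \<xi>"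
      by (simp add: power2_eq_square algebra_simps)
    finally have "\<bar>X.k t \<xi> - Y.k t \<xi>\<bar> \<le> t * dh \<xi> + 2 * dq \<xi> + (t * A * \<beta> * h' \<xi> + 2 * t * G3 \<xi> + t\<^sup>2 * w \<xi> + A * M * t\<^sup>2 / 4 * (2 + t) * z \<xi>)"
      by simp
    moreover have "(2 + t) * z \<xi> = 2 * z \<xi> + t * z \<xi>" by (rule distrib_right)
    ultimately show ?thesis using nn dz unfolding DD_def by linarith
  next
    case 2 then show ?thesis using single k_diff_single[OF t] by blast
  next
    case 3 then show ?thesis using single k_diff_single'[OF t] by blast
  next
    case 4
    have "\<bar>X.k t \<xi> - Y.k t \<xi>\<bar> = t * dh \<xi>"
      using t by (simp add: X.not_B_k[OF 4(1)] Y.not_B_k[OF 4(2)] dh_def abs_mult right_diff_distrib[symmetric])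
    then show ?thesis using DD_nonneg[OF t, of \<xi>] tp by linarith
  qed
qed

text \<open>The \<open>L\<^sup>1\<close> bound uses the normalisation \<open>a' + h' = 1\<close> in place of a bound on the measure
  of the set where waves have broken: there \<open>y\<^sub>\<xi> \<le> t\<^sup>2/4 H\<^sub>\<xi>\<close> for the broken solution.\<close>

lemma k_diff_L1_aux:
  assumes t: "0 \<le> t" and F0: "a' \<xi> + h' \<xi> = 1"
    and \<beta>: "\<And>s' \<xi>. 0 \<le> s' \<Longrightarrow> s' \<le> t \<Longrightarrow> \<bar>X.y s' \<xi> - Y.y s' \<xi>\<bar> \<le> \<beta>"
  shows "\<bar>X.k t \<xi> - Y.k t \<xi>\<bar> \<le> (t + t ^ 3 / 4) * dh \<xi> + t * A * \<beta> * h' \<xi>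
     + h' \<xi> * ((1 + t\<^sup>2 / 4) * DD t \<xi> + t * z \<xi>)"
proof -
  have b0: "0 \<le> \<beta>" using \<beta>[of 0] t abs_ge_zero order_trans by blast
  have h: "0 \<le> h \<xi>" "0 \<le> h' \<xi>" "h' \<xi> \<le> 1" "0 \<le> a' \<xi>" using X.nonneg Y.nonneg[of \<xi>] F0 by auto
  have DD: "0 \<le> DD t \<xi>" using DD_nonneg[OF t] .
  have tp: "0 \<le> t * A * \<beta> * h' \<xi>" using t b0 X.A_nonneg h by simp
  have nn: "0 \<le> h' \<xi> * ((1 + t\<^sup>2 / 4) * DD t \<xi> + t * z \<xi>)" "0 \<le> t ^ 3 / 4 * dh \<xi>"
    using h DD t by (auto intro!: mult_nonneg_nonneg add_nonneg_nonneg)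
  \<comment> \<open>\<open>DD\<close> is merely square integrable, so it must carry a factor
    \<open>h'\<close> before Cauchy-Schwarz can bound its integral. \<open>K\<close> retains both
    available bounds, and each case uses those that supply the missing factor.\<close>
  define K where "K = min (t * min (h \<xi>) (h' \<xi>)) (DD t \<xi>)"
  have K0: "0 \<le> K" unfolding K_def using t h DD by auto
  have "\<bar>X.k t \<xi> - Y.k t \<xi>\<bar> \<le> t * dh \<xi> + t * min (h \<xi>) (h' \<xi>)"
  proof -
    have "\<bar>X.k t \<xi> - Y.k t \<xi>\<bar> \<le> max (t * h \<xi>) (t * h' \<xi>)"
      using X.k_bounds[OF t, of \<xi>] Y.k_bounds[OF t, of \<xi>] by auto
    also have "\<dots> = t * max (h \<xi>) (h' \<xi>)" using t by (simp add: max_mult_distrib_left)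
    also have "max (h \<xi>) (h' \<xi>) = dh \<xi> + min (h \<xi>) (h' \<xi>)" by (auto simp: dh_def)
    finally show ?thesis by (simp add: distrib_left)
  qed
  then have W: "\<bar>X.k t \<xi> - Y.k t \<xi>\<bar> \<le> t * dh \<xi> + K + t * A * \<beta> * h' \<xi>"
    using k_diff_le_DD[OF t \<beta>, of \<xi>] tp unfolding K_def by (simp add: min_def)
  have e: "(t + t ^ 3 / 4) * dh \<xi> = t * dh \<xi> + t ^ 3 / 4 * dh \<xi>" by (rule distrib_right)
  consider (Y) "Y.B \<xi>" "Y.\<tau> \<xi> \<le> t" | (X) "X.B \<xi>" "X.\<tau> \<xi> \<le> t"
    | (N) "\<not> (X.B \<xi> \<and> X.\<tau> \<xi> \<le> t)" "\<not> (Y.B \<xi> \<and> Y.\<tau> \<xi> \<le> t)" by blast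
  then show ?thesis
  proof cases
    case Y
    have "(Y.\<tau> \<xi>)\<^sup>2 \<le> t\<^sup>2" using Y Y.B_facts(6)[OF Y(1)] by (intro power_mono) auto
    then have "a' \<xi> \<le> t\<^sup>2 / 4 * h' \<xi>" unfolding Y.B_facts(8)[OF Y(1)] using h by (intro mult_right_mono) auto
    then have 1: "1 \<le> (1 + t\<^sup>2 / 4) * h' \<xi>" using F0 by (simp add: algebra_simps)
    have "K \<le> DD t \<xi> * 1" by (simp add: K_def)
    also have "\<dots> \<le> DD t \<xi> * ((1 + t\<^sup>2 / 4) * h' \<xi>)" using 1 DD by (rule mult_left_mono)
    finally have "K \<le> h' \<xi> * ((1 + t\<^sup>2 / 4) * DD t \<xi>)" by (simp add: algebra_simps)
    then show ?thesis using W nn h t unfolding e distrib_left[of "h' \<xi>"] by (smt (verit) mult_nonneg_nonneg diffs_nonneg)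
  next
    case X
    have "(X.\<tau> \<xi>)\<^sup>2 \<le> t\<^sup>2" using X X.B_facts(6)[OF X(1)] by (intro power_mono) auto
    then have a: "a \<xi> \<le> t\<^sup>2 / 4 * h \<xi>" unfolding X.B_facts(8)[OF X(1)] using h by (intro mult_right_mono) auto
    have Kh: "K \<le> t * h' \<xi>" unfolding K_def using t mult_left_mono[of "min (h \<xi>) (h' \<xi>)" "h' \<xi>" t] by auto
    have Kt: "K \<le> t" using Kh h t mult_left_mono[of "h' \<xi>" 1 t] by linarith
    have KD: "K \<le> DD t \<xi>" by (simp add: K_def)
    \<comment> \<open>Only the first solution is known to have broken, so \<open>h'\<close> may be
      small. In the unit \<open>a' + h'\<close> the first term is at most
      \<open>dp + t^2/4 (h' + dh)\<close>; the products with \<open>dp\<close>, \<open>h'\<close>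
      and \<open>dh\<close> use \<open>K <= t h'\<close>, \<open>K <= DD\<close> and
      \<open>K <= t\<close>.\<close>
    have "K = K * (a' \<xi> + h' \<xi>)" using F0 by simp
    also have "\<dots> \<le> K * (dp \<xi> + t\<^sup>2 / 4 * (h' \<xi> + dh \<xi>) + h' \<xi>)"
    proof (intro mult_left_mono K0 add_right_mono)
      have "a' \<xi> \<le> dp \<xi> + a \<xi>" by (simp add: dp_def)
      moreover have "t\<^sup>2 / 4 * h \<xi> \<le> t\<^sup>2 / 4 * (h' \<xi> + dh \<xi>)" by (intro mult_left_mono) (auto simp: dh_def)
      ultimately show "a' \<xi> \<le> dp \<xi> + t\<^sup>2 / 4 * (h' \<xi> + dh \<xi>)" using a by linarith
    qed
    also have "\<dots> = K * dp \<xi> + K * ((1 + t\<^sup>2 / 4) * h' \<xi>) + K * (t\<^sup>2 / 4 * dh \<xi>)" by (simp add: algebra_simps)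
    also have "\<dots> \<le> (t * h' \<xi>) * z \<xi> + DD t \<xi> * ((1 + t\<^sup>2 / 4) * h' \<xi>) + t * (t\<^sup>2 / 4 * dh \<xi>)"
      using K0 Kh Kt KD h t DD diffs_le_z[of \<xi>] by (intro add_mono mult_mono mult_nonneg_nonneg) auto
    also have "\<dots> = h' \<xi> * ((1 + t\<^sup>2 / 4) * DD t \<xi> + t * z \<xi>) + t ^ 3 / 4 * dh \<xi>"
      by (simp add: power2_eq_square power3_eq_cube algebra_simps)
    finally show ?thesis using W unfolding e by linarith
  next
    case N
    have "X.k t \<xi> = t * h \<xi>" "Y.k t \<xi> = t * h' \<xi>" using N by (auto simp: X.k_def Y.k_def X.\<theta>_def Y.\<theta>_def)
    then have "\<bar>X.k t \<xi> - Y.k t \<xi>\<bar> = t * dh \<xi>"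
      using t by (simp add: dh_def abs_mult right_diff_distrib[symmetric])
    then show ?thesis using nn tp unfolding e by linarith
  qed
qed

end

section \<open>Differences of the breaking terms g2 and g3\<close>

context flow_pair
begin

lemma G23_both:
  assumes "X.B \<xi>" "Y.B \<xi>"
  shows "G2 \<xi> = \<bar>A * (LINT \<xi>|lborel. h \<xi>) * b \<xi> - A * (LINT \<xi>|lborel. h' \<xi>) * b' \<xi>\<bar>"
    "G3 \<xi> = \<bar>A * U0 \<xi> * b \<xi> - A * U0' \<xi> * b' \<xi>\<bar>"
  unfolding G2_def G3_def X.ldata_g23_D[OF order_refl] Y.ldata_g23_D[OF order_refl]
  using assms X.B_facts(2)[OF assms(1)] Y.B_facts(2)[OF assms(2)] by (simp_all add: min_def X.U0_eq Y.U0_eq)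

lemma G23_single:
  assumes "X.B \<xi>" "\<not> Y.B \<xi>"
  shows "G2 \<xi> = A * (LINT \<xi>|lborel. h \<xi>) * \<bar>b \<xi>\<bar>" "G3 \<xi> = A * \<bar>U0 \<xi>\<bar> * \<bar>b \<xi>\<bar>"
proof -
  have H: "0 \<le> (LINT \<xi>|lborel. h \<xi>)" using X.nonneg by (intro integral_nonneg_AE) auto
  show "G2 \<xi> = A * (LINT \<xi>|lborel. h \<xi>) * \<bar>b \<xi>\<bar>" "G3 \<xi> = A * \<bar>U0 \<xi>\<bar> * \<bar>b \<xi>\<bar>"
    unfolding G2_def G3_def X.ldata_g23_D[OF order_refl] Y.ldata_g23_D[OF order_refl]
    using assms X.B_facts(2)[OF assms(1)] X.A_nonneg H by (simp_all add: min_def X.U0_eq Y.U0_eq abs_mult)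
qed

text \<open>\<open>min 0 (b + t h / 2)\<close> is at most \<open>|b|\<close> in size, and
  \<open>U\<close> moves by at most \<open>t H / 4\<close>; the product \<open>A H |b|\<close>
  arising from this motion is the integrand of \<open>G2\<close>.\<close>

lemma g2_single:
  assumes t: "0 \<le> t" and B: "X.B \<xi>" "\<not> Y.B \<xi>"
  shows "\<bar>ldata_g2 \<alpha> (X.D t) \<xi> - ldata_g2 \<alpha> (Y.D t) \<xi>\<bar> \<le> G2 \<xi>"
    "\<bar>ldata_g3 \<alpha> (X.D t) \<xi> - ldata_g3 \<alpha> (Y.D t) \<xi>\<bar> \<le> G3 \<xi> + t / 4 * G2 \<xi>"
proof -
  define H where "H = (LINT \<xi>|lborel. h \<xi>)"
  have H: "0 \<le> H" unfolding H_def using X.nonneg by (intro integral_nonneg_AE) auto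
  have A: "0 \<le> A" using X.A_nonneg .
  let ?n = "min 0 (b \<xi> + t * h \<xi> / 2)"
  have n: "\<bar>?n\<bar> \<le> \<bar>b \<xi>\<bar>" using t X.nonneg(2)[of \<xi>] X.B_facts(2)[OF B(1)] by (auto simp: min_def)
  have "\<bar>A * H * ?n\<bar> \<le> A * H * \<bar>b \<xi>\<bar>" unfolding abs_mult using A H n by (intro mult_mono) auto
  then show "\<bar>ldata_g2 \<alpha> (X.D t) \<xi> - ldata_g2 \<alpha> (Y.D t) \<xi>\<bar> \<le> G2 \<xi>"
    unfolding X.ldata_g23_D[OF t] Y.ldata_g23_D[OF t] G23_single[OF B] using B by (simp add: H_def)
  have "\<bar>X.U t \<xi>\<bar> \<le> \<bar>U0 \<xi>\<bar> + t * H / 4" using X.I_le[OF t, of \<xi>] unfolding X.U_def H_def by linarith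
  then have "\<bar>A * X.U t \<xi> * ?n\<bar> \<le> A * (\<bar>U0 \<xi>\<bar> + t * H / 4) * \<bar>b \<xi>\<bar>"
    unfolding abs_mult using A n H t by (intro mult_mono) auto
  also have "\<dots> = G3 \<xi> + t / 4 * G2 \<xi>" unfolding G23_single[OF B] H_def by (simp add: algebra_simps)
  finally show "\<bar>ldata_g3 \<alpha> (X.D t) \<xi> - ldata_g3 \<alpha> (Y.D t) \<xi>\<bar> \<le> G3 \<xi> + t / 4 * G2 \<xi>"
    unfolding X.ldata_g23_D[OF t] Y.ldata_g23_D[OF t] using B by simp
qed

lemma g2_single':
  assumes t: "0 \<le> t" and B: "\<not> X.B \<xi>" "Y.B \<xi>"
  shows "\<bar>ldata_g2 \<alpha> (X.D t) \<xi> - ldata_g2 \<alpha> (Y.D t) \<xi>\<bar> \<le> G2 \<xi>"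
    "\<bar>ldata_g3 \<alpha> (X.D t) \<xi> - ldata_g3 \<alpha> (Y.D t) \<xi>\<bar> \<le> G3 \<xi> + t / 4 * G2 \<xi>"
proof -
  interpret S: flow_pair \<alpha> A M y0' U0' a' b' h' r' \<phi>' y0 U0 a b h r \<phi>
    by (rule flow_pair_swap) (rule flow_pair_axioms)
  have eq: "S.G3 \<xi> = G3 \<xi>" "S.G2 \<xi> = G2 \<xi>"
    by (simp_all add: S.G3_def G3_def S.G2_def G2_def abs_minus_commute)
  show "\<bar>ldata_g2 \<alpha> (X.D t) \<xi> - ldata_g2 \<alpha> (Y.D t) \<xi>\<bar> \<le> G2 \<xi>"
    "\<bar>ldata_g3 \<alpha> (X.D t) \<xi> - ldata_g3 \<alpha> (Y.D t) \<xi>\<bar> \<le> G3 \<xi> + t / 4 * G2 \<xi>"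
    using S.g2_single[OF t B(2,1)] unfolding eq by (simp_all add: abs_minus_commute)
qed

end

lemma min0_diff_le:
  fixes H H' x x' :: real
  assumes "0 \<le> H" "0 \<le> H'"
  shows "\<bar>H * min 0 x - H' * min 0 x'\<bar> \<le> \<bar>H * x - H' * x'\<bar>"
proof -
  have "H * min 0 x = min 0 (H * x)" "H' * min 0 x' = min 0 (H' * x')"
    using assms by (auto simp: min_mult_distrib_left)
  then show ?thesis by (auto simp: min_def)
qed

text \<open>Unlike \<open>H\<close> in \<open>min0_diff_le\<close>, the factor \<open>U\<close> has
  no sign and cannot be moved into the minimum; the price is the difference of the factors times the
  size of \<open>x'\<close>.\<close>

lemma prod_min0_diff_le:
  fixes U U' x x' :: real
  shows "\<bar>U * min 0 x - U' * min 0 x'\<bar> \<le> \<bar>U * x - U' * x'\<bar> + \<bar>U - U'\<bar> * (\<bar>x'\<bar> + \<bar>min 0 x'\<bar>)"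
proof -
  have "\<bar>min 0 x - min 0 x'\<bar> \<le> \<bar>x - x'\<bar>" by (auto simp: min_def)
  then have "\<bar>U\<bar> * \<bar>min 0 x - min 0 x'\<bar> \<le> \<bar>U\<bar> * \<bar>x - x'\<bar>" by (intro mult_left_mono) auto
  also have "\<dots> = \<bar>(U * x - U' * x') - (U - U') * x'\<bar>" by (simp add: abs_mult[symmetric] algebra_simps)
  also have "\<dots> \<le> \<bar>U * x - U' * x'\<bar> + \<bar>U - U'\<bar> * \<bar>x'\<bar>"
    using abs_triangle_ineq4[of "U * x - U' * x'" "(U - U') * x'"] by (simp add: abs_mult)
  finally have 1: "\<bar>U * (min 0 x - min 0 x')\<bar> \<le> \<bar>U * x - U' * x'\<bar> + \<bar>U - U'\<bar> * \<bar>x'\<bar>" by (simp add: abs_mult)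
  have "U * min 0 x - U' * min 0 x' = U * (min 0 x - min 0 x') + (U - U') * min 0 x'" by (simp add: algebra_simps)
  then have "\<bar>U * min 0 x - U' * min 0 x'\<bar> \<le> \<bar>U * (min 0 x - min 0 x')\<bar> + \<bar>(U - U') * min 0 x'\<bar>"
    by (simp only: abs_triangle_ineq)
  then show ?thesis using 1 unfolding distrib_left abs_mult[of "U - U'"] by linarith
qed

text \<open>The numbers \<open>a1\<close> to \<open>a8\<close> bound the eight summands of the
  distance at time 0, in their order. Only the second solution is normalised, since the first will
  be a relabelled one.\<close>

locale flow_pair_norms = flow_pair +
  fixes a1 a2 a3 a4 a5 a6 a7 a8 :: real
  assumes F0: "\<And>\<xi>. a' \<xi> + h' \<xi> = 1"
    and y0_le: "\<And>\<xi>. \<bar>y0 \<xi> - y0' \<xi>\<bar> \<le> a1" and U0_le: "\<And>\<xi>. \<bar>U0 \<xi> - U0' \<xi>\<bar> \<le> a2"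
    and w_le: "L2le w a3"
    and dh_le: "(\<integral>\<^sup>+\<xi>. ennreal (dh \<xi>) \<partial>lborel) \<le> ennreal a4" "0 \<le> a4"
    and z_le: "L2le z a5" and G_le: "L2le G a6" and G2_le: "L2le G2 a7" and G3_le: "L2le G3 a8"
begin

section \<open>Norm estimates and the feedback through y\<close>

definition "m = sqrt M"
definition "Dn t = (2 + t) * a5 + t * a6 + 2 * t * a8 + t\<^sup>2 / 4 * a7 + t\<^sup>2 * a3 + A * M * t\<^sup>2 / 4 * (2 + t) * a5"
text \<open>The part without feedback of the uniform bound \<open>E\<close> for the difference of
  \<open>I\<close>; the division by 4 is the size of the kernel. The factor \<open>A M t / 4\<close>
  of \<open>\<beta>\<close> in \<open>E\<close> becomes the Gronwall rate.\<close>

definition "P t = ((t + t ^ 3 / 4) * a4 + m * ((1 + t\<^sup>2 / 4) * Dn t + t * a5)) / 4"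
definition "E \<beta> t = P t + A * M * t / 4 * \<beta>"
definition "Rn \<beta> t = a6 + 2 * a8 + t / 4 * a7 + t * a3 + A * M * t / 4 * (2 + t) * a5 + A * \<beta> * m"

lemma M_m: "m * m = M" "0 \<le> m" using X.M_nonneg by (auto simp: m_def)

lemmas AM = X.A_nonneg X.M_nonneg M_m(2)

lemma a_nonneg: "0 \<le> a1" "0 \<le> a2" "0 \<le> a3" "0 \<le> a5" "0 \<le> a6" "0 \<le> a7" "0 \<le> a8"
  using order_trans[OF abs_ge_zero y0_le] order_trans[OF abs_ge_zero U0_le]
    w_le z_le G_le G2_le G3_le by (auto simp: L2le_def)

lemma Dn_mono: "0 \<le> s \<Longrightarrow> s \<le> t \<Longrightarrow> Dn s \<le> Dn t"
  unfolding Dn_def using a_nonneg AM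
  by (intro add_mono mult_mono power_mono divide_right_mono order_refl mult_nonneg_nonneg) auto

lemma Dn_nonneg: "0 \<le> t \<Longrightarrow> 0 \<le> Dn t"
  unfolding Dn_def using a_nonneg AM by (intro add_nonneg_nonneg mult_nonneg_nonneg) auto

lemma P_mono: "0 \<le> s \<Longrightarrow> s \<le> t \<Longrightarrow> P s \<le> P t"
  unfolding P_def using a_nonneg AM dh_le Dn_mono[of s t] Dn_nonneg[of s] Dn_nonneg[of t]
  by (intro add_mono mult_mono power_mono divide_right_mono order_refl mult_nonneg_nonneg add_nonneg_nonneg) auto

lemma P_nonneg: "0 \<le> t \<Longrightarrow> 0 \<le> P t"
  unfolding P_def using a_nonneg AM dh_le Dn_nonneg[of t]
  by (intro add_nonneg_nonneg mult_nonneg_nonneg divide_nonneg_nonneg) auto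

lemma h'_bounds: "0 \<le> h' \<xi>" "h' \<xi> \<le> 1" "0 \<le> a' \<xi>" "a' \<xi> \<le> 1"
  using Y.nonneg[of \<xi>] F0[of \<xi>] by auto

lemma h'_L1: "(\<integral>\<^sup>+\<xi>. ennreal (h' \<xi>) \<partial>lborel) \<le> ennreal M"
  using Y.h_int Y.nonneg Y.h_le by (subst nn_integral_eq_integral) (auto intro: ennreal_leI)

text \<open>The square of \<open>sqrt h'\<close> is \<open>h'\<close>, with integral at most
  \<open>M\<close>. As \<open>h' <= 1\<close>, this function dominates \<open>h'\<close>, so both
  have \<open>L2\<close> norm at most \<open>sqrt M\<close>.\<close>

lemma sqrt_h'_L2: "L2le (\<lambda>\<xi>. sqrt (h' \<xi>)) m"
  using h'_L1 h'_bounds X.M_nonneg by (simp add: L2le_def m_def)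

lemma h'_L2: "L2le h' m"
proof (rule L2le_mono[OF sqrt_h'_L2])
  fix \<xi>
  have "h' \<xi> * h' \<xi> \<le> h' \<xi>" using h'_bounds[of \<xi>] by (simp add: mult_left_le)
  then have "h' \<xi> \<le> sqrt (h' \<xi>)" by (intro real_le_rsqrt) (simp add: power2_eq_square)
  then show "\<bar>h' \<xi>\<bar> \<le> \<bar>sqrt (h' \<xi>)\<bar>" using h'_bounds[of \<xi>] by simp
qed simp

lemma DD_L2: "0 \<le> t \<Longrightarrow> L2le (DD t) (Dn t)"
  unfolding DD_def[abs_def] Dn_def using AM
  by (intro L2le_add L2le_cmult w_le z_le G_le G2_le G3_le mult_nonneg_nonneg divide_nonneg_nonneg) auto

lemma R_L2: "0 \<le> t \<Longrightarrow> 0 \<le> \<beta> \<Longrightarrow> L2le (R \<beta> t) (Rn \<beta> t)"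
  unfolding R_def[abs_def] Rn_def using AM
  by (intro L2le_add L2le_cmult w_le z_le G_le G2_le G3_le h'_L2 mult_nonneg_nonneg divide_nonneg_nonneg) auto

lemma dh_int: "integrable lborel dh" "(LINT \<xi>|lborel. dh \<xi>) \<le> a4"
proof -
  show i: "integrable lborel dh" unfolding dh_def[abs_def] using X.h_int Y.h_int by auto
  have "ennreal (LINT \<xi>|lborel. dh \<xi>) = (\<integral>\<^sup>+\<xi>. ennreal (dh \<xi>) \<partial>lborel)"
    using i by (subst nn_integral_eq_integral) auto
  then have "ennreal (LINT \<xi>|lborel. dh \<xi>) \<le> ennreal a4" using dh_le by simp
  then show "(LINT \<xi>|lborel. dh \<xi>) \<le> a4" using dh_le by simp
qed

lemma H_diff_le: "\<bar>(LINT \<xi>|lborel. h \<xi>) - (LINT \<xi>|lborel. h' \<xi>)\<bar> \<le> a4"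
proof -
  have "(LINT \<xi>|lborel. h \<xi>) - (LINT \<xi>|lborel. h' \<xi>) = (LINT \<xi>|lborel. h \<xi> - h' \<xi>)"
    using X.h_int Y.h_int by simp
  also have "\<bar>\<dots>\<bar> \<le> (LINT \<xi>|lborel. dh \<xi>)"
    using integral_norm_bound[of lborel "\<lambda>\<xi>. h \<xi> - h' \<xi>"] by (simp add: dh_def)
  finally show ?thesis using dh_int(2) by linarith
qed

text \<open>\<open>k_diff_L1_aux\<close> is integrated term by term: \<open>dh\<close> is bounded by
  \<open>a4\<close>, the feedback by the total energy \<open>M\<close>, and the product with
  \<open>h'\<close> by Cauchy-Schwarz.\<close>

lemma I_diff:
  assumes t: "0 \<le> t"
    and \<beta>: "\<And>s' \<xi>. 0 \<le> s' \<Longrightarrow> s' \<le> t \<Longrightarrow> \<bar>X.y s' \<xi> - Y.y s' \<xi>\<bar> \<le> \<beta>"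
  shows "\<bar>X.I t \<xi> - Y.I t \<xi>\<bar> \<le> E \<beta> t"
proof -
  have b0: "0 \<le> \<beta>" using \<beta>[of 0] t abs_ge_zero order_trans by blast
  have [measurable]: "dh \<in> borel_measurable borel" "z \<in> borel_measurable borel" "DD t \<in> borel_measurable borel"
    using dh_int z_le DD_L2[OF t] by (auto simp: L2le_def)
  let ?K = "\<lambda>\<xi>. \<bar>X.k t \<xi> - Y.k t \<xi>\<bar>" and ?Q = "\<lambda>\<xi>. (1 + t\<^sup>2 / 4) * DD t \<xi> + t * z \<xi>"
  let ?c = "t + t ^ 3 / 4" and ?d = "t * A * \<beta>"
  have c: "0 \<le> ?c" "0 \<le> ?d" using t b0 AM by auto
  have Q: "L2le ?Q ((1 + t\<^sup>2 / 4) * Dn t + t * a5)"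
    using t by (intro L2le_add L2le_cmult DD_L2 z_le) auto
  have Q0: "0 \<le> h' \<xi> * ?Q \<xi>" for \<xi>
    using h'_bounds[of \<xi>] DD_nonneg[OF t, of \<xi>] t by (intro mult_nonneg_nonneg add_nonneg_nonneg) auto
  have "(\<integral>\<^sup>+\<xi>. ennreal (?K \<xi>) \<partial>lborel)
     \<le> (\<integral>\<^sup>+\<xi>. ennreal ?c * ennreal (dh \<xi>) + ennreal ?d * ennreal (h' \<xi>) + ennreal \<bar>h' \<xi> * ?Q \<xi>\<bar> \<partial>lborel)"
  proof (rule nn_integral_mono)
    fix \<xi>
    have "?K \<xi> \<le> ?c * dh \<xi> + ?d * h' \<xi> + \<bar>h' \<xi> * ?Q \<xi>\<bar>"
      using k_diff_L1_aux[OF t F0 \<beta>, of \<xi>] Q0[of \<xi>] by simp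
    then have "ennreal (?K \<xi>) \<le> ennreal (?c * dh \<xi> + ?d * h' \<xi> + \<bar>h' \<xi> * ?Q \<xi>\<bar>)" by (rule ennreal_leI)
    also have "\<dots> = ennreal ?c * ennreal (dh \<xi>) + ennreal ?d * ennreal (h' \<xi>) + ennreal \<bar>h' \<xi> * ?Q \<xi>\<bar>"
      using c h'_bounds[of \<xi>] by (subst ennreal_plus ennreal_mult; simp)+
    finally show "ennreal (?K \<xi>) \<le> ennreal ?c * ennreal (dh \<xi>) + ennreal ?d * ennreal (h' \<xi>) + ennreal \<bar>h' \<xi> * ?Q \<xi>\<bar>" .
  qed
  also have "\<dots> = ennreal ?c * (\<integral>\<^sup>+\<xi>. ennreal (dh \<xi>) \<partial>lborel) + ennreal ?d * (\<integral>\<^sup>+\<xi>. ennreal (h' \<xi>) \<partial>lborel) + (\<integral>\<^sup>+\<xi>. ennreal \<bar>h' \<xi> * ?Q \<xi>\<bar> \<partial>lborel)"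
    by (simp add: nn_integral_add nn_integral_cmult)
  also have "\<dots> \<le> ennreal ?c * ennreal a4 + ennreal ?d * ennreal M + ennreal (m * ((1 + t\<^sup>2 / 4) * Dn t + t * a5))"
    by (intro add_mono mult_left_mono dh_le h'_L1 L2le_Cauchy_Schwarz h'_L2 Q) auto
  also have "\<dots> = ennreal (?c * a4 + ?d * M + m * ((1 + t\<^sup>2 / 4) * Dn t + t * a5))"
    using c dh_le AM L2le_nonneg[OF Q] by (simp add: ennreal_mult[symmetric] ennreal_plus[symmetric] del: ennreal_plus)
  also have "\<dots> = ennreal (4 * E \<beta> t)" unfolding E_def P_def by (intro arg_cong[where f=ennreal]) (simp add: field_simps)
  finally have "(\<integral>\<^sup>+\<xi>. ennreal (?K \<xi>) \<partial>lborel) \<le> ennreal (4 * E \<beta> t)" .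
  moreover have iK: "integrable lborel (\<lambda>\<xi>. X.k t \<xi> - Y.k t \<xi>)" using X.k_int[OF t] Y.k_int[OF t] by simp
  moreover have "(\<integral>\<^sup>+\<xi>. ennreal (?K \<xi>) \<partial>lborel) = ennreal (LINT \<xi>|lborel. ?K \<xi>)"
    using iK by (subst nn_integral_eq_integral) auto
  moreover have E0: "0 \<le> E \<beta> t" unfolding E_def using P_nonneg[OF t] AM t b0 by simp
  ultimately have K: "(LINT \<xi>|lborel. ?K \<xi>) \<le> 4 * E \<beta> t" by simp
  have "X.I t \<xi> - Y.I t \<xi> = (LINT \<eta>|lborel. kap \<xi> \<eta> * (X.k t \<eta> - Y.k t \<eta>))"
    unfolding X.I_def Y.I_def using X.k_int(1)[OF t] Y.k_int(1)[OF t] by (simp add: right_diff_distrib integrable_kap)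
  then show ?thesis using integral_kap_le[OF iK, of \<xi>] K by simp
qed

lemma U_diff:
  assumes t: "0 \<le> t"
    and \<beta>: "\<And>s' \<xi>. 0 \<le> s' \<Longrightarrow> s' \<le> t \<Longrightarrow> \<bar>X.y s' \<xi> - Y.y s' \<xi>\<bar> \<le> \<beta>"
  shows "\<bar>X.U t \<xi> - Y.U t \<xi>\<bar> \<le> a2 + E \<beta> t"
  using I_diff[OF t \<beta>, of \<xi>] U0_le[of \<xi>] unfolding X.U_def Y.U_def by linarith

lemma exp_time_integral:
  fixes s K :: real
  assumes "0 \<le> s"
  shows "set_integrable lborel {0..s} (\<lambda>x. exp (K * x))" "K * (LINT x:{0..s}|lborel. exp (K * x)) = exp (K * s) - 1"
proof -
  show i: "set_integrable lborel {0..s} (\<lambda>x. exp (K * x))"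
    unfolding set_integrable_def by (intro borel_integrable_compact continuous_intros) auto
  then have i2: "set_integrable lborel {0..s} (\<lambda>x. K * exp (K * x))" by simp
  have "((\<lambda>x. K * exp (K * x)) has_integral (exp (K * s) - exp (K * 0))) {0..s}"
    using assms by (intro fundamental_theorem_of_calculus)
      (auto intro!: derivative_eq_intros simp: has_real_derivative_iff_has_vector_derivative[symmetric])
  then have "(LINT x:{0..s}|lborel. K * exp (K * x)) = exp (K * s) - exp (K * 0)"
    unfolding set_borel_integral_eq_integral(2)[OF i2] by (rule integral_unique)
  then have "(LINT x:{0..s}|lborel. K * exp (K * x)) = exp (K * s) - 1" by simp
  then show "K * (LINT x:{0..s}|lborel. exp (K * x)) = exp (K * s) - 1" by simp
qed

text \<open>One step of a Gronwall argument: any bound \<open>c e\<^bsup>Ks\<^esup>\<close> for \<open>y - y'\<close> with \<open>c > F\<close> can be improved.\<close>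

lemma Gronwall_step:
  assumes T: "0 \<le> T" and K: "K = A * M * T / 4" and F: "F = a1 + T * a2 + T * P T" and c: "F \<le> c"
    and \<beta>: "\<And>s \<xi>. 0 \<le> s \<Longrightarrow> s \<le> T \<Longrightarrow> \<bar>X.y s \<xi> - Y.y s \<xi>\<bar> \<le> c * exp (K * s)"
    and s: "0 \<le> s" "s \<le> T"
  shows "\<bar>X.y s \<xi> - Y.y s \<xi>\<bar> \<le> (F + (c - F) * (1 - exp (- (K * T)))) * exp (K * s)"
proof -
  have K0: "0 \<le> K" unfolding K using AM T by simp
  have F0: "0 \<le> F" unfolding F using a_nonneg T P_nonneg[OF T] by simp
  have c0: "0 \<le> c" using F0 c by simp
  have Ud: "\<bar>X.U x \<xi> - Y.U x \<xi>\<bar> \<le> (a2 + P T) + K * c * exp (K * x)" if x: "0 \<le> x" "x \<le> s" for x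
  proof -
    have "\<bar>X.y s' \<xi> - Y.y s' \<xi>\<bar> \<le> c * exp (K * x)" if "0 \<le> s'" "s' \<le> x" for s' \<xi>
    proof -
      have "\<bar>X.y s' \<xi> - Y.y s' \<xi>\<bar> \<le> c * exp (K * s')" using \<beta>[of s'] that x s by simp
      also have "\<dots> \<le> c * exp (K * x)" using that K0 c0 by (intro mult_left_mono) (auto intro: mult_left_mono)
      finally show ?thesis .
    qed
    then have "\<bar>X.U x \<xi> - Y.U x \<xi>\<bar> \<le> a2 + E (c * exp (K * x)) x" by (rule U_diff[OF x(1)])
    also have "\<dots> \<le> a2 + (P T + K * (c * exp (K * x)))"
      unfolding E_def K using P_mono[of x T] x s AM c0
      by (intro add_mono mult_right_mono divide_right_mono mult_left_mono) auto
    finally show ?thesis by simp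
  qed
  note Xi = X.U_time_integral[OF s(1), of \<xi>] and Yi = Y.U_time_integral[OF s(1), of \<xi>]
  have i1: "set_integrable lborel {0..s} (\<lambda>x. a2 + P T)"
    unfolding set_integrable_def by (intro borel_integrable_compact) auto
  note ie = exp_time_integral[OF s(1), of K]
  have i2: "set_integrable lborel {0..s} (\<lambda>x. K * c * exp (K * x))" using ie(1) by simp
  have "\<bar>LINT x:{0..s}|lborel. X.U x \<xi> - Y.U x \<xi>\<bar> \<le> (LINT x:{0..s}|lborel. (a2 + P T) + K * c * exp (K * x))"
    unfolding set_lebesgue_integral_def real_norm_def[symmetric]
  proof (rule order_trans[OF integral_norm_bound integral_mono_AE])
    show "AE x in lborel. norm (indicator {0..s} x *\<^sub>R (X.U x \<xi> - Y.U x \<xi>)) \<le> indicator {0..s} x *\<^sub>R ((a2 + P T) + K * c * exp (K * x))"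
      using Ud by (intro AE_I2) (auto simp: indicator_def)
    show "integrable lborel (\<lambda>x. norm (indicator {0..s} x *\<^sub>R (X.U x \<xi> - Y.U x \<xi>)))"
      using set_integral_diff(1)[OF Xi(1) Yi(1)] unfolding set_integrable_def by (rule integrable_norm)
    show "integrable lborel (\<lambda>x. indicator {0..s} x *\<^sub>R ((a2 + P T) + K * c * exp (K * x)))"
      using set_integral_add(1)[OF i1 i2] unfolding set_integrable_def .
  qed
  also have "\<dots> = (LINT x:{0..s}|lborel. a2 + P T) + (LINT x:{0..s}|lborel. K * c * exp (K * x))"
    by (rule set_integral_add(2)[OF i1 i2])
  also have "(LINT x:{0..s}|lborel. a2 + P T) = s * (a2 + P T)" using s by (simp add: set_lebesgue_integral_def)
  also have "(LINT x:{0..s}|lborel. K * c * exp (K * x)) = c * (exp (K * s) - 1)"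
    unfolding ie(2)[symmetric] by simp
  finally have 1: "\<bar>LINT x:{0..s}|lborel. X.U x \<xi> - Y.U x \<xi>\<bar> \<le> s * (a2 + P T) + c * (exp (K * s) - 1)" .
  have "X.y s \<xi> - Y.y s \<xi> = (y0 \<xi> - y0' \<xi>) + (LINT x:{0..s}|lborel. X.U x \<xi> - Y.U x \<xi>)"
    using Xi(2) Yi(2) set_integral_diff(2)[OF Xi(1) Yi(1)] by simp
  then have "\<bar>X.y s \<xi> - Y.y s \<xi>\<bar> \<le> a1 + s * (a2 + P T) + c * (exp (K * s) - 1)"
    using 1 y0_le[of \<xi>] by linarith
  also have "s * (a2 + P T) \<le> T * (a2 + P T)" using s a_nonneg P_nonneg[OF T] by (intro mult_right_mono) auto
  finally have 2: "\<bar>X.y s \<xi> - Y.y s \<xi>\<bar> \<le> F + c * (exp (K * s) - 1)" unfolding F by (simp add: distrib_left)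
  \<comment> \<open>The gain of the step:
    \<open>F + c (exp (K s) - 1) = c exp (K s) - (c - F)\<close>, and \<open>c - F\<close> is at
    least \<open>(c - F) exp (K s - K T)\<close>.\<close>
  have "exp (K * s) * exp (- (K * T)) \<le> 1"
    using s K0 by (simp add: exp_minus[symmetric] exp_add[symmetric] mult_left_mono)
  then have "(c - F) * (exp (K * s) * exp (- (K * T))) \<le> (c - F) * 1" using c by (intro mult_left_mono) auto
  then have "F + c * (exp (K * s) - 1) \<le> (F + (c - F) * (1 - exp (- (K * T)))) * exp (K * s)"
    by (simp add: algebra_simps)
  then show ?thesis using 2 by linarith
qed

text \<open>Iterating the step shrinks the excess over \<open>F\<close> geometrically, starting from
  a crude bound. The iteration works with pointwise bounds uniform in \<open>\<xi>\<close>, so no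
  regularity in time of the supremum over \<open>\<xi>\<close> enters.\<close>

lemma y_diff:
  assumes T: "0 \<le> T" and s: "0 \<le> s" "s \<le> T"
  shows "\<bar>X.y s \<xi> - Y.y s \<xi>\<bar> \<le> (a1 + T * a2 + T * P T) * exp (A * M * T\<^sup>2 / 4)"
proof -
  define K where "K = A * M * T / 4"
  define F where "F = a1 + T * a2 + T * P T"
  define \<rho> where "\<rho> = 1 - exp (- (K * T))"
  \<comment> \<open>A crude initial excess: each of the two integrals of \<open>kk\<close> is at
    most \<open>T^2 M / 8\<close>.\<close>
  define d where "d = T\<^sup>2 * M"
  have K0: "0 \<le> K" unfolding K_def using AM T by simp
  have d0: "0 \<le> d" unfolding d_def using AM by simp
  have F0: "0 \<le> F" unfolding F_def using a_nonneg T P_nonneg[OF T] by simp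
  have \<rho>: "0 \<le> \<rho>" "\<rho> < 1" unfolding \<rho>_def using K0 T by auto
  have bd: "\<forall>s \<xi>. 0 \<le> s \<longrightarrow> s \<le> T \<longrightarrow> \<bar>X.y s \<xi> - Y.y s \<xi>\<bar> \<le> (F + d * \<rho> ^ n) * exp (K * s)" for n
  proof (induction n)
    case 0
    show ?case
    proof (intro allI impI)
      fix s \<xi> :: real assume s: "0 \<le> s" "s \<le> T"
      have XI: "\<bar>LINT \<eta>|lborel. kap \<xi> \<eta> * X.kk s \<eta>\<bar> \<le> T\<^sup>2 / 8 * M"
      proof -
        have "(LINT \<eta>|lborel. \<bar>X.kk s \<eta>\<bar>) \<le> (LINT \<eta>|lborel. s\<^sup>2 / 2 * h \<eta>)"
          using X.kk_bounds[OF s(1)] X.k_int[OF s(1)] X.h_int by (intro integral_mono) auto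
        also have "\<dots> \<le> T\<^sup>2 / 2 * M" using X.h_le s X.nonneg
          by (simp, intro mult_mono power_mono integral_nonneg_AE) auto
        finally show ?thesis using integral_kap_le[OF X.k_int(2)[OF s(1)], of \<xi>] by simp
      qed
      have YI: "\<bar>LINT \<eta>|lborel. kap \<xi> \<eta> * Y.kk s \<eta>\<bar> \<le> T\<^sup>2 / 8 * M"
      proof -
        have "(LINT \<eta>|lborel. \<bar>Y.kk s \<eta>\<bar>) \<le> (LINT \<eta>|lborel. s\<^sup>2 / 2 * h' \<eta>)"
          using Y.kk_bounds[OF s(1)] Y.k_int[OF s(1)] Y.h_int by (intro integral_mono) auto
        also have "\<dots> \<le> T\<^sup>2 / 2 * M" using Y.h_le s Y.nonneg
          by (simp, intro mult_mono power_mono integral_nonneg_AE) auto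
        finally show ?thesis using integral_kap_le[OF Y.k_int(2)[OF s(1)], of \<xi>] by simp
      qed
      have "\<bar>s * U0 \<xi> - s * U0' \<xi>\<bar> \<le> T * a2"
        unfolding right_diff_distrib[symmetric] abs_mult using s U0_le[of \<xi>] by (intro mult_mono) auto
      then have "\<bar>X.y s \<xi> - Y.y s \<xi>\<bar> \<le> a1 + T * a2 + d"
        using XI YI y0_le[of \<xi>] d0 unfolding X.y_def Y.y_def d_def by linarith
      also have "\<dots> \<le> F + d" unfolding F_def using T P_nonneg[OF T] by simp
      also have "\<dots> \<le> (F + d * \<rho> ^ 0) * exp (K * s)"
        using F0 d0 K0 s mult_left_mono[of 1 "exp (K * s)" "F + d"] by simp
      finally show "\<bar>X.y s \<xi> - Y.y s \<xi>\<bar> \<le> (F + d * \<rho> ^ 0) * exp (K * s)" .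
    qed
  next
    case (Suc n)
    have "F \<le> F + d * \<rho> ^ n" using d0 \<rho> by simp
    from Gronwall_step[OF T K_def F_def this] Suc
    show ?case by (simp add: \<rho>_def[symmetric] ac_simps)
  qed
  have "(\<lambda>n. (F + d * \<rho> ^ n) * exp (K * s)) \<longlonglongrightarrow> (F + d * 0) * exp (K * s)"
    using \<rho> by (intro tendsto_intros LIMSEQ_realpow_zero) auto
  then have "\<bar>X.y s \<xi> - Y.y s \<xi>\<bar> \<le> F * exp (K * s)"
    using bd s by (intro LIMSEQ_le_const[of "\<lambda>n. (F + d * \<rho> ^ n) * exp (K * s)"]) auto
  also have "\<dots> \<le> F * exp (A * M * T\<^sup>2 / 4)"
  proof -
    have "K * s \<le> K * T" using s K0 by (intro mult_left_mono) auto
    also have "K * T = A * M * T\<^sup>2 / 4" by (simp add: K_def power2_eq_square)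
    finally show ?thesis using F0 by (intro mult_left_mono) auto
  qed
  finally show ?thesis by (simp add: F_def)
qed

text \<open>\<open>H h - H' h' = H (h - h') + (H - H') h'\<close>, and the total energies differ by
  at most the \<open>L1\<close> bound \<open>a4\<close>.\<close>

lemma g2_diff:
  assumes t: "0 \<le> t"
  shows "\<bar>ldata_g2 \<alpha> (X.D t) \<xi> - ldata_g2 \<alpha> (Y.D t) \<xi>\<bar> \<le> G2 \<xi> + t / 2 * (A * M * z \<xi> + A * a4 * h' \<xi>)"
proof -
  have nn: "0 \<le> t / 2 * (A * M * z \<xi> + A * a4 * h' \<xi>)"
    using t AM dh_le h'_bounds[of \<xi>] by (intro mult_nonneg_nonneg add_nonneg_nonneg) auto
  consider "X.B \<xi>" "Y.B \<xi>" | "X.B \<xi>" "\<not> Y.B \<xi>" | "\<not> X.B \<xi>" "Y.B \<xi>" | "\<not> X.B \<xi>" "\<not> Y.B \<xi>" by blast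
  then show ?thesis
  proof cases
    case 1
    define H where "H = (LINT \<xi>|lborel. h \<xi>)"
    define H' where "H' = (LINT \<xi>|lborel. h' \<xi>)"
    have H: "0 \<le> H" "0 \<le> H'" "H \<le> M" "\<bar>H - H'\<bar> \<le> a4" unfolding H_def H'_def
      using X.nonneg Y.nonneg X.h_le H_diff_le by (auto intro: integral_nonneg_AE)
    let ?x = "b \<xi> + t * h \<xi> / 2" and ?x' = "b' \<xi> + t * h' \<xi> / 2"
    have "\<bar>A * H * min 0 ?x - A * H' * min 0 ?x'\<bar> \<le> \<bar>A * H * ?x - A * H' * ?x'\<bar>"
      using AM H by (intro min0_diff_le) auto
    also have "\<dots> = \<bar>(A * H * b \<xi> - A * H' * b' \<xi>) + t / 2 * (A * (H * (h \<xi> - h' \<xi>) + (H - H') * h' \<xi>))\<bar>"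
      by (rule arg_cong[where f=abs]) (simp add: field_simps)
    also have "\<dots> \<le> G2 \<xi> + t / 2 * (A * (M * z \<xi> + a4 * h' \<xi>))"
    proof -
      have "\<bar>H * (h \<xi> - h' \<xi>) + (H - H') * h' \<xi>\<bar> \<le> \<bar>H\<bar> * \<bar>h \<xi> - h' \<xi>\<bar> + \<bar>H - H'\<bar> * \<bar>h' \<xi>\<bar>"
        unfolding abs_mult[symmetric] by (rule abs_triangle_ineq)
      also have "\<dots> \<le> M * z \<xi> + a4 * h' \<xi>"
        using H h'_bounds[of \<xi>] diffs_le_z(3)[of \<xi>] dh_le AM unfolding dh_def by (intro add_mono mult_mono) auto
      finally have "\<bar>t / 2 * (A * (H * (h \<xi> - h' \<xi>) + (H - H') * h' \<xi>))\<bar> \<le> t / 2 * (A * (M * z \<xi> + a4 * h' \<xi>))"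
        unfolding abs_mult using t AM by (intro mult_mono) auto
      then show ?thesis unfolding G23_both[OF 1] H_def[symmetric] H'_def[symmetric] by linarith
    qed
    finally show ?thesis unfolding X.ldata_g23_D[OF t] Y.ldata_g23_D[OF t] H_def[symmetric] H'_def[symmetric]
      using 1 by (simp add: algebra_simps)
  next
    case 2 then show ?thesis using g2_single[OF t] nn by (meson add_increasing2 order_trans order_refl)
  next
    case 3 then show ?thesis using g2_single'[OF t] nn by (meson add_increasing2 order_trans order_refl)
  next
    case 4
    then show ?thesis unfolding X.ldata_g23_D[OF t] Y.ldata_g23_D[OF t] using nn diffs_nonneg(7)[of \<xi>] by simp
  qed
qed

lemma g3_diff:
  assumes t: "0 \<le> t" and Id: "\<And>\<xi>. \<bar>X.I t \<xi> - Y.I t \<xi>\<bar> \<le> \<epsilon>"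
  shows "\<bar>ldata_g3 \<alpha> (X.D t) \<xi> - ldata_g3 \<alpha> (Y.D t) \<xi>\<bar>
    \<le> G3 \<xi> + t / 4 * G2 \<xi> + t / 2 * w \<xi> + A * M * t / 4 * (1 + t / 2) * z \<xi>
      + (A * (1 + t / 2) * \<epsilon> + A * (2 + t / 2) * (a2 + \<epsilon>)) * sqrt (h' \<xi>)"
proof -
  have e0: "0 \<le> \<epsilon>" using order_trans[OF abs_ge_zero Id] .
  have nn: "0 \<le> t / 4 * G2 \<xi>" "0 \<le> t / 2 * w \<xi>" "0 \<le> A * M * t / 4 * (1 + t / 2) * z \<xi>"
    "0 \<le> (A * (1 + t / 2) * \<epsilon> + A * (2 + t / 2) * (a2 + \<epsilon>)) * sqrt (h' \<xi>)"
    using t AM a_nonneg e0 h'_bounds[of \<xi>] by auto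
  consider "X.B \<xi>" "Y.B \<xi>" | "X.B \<xi>" "\<not> Y.B \<xi>" | "\<not> X.B \<xi>" "Y.B \<xi>" | "\<not> X.B \<xi>" "\<not> Y.B \<xi>" by blast
  then show ?thesis
  proof cases
    case 1
    let ?x = "b \<xi> + t * h \<xi> / 2" and ?x' = "b' \<xi> + t * h' \<xi> / 2" and ?q = "sqrt (h' \<xi>)"
    \<comment> \<open>Both parts of \<open>?x'\<close> are dominated by \<open>?q = sqrt h'\<close>:
      \<open>h' <= 1\<close> gives \<open>h' <= ?q\<close>, and \<open>b'^2 = a' h' <= h'\<close>
      gives \<open>|b'| <= ?q\<close>. This yields a factor \<open>sqrt M\<close> in
      \<open>L2\<close>.\<close>
    have hq: "h' \<xi> \<le> ?q"
      using h'_bounds[of \<xi>] by (intro real_le_rsqrt) (simp add: power2_eq_square mult_left_le)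
    have "(b' \<xi>)\<^sup>2 \<le> h' \<xi>"
      using Y.B_facts(4)[OF 1(2)] mult_right_mono[OF h'_bounds(4)[of \<xi>] h'_bounds(1)[of \<xi>]] by simp
    then have bq: "\<bar>b' \<xi>\<bar> \<le> ?q" using real_sqrt_le_mono by fastforce
    have thq: "t * h' \<xi> / 2 \<le> t / 2 * ?q" using hq t by (simp add: mult_left_mono)
    have q0: "0 \<le> ?q" "0 \<le> t / 2 * ?q" using h'_bounds[of \<xi>] t by auto
    have th0: "0 \<le> t * h' \<xi> / 2" using t h'_bounds[of \<xi>] by simp
    have x1: "\<bar>?x'\<bar> \<le> (1 + t / 2) * ?q" and x2: "\<bar>?x'\<bar> + \<bar>min 0 ?x'\<bar> \<le> (2 + t / 2) * ?q"
      unfolding distrib_right using Y.B_facts(2)[OF 1(2)] bq thq q0 th0 by (auto simp: min_def)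
    have Ud: "\<bar>X.U t \<xi> - Y.U t \<xi>\<bar> \<le> a2 + \<epsilon>" using Id[of \<xi>] U0_le[of \<xi>] unfolding X.U_def Y.U_def by linarith
    have I: "\<bar>X.I t \<xi>\<bar> \<le> M * t / 4" using X.I_le[OF t, of \<xi>] mult_left_mono[OF X.h_le t] by (simp add: mult.commute)
    have xx: "\<bar>?x - ?x'\<bar> \<le> (1 + t / 2) * z \<xi>"
    proof -
      have "\<bar>t * h \<xi> / 2 - t * h' \<xi> / 2\<bar> = t / 2 * dh \<xi>" using t
        by (simp add: dh_def abs_mult diff_divide_distrib[symmetric] right_diff_distrib[symmetric])
      also have "\<dots> \<le> t / 2 * z \<xi>" using t diffs_le_z by (intro mult_left_mono) auto
      finally show ?thesis using diffs_le_z(2)[of \<xi>] unfolding dq_def distrib_right by linarith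
    qed
    define S where "S = \<bar>U0 \<xi> * b \<xi> - U0' \<xi> * b' \<xi>\<bar> + t / 2 * \<bar>U0 \<xi> * h \<xi> - U0' \<xi> * h' \<xi>\<bar>
        + M * t / 4 * ((1 + t / 2) * z \<xi>) + \<epsilon> * ((1 + t / 2) * ?q)"
    have 3: "\<bar>X.U t \<xi> * ?x - Y.U t \<xi> * ?x'\<bar> \<le> S"
    proof -
      \<comment> \<open>Only the initial velocities are paired with \<open>b\<close> and
        \<open>h\<close>, which reproduces the integrands of \<open>G3\<close> and \<open>w\<close>;
        the increments \<open>I\<close> and their difference have uniform bounds.\<close>
      have "X.U t \<xi> * ?x - Y.U t \<xi> * ?x' = (U0 \<xi> * b \<xi> - U0' \<xi> * b' \<xi>) + t / 2 * (U0 \<xi> * h \<xi> - U0' \<xi> * h' \<xi>)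
        + X.I t \<xi> * (?x - ?x') + (X.I t \<xi> - Y.I t \<xi>) * ?x'"
        unfolding X.U_def Y.U_def by (simp add: field_simps)
      moreover have "\<bar>t / 2 * (U0 \<xi> * h \<xi> - U0' \<xi> * h' \<xi>)\<bar> = t / 2 * \<bar>U0 \<xi> * h \<xi> - U0' \<xi> * h' \<xi>\<bar>" using t by (simp add: abs_mult)
      moreover have "\<bar>X.I t \<xi> * (?x - ?x')\<bar> \<le> M * t / 4 * ((1 + t / 2) * z \<xi>)"
        unfolding abs_mult using I xx AM t by (intro mult_mono) auto
      moreover have "\<bar>(X.I t \<xi> - Y.I t \<xi>) * ?x'\<bar> \<le> \<epsilon> * ((1 + t / 2) * ?q)"
        unfolding abs_mult using Id x1 e0 by (intro mult_mono) auto
      ultimately show ?thesis unfolding S_def by linarith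
    qed
    have 4: "\<bar>X.U t \<xi> - Y.U t \<xi>\<bar> * (\<bar>?x'\<bar> + \<bar>min 0 ?x'\<bar>) \<le> (a2 + \<epsilon>) * ((2 + t / 2) * ?q)"
      using Ud x2 a_nonneg e0 by (intro mult_mono) auto
    have "\<bar>X.U t \<xi> * min 0 ?x - Y.U t \<xi> * min 0 ?x'\<bar> \<le> S + (a2 + \<epsilon>) * ((2 + t / 2) * ?q)"
      using prod_min0_diff_le[of "X.U t \<xi>" ?x "Y.U t \<xi>" ?x'] 3 4 by linarith
    then have 5: "A * \<bar>X.U t \<xi> * min 0 ?x - Y.U t \<xi> * min 0 ?x'\<bar> \<le> A * (S + (a2 + \<epsilon>) * ((2 + t / 2) * ?q))"
      using AM by (intro mult_left_mono) auto
    have 6: "A * (S + (a2 + \<epsilon>) * ((2 + t / 2) * ?q)) = A * \<bar>U0 \<xi> * b \<xi> - U0' \<xi> * b' \<xi>\<bar> + t / 2 * w \<xi> + A * M * t / 4 * (1 + t / 2) * z \<xi>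
       + (A * (1 + t / 2) * \<epsilon> + A * (2 + t / 2) * (a2 + \<epsilon>)) * ?q"
      unfolding w_def S_def by (simp add: algebra_simps)
    have "A * U0 \<xi> * b \<xi> - A * U0' \<xi> * b' \<xi> = A * (U0 \<xi> * b \<xi> - U0' \<xi> * b' \<xi>)" by (simp add: algebra_simps)
    then have 7: "A * \<bar>U0 \<xi> * b \<xi> - U0' \<xi> * b' \<xi>\<bar> = G3 \<xi>"
      unfolding G23_both(2)[OF 1] using AM by (simp only: abs_mult abs_of_nonneg)
    have 2: "A * \<bar>X.U t \<xi> * min 0 ?x - Y.U t \<xi> * min 0 ?x'\<bar> \<le> G3 \<xi> + t / 2 * w \<xi> + A * M * t / 4 * (1 + t / 2) * z \<xi>
       + (A * (1 + t / 2) * \<epsilon> + A * (2 + t / 2) * (a2 + \<epsilon>)) * ?q"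
      using 5 6 unfolding 7 by linarith
    have "ldata_g3 \<alpha> (X.D t) \<xi> - ldata_g3 \<alpha> (Y.D t) \<xi> = A * (X.U t \<xi> * min 0 ?x - Y.U t \<xi> * min 0 ?x')"
      unfolding X.ldata_g23_D[OF t] Y.ldata_g23_D[OF t] using 1 by (simp add: algebra_simps)
    then have "\<bar>ldata_g3 \<alpha> (X.D t) \<xi> - ldata_g3 \<alpha> (Y.D t) \<xi>\<bar> = A * \<bar>X.U t \<xi> * min 0 ?x - Y.U t \<xi> * min 0 ?x'\<bar>"
      using AM by (simp only: abs_mult abs_of_nonneg)
    then show ?thesis using 2 nn by linarith
  next
    case 2 then show ?thesis using g2_single(2)[OF t 2] nn by linarith
  next
    case 3 then show ?thesis using g2_single'(2)[OF t 3] nn by linarith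
  next
    case 4
    then show ?thesis unfolding X.ldata_g23_D[OF t] Y.ldata_g23_D[OF t] using nn diffs_nonneg(8)[of \<xi>] by simp
  qed
qed

text \<open>There is one bound for each summand of \<open>ldist\<close>, in order.
  \<open>\<beta>\<close>, \<open>\<epsilon>\<close> and \<open>\<rho>\<close> stay symbolic so that
  the Gronwall factor can be extracted from the sum by homogeneity.\<close>

lemma ldist_le:
  assumes t: "0 \<le> t"
    and \<beta>: "\<And>s' \<xi>. 0 \<le> s' \<Longrightarrow> s' \<le> t \<Longrightarrow> \<bar>X.y s' \<xi> - Y.y s' \<xi>\<bar> \<le> \<beta>"
    and e: "\<epsilon> = E \<beta> t" and R: "\<rho> = Rn \<beta> t"
  shows "ldist \<alpha> (X.D t) (Y.D t) \<le> ennreal (\<beta> + (a2 + \<epsilon>) + (a3 + A * M * t / 4 * a5 + A * \<epsilon> * m) + a4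
    + ((1 + 3/2 * t + t\<^sup>2 / 2) * a5 + (t / 2 + t\<^sup>2 / 2) * \<rho>)
    + ((2 + t + t\<^sup>2 / 2) * a5 + (1 + t\<^sup>2 / 2) * \<rho>)
    + (a7 + t / 2 * (A * M * a5 + A * a4 * m))
    + (a8 + t / 4 * a7 + t / 2 * a3 + A * M * t / 4 * (1 + t / 2) * a5
       + (A * (1 + t / 2) * \<epsilon> + A * (2 + t / 2) * (a2 + \<epsilon>)) * m))"
proof -
  have b0: "0 \<le> \<beta>" using \<beta>[of 0] t abs_ge_zero order_trans by blast
  have Id: "\<bar>X.I t \<xi> - Y.I t \<xi>\<bar> \<le> \<epsilon>" for \<xi> unfolding e by (rule I_diff[OF t \<beta>])
  have e0: "0 \<le> \<epsilon>" using order_trans[OF abs_ge_zero Id] .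
  note RL = R_L2[OF t b0, folded R]
  note XD = X.D_meas[OF t] and YD = Y.D_meas[OF t]
  have [measurable]: "X.U t \<in> borel_measurable borel" "Y.U t \<in> borel_measurable borel"
    using XD YD by (auto simp: ldata_meas_def X.D_def Y.D_def)
  note [measurable] = ldata_g_meas[OF XD X.\<alpha>_meas] ldata_g_meas[OF YD X.\<alpha>_meas]
  have [measurable]: "R \<beta> t \<in> borel_measurable borel" "z \<in> borel_measurable borel"
    using RL z_le by (auto simp: L2le_def)
  have zR: "0 \<le> z \<xi> + R \<beta> t \<xi>" for \<xi> using R_nonneg[OF t b0, of \<xi>] by simp
  have 1: "Linf_norm (\<lambda>\<xi>. X.y t \<xi> - Y.y t \<xi>) \<le> ennreal \<beta>" by (intro Linf_norm_le \<beta>) (use t in auto)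
  have 2: "Linf_norm (\<lambda>\<xi>. X.U t \<xi> - Y.U t \<xi>) \<le> ennreal (a2 + \<epsilon>)" unfolding e by (intro Linf_norm_le U_diff t \<beta>)
  have 3: "ennreal (dnorm \<alpha>) * L2_norm (\<lambda>\<xi>. X.U t \<xi> * h \<xi> - Y.U t \<xi> * h' \<xi>) \<le> ennreal (a3 + A * M * t / 4 * a5 + A * \<epsilon> * m)"
  proof -
    have "L2le (\<lambda>\<xi>. A * (X.U t \<xi> * h \<xi> - Y.U t \<xi> * h' \<xi>)) (a3 + A * M * t / 4 * a5 + A * \<epsilon> * m)"
    proof (rule L2le_mono)
      show "L2le (\<lambda>\<xi>. w \<xi> + A * M * t / 4 * z \<xi> + A * \<epsilon> * h' \<xi>) (a3 + A * M * t / 4 * a5 + A * \<epsilon> * m)"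
        using AM t e0 by (intro L2le_add L2le_cmult w_le z_le h'_L2) auto
      fix \<xi>
      have I: "\<bar>X.I t \<xi>\<bar> \<le> M * t / 4" using X.I_le[OF t, of \<xi>] mult_left_mono[OF X.h_le t] by (simp add: mult.commute)
      have "X.U t \<xi> * h \<xi> - Y.U t \<xi> * h' \<xi> = (U0 \<xi> * h \<xi> - U0' \<xi> * h' \<xi>) + X.I t \<xi> * (h \<xi> - h' \<xi>) + (X.I t \<xi> - Y.I t \<xi>) * h' \<xi>"
        unfolding X.U_def Y.U_def by (simp add: algebra_simps)
      moreover have "\<bar>X.I t \<xi> * (h \<xi> - h' \<xi>)\<bar> \<le> M * t / 4 * z \<xi>"
        unfolding abs_mult using I diffs_le_z(3)[of \<xi>] AM t unfolding dh_def by (intro mult_mono) auto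
      moreover have "\<bar>(X.I t \<xi> - Y.I t \<xi>) * h' \<xi>\<bar> \<le> \<epsilon> * h' \<xi>"
        unfolding abs_mult using Id h'_bounds[of \<xi>] e0 by (intro mult_mono) auto
      ultimately have "\<bar>X.U t \<xi> * h \<xi> - Y.U t \<xi> * h' \<xi>\<bar> \<le> \<bar>U0 \<xi> * h \<xi> - U0' \<xi> * h' \<xi>\<bar> + M * t / 4 * z \<xi> + \<epsilon> * h' \<xi>"
        by linarith
      then have "A * \<bar>X.U t \<xi> * h \<xi> - Y.U t \<xi> * h' \<xi>\<bar> \<le> A * (\<bar>U0 \<xi> * h \<xi> - U0' \<xi> * h' \<xi>\<bar> + M * t / 4 * z \<xi> + \<epsilon> * h' \<xi>)"
        using AM by (intro mult_left_mono) auto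
      also have "\<dots> = w \<xi> + A * M * t / 4 * z \<xi> + A * \<epsilon> * h' \<xi>" by (simp add: w_def algebra_simps)
      finally show "\<bar>A * (X.U t \<xi> * h \<xi> - Y.U t \<xi> * h' \<xi>)\<bar> \<le> \<bar>w \<xi> + A * M * t / 4 * z \<xi> + A * \<epsilon> * h' \<xi>\<bar>"
        using AM by (simp add: abs_mult)
    qed simp
    then have "L2_norm (\<lambda>\<xi>. A * (X.U t \<xi> * h \<xi> - Y.U t \<xi> * h' \<xi>)) \<le> ennreal (a3 + A * M * t / 4 * a5 + A * \<epsilon> * m)"
      by (rule L2le_imp_le)
    moreover have "L2_norm (\<lambda>\<xi>. A * (X.U t \<xi> * h \<xi> - Y.U t \<xi> * h' \<xi>)) = ennreal A * L2_norm (\<lambda>\<xi>. X.U t \<xi> * h \<xi> - Y.U t \<xi> * h' \<xi>)"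
      by (rule L2_norm_cmult) (use AM in auto)
    ultimately show ?thesis using X.A_eq by simp
  qed
  have 4: "L1_norm (\<lambda>\<xi>. h \<xi> - h' \<xi>) \<le> ennreal a4" using dh_le(1) by (simp add: L1_norm_def dh_def)
  have 5: "sqrt_e (\<integral>\<^sup>+ \<xi>. ennreal ((X.y\<xi> t \<xi> - Y.y\<xi> t \<xi>)\<^sup>2 + (X.U\<xi> t \<xi> - Y.U\<xi> t \<xi>)\<^sup>2
         + (h \<xi> - h' \<xi>)\<^sup>2 + (r \<xi> - r' \<xi>)\<^sup>2) \<partial>lborel) \<le> ennreal ((1 + 3/2 * t + t\<^sup>2 / 2) * a5 + (t / 2 + t\<^sup>2 / 2) * \<rho>)"
  proof -
    let ?S = "\<lambda>\<xi>. (X.y\<xi> t \<xi> - Y.y\<xi> t \<xi>)\<^sup>2 + (X.U\<xi> t \<xi> - Y.U\<xi> t \<xi>)\<^sup>2 + (h \<xi> - h' \<xi>)\<^sup>2 + (r \<xi> - r' \<xi>)\<^sup>2"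
    have "L2le (\<lambda>\<xi>. sqrt (?S \<xi>)) ((1 + 3/2 * t + t\<^sup>2 / 2) * a5 + (t / 2 + t\<^sup>2 / 2) * \<rho>)"
    proof (rule L2le_mono)
      show "L2le (\<lambda>\<xi>. (1 + 3/2 * t + t\<^sup>2 / 2) * z \<xi> + (t / 2 + t\<^sup>2 / 2) * R \<beta> t \<xi>) ((1 + 3/2 * t + t\<^sup>2 / 2) * a5 + (t / 2 + t\<^sup>2 / 2) * \<rho>)"
        using t by (intro L2le_add L2le_cmult z_le RL) auto
      fix \<xi>
      have "sqrt (?S \<xi>) = sqrt ((X.y\<xi> t \<xi> - Y.y\<xi> t \<xi>)\<^sup>2 + (X.U\<xi> t \<xi> - Y.U\<xi> t \<xi>)\<^sup>2 + ((h \<xi> - h' \<xi>)\<^sup>2 + (r \<xi> - r' \<xi>)\<^sup>2))"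
        by (simp add: add.assoc)
      also have "\<dots> \<le> sqrt ((a \<xi> - a' \<xi>)\<^sup>2 + (b \<xi> - b' \<xi>)\<^sup>2 + ((h \<xi> - h' \<xi>)\<^sup>2 + (r \<xi> - r' \<xi>)\<^sup>2))
          + (t * dq \<xi> + t\<^sup>2 / 2 * (z \<xi> + R \<beta> t \<xi>)) + t / 2 * (z \<xi> + R \<beta> t \<xi>)"
        using y\<xi>_diff[OF t \<beta>, of \<xi>] U\<xi>_diff[OF t \<beta>, of \<xi>] t zR[of \<xi>] unfolding dp_def dq_def
        by (intro sqrt_sum_le) (auto simp: add.assoc)
      also have "\<dots> \<le> z \<xi> + (t * z \<xi> + t\<^sup>2 / 2 * (z \<xi> + R \<beta> t \<xi>)) + t / 2 * (z \<xi> + R \<beta> t \<xi>)"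
        using mult_left_mono[OF diffs_le_z(2) t, of \<xi>] by (simp add: z_def add.assoc)
      also have "\<dots> = (1 + 3/2 * t + t\<^sup>2 / 2) * z \<xi> + (t / 2 + t\<^sup>2 / 2) * R \<beta> t \<xi>" by (simp add: field_simps)
      finally show "\<bar>sqrt (?S \<xi>)\<bar> \<le> \<bar>(1 + 3/2 * t + t\<^sup>2 / 2) * z \<xi> + (t / 2 + t\<^sup>2 / 2) * R \<beta> t \<xi>\<bar>" by simp
    qed simp
    from L2le_imp_le[OF this] show ?thesis by (simp add: L2_norm_def)
  qed
  have 6: "L2_norm (\<lambda>\<xi>. ldata_g \<alpha> (X.D t) \<xi> - ldata_g \<alpha> (Y.D t) \<xi>) \<le> ennreal ((2 + t + t\<^sup>2 / 2) * a5 + (1 + t\<^sup>2 / 2) * \<rho>)"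
  proof (rule L2le_imp_le, rule L2le_mono)
    show "L2le (\<lambda>\<xi>. (2 + t + t\<^sup>2 / 2) * z \<xi> + (1 + t\<^sup>2 / 2) * R \<beta> t \<xi>) ((2 + t + t\<^sup>2 / 2) * a5 + (1 + t\<^sup>2 / 2) * \<rho>)"
      using t by (intro L2le_add L2le_cmult z_le RL) auto
    fix \<xi>
    have "\<bar>ldata_g \<alpha> (X.D t) \<xi> - ldata_g \<alpha> (Y.D t) \<xi>\<bar> \<le> \<bar>X.y\<xi> t \<xi> - Y.y\<xi> t \<xi>\<bar> + \<bar>X.e t \<xi> - Y.e t \<xi>\<bar>"
      unfolding X.ldata_g_D[OF t] Y.ldata_g_D[OF t] by linarith
    also have "\<dots> \<le> (z \<xi> + t * z \<xi> + t\<^sup>2 / 2 * (z \<xi> + R \<beta> t \<xi>)) + (z \<xi> + R \<beta> t \<xi>)"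
      using y\<xi>_diff[OF t \<beta>, of \<xi>] e_diff[OF t \<beta>, of \<xi>] mult_left_mono[OF diffs_le_z(2) t, of \<xi>] diffs_le_z(1)[of \<xi>]
      by linarith
    also have "\<dots> = (2 + t + t\<^sup>2 / 2) * z \<xi> + (1 + t\<^sup>2 / 2) * R \<beta> t \<xi>" by (simp add: field_simps)
    finally show "\<bar>ldata_g \<alpha> (X.D t) \<xi> - ldata_g \<alpha> (Y.D t) \<xi>\<bar> \<le> \<bar>(2 + t + t\<^sup>2 / 2) * z \<xi> + (1 + t\<^sup>2 / 2) * R \<beta> t \<xi>\<bar>" by simp
  qed simp
  have 7: "L2_norm (\<lambda>\<xi>. ldata_g2 \<alpha> (X.D t) \<xi> - ldata_g2 \<alpha> (Y.D t) \<xi>) \<le> ennreal (a7 + t / 2 * (A * M * a5 + A * a4 * m))"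
  proof (rule L2le_imp_le, rule L2le_mono)
    show "L2le (\<lambda>\<xi>. G2 \<xi> + t / 2 * (A * M * z \<xi> + A * a4 * h' \<xi>)) (a7 + t / 2 * (A * M * a5 + A * a4 * m))"
      using t AM dh_le by (intro L2le_add L2le_cmult z_le G2_le h'_L2) auto
    show "\<bar>ldata_g2 \<alpha> (X.D t) \<xi> - ldata_g2 \<alpha> (Y.D t) \<xi>\<bar> \<le> \<bar>G2 \<xi> + t / 2 * (A * M * z \<xi> + A * a4 * h' \<xi>)\<bar>" for \<xi>
      using g2_diff[OF t, of \<xi>] by simp
  qed simp
  have 8: "L2_norm (\<lambda>\<xi>. ldata_g3 \<alpha> (X.D t) \<xi> - ldata_g3 \<alpha> (Y.D t) \<xi>) \<le> ennreal (a8 + t / 4 * a7 + t / 2 * a3 + A * M * t / 4 * (1 + t / 2) * a5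
       + (A * (1 + t / 2) * \<epsilon> + A * (2 + t / 2) * (a2 + \<epsilon>)) * m)"
  proof (rule L2le_imp_le, rule L2le_mono)
    show "L2le (\<lambda>\<xi>. G3 \<xi> + t / 4 * G2 \<xi> + t / 2 * w \<xi> + A * M * t / 4 * (1 + t / 2) * z \<xi>
      + (A * (1 + t / 2) * \<epsilon> + A * (2 + t / 2) * (a2 + \<epsilon>)) * sqrt (h' \<xi>)) (a8 + t / 4 * a7 + t / 2 * a3 + A * M * t / 4 * (1 + t / 2) * a5
       + (A * (1 + t / 2) * \<epsilon> + A * (2 + t / 2) * (a2 + \<epsilon>)) * m)"
      using t AM e0 a_nonneg by (intro L2le_add L2le_cmult z_le G2_le G3_le w_le sqrt_h'_L2 add_nonneg_nonneg mult_nonneg_nonneg) auto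
    show "\<bar>ldata_g3 \<alpha> (X.D t) \<xi> - ldata_g3 \<alpha> (Y.D t) \<xi>\<bar> \<le> \<bar>G3 \<xi> + t / 4 * G2 \<xi> + t / 2 * w \<xi> + A * M * t / 4 * (1 + t / 2) * z \<xi>
      + (A * (1 + t / 2) * \<epsilon> + A * (2 + t / 2) * (a2 + \<epsilon>)) * sqrt (h' \<xi>)\<bar>" for \<xi>
      using g3_diff[OF t Id, of \<xi>] by simp
  qed simp
  have "ldist \<alpha> (X.D t) (Y.D t) \<le> ennreal \<beta> + ennreal (a2 + \<epsilon>) + ennreal (a3 + A * M * t / 4 * a5 + A * \<epsilon> * m) + ennreal a4
    + ennreal ((1 + 3/2 * t + t\<^sup>2 / 2) * a5 + (t / 2 + t\<^sup>2 / 2) * \<rho>)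
    + ennreal ((2 + t + t\<^sup>2 / 2) * a5 + (1 + t\<^sup>2 / 2) * \<rho>)
    + ennreal (a7 + t / 2 * (A * M * a5 + A * a4 * m))
    + ennreal (a8 + t / 4 * a7 + t / 2 * a3 + A * M * t / 4 * (1 + t / 2) * a5
       + (A * (1 + t / 2) * \<epsilon> + A * (2 + t / 2) * (a2 + \<epsilon>)) * m)"
    using 1 2 3 4 5 6 7 8 unfolding ldist_def X.D_def Y.D_def prod.case
    by (intro add_mono) (simp_all add: X.D_def[symmetric] Y.D_def[symmetric])
  moreover have \<rho>0: "0 \<le> \<rho>" using RL L2le_nonneg by blast
  have "0 \<le> a2 + \<epsilon>" "0 \<le> a3 + A * M * t / 4 * a5 + A * \<epsilon> * m"
    "0 \<le> (1 + 3/2 * t + t\<^sup>2 / 2) * a5 + (t / 2 + t\<^sup>2 / 2) * \<rho>"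
    "0 \<le> (2 + t + t\<^sup>2 / 2) * a5 + (1 + t\<^sup>2 / 2) * \<rho>"
    "0 \<le> a7 + t / 2 * (A * M * a5 + A * a4 * m)"
    "0 \<le> a8 + t / 4 * a7 + t / 2 * a3 + A * M * t / 4 * (1 + t / 2) * a5
       + (A * (1 + t / 2) * \<epsilon> + A * (2 + t / 2) * (a2 + \<epsilon>)) * m"
    using e0 a_nonneg AM t dh_le(2) \<rho>0
    by (auto intro!: add_nonneg_nonneg mult_nonneg_nonneg divide_nonneg_nonneg)
  note nn = b0 dh_le(2) this
  have "ennreal x1 + ennreal x2 + ennreal x3 + ennreal x4 + ennreal x5 + ennreal x6 + ennreal x7 + ennreal x8
    = ennreal (x1 + x2 + x3 + x4 + x5 + x6 + x7 + x8)"
    if "0 \<le> x1" "0 \<le> x2" "0 \<le> x3" "0 \<le> x4" "0 \<le> x5" "0 \<le> x6" "0 \<le> x7" "0 \<le> x8" for x1 x2 x3 x4 x5 x6 x7 x8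
    using that by (simp add: ennreal_plus)
  note this[OF nn(1) nn(3) nn(4) nn(2) nn(5-8)]
  ultimately show ?thesis by (simp only:)
qed

end

section \<open>The growth constant\<close>

text \<open>The difference of the two sides is a polynomial with nonnegative coefficients.\<close>

lemma constants_polynomial_bound:
  fixes t m A :: real
  assumes "0 \<le> t" "0 \<le> m" "0 \<le> A"
  shows "(3 + 2 * m * A + 5/2 * t + 3/2 * t * m * A + 3/2 * t * m ^ 2 * A + t * m ^ 3 * A ^ 2 + 2 * t ^ 2
       + t ^ 2 * m * A + 5/8 * t ^ 2 * m ^ 2 * A + t ^ 2 * m ^ 3 * A ^ 2 + t ^ 3 + t ^ 3 * m * A
       + 5/8 * t ^ 3 * m ^ 2 * A + 1/4 * t ^ 3 * m ^ 3 * A ^ 2 + 1/4 * t ^ 4 * m ^ 2 * A)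
    + (1 + 4 * m * A + t + 2 * t * m * A + 1/2 * t ^ 2 * m * A + 1/4 * t ^ 2 * m ^ 2 * A
       + t ^ 2 * m ^ 3 * A ^ 2 + t ^ 3 * m * A + 1/4 * t ^ 3 * m ^ 3 * A ^ 2)
      * (1/2 * m + 1/4 * t + 1/2 * t * m + 1/4 * t ^ 2 * m + 1/8 * t ^ 2 * m ^ 3 * A + 1/16 * t ^ 3
       + 1/8 * t ^ 3 * m + 1/16 * t ^ 3 * m ^ 3 * A + 1/16 * t ^ 4 * m + 1/32 * t ^ 4 * m ^ 3 * A
       + 1/64 * t ^ 5 * m ^ 3 * A)
    \<le> (3 + m + 5 * m * A + 3 * m ^ 2 * A + 3/2 * t + 3/16 * t ^ 3 + 1/8 * t ^ 3 * m ^ 2 * A)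
      * ((1 + 2 * t + 2 * t ^ 2) * (1 + t * m * A) * (1 + 1/2 * t * m) * (1 + t * m ^ 2 * A))" (is "?l \<le> ?r")
proof -
  have "?r - ?l = 1/2 * m + 3 * m * A + m ^ 2 * A + 19/4 * t + 5/2 * t * m + 21/2 * t * m * A + 1/2 * t * m ^ 2
       + 8 * t * m ^ 2 * A + 5 * t * m ^ 2 * A ^ 2 + 5/2 * t * m ^ 3 * A + 7 * t * m ^ 3 * A ^ 2
       + 3 * t * m ^ 4 * A ^ 2 + 27/4 * t ^ 2 + 5 * t ^ 2 * m + 16 * t ^ 2 * m * A + t ^ 2 * m ^ 2
       + 153/8 * t ^ 2 * m ^ 2 * A + 10 * t ^ 2 * m ^ 2 * A ^ 2 + 27/4 * t ^ 2 * m ^ 3 * A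
       + 41/2 * t ^ 2 * m ^ 3 * A ^ 2 + 1/2 * t ^ 2 * m ^ 4 * A + 10 * t ^ 2 * m ^ 4 * A ^ 2
       + 5 * t ^ 2 * m ^ 4 * A ^ 3 + 3/2 * t ^ 2 * m ^ 5 * A ^ 2 + 3 * t ^ 2 * m ^ 5 * A ^ 3
       + 17/8 * t ^ 3 + 33/8 * t ^ 3 * m + 61/8 * t ^ 3 * m * A + t ^ 3 * m ^ 2
       + 279/16 * t ^ 3 * m ^ 2 * A + 10 * t ^ 3 * m ^ 2 * A ^ 2 + 151/16 * t ^ 3 * m ^ 3 * A
       + 28 * t ^ 3 * m ^ 3 * A ^ 2 + t ^ 3 * m ^ 4 * A + 131/8 * t ^ 3 * m ^ 4 * A ^ 2
       + 10 * t ^ 3 * m ^ 4 * A ^ 3 + 7/2 * t ^ 3 * m ^ 5 * A ^ 2 + 17/2 * t ^ 3 * m ^ 5 * A ^ 3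
       + 3/2 * t ^ 3 * m ^ 6 * A ^ 3 + 5/16 * t ^ 4 + 45/32 * t ^ 4 * m + 45/16 * t ^ 4 * m * A
       + 105/16 * t ^ 4 * m ^ 2 * A + 173/32 * t ^ 4 * m ^ 3 * A + 225/16 * t ^ 4 * m ^ 3 * A ^ 2
       + t ^ 4 * m ^ 4 * A + 211/16 * t ^ 4 * m ^ 4 * A ^ 2 + 10 * t ^ 4 * m ^ 4 * A ^ 3
       + 127/32 * t ^ 4 * m ^ 5 * A ^ 2 + 11 * t ^ 4 * m ^ 5 * A ^ 3 + 23/8 * t ^ 4 * m ^ 6 * A ^ 3
       + 3/8 * t ^ 5 + 1/8 * t ^ 5 * m + 11/32 * t ^ 5 * m * A + 113/64 * t ^ 5 * m ^ 2 * A
       + 105/64 * t ^ 5 * m ^ 3 * A + 27/8 * t ^ 5 * m ^ 3 * A ^ 2 + 139/32 * t ^ 5 * m ^ 4 * A ^ 2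
       + 67/64 * t ^ 5 * m ^ 5 * A ^ 2 + 41/8 * t ^ 5 * m ^ 5 * A ^ 3 + 93/32 * t ^ 5 * m ^ 6 * A ^ 3
       + 3/16 * t ^ 6 * m + 5/16 * t ^ 6 * m * A + 13/32 * t ^ 6 * m ^ 2 * A + 9/32 * t ^ 6 * m ^ 3 * A
       + 39/64 * t ^ 6 * m ^ 3 * A ^ 2 + 113/64 * t ^ 6 * m ^ 4 * A ^ 2 + 15/128 * t ^ 6 * m ^ 5 * A ^ 2
       + 1/4 * t ^ 6 * m ^ 5 * A ^ 3 + 1/64 * t ^ 6 * m ^ 6 * A ^ 3 + 1/8 * t ^ 7 * m ^ 2 * A
       + 3/16 * t ^ 7 * m ^ 3 * A + 3/8 * t ^ 7 * m ^ 3 * A ^ 2 + 33/128 * t ^ 7 * m ^ 4 * A ^ 2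
       + 31/256 * t ^ 7 * m ^ 5 * A ^ 2 + 1/4 * t ^ 7 * m ^ 5 * A ^ 3 + 13/128 * t ^ 7 * m ^ 6 * A ^ 3
       + 11/64 * t ^ 8 * m ^ 4 * A ^ 2 + 31/256 * t ^ 8 * m ^ 6 * A ^ 3"
    by algebra
  also have "0 \<le> \<dots>"
    using assms by (intro add_nonneg_nonneg mult_nonneg_nonneg zero_le_power) auto
  finally show ?thesis unfolding diff_ge_0_iff_ge .
qed

text \<open>\<open>b\<close>, \<open>e\<close> and \<open>\<rho>\<close> are linear in
  \<open>a1\<close> to \<open>a8\<close> and \<open>p\<close>, hence so is the total; its
  coefficients are polynomials in \<open>t\<close>, \<open>m\<close> and \<open>A\<close>.\<close>

lemma growth_expand:
  fixes t m A p a1 a2 a3 a4 a5 a6 a7 a8 b e \<rho> :: real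
  assumes "M = m ^ 2" "b = a1 + t * a2 + t * p" "e = p + A * M * t / 4 * b"
    "\<rho> = a6 + 2 * a8 + t / 4 * a7 + t * a3 + A * M * t / 4 * (2 + t) * a5 + A * b * m"
  shows "b + (a2 + e) + (a3 + A * M * t / 4 * a5 + A * e * m) + a4
    + ((1 + 3/2 * t + t\<^sup>2 / 2) * a5 + (t / 2 + t\<^sup>2 / 2) * \<rho>)
    + ((2 + t + t\<^sup>2 / 2) * a5 + (1 + t\<^sup>2 / 2) * \<rho>)
    + (a7 + t / 2 * (A * M * a5 + A * a4 * m))
    + (a8 + t / 4 * a7 + t / 2 * a3 + A * M * t / 4 * (1 + t / 2) * a5
       + (A * (1 + t / 2) * e + A * (2 + t / 2) * (a2 + e)) * m)
    = (1 + m * A + 1/2 * t * m * A + 1/4 * t * m ^ 2 * A + t * m ^ 3 * A ^ 2 + t ^ 2 * m * A + 1/4 * t ^ 2 * m ^ 3 * A ^ 2) * a1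
     + (1 + 2 * m * A + t + 3/2 * t * m * A + 1/2 * t ^ 2 * m * A + 1/4 * t ^ 2 * m ^ 2 * A + t ^ 2 * m ^ 3 * A ^ 2 + t ^ 3 * m * A + 1/4 * t ^ 3 * m ^ 3 * A ^ 2) * a2
     + (1 + 3/2 * t + 1/2 * t ^ 2 + t ^ 3) * a3
     + (1 + 1/2 * t * m * A) * a4
     + (3 + 5/2 * t + 3/2 * t * m ^ 2 * A + t ^ 2 + 5/8 * t ^ 2 * m ^ 2 * A + 5/8 * t ^ 3 * m ^ 2 * A + 1/4 * t ^ 4 * m ^ 2 * A) * a5
     + (1 + 1/2 * t + t ^ 2) * a6
     + (1 + 1/2 * t + 1/8 * t ^ 2 + 1/4 * t ^ 3) * a7
     + (3 + t + 2 * t ^ 2) * a8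
     + (1 + 4 * m * A + t + 2 * t * m * A + 1/2 * t ^ 2 * m * A + 1/4 * t ^ 2 * m ^ 2 * A
       + t ^ 2 * m ^ 3 * A ^ 2 + t ^ 3 * m * A + 1/4 * t ^ 3 * m ^ 3 * A ^ 2) * p"
  unfolding assms(4) assms(3) assms(2) assms(1) by (simp add: field_simps power2_eq_square eval_nat_numeral)

lemma source_expand:
  fixes t m A a3 a4 a5 a6 a7 a8 :: real
  assumes "M = m ^ 2"
  shows "((t + t ^ 3 / 4) * a4 + m * ((1 + t\<^sup>2 / 4) * ((2 + t) * a5 + t * a6 + 2 * t * a8 + t\<^sup>2 / 4 * a7 + t\<^sup>2 * a3
      + A * M * t\<^sup>2 / 4 * (2 + t) * a5) + t * a5)) / 4 = (1/4 * t ^ 2 * m + 1/16 * t ^ 4 * m) * a3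
     + (1/4 * t + 1/16 * t ^ 3) * a4
     + (1/2 * m + 1/2 * t * m + 1/8 * t ^ 2 * m + 1/8 * t ^ 2 * m ^ 3 * A + 1/16 * t ^ 3 * m + 1/16 * t ^ 3 * m ^ 3 * A + 1/32 * t ^ 4 * m ^ 3 * A + 1/64 * t ^ 5 * m ^ 3 * A) * a5
     + (1/4 * t * m + 1/16 * t ^ 3 * m) * a6
     + (1/16 * t ^ 2 * m + 1/64 * t ^ 4 * m) * a7
     + (1/2 * t * m + 1/8 * t ^ 3 * m) * a8"
  unfolding assms by (simp add: field_simps power2_eq_square eval_nat_numeral)

text \<open>The summands \<open>2 t\<close>, \<open>A sqrt M t\<close>, \<open>sqrt M t / 2\<close>
  and \<open>A M t\<close> of \<open>t * Cbar \<alpha> M t\<close> each give one Taylor factor, of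
  second order for \<open>2 t\<close>. The summand \<open>A M t^2 / 4\<close> pays for the Gronwall
  factor.\<close>

lemma exp_Cbar_ge:
  assumes "0 \<le> t" "0 \<le> m" "0 \<le> dnorm \<alpha>" "m = sqrt M" "M = m ^ 2" "A = dnorm \<alpha>"
  shows "exp (A * M * t\<^sup>2 / 4) * ((1 + 2 * t + 2 * t ^ 2) * (1 + t * m * A) * (1 + 1/2 * t * m) * (1 + t * m ^ 2 * A))
     \<le> exp (t * Cbar \<alpha> M t)"
proof -
  have A: "0 \<le> A" using assms(3,6) by simp
  have 2: "1 + 2 * t + 2 * t ^ 2 \<le> exp (2 * t)"
    using exp_lower_Taylor_quadratic[of "2 * t"] assms(1) by (simp add: power2_eq_square)
  have "(1 + 2 * t + 2 * t ^ 2) * (1 + t * m * A) * (1 + 1/2 * t * m) * (1 + t * m ^ 2 * A)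
     \<le> exp (2 * t) * exp (t * m * A) * exp (1/2 * t * m) * exp (t * m ^ 2 * A)"
    using assms(1,2) A 2 exp_ge_add_one_self
    by (intro mult_mono mult_nonneg_nonneg add_nonneg_nonneg) auto
  then have "exp (A * M * t\<^sup>2 / 4) * ((1 + 2 * t + 2 * t ^ 2) * (1 + t * m * A) * (1 + 1/2 * t * m) * (1 + t * m ^ 2 * A))
     \<le> exp (A * M * t\<^sup>2 / 4) * (exp (2 * t) * exp (t * m * A) * exp (1/2 * t * m) * exp (t * m ^ 2 * A))"
    by (rule mult_left_mono) simp
  also have "\<dots> = exp (A * M * t\<^sup>2 / 4 + (2 * t + t * m * A + 1/2 * t * m + t * m ^ 2 * A))"
    by (simp add: exp_add)
  also have "\<dots> \<le> exp (t * Cbar \<alpha> M t)"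
  proof (subst exp_le_cancel_iff)
    have "t * Cbar \<alpha> M t = A * M * t\<^sup>2 / 4 + (2 * t + t * m * A + 1/2 * t * m + t * m ^ 2 * A)
        + (t ^ 2 * m / 8 + t ^ 3 * m / 16 + A * M * t ^ 3 / 8)"
      unfolding Cbar_def assms(6)[symmetric] assms(4)[symmetric] using assms(5)
      by (simp add: power2_eq_square power3_eq_cube algebra_simps)
    moreover have "0 \<le> t ^ 2 * m / 8 + t ^ 3 * m / 16 + A * M * t ^ 3 / 8"
      using assms(1,2,5) A by (intro add_nonneg_nonneg divide_nonneg_nonneg mult_nonneg_nonneg) auto
    ultimately show "A * M * t\<^sup>2 / 4 + (2 * t + t * m * A + 1/2 * t * m + t * m ^ 2 * A) \<le> t * Cbar \<alpha> M t" by linarith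
  qed
  finally show ?thesis .
qed

text \<open>The left side collects the summands that form the first factor on the right of
  \<open>constants_polynomial_bound\<close>; what remains of \<open>Ctilde\<close> is
  nonnegative.\<close>

lemma Ctilde_ge:
  assumes "0 \<le> t" "0 \<le> m" "0 \<le> dnorm \<alpha>" "m = sqrt M" "M = m ^ 2" "A = dnorm \<alpha>"
  shows "3 + m + 5 * m * A + 3 * m ^ 2 * A + 3/2 * t + 3/16 * t ^ 3 + 1/8 * t ^ 3 * m ^ 2 * A \<le> Ctilde \<alpha> M t"
proof -
  have "Ctilde \<alpha> M t = 3 + m + 5 * m * A + 3 * m ^ 2 * A + 3/2 * t + 3/16 * t ^ 3 + 1/8 * t ^ 3 * m ^ 2 * A
     + (1/2 * t ^ 2 + m * (1/4 * t + 1/4 * t ^ 2 + 1/16 * t ^ 3) + A * m * (2 * t + t ^ 2 + 3/8 * t ^ 3)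
       + A * m ^ 2 * (5/4 * t + 1/2 * t ^ 2))"
    unfolding Ctilde_def assms(6)[symmetric] assms(4)[symmetric] using assms(5) by (simp add: algebra_simps)
  moreover have "0 \<le> 1/2 * t ^ 2 + m * (1/4 * t + 1/4 * t ^ 2 + 1/16 * t ^ 3) + A * m * (2 * t + t ^ 2 + 3/8 * t ^ 3)
       + A * m ^ 2 * (5/4 * t + 1/2 * t ^ 2)"
    using assms(1-3) unfolding assms(6) by (intro add_nonneg_nonneg mult_nonneg_nonneg) auto
  ultimately show ?thesis by linarith
qed

section \<open>Growth of the distance between two solutions\<close>

context flow_pair_norms
begin

lemma m_eq: "m = sqrt M" "M = m ^ 2" using M_m by (simp_all add: m_def power2_eq_square)

lemma growth_constant:
  assumes t: "0 \<le> t"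
  defines "\<beta> \<equiv> (a1 + t * a2 + t * P t) * exp (A * M * t\<^sup>2 / 4)"
  defines "\<epsilon> \<equiv> E \<beta> t" and "\<rho> \<equiv> Rn \<beta> t"
  shows "\<beta> + (a2 + \<epsilon>) + (a3 + A * M * t / 4 * a5 + A * \<epsilon> * m) + a4
    + ((1 + 3/2 * t + t\<^sup>2 / 2) * a5 + (t / 2 + t\<^sup>2 / 2) * \<rho>)
    + ((2 + t + t\<^sup>2 / 2) * a5 + (1 + t\<^sup>2 / 2) * \<rho>)
    + (a7 + t / 2 * (A * M * a5 + A * a4 * m))
    + (a8 + t / 4 * a7 + t / 2 * a3 + A * M * t / 4 * (1 + t / 2) * a5
       + (A * (1 + t / 2) * \<epsilon> + A * (2 + t / 2) * (a2 + \<epsilon>)) * m)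
    \<le> Ctilde \<alpha> M t * exp (t * Cbar \<alpha> M t) * (a1 + a2 + a3 + a4 + a5 + a6 + a7 + a8)"
proof -
  \<comment> \<open>As a function of its arguments the total is linear with nonnegative
    coefficients. The Gronwall factor \<open>x >= 1\<close> can therefore be put on every argument
    and then pulled out.\<close>
  define Tot where "Tot = (\<lambda>\<beta> \<epsilon> \<rho> a2 a3 a4 a5 a7 a8. \<beta> + (a2 + \<epsilon>) + (a3 + A * M * t / 4 * a5 + A * \<epsilon> * m) + a4
    + ((1 + 3/2 * t + t\<^sup>2 / 2) * a5 + (t / 2 + t\<^sup>2 / 2) * \<rho>)
    + ((2 + t + t\<^sup>2 / 2) * a5 + (1 + t\<^sup>2 / 2) * \<rho>)
    + (a7 + t / 2 * (A * M * a5 + A * a4 * m))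
    + (a8 + t / 4 * a7 + t / 2 * a3 + A * M * t / 4 * (1 + t / 2) * a5
       + (A * (1 + t / 2) * \<epsilon> + A * (2 + t / 2) * (a2 + \<epsilon>)) * m))"
  define x where "x = exp (A * M * t\<^sup>2 / 4)"
  define b where "b = a1 + t * a2 + t * P t"
  define S where "S = a1 + a2 + a3 + a4 + a5 + a6 + a7 + a8"
  \<comment> \<open>\<open>Own\<close> dominates the coefficients of \<open>a1\<close> to
    \<open>a8\<close> outside \<open>P t\<close>, with constant term 3 because of \<open>a5\<close>
    and \<open>a8\<close>. \<open>Ph\<close> dominates the coefficients within \<open>P t\<close>,
    and \<open>cp\<close> is the coefficient of \<open>P t\<close> itself.\<close>
  define Own where "Own = 3 + 2 * m * A + 5/2 * t + 3/2 * t * m * A + 3/2 * t * m ^ 2 * A + t * m ^ 3 * A ^ 2 + 2 * t ^ 2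
       + t ^ 2 * m * A + 5/8 * t ^ 2 * m ^ 2 * A + t ^ 2 * m ^ 3 * A ^ 2 + t ^ 3 + t ^ 3 * m * A
       + 5/8 * t ^ 3 * m ^ 2 * A + 1/4 * t ^ 3 * m ^ 3 * A ^ 2 + 1/4 * t ^ 4 * m ^ 2 * A"
  define Ph where "Ph = 1/2 * m + 1/4 * t + 1/2 * t * m + 1/4 * t ^ 2 * m + 1/8 * t ^ 2 * m ^ 3 * A + 1/16 * t ^ 3
       + 1/8 * t ^ 3 * m + 1/16 * t ^ 3 * m ^ 3 * A + 1/16 * t ^ 4 * m + 1/32 * t ^ 4 * m ^ 3 * A
       + 1/64 * t ^ 5 * m ^ 3 * A"
  define cp where "cp = 1 + 4 * m * A + t + 2 * t * m * A + 1/2 * t ^ 2 * m * A + 1/4 * t ^ 2 * m ^ 2 * A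
       + t ^ 2 * m ^ 3 * A ^ 2 + t ^ 3 * m * A + 1/4 * t ^ 3 * m ^ 3 * A ^ 2"
  define L where "L = (1 + 2 * t + 2 * t ^ 2) * (1 + t * m * A) * (1 + 1/2 * t * m) * (1 + t * m ^ 2 * A)"
  note a0 = a_nonneg dh_le(2)
  have x: "1 \<le> x" unfolding x_def using AM by simp
  have b0: "0 \<le> b" unfolding b_def using a0 P_nonneg[OF t] t by simp
  have le: "c \<le> x * c" if "0 \<le> c" for c using mult_right_mono[OF x that] by simp
  have \<beta>: "\<beta> = x * b" by (simp add: \<beta>_def x_def b_def)
  have \<epsilon>: "\<epsilon> \<le> x * E b t"
    unfolding \<epsilon>_def \<beta> E_def using le[OF P_nonneg[OF t]] by (simp add: algebra_simps)
  have \<rho>: "\<rho> \<le> x * Rn b t"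
  proof -
    have "0 \<le> a6 + 2 * a8 + t / 4 * a7 + t * a3 + A * M * t / 4 * (2 + t) * a5"
      using a0 AM t by (intro add_nonneg_nonneg mult_nonneg_nonneg divide_nonneg_nonneg) auto
    from le[OF this] show ?thesis unfolding \<rho>_def \<beta> Rn_def by (simp add: algebra_simps)
  qed
  have mono: "Tot \<beta> \<epsilon> \<rho> a2 a3 a4 a5 a7 a8 \<le> Tot (x * b) (x * E b t) (x * Rn b t) (x * a2) (x * a3) (x * a4) (x * a5) (x * a7) (x * a8)"
    unfolding Tot_def using a0 AM t \<epsilon> \<rho> \<beta> le
    by (intro add_mono mult_left_mono mult_right_mono mult_nonneg_nonneg add_nonneg_nonneg divide_nonneg_nonneg) auto
  have hom: "Tot (x * b) (x * E b t) (x * Rn b t) (x * a2) (x * a3) (x * a4) (x * a5) (x * a7) (x * a8)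
     = x * Tot b (E b t) (Rn b t) a2 a3 a4 a5 a7 a8"
    unfolding Tot_def by (simp add: algebra_simps)
  have lin: "Tot b (E b t) (Rn b t) a2 a3 a4 a5 a7 a8 = (1 + m * A + 1/2 * t * m * A + 1/4 * t * m ^ 2 * A + t * m ^ 3 * A ^ 2 + t ^ 2 * m * A + 1/4 * t ^ 2 * m ^ 3 * A ^ 2) * a1
     + (1 + 2 * m * A + t + 3/2 * t * m * A + 1/2 * t ^ 2 * m * A + 1/4 * t ^ 2 * m ^ 2 * A + t ^ 2 * m ^ 3 * A ^ 2 + t ^ 3 * m * A + 1/4 * t ^ 3 * m ^ 3 * A ^ 2) * a2
     + (1 + 3/2 * t + 1/2 * t ^ 2 + t ^ 3) * a3
     + (1 + 1/2 * t * m * A) * a4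
     + (3 + 5/2 * t + 3/2 * t * m ^ 2 * A + t ^ 2 + 5/8 * t ^ 2 * m ^ 2 * A + 5/8 * t ^ 3 * m ^ 2 * A + 1/4 * t ^ 4 * m ^ 2 * A) * a5
     + (1 + 1/2 * t + t ^ 2) * a6
     + (1 + 1/2 * t + 1/8 * t ^ 2 + 1/4 * t ^ 3) * a7
     + (3 + t + 2 * t ^ 2) * a8
     + cp * P t"
    unfolding Tot_def cp_def by (rule growth_expand[OF m_eq(2) b_def E_def Rn_def])
  have mons: "0 \<le> m" "0 \<le> m * A" "0 \<le> t" "0 \<le> t * m" "0 \<le> t * m * A" "0 \<le> t * m ^ 2 * A" "0 \<le> t * m ^ 3 * A ^ 2" "0 \<le> t ^ 2" "0 \<le> t ^ 2 * m" "0 \<le> t ^ 2 * m * A" "0 \<le> t ^ 2 * m ^ 2 * A" "0 \<le> t ^ 2 * m ^ 3 * A" "0 \<le> t ^ 2 * m ^ 3 * A ^ 2" "0 \<le> t ^ 3" "0 \<le> t ^ 3 * m" "0 \<le> t ^ 3 * m * A" "0 \<le> t ^ 3 * m ^ 2 * A" "0 \<le> t ^ 3 * m ^ 3 * A" "0 \<le> t ^ 3 * m ^ 3 * A ^ 2" "0 \<le> t ^ 4 * m" "0 \<le> t ^ 4 * m ^ 2 * A" "0 \<le> t ^ 4 * m ^ 3 * A" "0 \<le> t ^ 5 * m ^ 3 * A"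
    using t AM by (auto intro!: mult_nonneg_nonneg)
  have own: "1 + m * A + 1/2 * t * m * A + 1/4 * t * m ^ 2 * A + t * m ^ 3 * A ^ 2 + t ^ 2 * m * A + 1/4 * t ^ 2 * m ^ 3 * A ^ 2 \<le> Own"
    "1 + 2 * m * A + t + 3/2 * t * m * A + 1/2 * t ^ 2 * m * A + 1/4 * t ^ 2 * m ^ 2 * A + t ^ 2 * m ^ 3 * A ^ 2 + t ^ 3 * m * A + 1/4 * t ^ 3 * m ^ 3 * A ^ 2 \<le> Own"
    "1 + 3/2 * t + 1/2 * t ^ 2 + t ^ 3 \<le> Own"
    "1 + 1/2 * t * m * A \<le> Own"
    "3 + 5/2 * t + 3/2 * t * m ^ 2 * A + t ^ 2 + 5/8 * t ^ 2 * m ^ 2 * A + 5/8 * t ^ 3 * m ^ 2 * A + 1/4 * t ^ 4 * m ^ 2 * A \<le> Own"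
    "1 + 1/2 * t + t ^ 2 \<le> Own"
    "1 + 1/2 * t + 1/8 * t ^ 2 + 1/4 * t ^ 3 \<le> Own"
    "3 + t + 2 * t ^ 2 \<le> Own"
    unfolding Own_def using mons by linarith+
  have ph: "1/4 * t ^ 2 * m + 1/16 * t ^ 4 * m \<le> Ph"
    "1/4 * t + 1/16 * t ^ 3 \<le> Ph"
    "1/2 * m + 1/2 * t * m + 1/8 * t ^ 2 * m + 1/8 * t ^ 2 * m ^ 3 * A + 1/16 * t ^ 3 * m + 1/16 * t ^ 3 * m ^ 3 * A + 1/32 * t ^ 4 * m ^ 3 * A + 1/64 * t ^ 5 * m ^ 3 * A \<le> Ph"
    "1/4 * t * m + 1/16 * t ^ 3 * m \<le> Ph"
    "1/16 * t ^ 2 * m + 1/64 * t ^ 4 * m \<le> Ph"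
    "1/2 * t * m + 1/8 * t ^ 3 * m \<le> Ph"
    unfolding Ph_def using mons by linarith+
  have ph0: "0 \<le> Ph" unfolding Ph_def using mons by linarith
  have "P t = (1/4 * t ^ 2 * m + 1/16 * t ^ 4 * m) * a3
     + (1/4 * t + 1/16 * t ^ 3) * a4
     + (1/2 * m + 1/2 * t * m + 1/8 * t ^ 2 * m + 1/8 * t ^ 2 * m ^ 3 * A + 1/16 * t ^ 3 * m + 1/16 * t ^ 3 * m ^ 3 * A + 1/32 * t ^ 4 * m ^ 3 * A + 1/64 * t ^ 5 * m ^ 3 * A) * a5
     + (1/4 * t * m + 1/16 * t ^ 3 * m) * a6
     + (1/16 * t ^ 2 * m + 1/64 * t ^ 4 * m) * a7
     + (1/2 * t * m + 1/8 * t ^ 3 * m) * a8"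
    unfolding P_def Dn_def by (rule source_expand[OF m_eq(2)])
  also have "\<dots> \<le> Ph * a3 + Ph * a4 + Ph * a5 + Ph * a6 + Ph * a7 + Ph * a8"
    by (intro add_mono mult_right_mono ph a0)
  also have "\<dots> \<le> Ph * S" unfolding S_def distrib_left using ph0 a0 by simp
  finally have PS: "P t \<le> Ph * S" .
  have cp0: "0 \<le> cp" unfolding cp_def using t AM by (intro add_nonneg_nonneg mult_nonneg_nonneg) auto
  have "Tot b (E b t) (Rn b t) a2 a3 a4 a5 a7 a8 \<le> (Own * a1 + Own * a2 + Own * a3 + Own * a4 + Own * a5 + Own * a6 + Own * a7 + Own * a8) + cp * (Ph * S)"
    unfolding lin by (intro add_mono mult_right_mono mult_left_mono own a0 PS cp0)
  also have "\<dots> = (Own + cp * Ph) * S" unfolding S_def by (simp add: algebra_simps)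
  also have "\<dots> \<le> (Ctilde \<alpha> M t * L) * S"
  proof (rule mult_right_mono)
    have d: "0 \<le> dnorm \<alpha>" using X.A_eq AM by simp
    have "Own + cp * Ph \<le> (3 + m + 5 * m * A + 3 * m ^ 2 * A + 3/2 * t + 3/16 * t ^ 3 + 1/8 * t ^ 3 * m ^ 2 * A) * L"
      unfolding Own_def cp_def Ph_def L_def by (rule constants_polynomial_bound) (use t AM in auto)
    also have "\<dots> \<le> Ctilde \<alpha> M t * L"
      unfolding L_def using Ctilde_ge[OF t AM(3) d m_eq X.A_eq] t AM
      by (intro mult_right_mono mult_nonneg_nonneg add_nonneg_nonneg) auto
    finally show "Own + cp * Ph \<le> Ctilde \<alpha> M t * L" .
    show "0 \<le> S" unfolding S_def using a0 by simp
  qed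
  finally have T: "Tot b (E b t) (Rn b t) a2 a3 a4 a5 a7 a8 \<le> (Ctilde \<alpha> M t * L) * S" .
  have d: "0 \<le> dnorm \<alpha>" using X.A_eq AM by simp
  have S0: "0 \<le> S" unfolding S_def using a0 by simp
  have C0: "0 \<le> Ctilde \<alpha> M t"
    unfolding Ctilde_def using t AM d by (intro add_nonneg_nonneg mult_nonneg_nonneg) auto
  have "Tot \<beta> \<epsilon> \<rho> a2 a3 a4 a5 a7 a8 \<le> x * ((Ctilde \<alpha> M t * L) * S)"
    using mono mult_left_mono[OF T, of x] x unfolding hom by linarith
  also have "\<dots> = Ctilde \<alpha> M t * (x * L) * S" by (simp add: algebra_simps)
  also have "\<dots> \<le> Ctilde \<alpha> M t * exp (t * Cbar \<alpha> M t) * S"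
    using exp_Cbar_ge[OF t AM(3) d m_eq X.A_eq] C0 S0 unfolding x_def L_def by (intro mult_right_mono mult_left_mono) auto
  finally show ?thesis unfolding Tot_def S_def .
qed

lemma ldist_growth_norms:
  assumes t: "0 \<le> t"
  shows "ldist \<alpha> (X.D t) (Y.D t) \<le> ennreal (Ctilde \<alpha> M t * exp (t * Cbar \<alpha> M t) * (a1 + a2 + a3 + a4 + a5 + a6 + a7 + a8))"
  using ldist_le[OF t y_diff[OF t] refl refl] growth_constant[OF t] by (meson ennreal_leI order_trans)

end

context flow_pair
begin

text \<open>An infinite distance is harmless because the constant is positive. A finite one has
  eight finite summands, which serve as \<open>a1\<close> to \<open>a8\<close>; continuity turns the
  two essential suprema into pointwise bounds.\<close>

lemma ldist_growth:
  assumes t: "0 \<le> t" and F0: "\<And>\<xi>. a' \<xi> + h' \<xi> = 1"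
  shows "ldist \<alpha> (X.D t) (Y.D t) \<le> ennreal (Ctilde \<alpha> M t * exp (t * Cbar \<alpha> M t)) * ldist \<alpha> (X.D 0) (Y.D 0)"
proof (cases "ldist \<alpha> (X.D 0) (Y.D 0) = top")
  case True
  have "3 \<le> Ctilde \<alpha> M t"
    unfolding Ctilde_def X.A_eq[symmetric] using t X.A_nonneg X.M_nonneg
    by (simp add: add_nonneg_nonneg add.assoc)
  then have "0 < Ctilde \<alpha> M t * exp (t * Cbar \<alpha> M t)" by (intro mult_pos_pos) auto
  then have "ennreal (Ctilde \<alpha> M t * exp (t * Cbar \<alpha> M t)) * top = top"
    by (intro ennreal_top_mult_left) (simp only: ennreal_eq_0_iff not_le)
  then show ?thesis unfolding True by simp
next
  case False
  let ?l1 = "Linf_norm (\<lambda>\<xi>. y0 \<xi> - y0' \<xi>)" and ?l2 = "Linf_norm (\<lambda>\<xi>. U0 \<xi> - U0' \<xi>)"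
    and ?l3 = "ennreal A * L2_norm (\<lambda>\<xi>. U0 \<xi> * h \<xi> - U0' \<xi> * h' \<xi>)" and ?l4 = "L1_norm (\<lambda>\<xi>. h \<xi> - h' \<xi>)"
    and ?l5 = "L2_norm z" and ?l6 = "L2_norm G" and ?l7 = "L2_norm G2" and ?l8 = "L2_norm G3"
  have d0: "X.y\<xi> 0 = a" "X.U\<xi> 0 = b" "Y.y\<xi> 0 = a'" "Y.U\<xi> 0 = b'"
    by (simp_all add: fun_eq_iff X.y\<xi>_def Y.y\<xi>_def X.U\<xi>_def Y.U\<xi>_def X.k_0 Y.k_0)
  have sum: "ldist \<alpha> (X.D 0) (Y.D 0) = ?l1 + ?l2 + ?l3 + ?l4 + ?l5 + ?l6 + ?l7 + ?l8"
  proof -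
    have D0: "X.D 0 = (y0, U0, a, b, h, r, X.v 0, LINT \<xi>|lborel. h \<xi>)"
      "Y.D 0 = (y0', U0', a', b', h', r', Y.v 0, LINT \<xi>|lborel. h' \<xi>)"
      by (simp_all add: X.D_def Y.D_def d0 X.y0_eq X.U0_eq Y.y0_eq Y.U0_eq)
    have "L2_norm z = sqrt_e (\<integral>\<^sup>+ \<xi>. ennreal ((a \<xi> - a' \<xi>)\<^sup>2 + (b \<xi> - b' \<xi>)\<^sup>2 + (h \<xi> - h' \<xi>)\<^sup>2 + (r \<xi> - r' \<xi>)\<^sup>2) \<partial>lborel)"
      by (simp add: L2_norm_def z_def del: ennreal_plus)
    moreover have "L2_norm G = L2_norm (\<lambda>\<xi>. ldata_g \<alpha> (X.D 0) \<xi> - ldata_g \<alpha> (Y.D 0) \<xi>)"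
      "L2_norm G2 = L2_norm (\<lambda>\<xi>. ldata_g2 \<alpha> (X.D 0) \<xi> - ldata_g2 \<alpha> (Y.D 0) \<xi>)"
      "L2_norm G3 = L2_norm (\<lambda>\<xi>. ldata_g3 \<alpha> (X.D 0) \<xi> - ldata_g3 \<alpha> (Y.D 0) \<xi>)"
      by (simp_all add: L2_norm_def G_def G2_def G3_def)
    ultimately show ?thesis unfolding X.A_eq by (simp only: ldist_def D0 prod.case)
  qed
  obtain a1 a2 a3 a4 a5 a6 a7 a8 where e: "?l1 = ennreal a1" "?l2 = ennreal a2" "?l3 = ennreal a3" "?l4 = ennreal a4"
    "?l5 = ennreal a5" "?l6 = ennreal a6" "?l7 = ennreal a7" "?l8 = ennreal a8"
    and nn: "0 \<le> a1" "0 \<le> a2" "0 \<le> a3" "0 \<le> a4" "0 \<le> a5" "0 \<le> a6" "0 \<le> a7" "0 \<le> a8"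
  proof -
    have f: "?l1 < top" "?l2 < top" "?l3 < top" "?l4 < top" "?l5 < top" "?l6 < top" "?l7 < top" "?l8 < top"
      using False unfolding sum by (auto simp: less_top[symmetric])
    have r: "\<exists>c. l = ennreal c \<and> 0 \<le> c" if "l < top" for l :: ennreal
      using that by (cases l) auto
    show thesis using that f[THEN r] by blast
  qed
  have [measurable]: "z \<in> borel_measurable borel" unfolding z_def[abs_def] by measurable
  note [measurable] = ldata_g_meas[OF X.D_meas[OF order_refl] X.\<alpha>_meas] ldata_g_meas[OF Y.D_meas[OF order_refl] X.\<alpha>_meas]
  have [measurable]: "G \<in> borel_measurable borel" "G2 \<in> borel_measurable borel" "G3 \<in> borel_measurable borel"
    unfolding G_def[abs_def] G2_def[abs_def] G3_def[abs_def] by measurable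
  have wl: "L2_norm w = ?l3"
    using L2_norm_cmult[OF X.A_nonneg, of "\<lambda>\<xi>. U0 \<xi> * h \<xi> - U0' \<xi> * h' \<xi>"]
    by (simp add: L2_norm_def w_def power_mult_distrib)
  have [measurable]: "w \<in> borel_measurable borel" unfolding w_def[abs_def] by measurable
  interpret N: flow_pair_norms \<alpha> A M y0 U0 a b h r \<phi> y0' U0' a' b' h' r' \<phi>' a1 a2 a3 a4 a5 a6 a7 a8
  proof (unfold_locales, goal_cases)
    case 1 show ?case by (rule F0)
  next
    case 2 show ?case
      by (rule Linf_norm_bound[of "\<lambda>\<xi>. y0 \<xi> - y0' \<xi>"])
        (use e nn X.deriv0 Y.deriv0 has_weak_deriv_continuous in \<open>auto intro!: continuous_on_diff\<close>)
  next
    case 3 show ?case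
      by (rule Linf_norm_bound[of "\<lambda>\<xi>. U0 \<xi> - U0' \<xi>"])
        (use e nn X.deriv0 Y.deriv0 has_weak_deriv_continuous in \<open>auto intro!: continuous_on_diff\<close>)
  qed (use e nn wl in \<open>auto intro!: L2le_norm_eq simp: dh_def L1_norm_def\<close>)
  have "ldist \<alpha> (X.D 0) (Y.D 0) = ennreal (a1 + a2 + a3 + a4 + a5 + a6 + a7 + a8)"
    unfolding sum e using nn by (simp add: ennreal_plus)
  moreover have "0 \<le> Ctilde \<alpha> M t * exp (t * Cbar \<alpha> M t)"
    unfolding Ctilde_def X.A_eq[symmetric] using t X.A_nonneg X.M_nonneg
    by (intro add_nonneg_nonneg mult_nonneg_nonneg) auto
  then have "ennreal (Ctilde \<alpha> M t * exp (t * Cbar \<alpha> M t) * (a1 + a2 + a3 + a4 + a5 + a6 + a7 + a8))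
      = ennreal (Ctilde \<alpha> M t * exp (t * Cbar \<alpha> M t)) * ennreal (a1 + a2 + a3 + a4 + a5 + a6 + a7 + a8)"
    by (rule ennreal_mult) (use nn in auto)
  ultimately show ?thesis using N.ldist_growth_norms[OF t] by (simp only:)
qed

end

section \<open>Existence and uniqueness of the flow\<close>

lemma breaking_flow_change:
  assumes "breaking_flow \<alpha> A M y0 U0 a b h r \<phi>" "\<psi> \<in> borel_measurable borel"
    "\<And>\<xi>. 0 \<le> \<psi> \<xi>" "\<And>\<xi>. \<psi> \<xi> \<le> 1"
  shows "breaking_flow \<alpha> A M y0 U0 a b h r \<psi>"
  using assms unfolding breaking_flow_def by blast

context breaking_flow
begin

text \<open>The label enters both as the point and through the time, so joint measurability of the
  integrand in \<open>(\<xi>, \<eta>)\<close> is used.\<close>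

lemma y_compose_meas:
  assumes [measurable]: "T \<in> borel_measurable borel"
  shows "(\<lambda>\<xi>. y (T \<xi>) \<xi>) \<in> borel_measurable borel"
proof -
  have "(\<lambda>x. kap (fst x) (snd x) * kk (T (fst x)) (snd x)) \<in> borel_measurable (borel \<Otimes>\<^sub>M lborel)"
    unfolding kap_def kk_def \<theta>_def by measurable
  then have [measurable]: "(\<lambda>\<xi>. LINT \<eta>|lborel. kap \<xi> \<eta> * kk (T \<xi>) \<eta>) \<in> borel_measurable borel"
    using lborel.borel_measurable_lebesgue_integral[of "\<lambda>\<xi> \<eta>. kap \<xi> \<eta> * kk (T \<xi>) \<eta>" borel] by (simp add: split_beta')
  show ?thesis unfolding y_def by measurable
qed

text \<open>Chosen so that \<open>A M / (4 lam^2) <= 1/2\<close>, the contraction factor; adding 1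
  keeps it positive when \<open>A M = 0\<close>.\<close>

definition "lam = sqrt (A * M / 2) + 1"

lemma lam: "0 < lam" "A * M \<le> 2 * lam\<^sup>2"
proof -
  have s: "0 \<le> sqrt (A * M / 2)" "(sqrt (A * M / 2))\<^sup>2 = A * M / 2" using A_nonneg M_nonneg by auto
  then show "0 < lam" unfolding lam_def by linarith
  have "(sqrt (A * M / 2))\<^sup>2 \<le> lam\<^sup>2" using s by (intro power_mono) (auto simp: lam_def)
  then show "A * M \<le> 2 * lam\<^sup>2" using s by simp
qed

text \<open>The fixed-point equation for the energy loss is a contraction in the sup norm with weight
  \<open>e\<^bsup>-lam \<tau>\<^esup>\<close>, since \<open>\<theta>\<^sup>2/2 \<le> e\<^bsup>lam \<theta>\<^esup>/lam\<^sup>2\<close>.\<close>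

lemma y_contraction:
  assumes \<psi>: "breaking_flow \<alpha> A M y0 U0 a b h r \<psi>" and c: "0 \<le> c"
    and d: "\<And>\<xi>. B \<xi> \<Longrightarrow> \<bar>\<phi> \<xi> - \<psi> \<xi>\<bar> \<le> c * exp (lam * \<tau> \<xi>)" and t: "0 \<le> t"
  shows "A * \<bar>y t \<xi> - breaking_flow.y y0 U0 a b h r \<psi> t \<xi>\<bar> \<le> c / 2 * exp (lam * t)"
proof -
  interpret F: breaking_flow \<alpha> A M y0 U0 a b h r \<psi> by (rule \<psi>)
  let ?C = "c * exp (lam * t) / lam\<^sup>2"
  have kd: "\<bar>kk t \<eta> - F.kk t \<eta>\<bar> \<le> ?C * h \<eta>" for \<eta>
  proof (cases "B \<eta> \<and> \<tau> \<eta> \<le> t")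
    case True
    have \<theta>: "\<theta> t \<eta> = t - \<tau> \<eta>" "0 \<le> t - \<tau> \<eta>" using True by (auto simp: \<theta>_def)
    have "(lam * (t - \<tau> \<eta>))\<^sup>2 / 2 \<le> exp (lam * (t - \<tau> \<eta>))"
      using exp_lower_Taylor_quadratic[of "lam * (t - \<tau> \<eta>)"] \<theta>(2) lam(1) mult_nonneg_nonneg[of lam "t - \<tau> \<eta>"] by linarith
    then have "lam\<^sup>2 * ((t - \<tau> \<eta>)\<^sup>2 / 2) \<le> exp (lam * (t - \<tau> \<eta>))" by (simp only: power_mult_distrib times_divide_eq_right)
    then have 1: "(t - \<tau> \<eta>)\<^sup>2 / 2 \<le> exp (lam * (t - \<tau> \<eta>)) / lam\<^sup>2"
      using lam(1) by (simp add: pos_le_divide_eq mult.commute)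
    have "\<bar>kk t \<eta> - F.kk t \<eta>\<bar> = \<bar>h \<eta> * ((t - \<tau> \<eta>)\<^sup>2 / 2 * (\<psi> \<eta> - \<phi> \<eta>))\<bar>"
      unfolding kk_def F.kk_def \<theta>(1) by (rule arg_cong[where f=abs]) (simp add: algebra_simps)
    also have "\<dots> = h \<eta> * ((t - \<tau> \<eta>)\<^sup>2 / 2 * \<bar>\<phi> \<eta> - \<psi> \<eta>\<bar>)"
      using nonneg(2)[of \<eta>] by (simp add: abs_mult abs_minus_commute)
    also have "\<dots> \<le> h \<eta> * (exp (lam * (t - \<tau> \<eta>)) / lam\<^sup>2 * (c * exp (lam * \<tau> \<eta>)))"
      using nonneg(2)[of \<eta>] 1 d True by (intro mult_left_mono mult_mono) auto
    also have "\<dots> = ?C * h \<eta>"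
      by (simp add: exp_diff right_diff_distrib)
    finally show ?thesis .
  next
    case False
    then have "kk t \<eta> = F.kk t \<eta>" by (auto simp: kk_def F.kk_def \<theta>_def)
    then show ?thesis using c nonneg(2)[of \<eta>] by simp
  qed
  have i: "integrable lborel (\<lambda>\<eta>. kk t \<eta> - F.kk t \<eta>)" using k_int(2)[OF t] F.k_int(2)[OF t] by simp
  have "y t \<xi> - F.y t \<xi> = (LINT \<eta>|lborel. kap \<xi> \<eta> * (kk t \<eta> - F.kk t \<eta>))"
    unfolding y_def F.y_def using k_int(2)[OF t] F.k_int(2)[OF t] by (simp add: right_diff_distrib integrable_kap)
  then have "\<bar>y t \<xi> - F.y t \<xi>\<bar> \<le> (LINT \<eta>|lborel. \<bar>kk t \<eta> - F.kk t \<eta>\<bar>) / 4" using integral_kap_le[OF i] by simp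
  also have "(LINT \<eta>|lborel. \<bar>kk t \<eta> - F.kk t \<eta>\<bar>) \<le> (LINT \<eta>|lborel. ?C * h \<eta>)"
    using kd i h_int by (intro integral_mono) auto
  also have "\<dots> \<le> ?C * M" using h_le c by (simp add: mult_left_mono divide_right_mono)
  finally have "A * \<bar>y t \<xi> - F.y t \<xi>\<bar> \<le> A * (?C * M / 4)" using A_nonneg by (intro mult_left_mono) auto
  also have "\<dots> = c * exp (lam * t) * (A * M / (4 * lam\<^sup>2))" by (simp add: ac_simps)
  also have "\<dots> \<le> c * exp (lam * t) * (1 / 2)"
    using lam c by (intro mult_left_mono) (auto simp: field_simps)
  finally show ?thesis by simp
qed

definition step :: "(real \<Rightarrow> real) \<Rightarrow> real \<Rightarrow> real" where
  "step \<psi> \<xi> = (if B \<xi> then \<alpha> (breaking_flow.y y0 U0 a b h r \<psi> (\<tau> \<xi>) \<xi>) else 0)"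

lemma step_flow:
  assumes "breaking_flow \<alpha> A M y0 U0 a b h r \<psi>"
  shows "breaking_flow \<alpha> A M y0 U0 a b h r (step \<psi>)"
proof (rule breaking_flow_change[OF assms])
  interpret F: breaking_flow \<alpha> A M y0 U0 a b h r \<psi> by (rule assms)
  note [measurable] = F.y_compose_meas[OF \<tau>_meas]
  show "step \<psi> \<in> borel_measurable borel" unfolding step_def[abs_def] by measurable
qed (auto simp: step_def \<alpha>_range)

lemma step_contraction:
  assumes \<psi>: "breaking_flow \<alpha> A M y0 U0 a b h r \<psi>" and \<zeta>: "breaking_flow \<alpha> A M y0 U0 a b h r \<zeta>" and c: "0 \<le> c"
    and d: "\<And>\<xi>. B \<xi> \<Longrightarrow> \<bar>\<psi> \<xi> - \<zeta> \<xi>\<bar> \<le> c * exp (lam * \<tau> \<xi>)"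
  shows "\<bar>step \<psi> \<xi> - step \<zeta> \<xi>\<bar> \<le> c / 2 * exp (lam * \<tau> \<xi>)"
proof (cases "B \<xi>")
  case True
  interpret F: breaking_flow \<alpha> A M y0 U0 a b h r \<psi> by (rule \<psi>)
  have "\<bar>step \<psi> \<xi> - step \<zeta> \<xi>\<bar> \<le> A * \<bar>F.y (\<tau> \<xi>) \<xi> - breaking_flow.y y0 U0 a b h r \<zeta> (\<tau> \<xi>) \<xi>\<bar>"
    using True by (simp add: step_def \<alpha>_lip)
  also have "\<dots> \<le> c / 2 * exp (lam * \<tau> \<xi>)"
    using d B_facts(6)[OF True] by (intro F.y_contraction[OF \<zeta> c, unfolded F.lam_def, folded lam_def]) auto
  finally show ?thesis .
qed (use c in \<open>simp add: step_def\<close>)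

text \<open>Picard iteration from zero loss. The weight \<open>exp (lam \<tau>)\<close> is finite at
  each label but need not be bounded, so convergence is taken pointwise, which keeps the limit
  measurable; \<open>near\<close> then shows that \<open>step\<close> fixes it on
  \<open>B\<close>.\<close>

lemma exists_solution:
  assumes "A = dnorm \<alpha>"
  shows "\<exists>\<psi>. breaking_solution \<alpha> A M y0 U0 a b h r \<psi>"
proof -
  define \<Phi> where "\<Phi> n = (step ^^ n) (\<lambda>_. 0)" for n
  have \<Phi>S: "\<Phi> (Suc n) = step (\<Phi> n)" for n by (simp add: \<Phi>_def)
  have fl: "breaking_flow \<alpha> A M y0 U0 a b h r (\<Phi> n)" for n
  proof (induction n)
    case 0 show ?case by (rule breaking_flow_change[OF breaking_flow_axioms]) (auto simp: \<Phi>_def)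
  qed (simp add: \<Phi>S step_flow)
  have rng: "0 \<le> \<Phi> n \<xi>" "\<Phi> n \<xi> \<le> 1" for n \<xi> using fl[of n] unfolding breaking_flow_def by auto
  have [measurable]: "\<Phi> n \<in> borel_measurable borel" for n using fl[of n] unfolding breaking_flow_def by auto
  have d: "\<bar>\<Phi> (Suc n) \<xi> - \<Phi> n \<xi>\<bar> \<le> (1/2) ^ n * exp (lam * \<tau> \<xi>)" if "B \<xi>" for n \<xi>
    using that
  proof (induction n arbitrary: \<xi>)
    case 0
    have "1 \<le> exp (lam * \<tau> \<xi>)" using B_facts(6)[OF 0] lam by simp
    then have "\<bar>\<Phi> (Suc 0) \<xi> - \<Phi> 0 \<xi>\<bar> \<le> exp (lam * \<tau> \<xi>)"
      using rng[of 0 \<xi>] rng[of "Suc 0" \<xi>] by linarith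
    then show ?case by simp
  next
    case (Suc n)
    show ?case using step_contraction[OF fl[of "Suc n"] fl[of n], of "(1/2) ^ n" \<xi>] Suc.IH by (simp add: \<Phi>S)
  qed
  have dm: "\<bar>\<Phi> (n + j) \<xi> - \<Phi> n \<xi>\<bar> \<le> 2 * (1/2) ^ n * (1 - (1/2) ^ j) * exp (lam * \<tau> \<xi>)" if "B \<xi>" for n j \<xi>
  proof (induction j)
    case (Suc j)
    have "\<bar>\<Phi> (n + Suc j) \<xi> - \<Phi> n \<xi>\<bar> \<le> (1/2) ^ (n + j) * exp (lam * \<tau> \<xi>) + 2 * (1/2) ^ n * (1 - (1/2) ^ j) * exp (lam * \<tau> \<xi>)"
      using Suc d[OF that, of "n + j"] by simp
    also have "\<dots> = 2 * (1/2) ^ n * (1 - (1/2) ^ Suc j) * exp (lam * \<tau> \<xi>)" by (simp add: power_add algebra_simps)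
    finally show ?case .
  qed simp
  have dm2: "\<bar>\<Phi> (n + j) \<xi> - \<Phi> n \<xi>\<bar> \<le> 2 * (1/2) ^ n * exp (lam * \<tau> \<xi>)" if "B \<xi>" for n j \<xi>
  proof -
    have "2 * (1/2) ^ n * (1 - (1/2) ^ j) * exp (lam * \<tau> \<xi>) \<le> 2 * (1/2) ^ n * 1 * exp (lam * \<tau> \<xi>)"
      by (intro mult_right_mono mult_left_mono) auto
    then show ?thesis using dm[OF that, of n j] by linarith
  qed
  have conv: "convergent (\<lambda>n. \<Phi> n \<xi>)" if "B \<xi>" for \<xi>
  proof -
    have "summable (\<lambda>n. \<Phi> (Suc n) \<xi> - \<Phi> n \<xi>)"
    proof (rule summable_comparison_test')
      show "summable (\<lambda>n. (1/2) ^ n * exp (lam * \<tau> \<xi>))" by (intro summable_mult2 summable_geometric) auto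
      show "norm (\<Phi> (Suc n) \<xi> - \<Phi> n \<xi>) \<le> (1/2) ^ n * exp (lam * \<tau> \<xi>)" if "0 \<le> n" for n using d[OF \<open>B \<xi>\<close>] by simp
    qed
    then have "convergent (\<lambda>n. \<Sum>k<n. \<Phi> (Suc k) \<xi> - \<Phi> k \<xi>)" by (simp add: summable_iff_convergent)
    moreover have "(\<Sum>k<n. \<Phi> (Suc k) \<xi> - \<Phi> k \<xi>) = \<Phi> n \<xi> - \<Phi> 0 \<xi>" for n
      by (rule sum_lessThan_telescope)
    ultimately have "convergent (\<lambda>n. \<Phi> n \<xi> - \<Phi> 0 \<xi>)" by simp
    then show ?thesis using convergent_diff_const_right_iff by blast
  qed
  define \<psi> where "\<psi> \<xi> = (if B \<xi> then lim (\<lambda>n. \<Phi> n \<xi>) else 0)" for \<xi>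
  have lim: "(\<lambda>n. \<Phi> n \<xi>) \<longlonglongrightarrow> \<psi> \<xi>" if "B \<xi>" for \<xi>
    using conv[OF that] that by (simp add: \<psi>_def convergent_LIMSEQ_iff)
  have [measurable]: "\<psi> \<in> borel_measurable borel" unfolding \<psi>_def[abs_def] by measurable
  have \<psi>r: "0 \<le> \<psi> \<xi>" "\<psi> \<xi> \<le> 1" for \<xi>
  proof -
    show "0 \<le> \<psi> \<xi>"
      using LIMSEQ_le_const[OF lim, of \<xi> 0] rng by (cases "B \<xi>") (auto simp: \<psi>_def)
    show "\<psi> \<xi> \<le> 1"
      using LIMSEQ_le_const2[OF lim, of \<xi> 1] rng by (cases "B \<xi>") (auto simp: \<psi>_def)
  qed
  interpret F: breaking_flow \<alpha> A M y0 U0 a b h r \<psi>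
    by (rule breaking_flow_change[OF breaking_flow_axioms]) (use \<psi>r in auto)
  have near: "\<bar>\<psi> \<xi> - \<Phi> n \<xi>\<bar> \<le> 2 * (1/2) ^ n * exp (lam * \<tau> \<xi>)" if "B \<xi>" for n \<xi>
  proof (rule LIMSEQ_le_const2)
    show "(\<lambda>j. \<bar>\<Phi> (n + j) \<xi> - \<Phi> n \<xi>\<bar>) \<longlonglongrightarrow> \<bar>\<psi> \<xi> - \<Phi> n \<xi>\<bar>"
      using LIMSEQ_ignore_initial_segment[OF lim[OF that], of n] by (intro tendsto_intros) (simp add: add.commute)
  qed (use dm2[OF that] in auto)
  have fix_eq: "\<psi> \<xi> = step \<psi> \<xi>" if "B \<xi>" for \<xi>
  proof -
    have "(\<lambda>n. \<Phi> (Suc n) \<xi>) \<longlonglongrightarrow> step \<psi> \<xi>"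
    proof (rule LIMSEQ_I)
      have b: "\<bar>step \<psi> \<xi> - \<Phi> (Suc n) \<xi>\<bar> \<le> (1/2) ^ n * exp (lam * \<tau> \<xi>)" for n
        using step_contraction[OF F.breaking_flow_axioms fl[of n], of "2 * (1/2) ^ n" \<xi>] near by (simp add: \<Phi>S)
      have z: "(\<lambda>n. (1/2) ^ n * exp (lam * \<tau> \<xi>)) \<longlonglongrightarrow> 0 * exp (lam * \<tau> \<xi>)"
        by (intro tendsto_intros LIMSEQ_realpow_zero) auto
      fix e :: real assume "0 < e"
      then obtain N where N: "\<And>n. n \<ge> N \<Longrightarrow> (1/2) ^ n * exp (lam * \<tau> \<xi>) < e"
        using LIMSEQ_D[OF z, of e] by auto
      show "\<exists>no. \<forall>n\<ge>no. norm (\<Phi> (Suc n) \<xi> - step \<psi> \<xi>) < e"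
      proof (intro exI[of _ N] allI impI)
        fix n assume "N \<le> n"
        then show "norm (\<Phi> (Suc n) \<xi> - step \<psi> \<xi>) < e"
          using N[of n] b[of n] by (simp add: abs_minus_commute)
      qed
    qed
    moreover have "(\<lambda>n. \<Phi> (Suc n) \<xi>) \<longlonglongrightarrow> \<psi> \<xi>" using lim[OF that] by (rule LIMSEQ_Suc)
    ultimately show ?thesis using LIMSEQ_unique by blast
  qed
  have "breaking_solution \<alpha> A M y0 U0 a b h r \<psi>"
    by unfold_locales (use assms fix_eq in \<open>auto simp: step_def\<close>)
  then show ?thesis by blast
qed

end

text \<open>Two fixed points differ by at most \<open>2^(-n) exp (lam \<tau>)\<close> for every
  \<open>n\<close>, so they agree on \<open>B\<close>, which determines \<open>k\<close> and
  \<open>kk\<close>.\<close>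

lemma breaking_solution_unique:
  assumes "breaking_solution \<alpha> A M y0 U0 a b h r \<phi>" "breaking_solution \<alpha> A M y0 U0 a b h r \<psi>" "0 \<le> t"
  shows "breaking_flow.y y0 U0 a b h r \<phi> t \<xi> = breaking_flow.y y0 U0 a b h r \<psi> t \<xi>"
    "breaking_flow.U U0 a b h r \<phi> t \<xi> = breaking_flow.U U0 a b h r \<psi> t \<xi>"
proof -
  interpret X: breaking_solution \<alpha> A M y0 U0 a b h r \<phi> by (rule assms)
  interpret Y: breaking_solution \<alpha> A M y0 U0 a b h r \<psi> by (rule assms)
  have d: "\<bar>\<phi> \<xi> - \<psi> \<xi>\<bar> \<le> (1/2) ^ n * exp (X.lam * X.\<tau> \<xi>)" if "X.B \<xi>" for n \<xi>
    using that
  proof (induction n arbitrary: \<xi>)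
    case 0
    have "1 \<le> exp (X.lam * X.\<tau> \<xi>)" using X.B_facts(6)[OF 0] X.lam by simp
    then have "\<bar>\<phi> \<xi> - \<psi> \<xi>\<bar> \<le> exp (X.lam * X.\<tau> \<xi>)"
      using X.\<phi>_range[of \<xi>] Y.\<phi>_range[of \<xi>] by linarith
    then show ?case by simp
  next
    case (Suc n)
    have "\<phi> \<xi> = X.step \<phi> \<xi>" "\<psi> \<xi> = X.step \<psi> \<xi>" using Suc.prems X.\<phi>_eq Y.\<phi>_eq by (simp_all add: X.step_def)
    then show ?case
      using X.step_contraction[OF X.breaking_flow_axioms Y.breaking_flow_axioms, of "(1/2) ^ n" \<xi>] Suc.IH by simp
  qed
  have eq: "\<phi> \<xi> = \<psi> \<xi>" if "X.B \<xi>" for \<xi>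
  proof -
    have "(\<lambda>n. (1/2) ^ n * exp (X.lam * X.\<tau> \<xi>)) \<longlonglongrightarrow> 0 * exp (X.lam * X.\<tau> \<xi>)"
      by (intro tendsto_intros LIMSEQ_realpow_zero) auto
    then have "\<bar>\<phi> \<xi> - \<psi> \<xi>\<bar> \<le> 0 * exp (X.lam * X.\<tau> \<xi>)"
      by (rule LIMSEQ_le_const) (use d[OF that] in blast)
    then show ?thesis by simp
  qed
  have "X.kk t = Y.kk t" "X.k t = Y.k t"
    using eq by (auto simp: X.kk_def Y.kk_def X.k_def Y.k_def X.\<theta>_def fun_eq_iff)
  then show "X.y t \<xi> = Y.y t \<xi>" "X.U t \<xi> = Y.U t \<xi>" by (simp_all add: X.y_def Y.y_def X.U_def Y.U_def X.I_def Y.I_def)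
qed

section \<open>Time integrals of functions monotone in time\<close>

lemma mono_set_integrable:
  fixes f :: "real \<Rightarrow> real"
  assumes "\<And>s s'. 0 \<le> s \<Longrightarrow> s \<le> s' \<Longrightarrow> f s \<le> f s'"
  shows "set_integrable lborel {0..t} f"
proof -
  \<comment> \<open>Monotonicity is known for nonnegative times; composing with \<open>max 0\<close>
    extends it to the line without changing \<open>f\<close> on \<open>{0..t}\<close>.\<close>
  have "mono (\<lambda>s. f (max 0 s))" using assms by (auto simp: mono_def)
  then have [measurable]: "(\<lambda>s. f (max 0 s)) \<in> borel_measurable borel" by (rule borel_measurable_mono)
  have "integrable lborel (\<lambda>s. indicator {0..t} s *\<^sub>R f (max 0 s))"
  proof (rule Bochner_Integration.integrable_bound)
    show "integrable lborel (\<lambda>s. indicator {0..t} s * (\<bar>f 0\<bar> + \<bar>f t\<bar>))"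
      by (intro integrable_mult_left integrable_real_indicator) (auto simp: emeasure_lborel_Icc_eq)
    show "AE s in lborel. norm (indicator {0..t} s *\<^sub>R f (max 0 s)) \<le> norm (indicator {0..t} s * (\<bar>f 0\<bar> + \<bar>f t\<bar>))"
    proof (rule AE_I2)
      fix s
      show "norm (indicator {0..t} s *\<^sub>R f (max 0 s)) \<le> norm (indicator {0..t} s * (\<bar>f 0\<bar> + \<bar>f t\<bar>))"
        using assms[of 0 s] assms[of s t] by (cases "s \<in> {0..t}") auto
    qed
  qed simp
  then show ?thesis unfolding set_integrable_def
    by (rule Bochner_Integration.integrable_cong[THEN iffD1, rotated 2]) (auto simp: indicator_def)
qed

text \<open>A function that is measurable in \<open>\<xi>\<close> and monotone in \<open>s\<close> may be sampled at the points
  \<open>k/n\<close>: the samples are jointly measurable and converge for almost every \<open>s\<close>.\<close>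

lemma mono_time_integral_measurable:
  fixes F :: "real \<Rightarrow> real \<Rightarrow> real"
  assumes meas: "\<And>s. 0 \<le> s \<Longrightarrow> F s \<in> borel_measurable borel"
    and mono: "\<And>s s' \<xi>. 0 \<le> s \<Longrightarrow> s \<le> s' \<Longrightarrow> F s \<xi> \<le> F s' \<xi>"
    and [measurable]: "T \<in> borel_measurable borel"
  shows "(\<lambda>\<xi>. LINT s:{0..T \<xi>}|lborel. F s \<xi>) \<in> borel_measurable borel"
proof (rule borel_measurable_LIMSEQ_real)
  let ?k = "\<lambda>n s. nat \<lfloor>real (Suc n) * s\<rfloor>"
  let ?q = "\<lambda>n s. real (?k n s) / real (Suc n)"
  fix n
  have [measurable]: "(\<lambda>\<xi>. F (real k / real (Suc n)) \<xi>) \<in> borel_measurable borel" for k using meas by simp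
  have [measurable]: "(\<lambda>x. F (real k / real (Suc n)) (fst x)) \<in> borel_measurable (borel \<Otimes>\<^sub>M borel)" for k by measurable
  have [measurable]: "(\<lambda>x. F (?q n (snd x)) (fst x)) \<in> borel_measurable (borel \<Otimes>\<^sub>M borel)"
    by (rule measurable_compose_countable[of "\<lambda>k x. F (real k / real (Suc n)) (fst x)"]) measurable
  have "(\<lambda>x. indicator {0..T (fst x)} (snd x) *\<^sub>R F (?q n (snd x)) (fst x)) \<in> borel_measurable (borel \<Otimes>\<^sub>M lborel)"
  proof -
    have [measurable]: "(\<lambda>x. F (?q n (snd x)) (fst x)) \<in> borel_measurable (borel \<Otimes>\<^sub>M lborel)" by measurable
    show ?thesis unfolding indicator_def atLeastAtMost_iff by measurable
  qed
  then show "(\<lambda>\<xi>. LINT s:{0..T \<xi>}|lborel. F (?q n s) \<xi>) \<in> borel_measurable borel"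
    using lborel.borel_measurable_lebesgue_integral[of "\<lambda>\<xi> s. indicator {0..T \<xi>} s *\<^sub>R F (?q n s) \<xi>" borel]
    by (simp add: split_beta' set_lebesgue_integral_def)
next
  let ?k = "\<lambda>n s. nat \<lfloor>real (Suc n) * s\<rfloor>"
  let ?q = "\<lambda>n s. real (?k n s) / real (Suc n)"
  fix \<xi> :: real
  have q: "0 \<le> ?q n s" "?q n s \<le> s" "s - 1 / real (Suc n) \<le> ?q n s" if "0 \<le> s" for n s
  proof -
    have r: "real (?k n s) = of_int \<lfloor>real (Suc n) * s\<rfloor>" using that by simp
    show "0 \<le> ?q n s" by simp
    show "?q n s \<le> s" unfolding r using of_int_floor_le[of "real (Suc n) * s"] by (simp add: divide_le_eq mult.commute)
    have "real (Suc n) * s - 1 \<le> of_int \<lfloor>real (Suc n) * s\<rfloor>" using real_of_int_floor_gt_diff_one[of "real (Suc n) * s"] by linarith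
    then have "(real (Suc n) * s - 1) / real (Suc n) \<le> of_int \<lfloor>real (Suc n) * s\<rfloor> / real (Suc n)" by (intro divide_right_mono) auto
    moreover have "(real (Suc n) * s - 1) / real (Suc n) = s - 1 / real (Suc n)" by (simp add: diff_divide_distrib)
    ultimately show "s - 1 / real (Suc n) \<le> ?q n s" unfolding r by simp
  qed
  have mono': "mono (\<lambda>s. F (max 0 s) \<xi>)" using mono by (auto simp: mono_def)
  have mf [measurable]: "(\<lambda>s. F (max 0 s) \<xi>) \<in> borel_measurable borel" by (rule borel_measurable_mono[OF mono'])
  have eqF: "(\<lambda>s. indicator {0..T \<xi>} s *\<^sub>R F s \<xi>) = (\<lambda>s. indicator {0..T \<xi>} s *\<^sub>R F (max 0 s) \<xi>)"
    by (auto simp: indicator_def fun_eq_iff)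
  show "(\<lambda>n. LINT s:{0..T \<xi>}|lborel. F (?q n s) \<xi>) \<longlonglongrightarrow> (LINT s:{0..T \<xi>}|lborel. F s \<xi>)"
    unfolding set_lebesgue_integral_def
  proof (rule integral_dominated_convergence[where w = "\<lambda>s. indicator {0..T \<xi>} s * (\<bar>F 0 \<xi>\<bar> + \<bar>F (T \<xi>) \<xi>\<bar>)"])
    show "(\<lambda>s. indicator {0..T \<xi>} s *\<^sub>R F s \<xi>) \<in> borel_measurable lborel" unfolding eqF by measurable
    have [measurable]: "(\<lambda>s. F (?q n s) \<xi>) \<in> borel_measurable borel" for n
      by (rule measurable_compose_countable[of "\<lambda>k s. F (real k / real (Suc n)) \<xi>"]) measurable
    show "(\<lambda>s. indicator {0..T \<xi>} s *\<^sub>R F (?q n s) \<xi>) \<in> borel_measurable lborel" for n by measurable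
    show "integrable lborel (\<lambda>s. indicator {0..T \<xi>} s * (\<bar>F 0 \<xi>\<bar> + \<bar>F (T \<xi>) \<xi>\<bar>))"
      by (intro integrable_mult_left integrable_real_indicator) (auto simp: emeasure_lborel_Icc_eq)
    show "AE s in lborel. norm (indicator {0..T \<xi>} s *\<^sub>R F (?q n s) \<xi>) \<le> indicator {0..T \<xi>} s * (\<bar>F 0 \<xi>\<bar> + \<bar>F (T \<xi>) \<xi>\<bar>)" for n
    proof (rule AE_I2)
      fix s
      show "norm (indicator {0..T \<xi>} s *\<^sub>R F (?q n s) \<xi>) \<le> indicator {0..T \<xi>} s * (\<bar>F 0 \<xi>\<bar> + \<bar>F (T \<xi>) \<xi>\<bar>)"
      proof (cases "s \<in> {0..T \<xi>}")
        case True
        then have "F 0 \<xi> \<le> F (?q n s) \<xi>" "F (?q n s) \<xi> \<le> F (T \<xi>) \<xi>"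
          using q[of s n] by (auto intro!: mono intro: order_trans)
        then show ?thesis using True by (simp only: indicator_simps real_norm_def) auto
      qed simp
    qed
    have "AE s in lborel. s \<notin> insert 0 {s. \<not> isCont (\<lambda>s. F (max 0 s) \<xi>) s}"
      using mono_ctble_discont[OF mono'] by (intro AE_not_in countable_imp_null_set_lborel) auto
    then show "AE s in lborel. (\<lambda>n. indicator {0..T \<xi>} s *\<^sub>R F (?q n s) \<xi>) \<longlonglongrightarrow> indicator {0..T \<xi>} s *\<^sub>R F s \<xi>"
    proof eventually_elim
      case (elim s)
      show ?case
      proof (cases "s \<in> {0..T \<xi>}")
        case True
        have "(\<lambda>n. s - 1 / real (Suc n)) \<longlonglongrightarrow> s - 0"
          using LIMSEQ_Suc[OF lim_1_over_n[where ?'a = real]] by (intro tendsto_intros) auto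
        then have "(\<lambda>n. s - 1 / real (Suc n)) \<longlonglongrightarrow> s" by simp
        then have "(\<lambda>n. ?q n s) \<longlonglongrightarrow> s"
          by (rule tendsto_sandwich[of "\<lambda>n. s - 1 / real (Suc n)" _ _ "\<lambda>n. s", rotated 2])
             (use q[of s] True in auto)
        then have "(\<lambda>n. F (max 0 (?q n s)) \<xi>) \<longlonglongrightarrow> F (max 0 s) \<xi>"
          using elim by (intro isCont_tendsto_compose[of s "\<lambda>s. F (max 0 s) \<xi>"]) auto
        then have "(\<lambda>n. F (?q n s) \<xi>) \<longlonglongrightarrow> F s \<xi>" using True by (simp add: max_absorb2)
        then show ?thesis by (intro tendsto_intros)
      qed simp
    qed
  qed
qed

text \<open>Connects Lagrangian data, for which \<open>tau\<close> and \<open>Vflow\<close> are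
  expressed by \<open>wd\<close>, with the representatives in the explicit solution
  formulas.\<close>

locale lag_flow = breaking_flow +
  fixes H r0 V0 :: "real \<Rightarrow> real"
  assumes wd_eq: "AE \<xi> in lborel. wd y0 \<xi> = a \<xi> \<and> wd U0 \<xi> = b \<xi> \<and> wd H \<xi> = h \<xi> \<and> r0 \<xi> = r \<xi>"
    and r0_meas [measurable]: "r0 \<in> borel_measurable borel"
    and H_deriv: "has_weak_deriv H h" and A_dnorm: "A = dnorm \<alpha>"
begin

abbreviation X0 :: lag where "X0 \<equiv> (y0, U0, H, r0, V0)"

lemma wd_meas [measurable]: "wd y0 \<in> borel_measurable borel" "wd U0 \<in> borel_measurable borel" "wd H \<in> borel_measurable borel"
  using has_weak_derivD(1)[OF has_weak_deriv_wd] deriv0 H_deriv by auto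

lemma tau_meas [measurable]: "tau X0 \<in> borel_measurable borel"
  unfolding tau_def[abs_def] by simp

lemma tau_eq: "AE \<xi> in lborel. tau X0 \<xi> = (if B \<xi> then ereal (\<tau> \<xi>) else \<infinity>)"
  using wd_eq
proof eventually_elim
  case (elim \<xi>)
  have "r \<xi> = 0 \<and> b \<xi> = 0" if "a \<xi> = 0" using energy[of \<xi>] that by (simp add: sum_power2_eq_zero_iff)
  then show ?case using elim by (auto simp: tau_def B_def \<tau>_def)
qed

text \<open>\<open>real_of_ereal\<close> maps an infinite breaking time to 0, but
  \<open>loss\<close> reads this value only when \<open>tau <= s\<close>.\<close>

definition T0 :: "real \<Rightarrow> real" where "T0 \<xi> = real_of_ereal (tau X0 \<xi>)"

lemma T0_meas [measurable]: "T0 \<in> borel_measurable borel" unfolding T0_def[abs_def] by measurable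

definition loss :: "(real \<Rightarrow> real \<Rightarrow> real) \<Rightarrow> real \<Rightarrow> real \<Rightarrow> real" where
  "loss yy s \<eta> = wd H \<eta> * (1 - (if tau X0 \<eta> \<le> ereal s then \<alpha> (yy (T0 \<eta>) \<eta>) else 0))"

lemma Vflow_loss: "Vflow \<alpha> X0 yy s \<xi> = (LINT \<eta>:{..\<xi>}|lborel. loss yy s \<eta>)"
  unfolding Vflow_def loss_def T0_def prod.case ..

lemma loss_bounds: "AE \<eta> in lborel. 0 \<le> loss yy s \<eta> \<and> loss yy s \<eta> \<le> h \<eta>"
  using wd_eq
proof eventually_elim
  case (elim \<eta>)
  then show ?case using nonneg(2)[of \<eta>] \<alpha>_range by (auto simp: loss_def mult_left_le)
qed

lemma loss_eq_v:
  assumes "\<And>\<xi>. B \<xi> \<Longrightarrow> \<phi> \<xi> = \<alpha> (yy (\<tau> \<xi>) \<xi>)"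
  shows "AE \<eta> in lborel. loss yy s \<eta> = v s \<eta>"
  using wd_eq tau_eq
  by eventually_elim (auto simp: loss_def v_def T0_def assms)

text \<open>Equality almost everywhere carries over to Bochner integrals of measurable integrands,
  which is why the trajectory is required to be measurable along \<open>T0\<close>.\<close>

lemma Vflow_eq:
  assumes \<phi>: "\<And>\<xi>. B \<xi> \<Longrightarrow> \<phi> \<xi> = \<alpha> (yy (\<tau> \<xi>) \<xi>)"
    and [measurable]: "(\<lambda>\<eta>. yy (T0 \<eta>) \<eta>) \<in> borel_measurable borel"
  shows "Vflow \<alpha> X0 yy s \<xi> = (LINT \<eta>:{..\<xi>}|lborel. v s \<eta>)" "Vflow_inf \<alpha> X0 yy s = (LINT \<eta>|lborel. v s \<eta>)"
proof -
  have [measurable]: "loss yy s \<in> borel_measurable borel" unfolding loss_def[abs_def] by measurable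
  show e: "Vflow \<alpha> X0 yy s \<xi> = (LINT \<eta>:{..\<xi>}|lborel. v s \<eta>)" for \<xi>
    unfolding Vflow_loss set_lebesgue_integral_def
    by (rule integral_cong_AE) (use loss_eq_v[of yy s, OF \<phi>] in auto)
  have "integrable lborel (v s)"
    by (rule Bochner_Integration.integrable_bound[OF h_int]) (use v_bounds nonneg in auto)
  then show "Vflow_inf \<alpha> X0 yy s = (LINT \<eta>|lborel. v s \<eta>)"
    unfolding Vflow_inf_def e by (intro tendsto_Lim tendsto_integral_atMost) auto
qed

lemma flow_of_solution:
  assumes \<phi>: "\<And>\<xi>. B \<xi> \<Longrightarrow> \<phi> \<xi> = \<alpha> (y (\<tau> \<xi>) \<xi>)"
  defines "yy \<equiv> \<lambda>t. if t < 0 then y0 else y t" and "UU \<equiv> \<lambda>t. if t < 0 then U0 else U t"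
  shows "is_flow \<alpha> X0 yy UU" "Vflow \<alpha> X0 yy s \<xi> = (LINT \<eta>:{..\<xi>}|lborel. v s \<eta>)"
proof -
  have 1: "\<phi> \<xi> = \<alpha> (yy (\<tau> \<xi>) \<xi>)" if "B \<xi>" for \<xi>
    using \<phi>[OF that] B_facts(6)[OF that] by (simp add: yy_def)
  note [measurable] = y_compose_meas[OF T0_meas]
  \<comment> \<open>On the null set where \<open>wd\<close> differs from the representatives,
    \<open>T0\<close> may be negative; there the value prescribed for negative times is
    taken.\<close>
  have "(\<lambda>\<eta>. yy (T0 \<eta>) \<eta>) = (\<lambda>\<eta>. if T0 \<eta> < 0 then y0 \<eta> else y (T0 \<eta>) \<eta>)" by (auto simp: yy_def)
  then have 2: "(\<lambda>\<eta>. yy (T0 \<eta>) \<eta>) \<in> borel_measurable borel" by simp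
  have V: "Vflow \<alpha> X0 yy s \<xi> = (LINT \<eta>:{..\<xi>}|lborel. v s \<eta>)" "Vflow_inf \<alpha> X0 yy s = (LINT \<eta>|lborel. v s \<eta>)" for s \<xi>
    by (rule Vflow_eq[where yy = yy, OF _ 2], erule 1)+
  show "Vflow \<alpha> X0 yy s \<xi> = (LINT \<eta>:{..\<xi>}|lborel. v s \<eta>)" by (rule V(1))
  have U: "(LINT s:{0..t}|lborel. UU s \<xi>) = (LINT s:{0..t}|lborel. U s \<xi>)" for t \<xi>
    unfolding set_lebesgue_integral_def by (intro Bochner_Integration.integral_cong) (auto simp: UU_def indicator_def)
  show "is_flow \<alpha> X0 yy UU"
    unfolding is_flow_def prod.case
  proof (intro allI conjI impI)
    fix t \<xi> :: real
    show "yy t \<xi> = y0 \<xi>" "UU t \<xi> = U0 \<xi>" if "t < 0" using that by (simp_all add: yy_def UU_def)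
    show "yy t \<xi> = y0 \<xi> + (LINT s:{0..t}|lborel. UU s \<xi>)" if "0 \<le> t"
      unfolding U using U_time_integral(2)[OF that] that by (simp add: yy_def)
    show "UU t \<xi> = U0 \<xi> + (LINT s:{0..t}|lborel. Vflow \<alpha> X0 yy s \<xi> / 2 - Vflow_inf \<alpha> X0 yy s / 4)" if "0 \<le> t"
      unfolding V using v_time_integral[OF that] that by (simp add: UU_def)
  qed
qed

text \<open>A solution of the integral equations need not be measurable in \<open>\<xi>\<close> by definition, and
  integrals of non-measurable functions are 0. It is measurable nevertheless: for every candidate
  the energy is monotone in time and, up to a down-closed domain, in \<open>\<xi>\<close>.\<close>

context
  fixes yy :: "real \<Rightarrow> real \<Rightarrow> real"
begin

definition "intdom s = {\<xi>. set_integrable lborel {..\<xi>} (loss yy s)}"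

lemma intdom_down: "\<xi> \<in> intdom s \<Longrightarrow> \<xi>' \<le> \<xi> \<Longrightarrow> \<xi>' \<in> intdom s"
  unfolding intdom_def mem_Collect_eq by (rule set_integrable_subset) auto

lemma Vflow_out: "\<xi> \<notin> intdom s \<Longrightarrow> Vflow \<alpha> X0 yy s \<xi> = 0"
  unfolding Vflow_loss intdom_def mem_Collect_eq set_integrable_def set_lebesgue_integral_def
  by (rule not_integrable_integral_eq)

lemma Vflow_bounds: "0 \<le> Vflow \<alpha> X0 yy s \<xi>" "Vflow \<alpha> X0 yy s \<xi> \<le> M"
proof -
  show "0 \<le> Vflow \<alpha> X0 yy s \<xi>"
    unfolding Vflow_loss set_lebesgue_integral_def
    by (rule integral_nonneg_AE) (use loss_bounds[of yy s] in eventually_elim, simp)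
  show "Vflow \<alpha> X0 yy s \<xi> \<le> M"
  proof (cases "\<xi> \<in> intdom s")
    case True
    have "Vflow \<alpha> X0 yy s \<xi> \<le> (LINT \<eta>|lborel. h \<eta>)"
      unfolding Vflow_loss set_lebesgue_integral_def
    proof (rule integral_mono_AE)
      show "AE x in lborel. indicat_real {..\<xi>} x *\<^sub>R loss yy s x \<le> h x"
        using loss_bounds[of yy s] by eventually_elim (use nonneg in \<open>auto simp: indicator_def\<close>)
    qed (use True h_int in \<open>auto simp: intdom_def set_integrable_def\<close>)
    then show ?thesis using h_le by simp
  qed (simp add: Vflow_out M_nonneg)
qed

lemma Vflow_mono_space:
  assumes "\<xi> \<le> \<xi>'" "\<xi>' \<in> intdom s" shows "Vflow \<alpha> X0 yy s \<xi> \<le> Vflow \<alpha> X0 yy s \<xi>'"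
  unfolding Vflow_loss set_lebesgue_integral_def
proof (rule integral_mono_AE)
  show "AE x in lborel. indicat_real {..\<xi>} x *\<^sub>R loss yy s x \<le> indicat_real {..\<xi>'} x *\<^sub>R loss yy s x"
    using loss_bounds[of yy s] by eventually_elim (use assms in \<open>auto simp: indicator_def\<close>)
qed (use assms intdom_down[OF assms(2,1)] in \<open>auto simp: intdom_def set_integrable_def\<close>)

text \<open>Outside the initial segment \<open>intdom s\<close> the energy is 0 by the convention
  for integrals. Raising it there to the upper bound \<open>M\<close> makes it monotone, and a
  factor built from a monotone indicator restores the original.\<close>

lemma Vflow_space_meas: "Vflow \<alpha> X0 yy s \<in> borel_measurable borel"
proof -
  let ?g = "\<lambda>\<xi>. if \<xi> \<in> intdom s then Vflow \<alpha> X0 yy s \<xi> else M" and ?i = "\<lambda>\<xi>. if \<xi> \<in> intdom s then 0 else 1 :: real"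
  have "mono ?g" "mono ?i"
    using Vflow_mono_space Vflow_bounds intdom_down by (auto simp: mono_def)
  then have [measurable]: "?g \<in> borel_measurable borel" "?i \<in> borel_measurable borel" by (auto intro: borel_measurable_mono)
  have "Vflow \<alpha> X0 yy s = (\<lambda>\<xi>. ?g \<xi> * (1 - ?i \<xi>))" using Vflow_out by auto
  then show ?thesis by (rule ssubst) measurable
qed

text \<open>Integrability passes from the later time \<open>s'\<close> back to \<open>s\<close>:
  where \<open>tau <= s\<close> the two integrands coincide, and elsewhere the one at
  \<open>s\<close> is \<open>wd H\<close>, which is integrable. If it fails at \<open>s'\<close>,
  the left side is 0.\<close>

lemma Vflow_antimono_time:
  assumes "s \<le> s'" shows "Vflow \<alpha> X0 yy s' \<xi> \<le> Vflow \<alpha> X0 yy s \<xi>"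
proof (cases "\<xi> \<in> intdom s'")
  case True
  have le: "AE \<eta> in lborel. loss yy s' \<eta> \<le> loss yy s \<eta>"
    using wd_eq
  proof eventually_elim
    case (elim \<eta>)
    have "tau X0 \<eta> \<le> ereal s'" if "tau X0 \<eta> \<le> ereal s" using that assms by (meson ereal_less_eq(3) order_trans)
    then show ?case using elim nonneg(2)[of \<eta>] \<alpha>_range by (auto simp: loss_def mult_left_le)
  qed
  have i: "set_integrable lborel {..\<xi>} (loss yy s)"
  proof -
    let ?S = "{\<eta>. tau X0 \<eta> \<le> ereal s}"
    have S: "?S \<in> sets borel" by measurable
    have "integrable lborel (\<lambda>\<eta>. indicator ?S \<eta> *\<^sub>R (indicator {..\<xi>} \<eta> *\<^sub>R loss yy s' \<eta>))"
      using True by (intro integrable_mult_indicator[OF _ _, of ?S] S) (auto simp: intdom_def set_integrable_def S)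
    moreover have "integrable lborel (\<lambda>\<eta>. indicator (- ?S) \<eta> *\<^sub>R (indicator {..\<xi>} \<eta> *\<^sub>R wd H \<eta>))"
    proof -
      have "integrable lborel (wd H) = integrable lborel h"
        by (rule integrable_cong_AE) (use wd_eq in auto)
      then have "integrable lborel (wd H)" using h_int by simp
      then show ?thesis using S by (intro integrable_mult_indicator) auto
    qed
    ultimately have "integrable lborel (\<lambda>\<eta>. indicator ?S \<eta> *\<^sub>R (indicator {..\<xi>} \<eta> *\<^sub>R loss yy s' \<eta>)
        + indicator (- ?S) \<eta> *\<^sub>R (indicator {..\<xi>} \<eta> *\<^sub>R wd H \<eta>))" by (rule Bochner_Integration.integrable_add)
    moreover have "indicator ?S \<eta> *\<^sub>R (indicator {..\<xi>} \<eta> *\<^sub>R loss yy s' \<eta>)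
        + indicator (- ?S) \<eta> *\<^sub>R (indicator {..\<xi>} \<eta> *\<^sub>R wd H \<eta>) = indicator {..\<xi>} \<eta> *\<^sub>R loss yy s \<eta>" for \<eta>
    proof -
      have "tau X0 \<eta> \<le> ereal s'" if "tau X0 \<eta> \<le> ereal s" using that assms by (meson ereal_less_eq(3) order_trans)
      then show ?thesis by (auto simp: loss_def indicator_def)
    qed
    ultimately show ?thesis unfolding set_integrable_def by simp
  qed
  show ?thesis
    unfolding Vflow_loss set_lebesgue_integral_def
  proof (rule integral_mono_AE)
    show "AE x in lborel. indicat_real {..\<xi>} x *\<^sub>R loss yy s' x \<le> indicat_real {..\<xi>} x *\<^sub>R loss yy s x"
      using le by eventually_elim (auto simp: indicator_def)
  qed (use i True in \<open>auto simp: intdom_def set_integrable_def\<close>)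
qed (use Vflow_bounds in \<open>simp add: Vflow_out\<close>)

text \<open>The \<open>Lim\<close> in \<open>Vflow_inf\<close> is a genuine limit: on a full domain
  the energy is monotone and bounded, otherwise it vanishes eventually.\<close>

lemma Vflow_inf_LIMSEQ: "(\<lambda>n. Vflow \<alpha> X0 yy s (real n)) \<longlonglongrightarrow> Vflow_inf \<alpha> X0 yy s"
proof -
  have "\<exists>L. ((\<lambda>\<xi>. Vflow \<alpha> X0 yy s \<xi>) \<longlongrightarrow> L) at_top"
  proof (cases "intdom s = UNIV")
    case True
    let ?V = "Vflow \<alpha> X0 yy s"
    have bdd: "bdd_above (range ?V)" using Vflow_bounds by (auto intro!: bdd_aboveI)
    have "(?V \<longlongrightarrow> (SUP \<xi>. ?V \<xi>)) at_top"
    proof (rule order_tendstoI)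
      fix c assume "c < (SUP \<xi>. ?V \<xi>)"
      then obtain \<xi> where x: "c < ?V \<xi>" using less_cSUP_iff[OF _ bdd] by auto
      show "\<forall>\<^sub>F \<xi> in at_top. c < ?V \<xi>"
        using eventually_ge_at_top[of \<xi>] by eventually_elim (use x Vflow_mono_space True in \<open>force intro: less_le_trans\<close>)
    next
      fix c assume "(SUP \<xi>. ?V \<xi>) < c"
      then show "\<forall>\<^sub>F \<xi> in at_top. ?V \<xi> < c" using cSUP_upper[OF _ bdd] by (auto intro!: always_eventually intro: le_less_trans)
    qed
    then show ?thesis by blast
  next
    case False
    then obtain \<xi> where "\<xi> \<notin> intdom s" by auto
    have "\<forall>\<^sub>F \<xi>' in at_top. Vflow \<alpha> X0 yy s \<xi>' = 0"
      using eventually_ge_at_top[of \<xi>]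
      by eventually_elim (use intdom_down \<open>\<xi> \<notin> intdom s\<close> Vflow_out in blast)
    then show ?thesis using tendsto_eventually by blast
  qed
  then obtain L where L: "((\<lambda>\<xi>. Vflow \<alpha> X0 yy s \<xi>) \<longlongrightarrow> L) at_top" by blast
  then have "Vflow_inf \<alpha> X0 yy s = L" unfolding Vflow_inf_def by (intro tendsto_Lim) auto
  then show ?thesis using filterlim_compose[OF L filterlim_real_sequentially] by simp
qed

lemma Vflow_inf_antimono: "s \<le> s' \<Longrightarrow> Vflow_inf \<alpha> X0 yy s' \<le> Vflow_inf \<alpha> X0 yy s"
  by (rule LIMSEQ_le[OF Vflow_inf_LIMSEQ Vflow_inf_LIMSEQ]) (use Vflow_antimono_time in auto)

lemma Vflow_inf_nonneg: "0 \<le> Vflow_inf \<alpha> X0 yy s"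
  by (rule LIMSEQ_le_const[OF Vflow_inf_LIMSEQ]) (use Vflow_bounds in auto)

text \<open>\<open>yy\<close> arises by two successive time integrations. The energy is
  nonincreasing in time and its time integrals \<open>G\<close> and \<open>C\<close> are
  nondecreasing, so the criterion for monotone functions applies both times, the second time with
  the variable end point \<open>T\<close>.\<close>

lemma candidate_meas:
  assumes flow: "is_flow \<alpha> X0 yy UU" and [measurable]: "T \<in> borel_measurable borel" and T: "\<And>\<xi>. 0 \<le> T \<xi>"
  shows "(\<lambda>\<xi>. yy (T \<xi>) \<xi>) \<in> borel_measurable borel"
proof -
  let ?V = "Vflow \<alpha> X0 yy" and ?Vi = "Vflow_inf \<alpha> X0 yy"
  define G where "G t \<xi> = (LINT s:{0..t}|lborel. ?V s \<xi>)" for t \<xi>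
  define C where "C t = (LINT s:{0..t}|lborel. ?Vi s)" for t
  have iV: "set_integrable lborel {0..t} (\<lambda>s. ?V s \<xi>)" for t \<xi>
    using mono_set_integrable[of "\<lambda>s. - ?V s \<xi>" t] Vflow_antimono_time by (simp add: set_integrable_def)
  have iVi: "set_integrable lborel {0..t} ?Vi" for t
    using mono_set_integrable[of "\<lambda>s. - ?Vi s" t] Vflow_inf_antimono by (simp add: set_integrable_def)
  have UU: "UU t \<xi> = U0 \<xi> + G t \<xi> / 2 - C t / 4" if "0 \<le> t" for t \<xi>
  proof -
    have "UU t \<xi> = U0 \<xi> + (LINT s:{0..t}|lborel. ?V s \<xi> / 2 - ?Vi s / 4)" using flow that by (simp add: is_flow_def)
    also have "(LINT s:{0..t}|lborel. ?V s \<xi> / 2 - ?Vi s / 4) = (LINT s:{0..t}|lborel. ?V s \<xi> / 2) - (LINT s:{0..t}|lborel. ?Vi s / 4)"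
      by (rule set_integral_diff) (use iV iVi in auto)
    finally show ?thesis by (simp add: G_def C_def)
  qed
  have Gmono: "G s \<xi> \<le> G s' \<xi>" if "0 \<le> s" "s \<le> s'" for s s' \<xi>
    unfolding G_def set_lebesgue_integral_def
    by (rule integral_mono) (use iV that Vflow_bounds in \<open>auto simp: set_integrable_def indicator_def\<close>)
  have Cmono: "C s \<le> C s'" if "0 \<le> s" "s \<le> s'" for s s'
    unfolding C_def set_lebesgue_integral_def
    by (rule integral_mono) (use iVi that Vflow_inf_nonneg in \<open>auto simp: set_integrable_def indicator_def\<close>)
  have Gm: "G t \<in> borel_measurable borel" for t
  proof -
    have "(\<lambda>\<xi>. LINT s:{0..t}|lborel. - ?V s \<xi>) \<in> borel_measurable borel"
      by (rule mono_time_integral_measurable) (use Vflow_antimono_time Vflow_space_meas in auto)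
    then have "(\<lambda>\<xi>. - G t \<xi>) \<in> borel_measurable borel" by (simp add: G_def set_lebesgue_integral_def)
    then show ?thesis using borel_measurable_uminus_eq[of "G t"] by simp
  qed
  have [measurable]: "(\<lambda>\<xi>. LINT s:{0..T \<xi>}|lborel. G s \<xi>) \<in> borel_measurable borel"
    by (rule mono_time_integral_measurable) (use Gmono Gm in auto)
  have [measurable]: "(\<lambda>\<xi>. LINT s:{0..T \<xi>}|lborel. C s) \<in> borel_measurable borel"
    by (rule mono_time_integral_measurable[of "\<lambda>s _. C s"]) (use Cmono in auto)
  have "yy (T \<xi>) \<xi> = y0 \<xi> + (T \<xi> * U0 \<xi> + (LINT s:{0..T \<xi>}|lborel. G s \<xi>) / 2 - (LINT s:{0..T \<xi>}|lborel. C s) / 4)" for \<xi>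
  proof -
    have iG: "set_integrable lborel {0..T \<xi>} (\<lambda>s. G s \<xi> / 2)" and iC: "set_integrable lborel {0..T \<xi>} (\<lambda>s. C s / 4)"
      using mono_set_integrable[of "\<lambda>s. G s \<xi>" "T \<xi>"] mono_set_integrable[of C "T \<xi>"] Gmono Cmono by auto
    have iU: "set_integrable lborel {0..T \<xi>} (\<lambda>s. U0 \<xi>)"
      unfolding set_integrable_def by (intro borel_integrable_compact) auto
    have "yy (T \<xi>) \<xi> = y0 \<xi> + (LINT s:{0..T \<xi>}|lborel. UU s \<xi>)" using flow T[of \<xi>] by (simp add: is_flow_def)
    also have "(LINT s:{0..T \<xi>}|lborel. UU s \<xi>) = (LINT s:{0..T \<xi>}|lborel. (U0 \<xi> + G s \<xi> / 2) - C s / 4)"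
      unfolding set_lebesgue_integral_def by (intro Bochner_Integration.integral_cong) (auto simp: UU indicator_def)
    also have "\<dots> = (LINT s:{0..T \<xi>}|lborel. U0 \<xi> + G s \<xi> / 2) - (LINT s:{0..T \<xi>}|lborel. C s / 4)"
      by (rule set_integral_diff(2)[OF set_integral_add(1)[OF iU iG] iC])
    also have "(LINT s:{0..T \<xi>}|lborel. U0 \<xi> + G s \<xi> / 2) = (LINT s:{0..T \<xi>}|lborel. U0 \<xi>) + (LINT s:{0..T \<xi>}|lborel. G s \<xi> / 2)"
      by (rule set_integral_add(2)[OF iU iG])
    also have "(LINT s:{0..T \<xi>}|lborel. U0 \<xi>) = T \<xi> * U0 \<xi>" using T[of \<xi>] by (simp add: set_lebesgue_integral_def)
    finally show ?thesis by simp
  qed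
  then show ?thesis by simp
qed

end

text \<open>The loss is read off from the candidate. Measurability identifies its energy with
  \<open>v\<close> for this loss, the integral equations then identify \<open>UU\<close> and
  \<open>yy\<close>, and so the loss is consistent with the trajectory it generates.\<close>

lemma flow_is_solution:
  assumes flow: "is_flow \<alpha> X0 yy UU"
  shows "\<exists>\<psi>. breaking_solution \<alpha> A M y0 U0 a b h r \<psi> \<and>
     (\<forall>t\<ge>0. yy t = breaking_flow.y y0 U0 a b h r \<psi> t \<and> UU t = breaking_flow.U U0 a b h r \<psi> t)"
proof -
  define \<psi> where "\<psi> \<xi> = (if B \<xi> then \<alpha> (yy (\<tau> \<xi>) \<xi>) else 0)" for \<xi>
  have [measurable]: "(\<lambda>\<xi>. yy (max 0 (\<tau> \<xi>)) \<xi>) \<in> borel_measurable borel" "(\<lambda>\<xi>. yy (max 0 (T0 \<xi>)) \<xi>) \<in> borel_measurable borel"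
    by (rule candidate_meas[OF flow]; simp)+
  \<comment> \<open>\<open>candidate_meas\<close> asks for a time that is nonnegative everywhere; on
    \<open>B\<close> the truncation has no effect.\<close>
  have "\<psi> = (\<lambda>\<xi>. if B \<xi> then \<alpha> (yy (max 0 (\<tau> \<xi>)) \<xi>) else 0)"
    using B_facts(6) by (auto simp: \<psi>_def fun_eq_iff max_absorb2)
  then have "\<psi> \<in> borel_measurable borel" by simp
  then interpret F: breaking_flow \<alpha> A M y0 U0 a b h r \<psi>
    by (intro breaking_flow_change[OF breaking_flow_axioms]) (auto simp: \<psi>_def \<alpha>_range)
  interpret F: lag_flow \<alpha> A M y0 U0 a b h r \<psi> H r0 V0
    by unfold_locales (rule wd_eq r0_meas H_deriv A_dnorm)+
  have neg: "yy t \<xi> = y0 \<xi>" if "t < 0" for t \<xi> using flow that by (simp add: is_flow_def)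
  have "(\<lambda>\<eta>. yy (T0 \<eta>) \<eta>) = (\<lambda>\<eta>. if T0 \<eta> < 0 then y0 \<eta> else yy (max 0 (T0 \<eta>)) \<eta>)"
    by (auto simp: neg max_def fun_eq_iff)
  then have [measurable]: "(\<lambda>\<eta>. yy (T0 \<eta>) \<eta>) \<in> borel_measurable borel" by simp
  have V: "Vflow \<alpha> X0 yy s \<xi> = (LINT \<eta>:{..\<xi>}|lborel. F.v s \<eta>)" "Vflow_inf \<alpha> X0 yy s = (LINT \<eta>|lborel. F.v s \<eta>)" for s \<xi>
    by (rule F.Vflow_eq; simp add: \<psi>_def)+
  have U: "UU t \<xi> = F.U t \<xi>" if "0 \<le> t" for t \<xi>
    using flow that F.v_time_integral[OF that, of \<xi>] by (simp add: is_flow_def V)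
  have y: "yy t \<xi> = F.y t \<xi>" if "0 \<le> t" for t \<xi>
  proof -
    have "yy t \<xi> = y0 \<xi> + (LINT s:{0..t}|lborel. UU s \<xi>)" using flow that by (simp add: is_flow_def)
    also have "(LINT s:{0..t}|lborel. UU s \<xi>) = (LINT s:{0..t}|lborel. F.U s \<xi>)"
      unfolding set_lebesgue_integral_def by (intro Bochner_Integration.integral_cong) (auto simp: U indicator_def)
    finally show ?thesis using F.U_time_integral(2)[OF that] by simp
  qed
  have "breaking_solution \<alpha> A M y0 U0 a b h r \<psi>"
    by unfold_locales (use A_dnorm y B_facts(6) in \<open>auto simp: \<psi>_def\<close>)
  then show ?thesis using y U by (intro exI[of _ \<psi>]) auto
qed

text \<open>Existence and uniqueness together evaluate the \<open>THE\<close> in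
  \<open>Sflow\<close>; a single loss serves for all times.\<close>

lemma Sflow_eq:
  "\<exists>\<psi>. breaking_solution \<alpha> A M y0 U0 a b h r \<psi> \<and>
     (\<forall>t\<ge>0. Sflow \<alpha> t X0 = (breaking_flow.y y0 U0 a b h r \<psi> t, breaking_flow.U U0 a b h r \<psi> t, H, r0,
        \<lambda>\<xi>. LINT \<eta>:{..\<xi>}|lborel. breaking_flow.v a b h r \<psi> t \<eta>))"
proof -
  obtain \<psi> where \<psi>: "breaking_solution \<alpha> A M y0 U0 a b h r \<psi>" using exists_solution[OF A_dnorm] by blast
  interpret F: breaking_solution \<alpha> A M y0 U0 a b h r \<psi> by (rule \<psi>)
  interpret F: lag_flow \<alpha> A M y0 U0 a b h r \<psi> H r0 V0
    by unfold_locales (rule wd_eq r0_meas H_deriv A_dnorm)+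
  define p where "p = (\<lambda>t. if t < 0 then y0 else F.y t, \<lambda>t. if t < 0 then U0 else F.U t)"
  have p: "is_flow \<alpha> X0 (fst p) (snd p)" unfolding p_def fst_conv snd_conv by (rule F.flow_of_solution(1)) (rule F.\<phi>_eq)
  have "q = p" if q: "is_flow \<alpha> X0 (fst q) (snd q)" for q
  proof -
    obtain \<zeta> where \<zeta>: "breaking_solution \<alpha> A M y0 U0 a b h r \<zeta>"
      "\<And>t. 0 \<le> t \<Longrightarrow> fst q t = breaking_flow.y y0 U0 a b h r \<zeta> t \<and> snd q t = breaking_flow.U U0 a b h r \<zeta> t"
      using flow_is_solution[OF q] by blast
    have "fst q t \<xi> = fst p t \<xi> \<and> snd q t \<xi> = snd p t \<xi>" for t \<xi>
    proof (cases "t < 0")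
      case True
      then show ?thesis using q p by (simp add: is_flow_def)
    next
      case False
      then show ?thesis using \<zeta>(2)[of t] breaking_solution_unique[OF \<zeta>(1) \<psi>, of t \<xi>] by (simp add: p_def)
    qed
    then show ?thesis by (auto simp: prod_eq_iff fun_eq_iff)
  qed
  then have the: "(THE p. is_flow \<alpha> X0 (fst p) (snd p)) = p"     by (intro the_equality[where P = "\<lambda>p. is_flow \<alpha> X0 (fst p) (snd p)"] p) blast
  have V: "Vflow \<alpha> X0 (fst p) t = (\<lambda>\<xi>. LINT \<eta>:{..\<xi>}|lborel. F.v t \<eta>)" for t
    unfolding p_def fst_conv by (rule ext) (rule F.flow_of_solution(2), rule F.\<phi>_eq)
  have "Sflow \<alpha> t X0 = (F.y t, F.U t, H, r0, \<lambda>\<xi>. LINT \<eta>:{..\<xi>}|lborel. F.v t \<eta>)" if "0 \<le> t" for t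
    unfolding Sflow_def prod.case the Let_def V using that by (simp add: p_def)
  then show ?thesis using \<psi> by blast
qed

end

section \<open>Relabelling and normalisation\<close>

lemma dtilde_commute: "dtilde \<alpha> X Xb = dtilde \<alpha> Xb X"
  by (cases X; cases Xb; hypsubst; unfold dtilde_def prod.case)
    (intro arg_cong2[where f = "(+)"] arg_cong2[where f = "(*)"] refl Linf_norm_minus_commute
        L1_norm_minus_commute L2_norm_minus_commute arg_cong[where f=sqrt_e] nn_integral_cong
        arg_cong[where f=ennreal] power2_commute)

text \<open>Multiplying by \<open>1 / c\<close> moves the constant to the other side, which works
  for infinite values too because \<open>c\<close> is finite and positive.\<close>

lemma le_cmult_INF:
  fixes x :: ennreal
  assumes "\<And>i. i \<in> S \<Longrightarrow> x \<le> ennreal c * F i" "0 < c"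
  shows "x \<le> ennreal c * (INF i\<in>S. F i)"
proof -
  have c: "ennreal (1 / c) * ennreal c = 1" using assms(2) by (simp add: ennreal_mult[symmetric])
  have "ennreal (1 / c) * x \<le> F i" if "i \<in> S" for i
  proof -
    have "ennreal (1 / c) * x \<le> ennreal (1 / c) * (ennreal c * F i)" by (rule mult_left_mono[OF assms(1)[OF that]]) simp
    then show ?thesis by (simp add: mult.assoc[symmetric] c)
  qed
  then have "ennreal (1 / c) * x \<le> (INF i\<in>S. F i)" by (rule INF_greatest)
  then have "ennreal c * (ennreal (1 / c) * x) \<le> ennreal c * (INF i\<in>S. F i)" by (rule mult_left_mono) simp
  then show ?thesis by (simp add: mult.assoc[symmetric] c mult.commute[of "ennreal c"])
qed

text \<open>\<open>W1inf\<close> makes the essential supremum finite, so that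
  \<open>enn2real\<close> does not collapse it to 0.\<close>

lemma dnorm_lipschitz:
  assumes "W1inf \<alpha>"
  shows "\<bar>\<alpha> x - \<alpha> y\<bar> \<le> dnorm \<alpha> * \<bar>x - y\<bar>"
proof -
  obtain g C where g: "has_weak_deriv \<alpha> g" "AE x in lborel. \<bar>g x\<bar> \<le> C"
    using assms by (auto simp: W1inf_def Linf_def)
  have "AE x in lborel. ennreal \<bar>wd \<alpha> x\<bar> \<le> ennreal C"
    using g(2) AE_wd_eq[OF g(1)] by eventually_elim (simp add: ennreal_leI)
  then have "Linf_norm (wd \<alpha>) \<le> ennreal C" unfolding Linf_norm_def by (intro INF_lower2[of "ennreal C"]) auto
  then have fin: "Linf_norm (wd \<alpha>) < top" by (rule le_less_trans) simp
  have "AE x in lborel. \<bar>wd \<alpha> x\<bar> \<le> dnorm \<alpha>"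
    using Linf_norm_AE_le[of "wd \<alpha>"]
  proof eventually_elim
    case (elim x)
    have "enn2real (ennreal \<bar>wd \<alpha> x\<bar>) \<le> enn2real (Linf_norm (wd \<alpha>))" using elim fin by (intro enn2real_mono) auto
    then show ?case by (simp add: dnorm_def)
  qed
  note L = has_weak_deriv_lipschitz[OF has_weak_deriv_wd[OF g(1)] this]
  show ?thesis using L[of x y] L[of y x] by (cases "x \<le> y") (auto simp: abs_minus_commute)
qed

lemma bilip_at_top: "bilip f f' \<Longrightarrow> filterlim f at_top at_top"
  unfolding filterlim_at_top
proof
  fix Z assume f: "bilip f f'"
  show "\<forall>\<^sub>F x in at_top. Z \<le> f x"
    using eventually_ge_at_top[of "inv f Z"]
    by eventually_elim (use bilip_le_iff[OF f, of "inv f Z"] bilip_inv(1)[OF f, of Z] in auto)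
qed

lemma ldata_of_relabel:
  assumes "ldata_of X D" and f: "bilip f f'"
  shows "ldata_of (relabel X f) (ldata_scale D f f')"
proof -
  obtain y U a b h r v Hi where D: "D = (y, U, a, b, h, r, v, Hi)" by (cases D rule: ldata_cases)
  from assms(1) D obtain H R V where X: "X = (y, U, H, R, V)" by (cases X) (auto simp: ldata_of_def)
  have w: "has_weak_deriv y a" "has_weak_deriv U b" "has_weak_deriv H h" "has_weak_deriv V v"
    "AE \<xi> in lborel. R \<xi> = r \<xi>" "(H \<longlongrightarrow> Hi) at_top"
    using assms(1) unfolding ldata_of_def X D prod.case by blast+
  have ff: "has_weak_deriv f f'" using f by (simp add: bilip_def)
  have "AE \<xi> in lborel. R (f \<xi>) * wd f \<xi> = r (f \<xi>) * f' \<xi>"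
    using bilip_AE[OF f w(5)] AE_wd_eq[OF ff] by eventually_elim simp
  moreover have "((\<lambda>\<xi>. H (f \<xi>)) \<longlongrightarrow> Hi) at_top" by (rule filterlim_compose[OF w(6) bilip_at_top[OF f]])
  ultimately show ?thesis
    using bilip_chain[OF f w(1)] bilip_chain[OF f w(2)] bilip_chain[OF f w(3)] bilip_chain[OF f w(4)]
    by (simp add: ldata_of_def relabel_def ldata_scale_def X D comp_def)
qed

context breaking_solution
begin

text \<open>All densities are multiplied by \<open>f'\<close>, so the quotient \<open>\<tau>\<close>
  and the condition \<open>B\<close> are merely composed with \<open>f\<close>. The kernel depends
  only on the order of its arguments, which \<open>f\<close> preserves, and substitution then gives
  \<open>y\<close> and \<open>U\<close>.\<close>

lemma scaled_solution:
  assumes f: "bilip f f'"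
  defines "h2 \<equiv> \<lambda>x. h (f x) * f' x"
  shows "breaking_solution \<alpha> A M (\<lambda>x. y0 (f x)) (\<lambda>x. U0 (f x)) (\<lambda>x. a (f x) * f' x) (\<lambda>x. b (f x) * f' x)
      h2 (\<lambda>x. r (f x) * f' x) (\<lambda>x. \<phi> (f x))" (is ?S)
    and "0 \<le> t \<Longrightarrow> breaking_solution.D (\<lambda>x. y0 (f x)) (\<lambda>x. U0 (f x)) (\<lambda>x. a (f x) * f' x) (\<lambda>x. b (f x) * f' x)
      h2 (\<lambda>x. r (f x) * f' x) (\<lambda>x. \<phi> (f x)) t = ldata_scale (D t) f f'" (is "_ \<Longrightarrow> ?E t")
proof -
  note [measurable] = bilip_measurable[OF f]
  have p: "0 < f' x" "0 \<le> f' x" for x using bilip_pos[OF f, of x] by auto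
  have hi: "integrable lborel h2" and hI: "(LINT \<xi>|lborel. h2 \<xi>) = (LINT \<xi>|lborel. h \<xi>)"
    unfolding h2_def using bilip_integrable[OF f, of h] bilip_integral[OF f, of h] h_int by auto
  interpret F: breaking_flow \<alpha> A M "\<lambda>x. y0 (f x)" "\<lambda>x. U0 (f x)" "\<lambda>x. a (f x) * f' x" "\<lambda>x. b (f x) * f' x"
      h2 "\<lambda>x. r (f x) * f' x" "\<lambda>x. \<phi> (f x)"
  proof
    show "a (f \<xi>) * f' \<xi> * h2 \<xi> = (b (f \<xi>) * f' \<xi>)\<^sup>2 + (r (f \<xi>) * f' \<xi>)\<^sup>2" for \<xi>
      using arg_cong[OF energy[of "f \<xi>"], of "\<lambda>z. z * (f' \<xi>)\<^sup>2"] unfolding h2_def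
      by (simp add: power_mult_distrib power2_eq_square algebra_simps)
    show "0 < a (f \<xi>) * f' \<xi> + h2 \<xi>" for \<xi>
      using mult_pos_pos[OF pos[of "f \<xi>"] p(1)[of \<xi>]] unfolding h2_def by (simp add: distrib_right)
    show "has_weak_deriv (\<lambda>x. y0 (f x)) (\<lambda>x. a (f x) * f' x)" "has_weak_deriv (\<lambda>x. U0 (f x)) (\<lambda>x. b (f x) * f' x)"
      by (rule bilip_chain[OF f deriv0(1)] bilip_chain[OF f deriv0(2)])+
  qed (use \<alpha>_lip \<alpha>_range nonneg p \<phi>_range hi hI h_le in \<open>auto simp: h2_def\<close>)
  have \<tau>: "F.\<tau> \<xi> = \<tau> (f \<xi>)" for \<xi> using p(1)[of \<xi>] unfolding F.\<tau>_def \<tau>_def by (simp add: h2_def)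
  have B: "F.B \<xi> = B (f \<xi>)" for \<xi> using p(1)[of \<xi>] by (auto simp: F.B_def B_def mult_less_0_iff)
  have \<theta>: "F.\<theta> t \<xi> = \<theta> t (f \<xi>)" for t \<xi> by (simp add: F.\<theta>_def \<theta>_def B \<tau>)
  have k: "F.k t \<xi> = k t (f \<xi>) * f' \<xi>" "F.kk t \<xi> = kk t (f \<xi>) * f' \<xi>" "F.v t \<xi> = v t (f \<xi>) * f' \<xi>" for t \<xi>
    unfolding F.k_def k_def F.kk_def kk_def F.v_def v_def \<theta> B \<tau> by (simp_all add: h2_def)
  have kap: "kap \<xi> \<eta> = kap (f \<xi>) (f \<eta>)" for \<xi> \<eta> using bilip_le_iff[OF f, of \<eta> \<xi>] by (simp add: kap_def)
  have I: "(LINT \<eta>|lborel. kap \<xi> \<eta> * (g (f \<eta>) * f' \<eta>)) = (LINT \<eta>|lborel. kap (f \<xi>) \<eta> * g \<eta>)"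
    if [measurable]: "g \<in> borel_measurable borel" for g \<xi>
    using bilip_integral[OF f, of "\<lambda>\<eta>. kap (f \<xi>) \<eta> * g \<eta>"] by (simp add: kap[of \<xi>] mult.assoc)
  have yU: "F.y t = (\<lambda>\<xi>. y t (f \<xi>))" "F.U t = (\<lambda>\<xi>. U t (f \<xi>))" for t
    unfolding F.y_def y_def F.U_def U_def F.I_def I_def k by (auto simp: I)
  show ?S
    by unfold_locales (auto simp: A_eq B \<tau> yU \<phi>_eq)
  then interpret F: breaking_solution \<alpha> A M "\<lambda>x. y0 (f x)" "\<lambda>x. U0 (f x)" "\<lambda>x. a (f x) * f' x" "\<lambda>x. b (f x) * f' x"
      h2 "\<lambda>x. r (f x) * f' x" "\<lambda>x. \<phi> (f x)" .
  show "?E t" if "0 \<le> t"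
    unfolding F.D_def D_def ldata_scale_def prod.case yU hI F.y\<xi>_def[abs_def] y\<xi>_def F.U\<xi>_def[abs_def] U\<xi>_def k
    by (auto simp: k h2_def algebra_simps fun_eq_iff)
qed

end

section \<open>The slope of the label map y + H\<close>

lemma exp_half_ge:
  fixes t :: real
  assumes "0 \<le> t"
  shows "t\<^sup>2 \<le> 4 * (1 - exp (- t)) * (1 + t\<^sup>2 / 4 - exp (- t))"
proof -
  \<comment> \<open>In terms of \<open>s\<close> the claim is
    \<open>(t s / 2)^2 <= (1 - s^2)^2\<close>; it follows from
    \<open>t s / 2 <= 1 - s <= 1 - s^2\<close>.\<close>
  define s where "s = exp (- (t / 2))"
  have s: "0 < s" "s \<le> 1" using assms by (auto simp: s_def)
  have e: "exp (- t) = s\<^sup>2" unfolding s_def by (simp add: exp_double[symmetric])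
  have "(1 + t / 2) * s \<le> exp (t / 2) * s" using exp_ge_add_one_self[of "t / 2"] s by (intro mult_right_mono) auto
  also have "exp (t / 2) * s = 1" by (simp add: s_def exp_minus)
  finally have 1: "t * s / 2 \<le> 1 - s" by (simp add: algebra_simps)
  also have "1 - s \<le> 1 - s\<^sup>2" using s by (simp add: power2_eq_square mult_left_le)
  finally have "(t * s / 2)\<^sup>2 \<le> (1 - s\<^sup>2)\<^sup>2" using s assms by (intro power_mono) auto
  then show ?thesis unfolding e by (simp add: power2_eq_square algebra_simps)
qed

text \<open>With \<open>P = 1 - exp (- t)\<close> and \<open>Q = 1 + t^2/4 - exp (- t)\<close> the
  claim is \<open>P a + t b + Q h >= 0\<close>. As \<open>b^2 <= a h\<close>, the inequality of
  arithmetic and geometric means reduces it to \<open>t^2 <= 4 P Q\<close>, which is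
  \<open>exp_half_ge\<close>.\<close>

lemma slope_lower_bound:
  fixes a b h t :: real
  assumes "0 \<le> a" "0 \<le> h" "b\<^sup>2 \<le> a * h" "0 \<le> t"
  shows "exp (- t) * (a + h) \<le> a + t * b + t\<^sup>2 / 4 * h + h"
proof -
  let ?P = "1 - exp (- t)" and ?Q = "1 + t\<^sup>2 / 4 - exp (- t)"
  have P: "0 \<le> ?P" and Q: "0 \<le> ?Q" using assms(4) by (auto intro: order_trans[of _ 1])
  have "(t * b)\<^sup>2 \<le> (4 * ?P * ?Q) * (a * h)"
    unfolding power_mult_distrib using exp_half_ge[OF assms(4)] assms P Q by (intro mult_mono) auto
  also have "\<dots> \<le> (?P * a + ?Q * h)\<^sup>2"
    using zero_le_power2[of "?P * a - ?Q * h"] by (simp add: power2_eq_square algebra_simps)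
  finally have "\<bar>t * b\<bar> \<le> \<bar>?P * a + ?Q * h\<bar>" by (rule abs_le_square_iff[THEN iffD2])
  also have "\<dots> = ?P * a + ?Q * h"
    by (rule abs_of_nonneg, rule add_nonneg_nonneg[OF mult_nonneg_nonneg[OF P assms(1)] mult_nonneg_nonneg[OF Q assms(2)]])
  finally have "- (t * b) \<le> ?P * a + ?Q * h" by linarith
  then show ?thesis by (simp add: algebra_simps)
qed

locale normalized_lagrangian = lag_flow +
  assumes F0: "\<And>\<xi>. a \<xi> + h \<xi> = 1" "\<And>\<xi>. y0 \<xi> + H \<xi> = \<xi>"
    and U0_bounded: "\<exists>C. \<forall>\<xi>. \<bar>U0 \<xi>\<bar> \<le> C" and b_L2: "integrable lborel (\<lambda>\<xi>. (b \<xi>)\<^sup>2)"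
    and H_lim: "(H \<longlongrightarrow> (LINT \<xi>|lborel. h \<xi>)) at_top"
begin

lemma a_h_le: "a \<xi> \<le> 1" "h \<xi> \<le> 1" using F0(1)[of \<xi>] nonneg[of \<xi>] by auto

text \<open>Without breaking the slope is the quadratic of \<open>slope_lower_bound\<close>. After
  breaking \<open>y\<xi> >= 0\<close> suffices, since \<open>a = \<tau>^2/4 h\<close> and
  \<open>a + h = 1\<close> give \<open>h >= 1 / (1 + t^2/4) >= exp (- t)\<close>.\<close>

lemma slope_ge:
  assumes t: "0 \<le> t" shows "exp (- t) \<le> y\<xi> t \<xi> + h \<xi>"
proof (cases "B \<xi> \<and> \<tau> \<xi> \<le> t")
  case True
  have \<tau>: "0 \<le> \<tau> \<xi>" and h: "0 < h \<xi>" using B_facts(3,6)[OF conjunct1[OF True]] by simp_all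
  have "0 \<le> h \<xi> / 4 * ((t - \<tau> \<xi>)\<^sup>2 * (1 - \<phi> \<xi>))" using h \<phi>_range[of \<xi>] by (intro mult_nonneg_nonneg) auto
  \<comment> \<open>\<open>y\<xi>\<close> vanishes at \<open>\<tau>\<close> together with its time
    derivative, so only the energy kept after breaking contributes.\<close>
  also have "\<dots> = y\<xi> t \<xi>"
    unfolding y\<xi>_def kk_def \<theta>_def B_facts(7)[OF conjunct1[OF True]] B_facts(8)[OF conjunct1[OF True]]
    using True by (simp add: power2_eq_square field_simps)
  finally have y: "0 \<le> y\<xi> t \<xi>" .
  have "(\<tau> \<xi>)\<^sup>2 \<le> t\<^sup>2" using True \<tau> by (intro power_mono) auto
  then have "(\<tau> \<xi>)\<^sup>2 / 4 * h \<xi> \<le> t\<^sup>2 / 4 * h \<xi>" using h by (intro mult_right_mono) auto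
  then have "1 \<le> (1 + t\<^sup>2 / 4) * h \<xi>" using F0(1)[of \<xi>] B_facts(8)[of \<xi>] True by (simp add: algebra_simps)
  also have "\<dots> \<le> exp t * h \<xi>"
  proof (rule mult_right_mono)
    have "0 \<le> t\<^sup>2" by simp
    then show "1 + t\<^sup>2 / 4 \<le> exp t" using exp_lower_Taylor_quadratic[OF t] t by linarith
  qed (use h in simp)
  finally have "exp (- t) * 1 \<le> exp (- t) * (exp t * h \<xi>)" by (intro mult_left_mono) auto
  also have "\<dots> = h \<xi>" by (simp add: exp_minus)
  finally show ?thesis using y by simp
next
  case False
  then have "y\<xi> t \<xi> = a \<xi> + t * b \<xi> + t\<^sup>2 / 4 * h \<xi>" by (auto simp: y\<xi>_def kk_def \<theta>_def)
  moreover have "(b \<xi>)\<^sup>2 \<le> a \<xi> * h \<xi>" using energy[of \<xi>] by simp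
  ultimately show ?thesis using slope_lower_bound[OF nonneg(1,2) _ t, of "b \<xi>" \<xi> \<xi>] F0(1)[of \<xi>] by simp
qed

text \<open>By \<open>a + h = 1\<close> the slope minus 1 is \<open>t b + kk / 2\<close>, where
  \<open>b\<close> is square integrable by assumption and \<open>kk\<close> because it is bounded
  and integrable.\<close>

lemma label_diffeo:
  assumes t: "0 \<le> t" shows "diffeo (\<lambda>\<xi>. y t \<xi> + H \<xi>) (\<lambda>\<xi>. y\<xi> t \<xi> + h \<xi>)"
  unfolding diffeo_def bilip_def
proof (intro conjI)
  show "has_weak_deriv (\<lambda>\<xi>. y t \<xi> + H \<xi>) (\<lambda>\<xi>. y\<xi> t \<xi> + h \<xi>)"
    by (intro has_weak_deriv_add deriv_t t H_deriv)
  have kkh: "kk t \<xi> \<le> t\<^sup>2 / 2" for \<xi>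
    using kk_bounds[OF t, of \<xi>] mult_left_mono[OF a_h_le(2)[of \<xi>], of "t\<^sup>2 / 2"] by simp
  have "y\<xi> t \<xi> + h \<xi> \<le> 1 + t + t\<^sup>2" for \<xi>
  proof -
    have "(b \<xi>)\<^sup>2 \<le> 1"
      using energy[of \<xi>] mult_le_one[OF a_h_le(1)[of \<xi>] nonneg(2)[of \<xi>] a_h_le(2)[of \<xi>]] zero_le_power2[of "r \<xi>"]
      by linarith
    then have "b \<xi> \<le> 1" unfolding abs_square_le_1 by simp
    then have "t * b \<xi> \<le> t" using t by (simp add: mult_left_le)
    then show ?thesis using kkh[of \<xi>] F0(1)[of \<xi>] zero_le_power2[of t] unfolding y\<xi>_def by linarith
  qed
  then show "\<exists>c>0. \<exists>C. \<forall>\<xi>. c \<le> y\<xi> t \<xi> + h \<xi> \<and> y\<xi> t \<xi> + h \<xi> \<le> C"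
    using slope_ge[OF t] by (intro exI[of _ "exp (- t)"]) auto
  obtain C where C: "\<And>\<xi>. \<bar>U0 \<xi>\<bar> \<le> C" using U0_bounded by blast
  have "\<bar>y t \<xi> + H \<xi> - \<xi>\<bar> \<le> t * C + t\<^sup>2 / 8 * (LINT \<xi>|lborel. h \<xi>)" for \<xi>
  proof -
    have "\<bar>y t \<xi> + H \<xi> - \<xi>\<bar> = \<bar>y t \<xi> - y0 \<xi>\<bar>" using F0(2)[of \<xi>] by (simp add: algebra_simps)
    also have "\<dots> \<le> t * \<bar>U0 \<xi>\<bar> + t\<^sup>2 / 8 * (LINT \<xi>|lborel. h \<xi>)" by (rule y_minus_y0_le[OF t])
    also have "\<dots> \<le> t * C + t\<^sup>2 / 8 * (LINT \<xi>|lborel. h \<xi>)" using C t by (intro add_right_mono mult_left_mono) auto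
    finally show ?thesis .
  qed
  then show "\<exists>C. \<forall>\<xi>. \<bar>y t \<xi> + H \<xi> - \<xi>\<bar> \<le> C" by blast
  have "integrable lborel (\<lambda>\<xi>. (t * b \<xi> + kk t \<xi> / 2)\<^sup>2)"
  proof (rule integrable_power2_add)
    show "integrable lborel (\<lambda>\<xi>. (t * b \<xi>)\<^sup>2)" using b_L2 by (simp add: power_mult_distrib)
    show "integrable lborel (\<lambda>\<xi>. (kk t \<xi> / 2)\<^sup>2)"
    proof (rule Bochner_Integration.integrable_bound)
      show "integrable lborel (\<lambda>\<xi>. t\<^sup>2 * kk t \<xi>)" using k_int(2)[OF t] by simp
      have "(kk t \<xi> / 2)\<^sup>2 \<le> t\<^sup>2 * kk t \<xi>" for \<xi>
      proof -
        have "kk t \<xi> * kk t \<xi> \<le> t\<^sup>2 / 2 * kk t \<xi>" using kkh[of \<xi>] kk_bounds(1)[OF t, of \<xi>] by (rule mult_right_mono)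
        moreover have "0 \<le> t\<^sup>2 * kk t \<xi>" using kk_bounds(1)[OF t, of \<xi>] by simp
        ultimately show ?thesis by (simp add: power2_eq_square[of "kk t \<xi>"] power_divide)
      qed
      then show "AE \<xi> in lborel. norm ((kk t \<xi> / 2)\<^sup>2) \<le> norm (t\<^sup>2 * kk t \<xi>)"
        using kk_bounds(1)[OF t] by (intro AE_I2) simp
    qed simp
  qed simp_all
  moreover have "y\<xi> t \<xi> + h \<xi> - 1 = t * b \<xi> + kk t \<xi> / 2" for \<xi> using F0(1)[of \<xi>] by (simp add: y\<xi>_def)
  ultimately show "integrable lborel (\<lambda>\<xi>. (y\<xi> t \<xi> + h \<xi> - 1)\<^sup>2)" by simp
qed

end

lemma inFi0M_normalized:
  assumes X: "inFi0M \<alpha> M (y0, U0, H, r0, V0)" and "W1inf \<alpha>" "\<And>x. 0 \<le> \<alpha> x" "\<And>x. \<alpha> x \<le> 1" "0 < M"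
  obtains a b h r where "normalized_lagrangian \<alpha> (dnorm \<alpha>) M y0 U0 a b h r (\<lambda>_. 0) H r0"
proof -
  from X have F: "inF \<alpha> (y0, U0, H, r0, V0)" and VH: "V0 = H" and id: "\<And>\<xi>. y0 \<xi> + H \<xi> = \<xi>"
    and HM: "Linf_norm H \<le> ennreal M"
    by (auto simp: inFi0M_def inFi_def inF0_def inFM_def)
  from F have E: "E2 (\<lambda>\<xi>. y0 \<xi> - \<xi>)" "E2 U0" "E1 H" "L2 r0"
    and AE1: "AE \<xi> in lborel. wd y0 \<xi> \<ge> 0" "AE \<xi> in lborel. wd H \<xi> \<ge> 0"
      "AE \<xi> in lborel. wd y0 \<xi> * wd H \<xi> = (wd U0 \<xi>)\<^sup>2 + (r0 \<xi>)\<^sup>2"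
    by (auto simp: inF_def VH)
  obtain g1 where "has_weak_deriv (\<lambda>\<xi>. y0 \<xi> - \<xi>) g1" using E(1) by (auto simp: E2_def)
  then have "has_weak_deriv y0 (\<lambda>\<xi>. g1 \<xi> + 1)" using has_weak_deriv_add[OF _ has_weak_deriv_id] by fastforce
  then have wy: "has_weak_deriv y0 (wd y0)" by (rule has_weak_deriv_wd)
  obtain g2 where g2: "has_weak_deriv U0 g2" "L2 g2" using E(2) by (auto simp: E2_def)
  have wU: "has_weak_deriv U0 (wd U0)" using g2(1) by (rule has_weak_deriv_wd)
  obtain g3 where "has_weak_deriv H g3" using E(3) by (auto simp: E1_def E2_def)
  then have wH: "has_weak_deriv H (wd H)" by (rule has_weak_deriv_wd)
  have H0: "(H \<longlongrightarrow> 0) at_bot" using E(3) by (simp add: E1_def)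
  have [measurable]: "wd y0 \<in> borel_measurable borel" "wd U0 \<in> borel_measurable borel" "wd H \<in> borel_measurable borel"
    "r0 \<in> borel_measurable borel" "g2 \<in> borel_measurable borel"
    using has_weak_derivD(1)[OF wy] has_weak_derivD(1)[OF wU] has_weak_derivD(1)[OF wH] has_weak_derivD(1)[OF g2(1)] E(4)
    by (auto simp: L2_def)
  have "has_weak_deriv (\<lambda>\<xi>. y0 \<xi> + H \<xi>) (\<lambda>\<xi>. 1)" unfolding id by (rule has_weak_deriv_id)
  then have AE2: "AE \<xi> in lborel. wd y0 \<xi> + wd H \<xi> = 1" by (rule has_weak_deriv_unique[OF has_weak_deriv_add[OF wy wH]])
  define good where "good \<xi> \<longleftrightarrow> wd y0 \<xi> \<ge> 0 \<and> wd H \<xi> \<ge> 0 \<and> wd y0 \<xi> * wd H \<xi> = (wd U0 \<xi>)\<^sup>2 + (r0 \<xi>)\<^sup>2 \<and> wd y0 \<xi> + wd H \<xi> = 1" for \<xi>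
  have gAE: "AE \<xi> in lborel. good \<xi>" using AE1 AE2 unfolding good_def by eventually_elim simp
  have [measurable]: "Measurable.pred borel good" unfolding good_def[abs_def] by measurable
  \<comment> \<open>On the exceptional null set the values \<open>a = 1\<close>,
    \<open>b = h = r = 0\<close> satisfy all pointwise constraints.\<close>
  define a where "a \<xi> = (if good \<xi> then wd y0 \<xi> else 1)" for \<xi>
  define b where "b \<xi> = (if good \<xi> then wd U0 \<xi> else 0)" for \<xi>
  define h where "h \<xi> = (if good \<xi> then wd H \<xi> else 0)" for \<xi>
  define r where "r \<xi> = (if good \<xi> then r0 \<xi> else 0)" for \<xi>
  have m [measurable]: "a \<in> borel_measurable borel" "b \<in> borel_measurable borel" "h \<in> borel_measurable borel" "r \<in> borel_measurable borel"
    unfolding a_def[abs_def] b_def[abs_def] h_def[abs_def] r_def[abs_def] by measurable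
  have eq: "AE \<xi> in lborel. wd y0 \<xi> = a \<xi> \<and> wd U0 \<xi> = b \<xi> \<and> wd H \<xi> = h \<xi> \<and> r0 \<xi> = r \<xi>"
    using gAE by eventually_elim (simp add: a_def b_def h_def r_def)
  have d: "has_weak_deriv y0 a" "has_weak_deriv U0 b" and Hh: "has_weak_deriv H h"
    by (rule has_weak_deriv_AE_cong[OF wy] has_weak_deriv_AE_cong[OF wU] has_weak_deriv_AE_cong[OF wH],
        use eq in eventually_elim, simp, simp)+
  have h0: "0 \<le> h \<xi>" for \<xi> by (auto simp: h_def good_def)
  have HMb: "\<bar>H \<xi>\<bar> \<le> M" for \<xi>
    using Linf_norm_bound[OF has_weak_deriv_continuous[OF Hh] HM] \<open>0 < M\<close> by simp
  have Hmono: "H \<xi> \<le> H \<xi>'" if "\<xi> \<le> \<xi>'" for \<xi> \<xi>'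
  proof -
    have "0 \<le> (LINT x:{\<xi>..\<xi>'}|lborel. h x)" unfolding set_lebesgue_integral_def using h0 by (intro integral_nonneg_AE) auto
    then show ?thesis using has_weak_derivD(3)[OF Hh that] by simp
  qed
  have Hnn: "0 \<le> H \<xi>" for \<xi>
    by (rule tendsto_upperbound[OF H0]) (auto intro!: eventually_mono[OF eventually_le_at_bot[of \<xi>]] Hmono)
  \<comment> \<open>Monotone convergence over \<open>{-n..n}\<close>, where the integral is an
    increment of \<open>H\<close> and \<open>0 <= H <= M\<close>.\<close>
  have nn: "(\<integral>\<^sup>+\<xi>. ennreal (h \<xi>) \<partial>lborel) \<le> ennreal M"
  proof -
    have "(\<integral>\<^sup>+\<xi>. ennreal (h \<xi>) \<partial>lborel) = (\<integral>\<^sup>+\<xi>. (SUP n. ennreal (h \<xi>) * indicator {- real n..real n} \<xi>) \<partial>lborel)"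
    proof (rule nn_integral_cong)
      fix \<xi>
      obtain n where n: "\<bar>\<xi>\<bar> \<le> real n" using real_arch_simple by blast
      have "ennreal (h \<xi>) \<le> ennreal (h \<xi>) * indicator {- real n..real n} \<xi>" using n by (auto simp: indicator_def)
      then have "ennreal (h \<xi>) \<le> (SUP n. ennreal (h \<xi>) * indicator {- real n..real n} \<xi>)" by (rule SUP_upper2[of n, OF UNIV_I])
      moreover have "(SUP n. ennreal (h \<xi>) * indicator {- real n..real n} \<xi>) \<le> ennreal (h \<xi>)"
        by (rule SUP_least) (auto simp: indicator_def)
      ultimately show "ennreal (h \<xi>) = (SUP n. ennreal (h \<xi>) * indicator {- real n..real n} \<xi>)" by (rule antisym)
    qed
    also have "\<dots> = (SUP n. \<integral>\<^sup>+\<xi>. ennreal (h \<xi>) * indicator {- real n..real n} \<xi> \<partial>lborel)"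
      by (rule nn_integral_monotone_convergence_SUP) (auto simp: incseq_def le_fun_def indicator_def)
    also have "\<dots> \<le> ennreal M"
    proof (rule SUP_least)
      fix n :: nat
      have i: "integrable lborel (\<lambda>\<xi>. indicator {- real n..real n} \<xi> *\<^sub>R h \<xi>)"
        using has_weak_derivD(2)[OF Hh, of "- real n" "real n"] by (simp add: set_integrable_def)
      have "(\<integral>\<^sup>+\<xi>. ennreal (h \<xi>) * indicator {- real n..real n} \<xi> \<partial>lborel) = (\<integral>\<^sup>+\<xi>. ennreal (indicator {- real n..real n} \<xi> *\<^sub>R h \<xi>) \<partial>lborel)"
        by (intro nn_integral_cong) (auto simp: indicator_def)
      also have "\<dots> = ennreal (H (real n) - H (- real n))"
        using i h0 has_weak_derivD(3)[OF Hh, of "- real n" "real n"]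
        by (subst nn_integral_eq_integral) (auto simp: set_lebesgue_integral_def)
      also have "\<dots> \<le> ennreal M" using HMb[of "real n"] Hnn[of "- real n"] by (intro ennreal_leI) simp
      finally show "(\<integral>\<^sup>+\<xi>. ennreal (h \<xi>) * indicator {- real n..real n} \<xi> \<partial>lborel) \<le> ennreal M" .
    qed
    finally show ?thesis .
  qed
  have hi: "integrable lborel h"
  proof (rule integrableI_bounded)
    have "(\<integral>\<^sup>+ x. ennreal (norm (h x)) \<partial>lborel) = (\<integral>\<^sup>+ x. ennreal (h x) \<partial>lborel)" using h0 by simp
    also have "\<dots> < \<infinity>" using nn by (rule le_less_trans) simp
    finally show "(\<integral>\<^sup>+ x. ennreal (norm (h x)) \<partial>lborel) < \<infinity>" .
  qed simp
  have hM: "(LINT \<xi>|lborel. h \<xi>) \<le> M"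
    using nn nn_integral_eq_integral[OF hi] h0 \<open>0 < M\<close> by (simp add: ennreal_le_iff)
  \<comment> \<open>\<open>H\<close> and the integral of \<open>h\<close> up to \<open>\<xi>\<close>
    differ by a constant, which is 0 because both vanish at minus infinity.\<close>
  have Hlim: "(H \<longlongrightarrow> (LINT \<xi>|lborel. h \<xi>)) at_top"
  proof -
    let ?F = "\<lambda>\<xi>. LINT \<eta>:{..\<xi>}|lborel. h \<eta>"
    have "H \<xi> - H 0 = ?F \<xi> - ?F 0" for \<xi>
    proof -
      have "(H \<xi> - ?F \<xi>) - (H 0 - ?F 0) = 0"
        using has_weak_deriv_lipschitz[OF has_weak_deriv_diff[OF Hh has_weak_deriv_atMost[OF hi]], of 0 0 \<xi>]
          has_weak_deriv_lipschitz[OF has_weak_deriv_diff[OF Hh has_weak_deriv_atMost[OF hi]], of 0 \<xi> 0]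
        by (cases "0 \<le> \<xi>") auto
      then show ?thesis by simp
    qed
    then have HF: "H \<xi> = ?F \<xi> + (H 0 - ?F 0)" for \<xi> by (simp add: algebra_simps)
    have "(\<lambda>n. LINT \<eta>|lborel. indicator {..- real n} \<eta> *\<^sub>R h \<eta>) \<longlonglongrightarrow> integral\<^sup>L lborel (\<lambda>_::real. 0::real)"
    proof (rule integral_dominated_convergence[where w = h])
      show "AE \<eta> in lborel. (\<lambda>n. indicator {..- real n} \<eta> *\<^sub>R h \<eta>) \<longlonglongrightarrow> 0"
      proof (rule AE_I2)
        fix \<eta> :: real
        obtain N where N: "- \<eta> < real N" using reals_Archimedean2 by blast
        have "\<forall>\<^sub>F n in sequentially. indicator {..- real n} \<eta> *\<^sub>R h \<eta> = 0"
          using eventually_ge_at_top[of N] by eventually_elim (use N in \<open>auto simp: indicator_def\<close>)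
        then show "(\<lambda>n. indicator {..- real n} \<eta> *\<^sub>R h \<eta>) \<longlonglongrightarrow> 0" by (rule tendsto_eventually)
      qed
    qed (use hi h0 in \<open>auto simp: indicator_def\<close>)
    then have F0: "(\<lambda>n. ?F (- real n)) \<longlonglongrightarrow> 0" by (simp add: set_lebesgue_integral_def)
    have "filterlim (\<lambda>n. - real n) at_bot sequentially"
      by (simp add: filterlim_uminus_at_bot filterlim_real_sequentially)
    from filterlim_compose[OF H0 this] have "(\<lambda>n. H (- real n)) \<longlonglongrightarrow> 0" .
    moreover have "(\<lambda>n. H (- real n)) \<longlonglongrightarrow> 0 + (H 0 - ?F 0)"
      unfolding HF[of "- real _"] using F0 by (rule tendsto_add) simp
    ultimately have "0 = 0 + (H 0 - ?F 0)" by (rule LIMSEQ_unique)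
    then have "H \<xi> = ?F \<xi>" for \<xi> using HF[of \<xi>] by linarith
    then have "H = ?F" by (rule ext)
    then show ?thesis using tendsto_integral_atMost[OF hi] by (simp only:)
  qed
  have Ub: "\<exists>C. \<forall>\<xi>. \<bar>U0 \<xi>\<bar> \<le> C"
  proof -
    obtain C where "AE \<xi> in lborel. \<bar>U0 \<xi>\<bar> \<le> C" using E(2) by (auto simp: E2_def Linf_def)
    then have "\<bar>U0 \<xi>\<bar> \<le> C" for \<xi>
      by (rule continuous_AE_le[of "\<lambda>x. \<bar>U0 x\<bar>", rotated]) (intro continuous_intros has_weak_deriv_continuous[OF wU])
    then show ?thesis by blast
  qed
  have bL2: "integrable lborel (\<lambda>\<xi>. (b \<xi>)\<^sup>2)"
  proof (subst integrable_cong_AE)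
    show "AE \<xi> in lborel. (b \<xi>)\<^sup>2 = (g2 \<xi>)\<^sup>2" using has_weak_deriv_unique[OF d(2) g2(1)] by eventually_elim simp
    show "integrable lborel (\<lambda>\<xi>. (g2 \<xi>)\<^sup>2)" using g2(2) by (simp add: L2_def)
  qed auto
  have "normalized_lagrangian \<alpha> (dnorm \<alpha>) M y0 U0 a b h r (\<lambda>_. 0) H r0"
  proof (unfold_locales, goal_cases)
    case (1 x y) show ?case by (rule dnorm_lipschitz[OF assms(2)])
  qed (use assms(3,4) m d hi hM eq Hh id Ub bL2 Hlim in \<open>auto simp: a_def b_def h_def r_def good_def\<close>)
  then show thesis by (rule that)
qed

text \<open>Growth of the distance of two relabelled solutions: a relabelling \<open>f\<close> at time 0 corresponds
  to the relabelling \<open>h\<^sub>t \<circ> f \<circ> k\<close> of the normalised solutions at time \<open>t\<close>, where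
  \<open>h\<^sub>t = y + H\<close> and \<open>k\<close> is the inverse of its counterpart for the second solution.\<close>

lemma relabelled_growth:
  assumes X: "inFi0M \<alpha> M X" and Xb: "inFi0M \<alpha> M Xb" and "W1inf \<alpha>" "\<And>x. 0 \<le> \<alpha> x" "\<And>x. \<alpha> x \<le> 1" "0 < M"
    and t: "0 \<le> t" and "inG f"
  shows "\<exists>f2. inG f2 \<and> dtilde \<alpha> (relabel (PiX (Sflow \<alpha> t X)) f2) (PiX (Sflow \<alpha> t Xb))
     \<le> ennreal (Chat \<alpha> M t) * dtilde \<alpha> (relabel (PiX (Sflow \<alpha> 0 X)) f) (PiX (Sflow \<alpha> 0 Xb))"
proof -
  obtain y0 U0 H r0 V0 where Xe: "X = (y0, U0, H, r0, V0)" by (cases X)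
  obtain y0' U0' H' r0' V0' where Xbe: "Xb = (y0', U0', H', r0', V0')" by (cases Xb)
  obtain a b h r where "normalized_lagrangian \<alpha> (dnorm \<alpha>) M y0 U0 a b h r (\<lambda>_. 0) H r0"
    using inFi0M_normalized[OF X[unfolded Xe] assms(3-6)] by blast
  then interpret N: normalized_lagrangian \<alpha> "dnorm \<alpha>" M y0 U0 a b h r "\<lambda>_. 0" H r0 V0 .
  obtain a' b' h' r' where "normalized_lagrangian \<alpha> (dnorm \<alpha>) M y0' U0' a' b' h' r' (\<lambda>_. 0) H' r0'"
    using inFi0M_normalized[OF Xb[unfolded Xbe] assms(3-6)] by blast
  then interpret N': normalized_lagrangian \<alpha> "dnorm \<alpha>" M y0' U0' a' b' h' r' "\<lambda>_. 0" H' r0' V0' .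
  obtain \<phi> where \<phi>: "breaking_solution \<alpha> (dnorm \<alpha>) M y0 U0 a b h r \<phi>"
    and S: "\<And>t. 0 \<le> t \<Longrightarrow> Sflow \<alpha> t X = (breaking_flow.y y0 U0 a b h r \<phi> t, breaking_flow.U U0 a b h r \<phi> t, H, r0,
        \<lambda>\<xi>. LINT \<eta>:{..\<xi>}|lborel. breaking_flow.v a b h r \<phi> t \<eta>)"
    using N.Sflow_eq unfolding Xe by blast
  obtain \<phi>' where \<phi>': "breaking_solution \<alpha> (dnorm \<alpha>) M y0' U0' a' b' h' r' \<phi>'"
    and S': "\<And>t. 0 \<le> t \<Longrightarrow> Sflow \<alpha> t Xb = (breaking_flow.y y0' U0' a' b' h' r' \<phi>' t, breaking_flow.U U0' a' b' h' r' \<phi>' t, H', r0',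
        \<lambda>\<xi>. LINT \<eta>:{..\<xi>}|lborel. breaking_flow.v a' b' h' r' \<phi>' t \<eta>)"
    using N'.Sflow_eq unfolding Xbe by blast
  interpret F: breaking_solution \<alpha> "dnorm \<alpha>" M y0 U0 a b h r \<phi> by (rule \<phi>)
  interpret F': breaking_solution \<alpha> "dnorm \<alpha>" M y0' U0' a' b' h' r' \<phi>' by (rule \<phi>')
  interpret F: normalized_lagrangian \<alpha> "dnorm \<alpha>" M y0 U0 a b h r \<phi> H r0 V0
    by unfold_locales (rule N.wd_eq N.r0_meas N.H_deriv N.F0 N.U0_bounded N.b_L2 N.H_lim refl)+
  interpret F': normalized_lagrangian \<alpha> "dnorm \<alpha>" M y0' U0' a' b' h' r' \<phi>' H' r0' V0'
    by unfold_locales (rule N'.wd_eq N'.r0_meas N'.H_deriv N'.F0 N'.U0_bounded N'.b_L2 N'.H_lim refl)+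
  have LX: "ldata_of (Sflow \<alpha> t X) (F.D t)" if "0 \<le> t" for t
    using F.deriv_t[OF that] F.H_deriv F.H_lim has_weak_deriv_atMost[OF F.k_int(3)[OF that]] F.wd_eq
    by (auto simp: ldata_of_def S[OF that] F.D_def)
  have LX': "ldata_of (Sflow \<alpha> t Xb) (F'.D t)" if "0 \<le> t" for t
    using F'.deriv_t[OF that] F'.H_deriv F'.H_lim has_weak_deriv_atMost[OF F'.k_int(3)[OF that]] F'.wd_eq
    by (auto simp: ldata_of_def S'[OF that] F'.D_def)
  obtain f' where f: "diffeo f f'" using inG_imp_diffeo[OF \<open>inG f\<close>] by blast
  note bf = diffeo_bilip[OF f]
  define l where "l = (\<lambda>\<xi>. F.y t \<xi> + H \<xi>)"
  define l' where "l' = (\<lambda>\<xi>. F.y\<xi> t \<xi> + h \<xi>)"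
  define lb where "lb = (\<lambda>\<xi>. F'.y t \<xi> + H' \<xi>)"
  define lb' where "lb' = (\<lambda>\<xi>. F'.y\<xi> t \<xi> + h' \<xi>)"
  have l: "diffeo l l'" unfolding l_def l'_def by (rule F.label_diffeo[OF t])
  have lb: "diffeo lb lb'" unfolding lb_def lb'_def by (rule F'.label_diffeo[OF t])
  note bl = diffeo_bilip[OF l] and blb = diffeo_bilip[OF lb]
  define k where "k = inv lb"
  define k' where "k' = (\<lambda>x. 1 / lb' (k x))"
  have k: "diffeo k k'" unfolding k'_def k_def by (rule diffeo_inverse[OF lb])
  note bk = diffeo_bilip[OF k]
  have k_le: "k' x \<le> exp t" for x
  proof -
    have "exp (- t) \<le> lb' (k x)" unfolding lb'_def by (rule F'.slope_ge[OF t])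
    then have "1 / lb' (k x) \<le> 1 / exp (- t)" by (intro divide_left_mono) (auto intro: less_le_trans[OF exp_gt_zero] mult_pos_pos)
    then show ?thesis by (simp add: k'_def exp_minus inverse_eq_divide)
  qed
  define f2 where "f2 = (\<lambda>x. l (f (k x)))"
  define f2' where "f2' = (\<lambda>x. l' (f (k x)) * (f' (k x) * k' x))"
  have f2: "diffeo f2 f2'" unfolding f2_def f2'_def by (rule diffeo_comp[OF l diffeo_comp[OF f k]])
  note bil = diffeo_bilip[OF diffeo_inverse[OF l]]
  have PX: "PiX (Sflow \<alpha> t X) = relabel (Sflow \<alpha> t X) (inv l)" by (simp add: PiX_def S[OF t] l_def)
  have PXb: "PiX (Sflow \<alpha> t Xb) = relabel (Sflow \<alpha> t Xb) k" by (simp add: PiX_def S'[OF t] k_def lb_def)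
  \<comment> \<open>At time 0 the label map \<open>y + H\<close> is the identity, so normalisation
    changes nothing.\<close>
  have P0: "ldata_of (PiX (Sflow \<alpha> 0 X)) (F.D 0)" "ldata_of (PiX (Sflow \<alpha> 0 Xb)) (F'.D 0)"
  proof -
    have bid: "bilip (\<lambda>x. x) (\<lambda>x. 1)" unfolding bilip_def using has_weak_deriv_id by (auto intro!: exI[of _ 1])
    have sc: "ldata_scale E (\<lambda>x. x) (\<lambda>x. 1) = E" for E by (cases E rule: ldata_cases) (simp add: ldata_scale_def)
    have iv: "inv (\<lambda>x::real. x) = (\<lambda>x. x)" by (rule inv_equality) auto
    have "PiX (Sflow \<alpha> 0 X) = relabel (Sflow \<alpha> 0 X) (\<lambda>x. x)" "PiX (Sflow \<alpha> 0 Xb) = relabel (Sflow \<alpha> 0 Xb) (\<lambda>x. x)"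
      by (simp_all add: PiX_def S[OF order_refl] S'[OF order_refl] F.y0_eq F'.y0_eq F.F0 F'.F0 iv)
    then show "ldata_of (PiX (Sflow \<alpha> 0 X)) (F.D 0)" "ldata_of (PiX (Sflow \<alpha> 0 Xb)) (F'.D 0)"
      using ldata_of_relabel[OF LX[OF order_refl] bid] ldata_of_relabel[OF LX'[OF order_refl] bid] by (simp_all add: sc)
  qed
  note sol = F.scaled_solution[OF bf]
  interpret Y: breaking_solution \<alpha> "dnorm \<alpha>" M "\<lambda>x. y0 (f x)" "\<lambda>x. U0 (f x)" "\<lambda>x. a (f x) * f' x" "\<lambda>x. b (f x) * f' x"
      "\<lambda>x. h (f x) * f' x" "\<lambda>x. r (f x) * f' x" "\<lambda>x. \<phi> (f x)" by (rule sol(1))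
  interpret P: flow_pair \<alpha> "dnorm \<alpha>" M "\<lambda>x. y0 (f x)" "\<lambda>x. U0 (f x)" "\<lambda>x. a (f x) * f' x" "\<lambda>x. b (f x) * f' x"
      "\<lambda>x. h (f x) * f' x" "\<lambda>x. r (f x) * f' x" "\<lambda>x. \<phi> (f x)" y0' U0' a' b' h' r' \<phi>' ..
  \<comment> \<open>The normalisation by \<open>inv l\<close> cancels the outer \<open>l\<close> in
    \<open>f2\<close>, leaving the relabelling by \<open>f\<close> followed by \<open>k\<close>.
    Both solutions then carry the common relabelling \<open>k\<close>, as
    \<open>ldist_scale_le\<close> requires.\<close>
  have "ldata_of (relabel (PiX (Sflow \<alpha> t X)) f2) (ldata_scale (ldata_scale (F.D t) (inv l) (\<lambda>x. 1 / l' (inv l x))) f2 f2')"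
    unfolding PX by (intro ldata_of_relabel LX t bil diffeo_bilip[OF f2])
  moreover have "ldata_scale (ldata_scale (F.D t) (inv l) (\<lambda>x. 1 / l' (inv l x))) f2 f2' = ldata_scale (Y.D t) k k'"
  proof -
    have "inv l (f2 x) = f (k x)" for x by (simp add: f2_def bilip_inv[OF bl])
    moreover have "1 / l' (f (k x)) * f2' x = f' (k x) * k' x" for x
      using bilip_pos[OF bl, of "f (k x)"] by (simp add: f2'_def)
    ultimately show ?thesis unfolding sol(2)[OF t] ldata_scale_comp by simp
  qed
  ultimately have 1: "ldata_of (relabel (PiX (Sflow \<alpha> t X)) f2) (ldata_scale (Y.D t) k k')" by simp
  have 2: "ldata_of (PiX (Sflow \<alpha> t Xb)) (ldata_scale (F'.D t) k k')"
    unfolding PXb by (intro ldata_of_relabel LX' t bk)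
  have 3: "ldata_of (relabel (PiX (Sflow \<alpha> 0 X)) f) (Y.D 0)"
    unfolding sol(2)[OF order_refl] by (intro ldata_of_relabel P0 bf)
  have "dtilde \<alpha> (relabel (PiX (Sflow \<alpha> t X)) f2) (PiX (Sflow \<alpha> t Xb)) = ldist \<alpha> (ldata_scale (Y.D t) k k') (ldata_scale (F'.D t) k k')"
    by (rule dtilde_eq_ldist[OF 1 2])
  also have "\<dots> \<le> ennreal (sqrt (exp t)) * ldist \<alpha> (Y.D t) (F'.D t)"
    by (rule ldist_scale_le[OF bk k_le _ Y.D_meas[OF t] F'.D_meas[OF t] F.\<alpha>_meas]) (use t in simp)
  also have "\<dots> \<le> ennreal (sqrt (exp t)) * (ennreal (Ctilde \<alpha> M t * exp (t * Cbar \<alpha> M t)) * ldist \<alpha> (Y.D 0) (F'.D 0))"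
    by (intro mult_left_mono P.ldist_growth[OF t F'.F0(1)]) auto
  also have "\<dots> = ennreal (Chat \<alpha> M t) * ldist \<alpha> (Y.D 0) (F'.D 0)"
  proof -
    have "sqrt (exp t) = exp (t / 2)"
      by (rule real_sqrt_unique) (auto simp: power2_eq_square exp_add[symmetric])
    then have "sqrt (exp t) * (Ctilde \<alpha> M t * exp (t * Cbar \<alpha> M t)) = Chat \<alpha> M t" by (simp add: Chat_def)
    then show ?thesis by (simp add: mult.assoc[symmetric] ennreal_mult'[symmetric])
  qed
  also have "ldist \<alpha> (Y.D 0) (F'.D 0) = dtilde \<alpha> (relabel (PiX (Sflow \<alpha> 0 X)) f) (PiX (Sflow \<alpha> 0 Xb))"
    by (rule dtilde_eq_ldist[OF 3 P0(2), symmetric])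
  finally show ?thesis using diffeo_imp_inG[OF f2] by blast
qed

section \<open>From relabelled solutions to the metric\<close>

lemma Chat_pos:
  assumes "0 \<le> dnorm \<alpha>" "0 < M" "0 \<le> t"
  shows "0 < Chat \<alpha> M t"
proof -
  have "0 < Ctilde \<alpha> M t"
    unfolding Ctilde_def using assms by (intro add_pos_nonneg mult_nonneg_nonneg add_nonneg_nonneg) auto
  then show ?thesis by (simp add: Chat_def)
qed

text \<open>Each pair of relabellings at time 0 yields one at time \<open>t\<close>. The second
  summand is the first with the two data exchanged, because \<open>dtilde\<close> is
  symmetric.\<close>

lemma Jdist_growth:
  assumes "inFi0M \<alpha> M X" "inFi0M \<alpha> M Xb" "W1inf \<alpha>" "\<And>x. 0 \<le> \<alpha> x" "\<And>x. \<alpha> x \<le> 1" "0 < M" "0 \<le> t"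
  shows "Jdist \<alpha> (PiX (Sflow \<alpha> t X)) (PiX (Sflow \<alpha> t Xb))
    \<le> ennreal (Chat \<alpha> M t) * Jdist \<alpha> (PiX (Sflow \<alpha> 0 X)) (PiX (Sflow \<alpha> 0 Xb))"
  unfolding Jdist_def[of _ "PiX (Sflow \<alpha> 0 X)"]
proof (rule le_cmult_INF)
  show "0 < Chat \<alpha> M t" by (rule Chat_pos) (use assms in \<open>auto simp: dnorm_def\<close>)
  fix fg assume "fg \<in> {fg. inG (fst fg) \<and> inG (snd fg)}"
  then have fg: "inG (fst fg)" "inG (snd fg)" by auto
  obtain f2 where f2: "inG f2" "dtilde \<alpha> (relabel (PiX (Sflow \<alpha> t X)) f2) (PiX (Sflow \<alpha> t Xb))
     \<le> ennreal (Chat \<alpha> M t) * dtilde \<alpha> (relabel (PiX (Sflow \<alpha> 0 X)) (fst fg)) (PiX (Sflow \<alpha> 0 Xb))"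
    using relabelled_growth[OF assms fg(1)] by blast
  obtain g2 where g2: "inG g2" "dtilde \<alpha> (PiX (Sflow \<alpha> t X)) (relabel (PiX (Sflow \<alpha> t Xb)) g2)
     \<le> ennreal (Chat \<alpha> M t) * dtilde \<alpha> (PiX (Sflow \<alpha> 0 X)) (relabel (PiX (Sflow \<alpha> 0 Xb)) (snd fg))"
    using relabelled_growth[OF assms(2,1,3-7) fg(2)] dtilde_commute by metis
  have "Jdist \<alpha> (PiX (Sflow \<alpha> t X)) (PiX (Sflow \<alpha> t Xb))
     \<le> dtilde \<alpha> (relabel (PiX (Sflow \<alpha> t X)) f2) (PiX (Sflow \<alpha> t Xb)) + dtilde \<alpha> (PiX (Sflow \<alpha> t X)) (relabel (PiX (Sflow \<alpha> t Xb)) g2)"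
    unfolding Jdist_def by (rule INF_lower2[of "(f2, g2)"]) (use f2 g2 in auto)
  also have "\<dots> \<le> ennreal (Chat \<alpha> M t) * dtilde \<alpha> (relabel (PiX (Sflow \<alpha> 0 X)) (fst fg)) (PiX (Sflow \<alpha> 0 Xb))
     + ennreal (Chat \<alpha> M t) * dtilde \<alpha> (PiX (Sflow \<alpha> 0 X)) (relabel (PiX (Sflow \<alpha> 0 Xb)) (snd fg))"
    by (intro add_mono f2 g2)
  finally show "Jdist \<alpha> (PiX (Sflow \<alpha> t X)) (PiX (Sflow \<alpha> t Xb)) \<le> ennreal (Chat \<alpha> M t) *
     (dtilde \<alpha> (relabel (PiX (Sflow \<alpha> 0 X)) (fst fg)) (PiX (Sflow \<alpha> 0 Xb))
     + dtilde \<alpha> (PiX (Sflow \<alpha> 0 X)) (relabel (PiX (Sflow \<alpha> 0 Xb)) (snd fg)))"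
    by (simp add: distrib_left)
qed

text \<open>A chain consists of initial data, so the same chains compete at every time, and the
  bound for \<open>Jdist\<close> is summed along each of them.\<close>

lemma dM_growth:
  assumes "W1inf \<alpha>" "\<And>x. 0 \<le> \<alpha> x" "\<And>x. \<alpha> x \<le> 1" "0 < M" "0 \<le> t"
  shows "dM \<alpha> M t X Xb \<le> ennreal (Chat \<alpha> M t) * dM \<alpha> M 0 X Xb"
  unfolding dM_def[of _ _ 0]
proof (rule le_cmult_INF)
  show "0 < Chat \<alpha> M t" by (rule Chat_pos) (use assms in \<open>auto simp: dnorm_def\<close>)
  fix NXs assume S: "NXs \<in> {(N::nat, Xs). Xs 0 = X \<and> Xs N = Xb \<and> (\<forall>n\<le>N. inFi0M \<alpha> M (Xs n))}"
  then have F: "inFi0M \<alpha> M (snd NXs n)" if "n \<le> fst NXs" for n using that by auto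
  have "dM \<alpha> M t X Xb \<le> (\<Sum>n\<in>{1..fst NXs}. Jdist \<alpha> (PiX (Sflow \<alpha> t (snd NXs (n - 1)))) (PiX (Sflow \<alpha> t (snd NXs n))))"
    unfolding dM_def by (rule INF_lower[OF S])
  also have "\<dots> \<le> (\<Sum>n\<in>{1..fst NXs}. ennreal (Chat \<alpha> M t) * Jdist \<alpha> (PiX (Sflow \<alpha> 0 (snd NXs (n - 1)))) (PiX (Sflow \<alpha> 0 (snd NXs n))))"
    by (intro sum_mono Jdist_growth assms F) auto
  finally show "dM \<alpha> M t X Xb \<le> ennreal (Chat \<alpha> M t) * (\<Sum>n\<in>{1..fst NXs}. Jdist \<alpha> (PiX (Sflow \<alpha> 0 (snd NXs (n - 1)))) (PiX (Sflow \<alpha> 0 (snd NXs n))))"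
    by (simp add: sum_distrib_left)
qed

theorem theorem4p21:
  fixes \<alpha> :: "real \<Rightarrow> real" and M t :: real
    and u0 \<rho>0 ub \<rho>b :: "real \<Rightarrow> real" and \<nu>0 \<mu>0 \<nu>b \<mu>b :: "real measure"
  assumes "W1inf \<alpha>"
    and "(\<forall>x. 0 \<le> \<alpha> x \<and> \<alpha> x < 1) \<or> (\<forall>x. \<alpha> x = 1)"
    and "M > 0"
    and "inD0M \<alpha> M (u0, \<rho>0, \<nu>0, \<mu>0)"
    and "inD0M \<alpha> M (ub, \<rho>b, \<nu>b, \<mu>b)"
    and "t \<ge> 0"
  shows "dD \<alpha> M t (u0, \<rho>0, \<nu>0, \<mu>0) (ub, \<rho>b, \<nu>b, \<mu>b)
           \<le> ennreal (Chat \<alpha> M t) * dD \<alpha> M 0 (u0, \<rho>0, \<nu>0, \<mu>0) (ub, \<rho>b, \<nu>b, \<mu>b)"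
proof -
  have "0 \<le> \<alpha> x" "\<alpha> x \<le> 1" for x using assms(2) by (auto intro: less_imp_le)
  then show ?thesis unfolding dD_def by (rule dM_growth[OF assms(1) _ _ assms(3,6)])
qed

end
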